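(* Let $k$ be a commutative artinian ring with unit and let $\mathcal{C}$ be a skeletally small Hom-finite $k$-linear abelian category. Then $\mathcal{C}$ has Serre duality if and only if $\mathcal{C}$ has right determined epimorphisms and left determined monomorphisms.
   Context: Let $k\text{-mod}$ be the category of finitely generated $k$-modules, $E$ the minimal injective cogenerator of $k$, and $D=\mathrm{Hom}_k(-,E)$ the resulting duality on $k\text{-mod}$. A $k$-linear category is Hom-finite if every $\mathrm{Hom}_\mathcal{C}(X,Y)$ is a finitely generated $k$-module; it is skeletally small if the isomorphism classes of objects form a set. A Hom-finite $k$-linear abelian category $\mathcal{C}$ has Serre duality if there is a $k$-linear auto-equivalence $\tau\colon\mathcal{C}\to\mathcal{C}$ together with a functorial isomorphism $D\,\mathrm{Ext}^1_\mathcal{C}(X,Y)\simeq \mathrm{Hom}_\mathcal{C}(Y,\tau(X))$ for all objects $X,Y$ in $\mathcal{C}$. For an object $C$ put $\Gamma(C)=\mathrm{End}_\mathcal{C}(C)^{\rm op}$; each $\mathrm{Hom}_\mathcal{C}(C,X)$ is a left $\Gamma(C)$-module via precomposition. For $\alpha\colon X\to Y$, $\mathrm{Im}\,\mathrm{Hom}_\mathcal{C}(C,\alpha)\subseteq\mathrm{Hom}_\mathcal{C}(C,Y)$ denotes the image of the induced map $\mathrm{Hom}_\mathcal{C}(C,X)\to\mathrm{Hom}_\mathcal{C}(C,Y)$. The morphism $\alpha$ is right determined by $C$ if every $t\colon T\to Y$ with $\mathrm{Im}\,\mathrm{Hom}_\mathcal{C}(C,t)\subseteq\mathrm{Im}\,\mathrm{Hom}_\mathcal{C}(C,\alpha)$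 factors as $t=\alpha\circ t'$ for some $t'\colon T\to X$. For a $\Gamma(C)$-submodule $H\subseteq\mathrm{Hom}_\mathcal{C}(C,Y)$, the pair $(C,H)$ is right represented by $\alpha\colon X\to Y$ if $\alpha$ is right determined by $C$ and $H=\mathrm{Im}\,\mathrm{Hom}_\mathcal{C}(C,\alpha)$. An object $Y$ is right epi-classified if (REC1) each epimorphism $\alpha\colon X\to Y$ ending at $Y$ is right determined by some object $C$; and (REC2) for any object $C$ and any $\Gamma(C)$-submodule $H$ of $\mathrm{Hom}_\mathcal{C}(C,Y)$, the pair $(C,H)$ is right represented by some epimorphism $\alpha\colon X\to Y$. $\mathcal{C}$ has right determined epimorphisms if each object is right epi-classified. An object is left mono-classified if it is right epi-classified as an object of $\mathcal{C}^{\rm op}$, and $\mathcal{C}$ has left determined monomorphisms if each object is left mono-classified. *)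

theory Defs
  imports "HOL-Algebra.Ideal" "HOL-Algebra.Module"
begin

section \<open>Modules over a commutative artinian ring\<close>

definition artinian_cring :: "'k ring \<Rightarrow> bool" where
  "artinian_cring k \<longleftrightarrow> cring k \<and>
     (\<forall>I :: nat \<Rightarrow> 'k set. (\<forall>n. ideal (I n) k) \<and> (\<forall>n. I (Suc n) \<subseteq> I n)
        \<longrightarrow> (\<exists>N. \<forall>n\<ge>N. I n = I N))"

definition fg_module :: "'k ring \<Rightarrow> ('k, 'a) module \<Rightarrow> bool" where
  "fg_module k M \<longleftrightarrow> (\<exists>S. finite S \<and> S \<subseteq> carrier M \<and>
     (\<forall>x\<in>carrier M. \<exists>c\<in>S \<rightarrow> carrier k. x = (\<Oplus>\<^bsub>M\<^esub>s\<in>S. c s \<odot>\<^bsub>M\<^esub> s)))"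

text \<open>Linear maps are extensional functions (undefined off the carrier), so that
  equality of maps is equality of functions.\<close>

definition lin_hom :: "'k ring \<Rightarrow> ('k, 'a) module \<Rightarrow> ('k, 'b) module \<Rightarrow> ('a \<Rightarrow> 'b) set" where
  "lin_hom k M N = {f \<in> carrier M \<rightarrow>\<^sub>E carrier N.
     (\<forall>x\<in>carrier M. \<forall>y\<in>carrier M. f (x \<oplus>\<^bsub>M\<^esub> y) = f x \<oplus>\<^bsub>N\<^esub> f y) \<and>
     (\<forall>a\<in>carrier k. \<forall>x\<in>carrier M. f (a \<odot>\<^bsub>M\<^esub> x) = a \<odot>\<^bsub>N\<^esub> f x)}"

definition lin_iso :: "'k ring \<Rightarrow> ('k, 'a) module \<Rightarrow> ('k, 'b) module \<Rightarrow> ('a \<Rightarrow> 'b) set" where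
  "lin_iso k M N = {f \<in> lin_hom k M N. bij_betw f (carrier M) (carrier N)}"

text \<open>Injectivity and cogeneration quantify over modules carried by the type
  \<open>(nat \<Rightarrow> 'k) set\<close>. Every quotient of a submodule of a product of countably many copies of \<open>k\<close>,
  in particular every finitely generated module, has a copy there. As \<open>k\<close> and its ideals are
  among them, Baer's criterion shows that the resulting notion of injectivity does not depend
  on this bound; nor does cogeneration by an injective module, which is decided on cyclic
  modules.\<close>

definition injective_module :: "'k ring \<Rightarrow> ('k, 'e) module \<Rightarrow> bool" where
  "injective_module k E \<longleftrightarrow> module k E \<and>
     (\<forall>(A :: ('k, (nat \<Rightarrow> 'k) set) module) (B :: ('k, (nat \<Rightarrow> 'k) set) module).
        module k A \<longrightarrow> module k B \<longrightarrow>
        (\<forall>f\<in>lin_hom k A B. \<forall>g\<in>lin_hom k A E. inj_on f (carrier A) \<longrightarrow>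
           (\<exists>h\<in>lin_hom k B E. \<forall>a\<in>carrier A. h (f a) = g a)))"

definition cogenerator :: "'k ring \<Rightarrow> ('k, 'e) module \<Rightarrow> bool" where
  "cogenerator k E \<longleftrightarrow> module k E \<and>
     (\<forall>M :: ('k, (nat \<Rightarrow> 'k) set) module. module k M \<longrightarrow>
        (\<forall>x\<in>carrier M. x \<noteq> \<zero>\<^bsub>M\<^esub> \<longrightarrow> (\<exists>f\<in>lin_hom k M E. f x \<noteq> \<zero>\<^bsub>E\<^esub>)))"

definition minimal_injective_cogenerator :: "'k ring \<Rightarrow> ('k, 'e) module \<Rightarrow> bool" where
  "minimal_injective_cogenerator k E \<longleftrightarrow>
     injective_module k E \<and> cogenerator k E \<and>
     (\<forall>N. submodule N k E \<and> injective_module k (E\<lparr>carrier := N\<rparr>) \<and>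
          cogenerator k (E\<lparr>carrier := N\<rparr>) \<longrightarrow> N = carrier E)"

text \<open>The record type of modules extends that of rings; the ring multiplication and unit of a
  module play no role.\<close>

definition dual_module :: "'k ring \<Rightarrow> ('k, 'e) module \<Rightarrow> ('k, 'a) module \<Rightarrow> ('k, 'a \<Rightarrow> 'e) module" where
  "dual_module k E M =
     \<lparr>carrier = lin_hom k M E, monoid.mult = undefined, one = undefined,
      ring.zero = (\<lambda>x\<in>carrier M. \<zero>\<^bsub>E\<^esub>),
      ring.add = (\<lambda>f g. \<lambda>x\<in>carrier M. f x \<oplus>\<^bsub>E\<^esub> g x),
      module.smult = (\<lambda>a f. \<lambda>x\<in>carrier M. a \<odot>\<^bsub>E\<^esub> f x)\<rparr>"

definition dual_map :: "('k, 'a) module \<Rightarrow> ('a \<Rightarrow> 'b) \<Rightarrow> ('b \<Rightarrow> 'e) \<Rightarrow> ('a \<Rightarrow> 'e)" where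
  "dual_map M u \<phi> = (\<lambda>x\<in>carrier M. \<phi> (u x))"


section \<open>Linear and abelian categories\<close>

text \<open>The objects form a set \<open>Ob\<close> over a type, so these categories are small. Up to equivalence
  they are exactly the skeletally small ones, and all notions below are invariant under
  equivalence; for a category in this sense the isomorphism classes of objects always form a
  set, so skeletal smallness is not a separate hypothesis.

  The sets \<open>Hom X Y\<close> are not required to be disjoint, so every definition carries domains and
  codomains explicitly.\<close>

record ('k, 'o, 'm) lincat =
  Ob :: "'o set"
  Hom :: "'o \<Rightarrow> 'o \<Rightarrow> ('k, 'm) module"
  Ident :: "'o \<Rightarrow> 'm"
  Comp :: "'m \<Rightarrow> 'm \<Rightarrow> 'm" (infixl \<open>\<cdot>\<index>\<close> 75)

abbreviation arr :: "('k, 'o, 'm) lincat \<Rightarrow> 'o \<Rightarrow> 'o \<Rightarrow> 'm set" where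
  "arr C X Y \<equiv> carrier (Hom C X Y)"

locale linear_category =
  fixes k :: "'k ring" and C :: "('k, 'o, 'm) lincat" (structure)
  assumes base_cring: "cring k"
    and hom_module: "\<lbrakk>X \<in> Ob C; Y \<in> Ob C\<rbrakk> \<Longrightarrow> module k (Hom C X Y)"
    and ident_closed: "X \<in> Ob C \<Longrightarrow> Ident C X \<in> arr C X X"
    and comp_closed: "\<lbrakk>X \<in> Ob C; Y \<in> Ob C; Z \<in> Ob C; f \<in> arr C X Y; g \<in> arr C Y Z\<rbrakk>
          \<Longrightarrow> g \<cdot> f \<in> arr C X Z"
    and comp_ident_right: "\<lbrakk>X \<in> Ob C; Y \<in> Ob C; f \<in> arr C X Y\<rbrakk> \<Longrightarrow> f \<cdot> Ident C X = f"
    and comp_ident_left: "\<lbrakk>X \<in> Ob C; Y \<in> Ob C; f \<in> arr C X Y\<rbrakk> \<Longrightarrow> Ident C Y \<cdot> f = f"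
    and comp_assoc: "\<lbrakk>W \<in> Ob C; X \<in> Ob C; Y \<in> Ob C; Z \<in> Ob C;
          f \<in> arr C W X; g \<in> arr C X Y; h \<in> arr C Y Z\<rbrakk> \<Longrightarrow> h \<cdot> g \<cdot> f = h \<cdot> (g \<cdot> f)"
    and comp_add_right: "\<lbrakk>X \<in> Ob C; Y \<in> Ob C; Z \<in> Ob C; f \<in> arr C X Y; f' \<in> arr C X Y; g \<in> arr C Y Z\<rbrakk>
          \<Longrightarrow> g \<cdot> (f \<oplus>\<^bsub>Hom C X Y\<^esub> f') = g \<cdot> f \<oplus>\<^bsub>Hom C X Z\<^esub> g \<cdot> f'"
    and comp_add_left: "\<lbrakk>X \<in> Ob C; Y \<in> Ob C; Z \<in> Ob C; f \<in> arr C X Y; g \<in> arr C Y Z; g' \<in> arr C Y Z\<rbrakk>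
          \<Longrightarrow> (g \<oplus>\<^bsub>Hom C Y Z\<^esub> g') \<cdot> f = g \<cdot> f \<oplus>\<^bsub>Hom C X Z\<^esub> g' \<cdot> f"
    and comp_smult_right: "\<lbrakk>X \<in> Ob C; Y \<in> Ob C; Z \<in> Ob C; a \<in> carrier k; f \<in> arr C X Y; g \<in> arr C Y Z\<rbrakk>
          \<Longrightarrow> g \<cdot> (a \<odot>\<^bsub>Hom C X Y\<^esub> f) = a \<odot>\<^bsub>Hom C X Z\<^esub> (g \<cdot> f)"
    and comp_smult_left: "\<lbrakk>X \<in> Ob C; Y \<in> Ob C; Z \<in> Ob C; a \<in> carrier k; f \<in> arr C X Y; g \<in> arr C Y Z\<rbrakk>
          \<Longrightarrow> (a \<odot>\<^bsub>Hom C Y Z\<^esub> g) \<cdot> f = a \<odot>\<^bsub>Hom C X Z\<^esub> (g \<cdot> f)"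

definition opposite :: "('k, 'o, 'm) lincat \<Rightarrow> ('k, 'o, 'm) lincat" where
  "opposite C = \<lparr>Ob = Ob C, Hom = (\<lambda>X Y. Hom C Y X), Ident = Ident C, Comp = (\<lambda>g f. f \<cdot>\<^bsub>C\<^esub> g)\<rparr>"

definition iso_arr :: "('k, 'o, 'm) lincat \<Rightarrow> 'o \<Rightarrow> 'o \<Rightarrow> 'm set" where
  "iso_arr C X Y = {f \<in> arr C X Y. \<exists>g\<in>arr C Y X.
     g \<cdot>\<^bsub>C\<^esub> f = Ident C X \<and> f \<cdot>\<^bsub>C\<^esub> g = Ident C Y}"

definition mono_arr :: "('k, 'o, 'm) lincat \<Rightarrow> 'o \<Rightarrow> 'o \<Rightarrow> 'm set" where
  "mono_arr C X Y = {f \<in> arr C X Y. \<forall>Z\<in>Ob C. \<forall>u\<in>arr C Z X. \<forall>v\<in>arr C Z X.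
     f \<cdot>\<^bsub>C\<^esub> u = f \<cdot>\<^bsub>C\<^esub> v \<longrightarrow> u = v}"

definition epi_arr :: "('k, 'o, 'm) lincat \<Rightarrow> 'o \<Rightarrow> 'o \<Rightarrow> 'm set" where
  "epi_arr C X Y = {f \<in> arr C X Y. \<forall>Z\<in>Ob C. \<forall>u\<in>arr C Y Z. \<forall>v\<in>arr C Y Z.
     u \<cdot>\<^bsub>C\<^esub> f = v \<cdot>\<^bsub>C\<^esub> f \<longrightarrow> u = v}"

definition is_kernel :: "('k, 'o, 'm) lincat \<Rightarrow> 'o \<Rightarrow> 'o \<Rightarrow> 'm \<Rightarrow> 'o \<Rightarrow> 'm \<Rightarrow> bool" where
  "is_kernel C X Y f K i \<longleftrightarrow> K \<in> Ob C \<and> i \<in> arr C K X \<and> f \<cdot>\<^bsub>C\<^esub> i = \<zero>\<^bsub>Hom C K Y\<^esub> \<and>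
     (\<forall>Z\<in>Ob C. \<forall>g\<in>arr C Z X. f \<cdot>\<^bsub>C\<^esub> g = \<zero>\<^bsub>Hom C Z Y\<^esub> \<longrightarrow>
        (\<exists>!h. h \<in> arr C Z K \<and> i \<cdot>\<^bsub>C\<^esub> h = g))"

definition is_cokernel :: "('k, 'o, 'm) lincat \<Rightarrow> 'o \<Rightarrow> 'o \<Rightarrow> 'm \<Rightarrow> 'o \<Rightarrow> 'm \<Rightarrow> bool" where
  "is_cokernel C X Y f Q p \<longleftrightarrow> Q \<in> Ob C \<and> p \<in> arr C Y Q \<and> p \<cdot>\<^bsub>C\<^esub> f = \<zero>\<^bsub>Hom C X Q\<^esub> \<and>
     (\<forall>Z\<in>Ob C. \<forall>g\<in>arr C Y Z. g \<cdot>\<^bsub>C\<^esub> f = \<zero>\<^bsub>Hom C X Z\<^esub> \<longrightarrow>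
        (\<exists>!h. h \<in> arr C Q Z \<and> h \<cdot>\<^bsub>C\<^esub> p = g))"

definition is_zero_object :: "('k, 'o, 'm) lincat \<Rightarrow> 'o \<Rightarrow> bool" where
  "is_zero_object C Z \<longleftrightarrow> Z \<in> Ob C \<and>
     (\<forall>X\<in>Ob C. arr C Z X = {\<zero>\<^bsub>Hom C Z X\<^esub>} \<and> arr C X Z = {\<zero>\<^bsub>Hom C X Z\<^esub>})"

definition is_biproduct ::
  "('k, 'o, 'm) lincat \<Rightarrow> 'o \<Rightarrow> 'o \<Rightarrow> 'o \<Rightarrow> 'm \<Rightarrow> 'm \<Rightarrow> 'm \<Rightarrow> 'm \<Rightarrow> bool" where
  "is_biproduct C A B P i\<^sub>1 i\<^sub>2 p\<^sub>1 p\<^sub>2 \<longleftrightarrow> P \<in> Ob C \<and>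
     i\<^sub>1 \<in> arr C A P \<and> i\<^sub>2 \<in> arr C B P \<and> p\<^sub>1 \<in> arr C P A \<and> p\<^sub>2 \<in> arr C P B \<and>
     p\<^sub>1 \<cdot>\<^bsub>C\<^esub> i\<^sub>1 = Ident C A \<and> p\<^sub>2 \<cdot>\<^bsub>C\<^esub> i\<^sub>2 = Ident C B \<and>
     p\<^sub>2 \<cdot>\<^bsub>C\<^esub> i\<^sub>1 = \<zero>\<^bsub>Hom C A B\<^esub> \<and> p\<^sub>1 \<cdot>\<^bsub>C\<^esub> i\<^sub>2 = \<zero>\<^bsub>Hom C B A\<^esub> \<and>
     i\<^sub>1 \<cdot>\<^bsub>C\<^esub> p\<^sub>1 \<oplus>\<^bsub>Hom C P P\<^esub> i\<^sub>2 \<cdot>\<^bsub>C\<^esub> p\<^sub>2 = Ident C P"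

locale abelian_category = linear_category +
  assumes zero_object: "\<exists>Z. is_zero_object C Z"
    and biproducts: "\<lbrakk>A \<in> Ob C; B \<in> Ob C\<rbrakk> \<Longrightarrow> \<exists>P i\<^sub>1 i\<^sub>2 p\<^sub>1 p\<^sub>2. is_biproduct C A B P i\<^sub>1 i\<^sub>2 p\<^sub>1 p\<^sub>2"
    and kernels: "\<lbrakk>X \<in> Ob C; Y \<in> Ob C; f \<in> arr C X Y\<rbrakk> \<Longrightarrow> \<exists>K i. is_kernel C X Y f K i"
    and cokernels: "\<lbrakk>X \<in> Ob C; Y \<in> Ob C; f \<in> arr C X Y\<rbrakk> \<Longrightarrow> \<exists>Q p. is_cokernel C X Y f Q p"
    and mono_is_kernel: "\<lbrakk>X \<in> Ob C; Y \<in> Ob C; i \<in> mono_arr C X Y\<rbrakk>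
          \<Longrightarrow> \<exists>Z\<in>Ob C. \<exists>f\<in>arr C Y Z. is_kernel C Y Z f X i"
    and epi_is_cokernel: "\<lbrakk>X \<in> Ob C; Y \<in> Ob C; p \<in> epi_arr C X Y\<rbrakk>
          \<Longrightarrow> \<exists>Z\<in>Ob C. \<exists>f\<in>arr C Z X. is_cokernel C Z X f Y p"

definition hom_finite :: "'k ring \<Rightarrow> ('k, 'o, 'm) lincat \<Rightarrow> bool" where
  "hom_finite k C \<longleftrightarrow> (\<forall>X\<in>Ob C. \<forall>Y\<in>Ob C. fg_module k (Hom C X Y))"


section \<open>Extension groups\<close>

text \<open>\<open>ses C X Y\<close> consists of the short exact sequences \<open>0 \<rightarrow> Y \<rightarrow> E \<rightarrow> X \<rightarrow> 0\<close>, written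
  \<open>(E, i, p)\<close>. The category need not have enough projectives or injectives, so \<open>Ext\<^sup>1(X, Y)\<close> is
  the module of Yoneda classes with Baer addition.\<close>

definition ses :: "('k, 'o, 'm) lincat \<Rightarrow> 'o \<Rightarrow> 'o \<Rightarrow> ('o \<times> 'm \<times> 'm) set" where
  "ses C X Y = {(E, i, p). E \<in> Ob C \<and> i \<in> arr C Y E \<and> p \<in> arr C E X \<and>
     is_kernel C E X p Y i \<and> is_cokernel C Y E i X p}"

definition ses_equiv ::
  "('k, 'o, 'm) lincat \<Rightarrow> 'o \<Rightarrow> 'o \<Rightarrow> (('o \<times> 'm \<times> 'm) \<times> ('o \<times> 'm \<times> 'm)) set" where
  "ses_equiv C X Y = {((E, i, p), (E', i', p')).
     (E, i, p) \<in> ses C X Y \<and> (E', i', p') \<in> ses C X Y \<and>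
     (\<exists>h\<in>iso_arr C E E'. h \<cdot>\<^bsub>C\<^esub> i = i' \<and> p' \<cdot>\<^bsub>C\<^esub> h = p)}"

text \<open>For \<open>g : Y \<rightarrow> Y'\<close> and a class \<open>c\<close> in \<open>Ext\<^sup>1(X, Y)\<close>, \<open>ext_push C X Y' g c\<close> is the class \<open>g c\<close>,
  consisting of all extensions that receive a morphism \<open>(g, h, 1)\<close> from a member of \<open>c\<close>; dually,
  for \<open>f : X' \<rightarrow> X\<close>, \<open>ext_pull C X' Y f c\<close> is the class \<open>c f\<close>. The existence of such a morphism
  forces the relevant square to be a pushout, respectively a pullback.\<close>

definition ext_push ::
  "('k, 'o, 'm) lincat \<Rightarrow> 'o \<Rightarrow> 'o \<Rightarrow> 'm \<Rightarrow> ('o \<times> 'm \<times> 'm) set \<Rightarrow> ('o \<times> 'm \<times> 'm) set" where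
  "ext_push C X Y' g c = {(E', i', p'). (E', i', p') \<in> ses C X Y' \<and>
     (\<exists>(E, i, p)\<in>c. \<exists>h\<in>arr C E E'. h \<cdot>\<^bsub>C\<^esub> i = i' \<cdot>\<^bsub>C\<^esub> g \<and> p' \<cdot>\<^bsub>C\<^esub> h = p)}"

definition ext_pull ::
  "('k, 'o, 'm) lincat \<Rightarrow> 'o \<Rightarrow> 'o \<Rightarrow> 'm \<Rightarrow> ('o \<times> 'm \<times> 'm) set \<Rightarrow> ('o \<times> 'm \<times> 'm) set" where
  "ext_pull C X' Y f c = {(E', i', p'). (E', i', p') \<in> ses C X' Y \<and>
     (\<exists>(E, i, p)\<in>c. \<exists>h\<in>arr C E' E. h \<cdot>\<^bsub>C\<^esub> i' = i \<and> p \<cdot>\<^bsub>C\<^esub> h = f \<cdot>\<^bsub>C\<^esub> p')}"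

text \<open>The Baer sum of \<open>\<xi>\<^sub>1\<close> and \<open>\<xi>\<^sub>2\<close> is \<open>\<nabla>(\<xi>\<^sub>1 \<oplus> \<xi>\<^sub>2)\<Delta>\<close>. The existential quantifiers range over
  all choices of the three biproducts \<open>XX\<close>, \<open>YY\<close>, \<open>EE\<close>; the class does not depend on them.\<close>

definition baer_sum ::
  "('k, 'o, 'm) lincat \<Rightarrow> 'o \<Rightarrow> 'o \<Rightarrow>
   ('o \<times> 'm \<times> 'm) set \<Rightarrow> ('o \<times> 'm \<times> 'm) set \<Rightarrow> ('o \<times> 'm \<times> 'm) set" where
  "baer_sum C X Y c\<^sub>1 c\<^sub>2 = {\<zeta>. \<exists>(E\<^sub>1, i\<^sub>1, p\<^sub>1)\<in>c\<^sub>1. \<exists>(E\<^sub>2, i\<^sub>2, p\<^sub>2)\<in>c\<^sub>2.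
     \<exists>XX x\<^sub>1 x\<^sub>2 x\<^sub>1' x\<^sub>2' YY y\<^sub>1 y\<^sub>2 y\<^sub>1' y\<^sub>2' EE e\<^sub>1 e\<^sub>2 e\<^sub>1' e\<^sub>2'.
       is_biproduct C X X XX x\<^sub>1 x\<^sub>2 x\<^sub>1' x\<^sub>2' \<and>
       is_biproduct C Y Y YY y\<^sub>1 y\<^sub>2 y\<^sub>1' y\<^sub>2' \<and>
       is_biproduct C E\<^sub>1 E\<^sub>2 EE e\<^sub>1 e\<^sub>2 e\<^sub>1' e\<^sub>2' \<and>
       (let i = e\<^sub>1 \<cdot>\<^bsub>C\<^esub> i\<^sub>1 \<cdot>\<^bsub>C\<^esub> y\<^sub>1' \<oplus>\<^bsub>Hom C YY EE\<^esub> e\<^sub>2 \<cdot>\<^bsub>C\<^esub> i\<^sub>2 \<cdot>\<^bsub>C\<^esub> y\<^sub>2';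
            p = x\<^sub>1 \<cdot>\<^bsub>C\<^esub> p\<^sub>1 \<cdot>\<^bsub>C\<^esub> e\<^sub>1' \<oplus>\<^bsub>Hom C EE XX\<^esub> x\<^sub>2 \<cdot>\<^bsub>C\<^esub> p\<^sub>2 \<cdot>\<^bsub>C\<^esub> e\<^sub>2';
            diag = x\<^sub>1 \<oplus>\<^bsub>Hom C X XX\<^esub> x\<^sub>2;
            codiag = y\<^sub>1' \<oplus>\<^bsub>Hom C YY Y\<^esub> y\<^sub>2'
        in \<zeta> \<in> ext_pull C X Y diag (ext_push C XX Y codiag {(EE, i, p)}))}"

definition Ext1 :: "('k, 'o, 'm) lincat \<Rightarrow> 'o \<Rightarrow> 'o \<Rightarrow> ('k, ('o \<times> 'm \<times> 'm) set) module" where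
  "Ext1 C X Y =
     \<lparr>carrier = ses C X Y // ses_equiv C X Y, monoid.mult = undefined, one = undefined,
      ring.zero = {(E, i, p). (E, i, p) \<in> ses C X Y \<and> (\<exists>s\<in>arr C X E. p \<cdot>\<^bsub>C\<^esub> s = Ident C X)},
      ring.add = baer_sum C X Y,
      module.smult = (\<lambda>a. ext_push C X Y (a \<odot>\<^bsub>Hom C Y Y\<^esub> Ident C Y))\<rparr>"


section \<open>Serre duality\<close>

text \<open>A functor is given by its object map and, for each pair of objects, its map on morphisms.\<close>

locale endofunctor =
  fixes C :: "('k, 'o, 'm) lincat" (structure)
    and Fo :: "'o \<Rightarrow> 'o" and Fm :: "'o \<Rightarrow> 'o \<Rightarrow> 'm \<Rightarrow> 'm"
  assumes ob_closed: "X \<in> Ob C \<Longrightarrow> Fo X \<in> Ob C"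
    and arr_closed: "\<lbrakk>X \<in> Ob C; Y \<in> Ob C; f \<in> arr C X Y\<rbrakk> \<Longrightarrow> Fm X Y f \<in> arr C (Fo X) (Fo Y)"
    and map_ident: "X \<in> Ob C \<Longrightarrow> Fm X X (Ident C X) = Ident C (Fo X)"
    and map_comp: "\<lbrakk>X \<in> Ob C; Y \<in> Ob C; Z \<in> Ob C; f \<in> arr C X Y; g \<in> arr C Y Z\<rbrakk>
          \<Longrightarrow> Fm X Z (g \<cdot> f) = Fm Y Z g \<cdot> Fm X Y f"

locale linear_endofunctor = endofunctor C Fo Fm
  for k :: "'k ring" and C :: "('k, 'o, 'm) lincat" (structure)
    and Fo :: "'o \<Rightarrow> 'o" and Fm :: "'o \<Rightarrow> 'o \<Rightarrow> 'm \<Rightarrow> 'm" +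
  assumes map_add: "\<lbrakk>X \<in> Ob C; Y \<in> Ob C; f \<in> arr C X Y; g \<in> arr C X Y\<rbrakk>
          \<Longrightarrow> Fm X Y (f \<oplus>\<^bsub>Hom C X Y\<^esub> g) = Fm X Y f \<oplus>\<^bsub>Hom C (Fo X) (Fo Y)\<^esub> Fm X Y g"
    and map_smult: "\<lbrakk>X \<in> Ob C; Y \<in> Ob C; a \<in> carrier k; f \<in> arr C X Y\<rbrakk>
          \<Longrightarrow> Fm X Y (a \<odot>\<^bsub>Hom C X Y\<^esub> f) = a \<odot>\<^bsub>Hom C (Fo X) (Fo Y)\<^esub> Fm X Y f"

definition naturally_isomorphic ::
  "('k, 'o, 'm) lincat \<Rightarrow> ('o \<Rightarrow> 'o) \<Rightarrow> ('o \<Rightarrow> 'o \<Rightarrow> 'm \<Rightarrow> 'm) \<Rightarrow>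
   ('o \<Rightarrow> 'o) \<Rightarrow> ('o \<Rightarrow> 'o \<Rightarrow> 'm \<Rightarrow> 'm) \<Rightarrow> bool" where
  "naturally_isomorphic C Fo Fm Go Gm \<longleftrightarrow>
     (\<exists>\<eta>. (\<forall>X\<in>Ob C. \<eta> X \<in> iso_arr C (Fo X) (Go X)) \<and>
          (\<forall>X\<in>Ob C. \<forall>Y\<in>Ob C. \<forall>f\<in>arr C X Y. Gm X Y f \<cdot>\<^bsub>C\<^esub> \<eta> X = \<eta> Y \<cdot>\<^bsub>C\<^esub> Fm X Y f))"

definition auto_equivalence ::
  "('k, 'o, 'm) lincat \<Rightarrow> ('o \<Rightarrow> 'o) \<Rightarrow> ('o \<Rightarrow> 'o \<Rightarrow> 'm \<Rightarrow> 'm) \<Rightarrow> bool" where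
  "auto_equivalence C Fo Fm \<longleftrightarrow> endofunctor C Fo Fm \<and>
     (\<exists>Go Gm. endofunctor C Go Gm \<and>
        naturally_isomorphic C (\<lambda>X. Go (Fo X)) (\<lambda>X Y f. Gm (Fo X) (Fo Y) (Fm X Y f))
          (\<lambda>X. X) (\<lambda>X Y f. f) \<and>
        naturally_isomorphic C (\<lambda>X. Fo (Go X)) (\<lambda>X Y f. Fm (Go X) (Go Y) (Gm X Y f))
          (\<lambda>X. X) (\<lambda>X Y f. f))"

text \<open>The last two conjuncts state naturality of \<open>\<phi> X Y : D Ext\<^sup>1(X, Y) \<rightarrow> Hom(Y, \<tau> X)\<close> in \<open>X\<close>
  (covariant) and in \<open>Y\<close> (contravariant).\<close>

definition has_serre_duality :: "'k ring \<Rightarrow> ('k, 'e) module \<Rightarrow> ('k, 'o, 'm) lincat \<Rightarrow> bool" where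
  "has_serre_duality k E C \<longleftrightarrow>
     (\<exists>\<tau>o \<tau>m. linear_endofunctor k C \<tau>o \<tau>m \<and> auto_equivalence C \<tau>o \<tau>m \<and>
        (\<exists>\<phi>. (\<forall>X\<in>Ob C. \<forall>Y\<in>Ob C.
                 \<phi> X Y \<in> lin_iso k (dual_module k E (Ext1 C X Y)) (Hom C Y (\<tau>o X))) \<and>
             (\<forall>X\<in>Ob C. \<forall>X'\<in>Ob C. \<forall>Y\<in>Ob C. \<forall>f\<in>arr C X X'.
                \<forall>d\<in>carrier (dual_module k E (Ext1 C X Y)).
                  \<phi> X' Y (dual_map (Ext1 C X' Y) (ext_pull C X Y f) d)
                    = \<tau>m X X' f \<cdot>\<^bsub>C\<^esub> \<phi> X Y d) \<and>
             (\<forall>X\<in>Ob C. \<forall>Y\<in>Ob C. \<forall>Y'\<in>Ob C. \<forall>g\<in>arr C Y' Y.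
                \<forall>d\<in>carrier (dual_module k E (Ext1 C X Y)).
                  \<phi> X Y' (dual_map (Ext1 C X Y') (ext_push C X Y g) d)
                    = \<phi> X Y d \<cdot>\<^bsub>C\<^esub> g)))"


section \<open>Morphisms determined by objects\<close>

definition Gamma :: "('k, 'o, 'm) lincat \<Rightarrow> 'o \<Rightarrow> 'm ring" where
  "Gamma \<C> C =
     \<lparr>carrier = arr \<C> C C, monoid.mult = (\<lambda>a b. b \<cdot>\<^bsub>\<C>\<^esub> a), one = Ident \<C> C,
      ring.zero = \<zero>\<^bsub>Hom \<C> C C\<^esub>, ring.add = (\<lambda>a b. a \<oplus>\<^bsub>Hom \<C> C C\<^esub> b)\<rparr>"

text \<open>\<open>Hom(C, X)\<close> as a left module over \<open>Gamma \<C> C\<close>. The library predicate \<open>submodule\<close> is applied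
  to it below; unlike \<open>module\<close>, that predicate does not presuppose a commutative ring.\<close>

definition HomGamma :: "('k, 'o, 'm) lincat \<Rightarrow> 'o \<Rightarrow> 'o \<Rightarrow> ('m, 'm) module" where
  "HomGamma \<C> C X =
     \<lparr>carrier = arr \<C> C X, monoid.mult = undefined, one = undefined,
      ring.zero = \<zero>\<^bsub>Hom \<C> C X\<^esub>, ring.add = (\<lambda>f g. f \<oplus>\<^bsub>Hom \<C> C X\<^esub> g),
      module.smult = (\<lambda>a f. f \<cdot>\<^bsub>\<C>\<^esub> a)\<rparr>"

definition Im_Hom :: "('k, 'o, 'm) lincat \<Rightarrow> 'o \<Rightarrow> 'o \<Rightarrow> 'm \<Rightarrow> 'm set" where
  "Im_Hom \<C> C X \<alpha> = (\<lambda>f. \<alpha> \<cdot>\<^bsub>\<C>\<^esub> f) ` arr \<C> C X"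

definition right_determined :: "('k, 'o, 'm) lincat \<Rightarrow> 'o \<Rightarrow> 'o \<Rightarrow> 'm \<Rightarrow> 'o \<Rightarrow> bool" where
  "right_determined \<C> X Y \<alpha> C \<longleftrightarrow>
     (\<forall>T\<in>Ob \<C>. \<forall>t\<in>arr \<C> T Y. Im_Hom \<C> C T t \<subseteq> Im_Hom \<C> C X \<alpha> \<longrightarrow>
        (\<exists>t'\<in>arr \<C> T X. t = \<alpha> \<cdot>\<^bsub>\<C>\<^esub> t'))"

definition right_represented :: "('k, 'o, 'm) lincat \<Rightarrow> 'o \<Rightarrow> 'm set \<Rightarrow> 'o \<Rightarrow> 'o \<Rightarrow> 'm \<Rightarrow> bool" where
  "right_represented \<C> C H X Y \<alpha> \<longleftrightarrow> right_determined \<C> X Y \<alpha> C \<and> H = Im_Hom \<C> C X \<alpha>"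

definition right_epi_classified :: "('k, 'o, 'm) lincat \<Rightarrow> 'o \<Rightarrow> bool" where
  "right_epi_classified \<C> Y \<longleftrightarrow>
     (\<forall>X\<in>Ob \<C>. \<forall>\<alpha>\<in>epi_arr \<C> X Y. \<exists>C\<in>Ob \<C>. right_determined \<C> X Y \<alpha> C) \<and>
     (\<forall>C\<in>Ob \<C>. \<forall>H. submodule H (Gamma \<C> C) (HomGamma \<C> C Y) \<longrightarrow>
        (\<exists>X\<in>Ob \<C>. \<exists>\<alpha>\<in>epi_arr \<C> X Y. right_represented \<C> C H X Y \<alpha>))"

definition has_right_determined_epis :: "('k, 'o, 'm) lincat \<Rightarrow> bool" where
  "has_right_determined_epis \<C> \<longleftrightarrow> (\<forall>Y\<in>Ob \<C>. right_epi_classified \<C> Y)"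

definition left_mono_classified :: "('k, 'o, 'm) lincat \<Rightarrow> 'o \<Rightarrow> bool" where
  "left_mono_classified \<C> Y \<longleftrightarrow> right_epi_classified (opposite \<C>) Y"

definition has_left_determined_monos :: "('k, 'o, 'm) lincat \<Rightarrow> bool" where
  "has_left_determined_monos \<C> \<longleftrightarrow> (\<forall>Y\<in>Ob \<C>. left_mono_classified \<C> Y)"

end

theory Submission
  imports Defs
begin

text \<open>A Serre pairing for \<open>X\<close> is an object \<open>K\<close> with a functional \<open>t\<close> on \<open>Ext\<^sup>1(X, K)\<close> such that
  \<open>Hom(Y, K) \<times> Ext\<^sup>1(X, Y) \<rightarrow> Ext\<^sup>1(X, K) \<rightarrow> E\<close> is perfect for every \<open>Y\<close>, and likewise
  \<open>Ext\<^sup>1(Z, K) \<times> Hom(X, Z) \<rightarrow> Ext\<^sup>1(X, K) \<rightarrow> E\<close> for every \<open>Z\<close>. Serre duality amounts to the existence of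
  such a pairing for every object \<open>X\<close> and, on the other side, for every object \<open>K\<close>; then \<open>K = \<tau> X\<close>.

  Given the pairings, an extension \<open>c\<close> of \<open>Y\<close> by \<open>K = \<tau> C\<close> determines its epimorphism by \<open>C\<close>, because a
  class \<open>c h\<close> in \<open>Ext\<^sup>1(T, K)\<close> vanishes as soon as it pairs trivially with \<open>Hom(C, T)\<close>; and every submodule
  of \<open>Hom(C, Y)\<close> is a finite intersection of annihilators of such classes, by Matlis duality.
  Conversely, if \<open>X\<close> is indecomposable, then (REC2) applied to the radical of \<open>End(X)\<close>, together with its dual,
  yields an almost split class in \<open>Ext\<^sup>1(X, K)\<close>, and a functional that does not vanish on it gives a Serre
  pairing. Serre pairings add up along biproducts, and by Fitting's lemma and the descending chain
  condition every object is reached.\<close>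

text \<open>At the outset only the \<open>Hom\<close> modules are known to be finitely generated,
  not the \<open>Ext\<close> modules. The duality is therefore arranged so that perfectness of a
  pairing asks for finiteness on the \<open>Hom\<close> side alone; finiteness of \<open>Ext\<close>
  comes afterwards, because the pairing makes its dual a quotient of a \<open>Hom\<close> module.
  Matlis theory has to be drawn from a module \<open>E\<close> that is given by minimality only: the
  decisive fact is that every endomorphism of \<open>E\<close> is multiplication by a scalar, and
  there minimality and the artinian hypothesis meet. A class that is almost split on one side only
  would leave one argument of the pairing degenerate, hence the dual condition; the two one-sided
  classes are then matched by an isomorphism. To have each mirror statement from its original,
  \<open>Hom\<close> and \<open>Ext\<close> form one partial composition with degrees, whose axioms
  are symmetric in source and target.\<close>

abbreviation (input) add_in ("(_ +[_]/ _)" [65, 0, 66] 65) where "x +[M] y == x \<oplus>\<^bsub>M\<^esub> y"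
abbreviation (input) minus_in ("(_ -[_]/ _)" [65, 0, 66] 65) where "x -[M] y == x \<ominus>\<^bsub>M\<^esub> y"
abbreviation (input) neg_in ("(-[_] _)" [0, 81] 80) where "-[M] x == \<ominus>\<^bsub>M\<^esub> x"
abbreviation (input) mult_in ("(_ *[_]/ _)" [70, 0, 71] 70) where "x *[R] y == x \<otimes>\<^bsub>R\<^esub> y"
abbreviation (input) smult_in ("(_ .[_]/ _)" [70, 0, 71] 70) where "a .[M] x == a \<odot>\<^bsub>M\<^esub> x"
abbreviation (input) zero_in ("0[_]") where "0[M] == \<zero>\<^bsub>M\<^esub>"
abbreviation (input) iff_in :: "bool => bool => bool" (infixr "<->" 25) where "A <-> B == A = B"
abbreviation (input) one_in ("1[_]") where "1[R] == \<one>\<^bsub>R\<^esub>"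

section \<open>Submodules, partially defined linear maps and Zorn's lemma\<close>

definition subm :: "('k, 'x) ring_scheme => ('k, 'a, 'y) module_scheme => 'a set => bool" where
  "subm k M W <-> W \<subseteq> carrier M & 0[M] \<in> W & (\<forall>x\<in>W. \<forall>y\<in>W. x +[M] y \<in> W) &
     (\<forall>a\<in>carrier k. \<forall>x\<in>W. a .[M] x \<in> W)"

text \<open>Linearity on a subset and without extensionality, so that a map can be restricted and
  extended while the record \<open>M\<close> stays the same.\<close>

definition lin_on :: "('k, 'x) ring_scheme => ('k, 'a, 'y) module_scheme => ('k, 'b, 'z) module_scheme => 'a set => ('a => 'b) => bool" where
  "lin_on k M N W f <-> (\<forall>x\<in>W. f x \<in> carrier N) &
     (\<forall>x\<in>W. \<forall>y\<in>W. f (x +[M] y) = f x +[N] f y) &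
     (\<forall>a\<in>carrier k. \<forall>x\<in>W. f (a .[M] x) = a .[N] f x)"

lemma submD:
  assumes "subm k M W"
  shows "W \<subseteq> carrier M" "0[M] \<in> W" "!!x. x \<in> W ==> x \<in> carrier M"
    "!!x y. [| x \<in> W; y \<in> W |] ==> x +[M] y \<in> W"
    "!!a x. [| a \<in> carrier k; x \<in> W |] ==> a .[M] x \<in> W" using assms unfolding subm_def by auto

lemma lin_onD:
  assumes "lin_on k M N W f"
  shows "!!x. x \<in> W ==> f x \<in> carrier N"
    "!!x y. [| x \<in> W; y \<in> W |] ==> f (x +[M] y) = f x +[N] f y"
    "!!a x. [| a \<in> carrier k; x \<in> W |] ==> f (a .[M] x) = a .[N] f x" using assms unfolding lin_on_def by auto

lemma lin_onI:
  assumes "!!x. x \<in> W ==> f x \<in> carrier N"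
    "!!x y. [| x \<in> W; y \<in> W |] ==> f (x +[M] y) = f x +[N] f y"
    "!!a x. [| a \<in> carrier k; x \<in> W |] ==> f (a .[M] x) = a .[N] f x"
  shows "lin_on k M N W f" using assms unfolding lin_on_def by auto

lemma submI:
  assumes "!!x. x \<in> W ==> x \<in> carrier M" "0[M] \<in> W"
    "!!x y. [| x \<in> W; y \<in> W |] ==> x +[M] y \<in> W"
    "!!a x. [| a \<in> carrier k; x \<in> W |] ==> a .[M] x \<in> W"
  shows "subm k M W" using assms unfolding subm_def by auto

lemma subset_chain_total:
  assumes "subset.chain \<F> \<C>" "V \<in> \<C>" "W \<in> \<C>"
  shows "V \<subseteq> W \<or> W \<subseteq> V"
proof -
  have "\<forall>x\<in>\<C>. \<forall>y\<in>\<C>. x \<subseteq> y \<or> y \<subseteq> x" using assms(1) unfolding subset.chain_def by auto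
  thus ?thesis using assms(2,3) by blast
qed

lemma lin_on_subset: "lin_on k M N V f ==> W \<subseteq> V ==> lin_on k M N W f" unfolding lin_on_def by blast

context module begin

lemma subm_carrier: "subm R M (carrier M)" by (rule submI) auto

lemma subm_neg: "subm R M W ==> x \<in> W ==> -[M] x \<in> W"
  using submD(5)[of R M W "\<ominus> \<one>" x] smult_l_minus[of \<one> x] submD(3)[of R M W x] by auto

lemma subm_minus: "subm R M W ==> x \<in> W ==> y \<in> W ==> x -[M] y \<in> W" unfolding a_minus_def using subm_neg submD(4) by metis

lemma minus_eq_zero: "x \<in> carrier M ==> y \<in> carrier M ==> x -[M] y = 0[M] <-> x = y"
  using M.add.inv_solve_right[of "0[M]" x y] unfolding a_minus_def by auto

lemma minus_add_cancel: "x \<in> carrier M ==> y \<in> carrier M ==> (x -[M] y) +[M] y = x"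
  unfolding a_minus_def by (simp add: M.a_assoc M.l_neg)

lemma add_cancel_swap:
  assumes "x \<in> carrier M" "y \<in> carrier M" "x' \<in> carrier M" "y' \<in> carrier M"
  shows "x +[M] y = x' +[M] y' <-> y -[M] y' = x' -[M] x"
proof
  assume eq: "x +[M] y = x' +[M] y'"
  have "y -[M] y' = (x -[M] x) +[M] (y -[M] y')" using assms by (simp add: a_minus_def M.r_neg)
  also have "\<dots> = (x +[M] y) -[M] x -[M] y'" using assms by (simp add: a_minus_def M.a_ac)
  also have "\<dots> = (x' -[M] x) +[M] (y' -[M] y')" unfolding eq using assms by (simp add: a_minus_def M.a_ac)
  also have "\<dots> = x' -[M] x" using assms by (simp add: a_minus_def M.r_neg)
  finally show "y -[M] y' = x' -[M] x" .
next
  assume eq: "y -[M] y' = x' -[M] x"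
  have "x +[M] y = x +[M] ((y -[M] y') +[M] y')" using assms by (simp add: minus_add_cancel)
  also have "\<dots> = ((x' -[M] x) +[M] x) +[M] y'" unfolding eq using assms by (simp add: a_minus_def M.a_ac)
  also have "\<dots> = x' +[M] y'" using assms by (simp add: minus_add_cancel)
  finally show "x +[M] y = x' +[M] y'" .
qed

lemma subm_zero: "subm R M {0[M]}" by (rule submI) auto

lemma lin_zero:
  assumes "lin_on R M N W f" "subm R M W" "module R N"
  shows "f 0[M] = 0[N]"
proof -
  interpret N: module R N by fact
  have "f (\<zero> .[M] 0[M]) = \<zero> .[N] f 0[M]" using lin_onD(3)[OF assms(1)] submD(2)[OF assms(2)] by blast
  thus ?thesis using lin_onD(1)[OF assms(1) submD(2)[OF assms(2)]] by simp
qed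

lemma lin_neg:
  assumes "lin_on R M N W f" "subm R M W" "module R N" "x \<in> W"
  shows "f (-[M] x) = -[N] f x"
proof -
  interpret N: module R N by fact
  have "f ((\<ominus> \<one>) .[M] x) = (\<ominus> \<one>) .[N] f x" using lin_onD(3)[OF assms(1)] assms(4) by blast
  thus ?thesis using lin_onD(1)[OF assms(1,4)] submD(3)[OF assms(2,4)] smult_l_minus[of \<one> x] N.smult_l_minus[of \<one> "f x"] by auto
qed

lemma lin_minus:
  assumes "lin_on R M N W f" "subm R M W" "module R N" "x \<in> W" "y \<in> W"
  shows "f (x -[M] y) = f x -[N] f y" unfolding a_minus_def using lin_neg[OF assms(1-3,5)] lin_onD(2)[OF assms(1,4), of "-[M] y"]
  subm_neg[OF assms(2,5)] by auto

lemma smult_r_minus2: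
  "[| a \<in> carrier R; x \<in> carrier M; y \<in> carrier M |] ==> a .[M] (x -[M] y) = a .[M] x -[M] a .[M] y"
  unfolding a_minus_def by (simp add: smult_r_distr smult_r_minus)

lemma smult_l_minus2:
  "[| a \<in> carrier R; b \<in> carrier R; x \<in> carrier M |] ==> (a \<ominus> b) .[M] x = a .[M] x -[M] b .[M] x"
  unfolding a_minus_def by (simp add: smult_l_distr smult_l_minus)

lemma subm_sum1:
  assumes "subm R M W" "x \<in> carrier M"
  shows "subm R M {w +[M] a .[M] x | w a. w \<in> W & a \<in> carrier R}" (is "subm R M ?S")
proof (rule submI)
  note W = submD[OF assms(1)]
  show "y \<in> carrier M" if "y \<in> ?S" for y using that W(3) assms(2) by auto
  have "0[M] = 0[M] +[M] \<zero> .[M] x" using assms by simp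
  thus "0[M] \<in> ?S" using W(2) by blast
  show "y +[M] z \<in> ?S" if yz: "y \<in> ?S" "z \<in> ?S" for y z
  proof -
    from yz(1) obtain w a where 1: "y = w +[M] a .[M] x" "w \<in> W" "a \<in> carrier R" by auto
    from yz(2) obtain v b where 2: "z = v +[M] b .[M] x" "v \<in> W" "b \<in> carrier R" by auto
    have "y +[M] z = (w +[M] v) +[M] (a \<oplus> b) .[M] x" using 1 2 assms(2) W(3) by (simp add: smult_l_distr M.a_ac)
    thus ?thesis using 1 2 W(4) by blast
  qed
  show "b .[M] y \<in> ?S" if yz: "b \<in> carrier R" "y \<in> ?S" for b y
  proof -
    from yz(2) obtain w a where 1: "y = w +[M] a .[M] x" "w \<in> W" "a \<in> carrier R" by auto
    have "b .[M] y = (b .[M] w) +[M] (b \<otimes> a) .[M] x" using 1 yz assms(2) W(3) by (simp add: smult_r_distr smult_assoc1)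
    thus ?thesis using 1 yz W(5) by blast
  qed
qed

lemma subm_sum1_sup:
  assumes "subm R M W" "x \<in> carrier M"
  shows "W \<subseteq> {w +[M] a .[M] x | w a. w \<in> W & a \<in> carrier R}"
    "x \<in> {w +[M] a .[M] x | w a. w \<in> W & a \<in> carrier R}"
proof -
  note W = submD[OF assms(1)]
  show "W \<subseteq> {w +[M] a .[M] x | w a. w \<in> W & a \<in> carrier R}"
  proof
    fix w assume "w \<in> W"
    hence "w = w +[M] \<zero> .[M] x" using assms W(3) by simp
    thus "w \<in> {w +[M] a .[M] x | w a. w \<in> W & a \<in> carrier R}" using \<open>w \<in> W\<close> by blast
  qed
  have "x = 0[M] +[M] \<one> .[M] x" using assms by simp
  thus "x \<in> {w +[M] a .[M] x | w a. w \<in> W & a \<in> carrier R}" using W(2) by blast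
qed

lemma subm_chain_Union:
  assumes "\<C> ~= {}" "!!W. W \<in> \<C> ==> subm R M W" "!!V W. V \<in> \<C> ==> W \<in> \<C> ==> V \<subseteq> W \<or> W \<subseteq> V"
  shows "subm R M (\<Union>\<C>)"
proof (rule submI)
  show "x \<in> carrier M" if "x \<in> \<Union>\<C>" for x using that submD(3)[OF assms(2)] by blast
  show "0[M] \<in> \<Union>\<C>" using assms(1,2) submD(2) by blast
  show "x +[M] y \<in> \<Union>\<C>" if xy: "x \<in> \<Union>\<C>" "y \<in> \<Union>\<C>" for x y
  proof -
    obtain V W where "V \<in> \<C>" "W \<in> \<C>" "x \<in> V" "y \<in> W" using xy by blast
    with assms(3)[of V W] obtain U where "U \<in> \<C>" "x \<in> U" "y \<in> U" by blast
    thus ?thesis using submD(4)[OF assms(2)] by blast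
  qed
  show "a .[M] x \<in> \<Union>\<C>" if "a \<in> carrier R" "x \<in> \<Union>\<C>" for a x using that submD(5)[OF assms(2)] by blast
qed

text \<open>Zorn's lemma in the one form used below. The forbidden set \<open>A\<close> varies:
  nonzero elements of \<open>0 \<times> E\<close> for extending maps, nonzero elements of a cyclic
  submodule or of \<open>N\<close> for complements inside \<open>E\<close>.\<close>

lemma maximal_subm_avoiding:
  assumes "subm R M T" "!!x. x \<in> A ==> x \<notin> T"
  obtains N where "subm R M N" "T \<subseteq> N" "N \<inter> A = {}"
    "!!N'. subm R M N' ==> N \<subseteq> N' ==> N' \<inter> A = {} ==> N' = N"
proof -
  let ?F = "{N. subm R M N & T \<subseteq> N & N \<inter> A = {}}"
  have "\<exists>M\<in>?F. \<forall>X\<in>?F. M \<subseteq> X --> X = M"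
  proof (rule subset_Zorn_nonempty)
    show "?F ~= {}" using assms by auto
    fix \<C> assume C: "\<C> ~= {}" "subset.chain ?F \<C>"
    have sub: "!!W. W \<in> \<C> ==> W \<in> ?F" using C(2) unfolding subset.chain_def by blast
    have "V \<subseteq> W \<or> W \<subseteq> V" if "V \<in> \<C>" "W \<in> \<C>" for V W using subset_chain_total[OF C(2) that] .
    moreover have "subm R M W" if "W \<in> \<C>" for W using sub[OF that] by simp
    ultimately have "subm R M (\<Union>\<C>)" by (intro subm_chain_Union C(1))
    thus "\<Union>\<C> \<in> ?F" using C(1) sub by fastforce
  qed
  then obtain N where N: "N \<in> ?F" "\<forall>X\<in>?F. N \<subseteq> X --> X = N" by blast
  show ?thesis
  proof (rule that[of N])
    fix N' assume "subm R M N'" "N \<subseteq> N'" "N' \<inter> A = {}"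
    moreover have "T \<subseteq> N'" using N(1) \<open>N \<subseteq> N'\<close> by blast
    ultimately show "N' = N" using N(2) by simp
  qed (use N(1) in auto)
qed

end

section \<open>Baer's criterion and extension of linear maps into an injective module\<close>

text \<open>The module \<open>I / J\<close> for ideals \<open>J \<subseteq> I\<close> of \<open>k\<close>, carried by the type over which
  injectivity and cogeneration quantify; \<open>r\<close> picks representatives modulo \<open>J\<close>.\<close>

definition idquot :: "('k, 'x) ring_scheme => 'k set => ('k => 'k) => ('k, (nat => 'k) set) module" where
  "idquot k I r = \<lparr>carrier = (%x. {%_. r x}) ` I, monoid.mult = undefined, one = undefined,
     ring.zero = {%_. r 0[k]},
     ring.add = (%X Y. {%_. r (the_elem X 0 +[k] the_elem Y 0)}),
     module.smult = (%a X. {%_. r (a *[k] the_elem X 0)})\<rparr>"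

definition idl :: "('k, 'x) ring_scheme => 'k set => bool" where
  "idl k I <-> I \<subseteq> carrier k & 0[k] \<in> I & (\<forall>x\<in>I. \<forall>y\<in>I. x +[k] y \<in> I) &
     (\<forall>a\<in>carrier k. \<forall>x\<in>I. a *[k] x \<in> I)"

lemma idlD:
  assumes "idl k I"
  shows "!!x. x \<in> I ==> x \<in> carrier k" "0[k] \<in> I"
    "!!x y. [| x \<in> I; y \<in> I |] ==> x +[k] y \<in> I" "!!a x. [| a \<in> carrier k; x \<in> I |] ==> a *[k] x \<in> I"
  using assms unfolding idl_def by auto

lemma idlI:
  assumes "!!x. x \<in> I ==> x \<in> carrier k" "0[k] \<in> I"
    "!!x y. [| x \<in> I; y \<in> I |] ==> x +[k] y \<in> I" "!!a x. [| a \<in> carrier k; x \<in> I |] ==> a *[k] x \<in> I"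
  shows "idl k I" using assms unfolding idl_def by auto

context cring begin

lemma idl_neg: "idl R I ==> x \<in> I ==> \<ominus> x \<in> I"
  using idlD(4)[of R I "\<ominus> \<one>" x] idlD(1)[of R I x] l_minus[of \<one> x] by auto

lemma idl_ideal:
  assumes I: "idl R I"
  shows "ideal I R"
proof (rule idealI[OF ring_axioms])
  show "subgroup I (add_monoid R)"
  proof (rule add.subgroupI)
    show "I \<subseteq> carrier R" "I ~= {}" using idlD(1,2)[OF I] by auto
    show "\<ominus> a \<in> I" if "a \<in> I" for a using idl_neg[OF I that] .
    show "a \<oplus> b \<in> I" if "a \<in> I" "b \<in> I" for a b using idlD(3)[OF I] that by simp
  qed
  fix a x assume "a \<in> I" "x \<in> carrier R"
  thus "x \<otimes> a \<in> I" "a \<otimes> x \<in> I" using idlD(1,4)[OF I] m_comm by metis+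
qed

lemma idl_minus: "idl R I ==> x \<in> I ==> y \<in> I ==> x \<ominus> y \<in> I" unfolding a_minus_def using idl_neg idlD(3) by metis

text \<open>The representative function commutes with sums and with multiples up to one further
  application of \<open>r\<close> (\<open>radd\<close>, \<open>rmul\<close>), so every module law is
  inherited from the ring.\<close>

lemma idquot_module:
  assumes I: "idl R I" and J: "idl R J" "J \<subseteq> I"
    and r: "!!x. x \<in> carrier R ==> r x \<in> carrier R & x \<ominus> r x \<in> J"
      "!!x y. [| x \<in> carrier R; y \<in> carrier R; x \<ominus> y \<in> J |] ==> r x = r y"
  shows "module R (idquot R I r)"
proof -
  note I' = idlD[OF I] and J' = idlD[OF J(1)]
  have radd: "r (r x \<oplus> r y) = r (x \<oplus> y)" if "x \<in> carrier R" "y \<in> carrier R" for x y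
  proof (rule r(2))
    have "(x \<ominus> r x) \<oplus> (y \<ominus> r y) \<in> J" using r(1) that J'(3) by blast
    hence "\<ominus> ((x \<ominus> r x) \<oplus> (y \<ominus> r y)) \<in> J" using idl_neg J(1) by blast
    moreover have "\<ominus> ((x \<ominus> r x) \<oplus> (y \<ominus> r y)) = r x \<oplus> r y \<ominus> (x \<oplus> y)"
      using r(1)[OF that(1)] r(1)[OF that(2)] that by (simp add: a_minus_def minus_add a_ac add.inv_mult_group)
    ultimately show "r x \<oplus> r y \<ominus> (x \<oplus> y) \<in> J" by simp
  qed (use r(1) that in auto)
  have rmul: "r (a \<otimes> r x) = r (a \<otimes> x)" if "a \<in> carrier R" "x \<in> carrier R" for a x
  proof (rule r(2))
    have "(\<ominus> a) \<otimes> (x \<ominus> r x) \<in> J" using r(1) that J'(4) by simp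
    moreover have "(\<ominus> a) \<otimes> (x \<ominus> r x) = a \<otimes> r x \<ominus> a \<otimes> x"
      using r(1)[OF that(2)] that by (simp add: a_minus_def r_distr l_minus r_minus minus_add a_ac)
    ultimately show "a \<otimes> r x \<ominus> a \<otimes> x \<in> J" by simp
  qed (use r(1) that in auto)
  have ls: "r (r x) = r x" if "x \<in> carrier R" for x using rmul[of \<one> x] r(1)[OF that] that by simp
  let ?Q = "idquot R I r"
  have car: "carrier ?Q = (%x. {%_. r x}) ` I"
    and ze: "0[?Q] = {%_. r \<zero>}"
    and ad: "!!x y. {%_. x} +[?Q] {%_. y} = {%_. r (x \<oplus> y)}"
    and sm: "!!a x. a .[?Q] {%_. x} = {%_. r (a \<otimes> x)}" by (auto simp: idquot_def)
  have cl: "{%_. r x} \<in> carrier ?Q" if "x \<in> I" for x using that car by blast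
  have elt: "\<exists>u\<in>I. x = {%_. r u}" if "x \<in> carrier ?Q" for x using that car by auto
  have ad': "{%_. r x} +[?Q] {%_. r y} = {%_. r (x \<oplus> y)}" if "x \<in> I" "y \<in> I" for x y using that by (simp add: ad radd I'(1))
  have sm': "a .[?Q] {%_. r x} = {%_. r (a \<otimes> x)}" if "a \<in> carrier R" "x \<in> I" for a x using that by (simp add: sm rmul I'(1))
  have "abelian_group ?Q"
  proof (rule abelian_groupI)
    fix x y z assume "x \<in> carrier ?Q" "y \<in> carrier ?Q" "z \<in> carrier ?Q"
    then obtain u v w where u: "u \<in> I" "x = {%_. r u}" "v \<in> I" "y = {%_. r v}" "w \<in> I" "z = {%_. r w}"
      using elt[of x] elt[of y] elt[of z] by blast
    show "x +[?Q] y \<in> carrier ?Q" using u I'(3) by (simp add: ad' cl)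
    show "x +[?Q] y +[?Q] z = x +[?Q] (y +[?Q] z)" using u I'(1,3) by (simp add: ad' a_assoc)
    show "x +[?Q] y = y +[?Q] x" using u I'(1) by (simp add: ad' a_comm)
    show "0[?Q] +[?Q] x = x" using u I'(1,2) by (simp add: ad' ze)
    show "\<exists>y\<in>carrier ?Q. y +[?Q] x = 0[?Q]"
      by (rule bexI[of _ "{%_. r (\<ominus> u)}"]) (use u I'(1) idl_neg[OF I] in \<open>simp_all add: ad' ze l_neg cl\<close>)
  next
    show "0[?Q] \<in> carrier ?Q" using I'(2) by (simp add: ze cl)
  qed
  thus ?thesis
  proof (rule moduleI[OF is_cring])
    fix a b x y assume ab: "a \<in> carrier R" and "x \<in> carrier ?Q"
    then obtain u where u: "u \<in> I" "x = {%_. r u}" using elt[of x] by blast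
    show "a .[?Q] x \<in> carrier ?Q" using u ab I'(4) by (simp add: sm' cl)
    {
      assume b: "b \<in> carrier R"
      show "(a \<oplus> b) .[?Q] x = a .[?Q] x +[?Q] b .[?Q] x" using u ab b I'(1,4) by (simp add: sm' ad' l_distr)
      show "a \<otimes> b .[?Q] x = a .[?Q] (b .[?Q] x)" using u ab b I'(1,4) by (simp add: sm' m_assoc)
    }
    assume "y \<in> carrier ?Q"
    then obtain v where v: "v \<in> I" "y = {%_. r v}" using elt[of y] by blast
    show "a .[?Q] (x +[?Q] y) = a .[?Q] x +[?Q] a .[?Q] y" using u v ab I'(1,3,4) by (simp add: sm' ad' r_distr)
  next
    fix x assume "x \<in> carrier ?Q"
    then obtain u where u: "u \<in> I" "x = {%_. r u}" using elt[of x] by blast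
    thus "\<one> .[?Q] x = x" using I'(1) by (simp add: sm')
  qed
qed

end

text \<open>The inclusion of \<open>I\<close> into \<open>k\<close> is one of the admissible test
  inclusions; the scalar \<open>\<epsilon>\<close> is the value at \<open>1\<close> of the extended
  map.\<close>

lemma ideal_hom_scalar:
  fixes k :: "'k ring" and E :: "('k, 'e) module"
  assumes k: "cring k" and E: "injective_module k E" and I: "idl k I"
    and f: "!!a. a \<in> I ==> f a \<in> carrier E"
      "!!a b. [| a \<in> I; b \<in> I |] ==> f (a +[k] b) = f a +[E] f b"
      "!!c a. [| c \<in> carrier k; a \<in> I |] ==> f (c *[k] a) = c .[E] f a"
  shows "\<exists>\<epsilon>\<in>carrier E. \<forall>a\<in>I. f a = a .[E] \<epsilon>"
proof -
  interpret k: cring k by fact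
  interpret E: module k E using E unfolding injective_module_def by simp
  note I' = idlD[OF I]
  \<comment> \<open>For \<open>J = 0\<close> the identity picks representatives, so these are copies
    of \<open>I\<close> and of \<open>k\<close> in the type over which injectivity
    quantifies.\<close>
  let ?A = "idquot k I (%x. x)" and ?B = "idquot k (carrier k) (%x. x)"
  have z: "idl k {0[k]}" by (rule idlI) auto
  have kk: "idl k (carrier k)" by (rule idlI) auto
  have eq: "x = y" if "x \<in> carrier k" "y \<in> carrier k" "x -[k] y \<in> {0[k]}" for x y
    using that k.add.inv_solve_right[of "0[k]" x y] by (simp add: a_minus_def)
  have A: "module k ?A" by (rule k.idquot_module[OF I z]) (use I' eq in \<open>auto simp: a_minus_def k.r_neg\<close>)
  have B: "module k ?B" by (rule k.idquot_module[OF kk z]) (use eq in \<open>auto simp: a_minus_def k.r_neg\<close>)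
  let ?f = "\<lambda>X\<in>carrier ?A. X" and ?g = "\<lambda>X\<in>carrier ?A. f (the_elem X 0)"
  have "?f \<in> lin_hom k ?A ?B" "inj_on ?f (carrier ?A)" unfolding lin_hom_def using I' by (auto simp: idquot_def inj_on_def)
  moreover have "?g \<in> lin_hom k ?A E" unfolding lin_hom_def using f I' by (auto simp: idquot_def)
  ultimately obtain h where h: "h \<in> lin_hom k ?B E" "\<forall>a\<in>carrier ?A. h (?f a) = ?g a"
    using E A B unfolding injective_module_def by blast
  have 1: "{%_. a} = a .[?B] {%_. 1[k]}" if "a \<in> carrier k" for a using that by (simp add: idquot_def)
  have o: "{%_. 1[k]} \<in> carrier ?B" by (auto simp: idquot_def)
  have "f a = a .[E] h {%_. 1[k]}" if "a \<in> I" for a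
  proof -
    have "{%_::nat. a} \<in> carrier ?A" using that by (auto simp: idquot_def)
    hence "f a = h {%_. a}" using h(2) by auto
    also have "\<dots> = a .[E] h {%_. 1[k]}" using h(1) o I'(1)[OF that] unfolding lin_hom_def by (subst 1) auto
    finally show ?thesis .
  qed
  moreover have "h {%_. 1[k]} \<in> carrier E" using h(1) o unfolding lin_hom_def by auto
  ultimately show ?thesis by blast
qed

definition prod_mod :: "('k, 'a) module => ('k, 'b) module => ('k, 'a \<times> 'b) module" where
  "prod_mod M N = \<lparr>carrier = carrier M \<times> carrier N, monoid.mult = undefined, one = undefined,
     ring.zero = (0[M], 0[N]), ring.add = (%p q. (fst p +[M] fst q, snd p +[N] snd q)),
     module.smult = (%a p. (a .[M] fst p, a .[N] snd p))\<rparr>"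

lemma prod_mod_simps [simp]:
  "carrier (prod_mod M N) = carrier M \<times> carrier N" "0[prod_mod M N] = (0[M], 0[N])"
  "p +[prod_mod M N] q = (fst p +[M] fst q, snd p +[N] snd q)"
  "a .[prod_mod M N] p = (a .[M] fst p, a .[N] snd p)" by (simp_all add: prod_mod_def)

lemma prod_mod_module:
  assumes "module k M" "module k N"
  shows "module k (prod_mod M N)"
proof -
  interpret M: module k M by fact
  interpret N: module k N by fact
  show ?thesis
  proof (intro moduleI M.is_cring abelian_groupI)
    show "\<exists>q\<in>carrier (prod_mod M N). q +[prod_mod M N] p = 0[prod_mod M N]" if "p \<in> carrier (prod_mod M N)" for p
      using that by (intro bexI[of _ "(-[M] fst p, -[N] snd p)"]) (auto simp: M.l_neg N.l_neg)
  qed (auto simp: M.M.a_ac N.M.a_ac M.smult_l_distr N.smult_l_distr M.smult_r_distr N.smult_r_distr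
      M.smult_assoc1 N.smult_assoc1)
qed

text \<open>A linear map on a submodule is a submodule of \<open>M \<times> E\<close> that meets \<open>0 \<times> E\<close> only in zero;
  by Baer's criterion a maximal one is defined everywhere.\<close>

theorem baer_extension:
  fixes k :: "'k ring" and E :: "('k, 'e) module" and M :: "('k, 'a) module"
  assumes E: "injective_module k E" and M: "module k M" and W: "subm k M W" and f: "lin_on k M E W f"
  shows "\<exists>h. lin_on k M E (carrier M) h & (\<forall>x\<in>W. h x = f x)"
proof -
  interpret M: module k M by fact
  interpret E: module k E using E unfolding injective_module_def by simp
  let ?P = "prod_mod M E" and ?A = "{0[M]} \<times> (carrier E - {0[E]})"
  interpret P: module k ?P by (rule prod_mod_module[OF M E.module_axioms])
  note W' = submD[OF W] and f' = lin_onD[OF f]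
  have f0: "f 0[M] = 0[E]" using M.lin_zero[OF f W E.module_axioms] .
  have T: "subm k ?P ((%x. (x, f x)) ` W)"
  proof (rule submI)
    show "0[?P] \<in> (%x. (x, f x)) ` W" using W'(2) f0 by force
  qed (use W' f' in \<open>auto simp: image_iff\<close>)
  have "p \<notin> (%x. (x, f x)) ` W" if "p \<in> ?A" for p using that f0 by auto
  from P.maximal_subm_avoiding[of _ ?A, OF T this] obtain G where G: "subm k ?P G" "(%x. (x, f x)) ` W \<subseteq> G" "G \<inter> ?A = {}"
    "!!G'. subm k ?P G' ==> G \<subseteq> G' ==> G' \<inter> ?A = {} ==> G' = G" by blast
  note G' = submD[OF G(1), simplified]
  have Gc: "x \<in> carrier M & y \<in> carrier E" if "(x, y) \<in> G" for x y using G'(1) that by blast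
  \<comment> \<open>Two values at one point differ by an element of \<open>G\<close> in
    \<open>0 \<times> E\<close>, hence by zero: \<open>G\<close> is the graph of a partial
    map.\<close>
  have Gu: "y = z" if "(x, y) \<in> G" "(x, z) \<in> G" for x y z
  proof -
    have "(x, y) -[?P] (x, z) \<in> G" using P.subm_minus[OF G(1) that] .
    moreover have "-[?P] (x, z) = (-[M] x, -[E] z)"
      by (rule P.M.minus_equality) (use Gc[OF that(2)] in \<open>auto simp: M.l_neg E.l_neg\<close>)
    ultimately have "(0[M], y -[E] z) \<in> G" using Gc[OF that(1)] by (simp add: a_minus_def M.r_neg)
    hence "y -[E] z = 0[E]" using G(3) Gc by blast
    thus ?thesis using E.minus_eq_zero Gc that by blast
  qed
  have total: "x \<in> Domain G" if x: "x \<in> carrier M" for x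
  proof -
    \<comment> \<open>The scalars that bring \<open>x\<close> into the domain. On them the partial
      map is multiplication into some \<open>\<epsilon>\<close>, and adjoining
      \<open>(x, \<epsilon>)\<close> to \<open>G\<close> creates no new element over zero.\<close>
    define I where "I = {a \<in> carrier k. a .[M] x \<in> Domain G}"
    define \<phi> where "\<phi> a = (THE y. (a .[M] x, y) \<in> G)" for a
    have \<phi>: "\<phi> a = y" if "(a .[M] x, y) \<in> G" for a y unfolding \<phi>_def using that Gu by blast
    have \<phi>I: "(a .[M] x, \<phi> a) \<in> G" if a: "a \<in> I" for a using a \<phi> unfolding I_def by auto
    have Ik: "a \<in> carrier k" if "a \<in> I" for a using that unfolding I_def by simp
    have s: "((a +[k] b) .[M] x, \<phi> a +[E] \<phi> b) \<in> G" if "a \<in> I" "b \<in> I" for a b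
      using G'(4)[OF \<phi>I[OF that(1)] \<phi>I[OF that(2)]] x Ik that by (simp add: M.smult_l_distr)
    have m: "((c *[k] a) .[M] x, c .[E] \<phi> a) \<in> G" if "c \<in> carrier k" "a \<in> I" for a c
      using G'(5)[OF that(1) \<phi>I[OF that(2)]] x Ik that by (simp add: M.smult_assoc1)
    have I: "idl k I"
    proof (rule idlI)
      show "0[k] \<in> I" unfolding I_def using x G'(2) by auto
      show "a +[k] b \<in> I" if "a \<in> I" "b \<in> I" for a b using Ik that DomainI[OF s[OF that]] unfolding I_def by blast
      show "c *[k] a \<in> I" if "c \<in> carrier k" "a \<in> I" for c a using Ik that DomainI[OF m[OF that]] unfolding I_def by blast
    qed (use Ik in blast)
    have "\<exists>\<epsilon>\<in>carrier E. \<forall>a\<in>I. \<phi> a = a .[E] \<epsilon>"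
      using \<phi>I Gc \<phi>[OF s] \<phi>[OF m] by (intro ideal_hom_scalar[OF M.is_cring E I]) blast+
    then obtain \<epsilon> where e: "\<epsilon> \<in> carrier E" "!!a. a \<in> I ==> \<phi> a = a .[E] \<epsilon>" by blast
    have xe: "(x, \<epsilon>) \<in> carrier ?P" using x e by simp
    define G2 where "G2 = {p +[?P] a .[?P] (x, \<epsilon>) | p a. p \<in> G & a \<in> carrier k}"
    have "v = 0[E]" if v: "(0[M], v) \<in> G2" for v
    proof -
      obtain d y a where 1: "0[M] = d +[M] a .[M] x" "v = y +[E] a .[E] \<epsilon>" "(d, y) \<in> G" "a \<in> carrier k"
        using v unfolding G2_def by auto
      have "-[M] d = a .[M] x" using 1 x Gc M.M.minus_equality[of "a .[M] x" d] by (simp add: M.a_comm)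
      moreover have "(-[k] 1[k] .[M] d, -[k] 1[k] .[E] y) \<in> G" using G'(5)[OF _ 1(3)] by simp
      ultimately have 2: "(a .[M] x, -[E] y) \<in> G" using Gc[OF 1(3)] by (simp add: M.smult_l_minus E.smult_l_minus)
      hence "a \<in> I" unfolding I_def using 1(4) by blast
      hence "a .[E] \<epsilon> = -[E] y" using e(2) \<phi>[OF 2] by simp
      thus ?thesis using 1(2) Gc[OF 1(3)] by (simp add: E.r_neg)
    qed
    hence A: "G2 \<inter> ?A = {}" by auto
    have 3: "subm k ?P G2" unfolding G2_def by (rule P.subm_sum1[OF G(1) xe])
    have 4: "G \<subseteq> G2" "(x, \<epsilon>) \<in> G2" unfolding G2_def by (rule P.subm_sum1_sup[OF G(1) xe])+
    show ?thesis using 4(2) G(4)[OF 3 4(1) A] by blast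
  qed
  define h where "h x = (THE y. (x, y) \<in> G)" for x
  have h: "h x = y" if "(x, y) \<in> G" for x y unfolding h_def using that Gu by blast
  have hG: "(x, h x) \<in> G" if x: "x \<in> carrier M" for x using total[OF x] h by auto
  have "lin_on k M E (carrier M) h"
  proof (rule lin_onI)
    show "h x \<in> carrier E" if "x \<in> carrier M" for x using hG[OF that] Gc by blast
    show "h (x +[M] y) = h x +[E] h y" if "x \<in> carrier M" "y \<in> carrier M" for x y
      using h G'(4)[OF hG[OF that(1)] hG[OF that(2)]] by simp
    show "h (a .[M] x) = a .[E] h x" if "a \<in> carrier k" "x \<in> carrier M" for a x using h G'(5)[OF that(1) hG[OF that(2)]] by simp
  qed
  moreover have "h x = f x" if "x \<in> W" for x using h G(2) that by blast
  ultimately show ?thesis by blast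
qed

definition ring_mod :: "'k ring => ('k, 'k) module" where
  "ring_mod k = \<lparr>carrier = carrier k, monoid.mult = undefined, one = undefined, ring.zero = 0[k],
     ring.add = ring.add k, module.smult = monoid.mult k\<rparr>"

lemma ring_mod_simps [simp]:
  "carrier (ring_mod k) = carrier k" "0[ring_mod k] = 0[k]"
  "a +[ring_mod k] b = a +[k] b" "a .[ring_mod k] b = a *[k] b" by (simp_all add: ring_mod_def)

lemma ring_mod_module:
  assumes "cring k"
  shows "module k (ring_mod k)"
proof -
  interpret k: cring k by fact
  show ?thesis
  proof (intro moduleI assms abelian_groupI)
    show "\<exists>y\<in>carrier (ring_mod k). y +[ring_mod k] x = 0[ring_mod k]" if "x \<in> carrier (ring_mod k)" for x
      using that by (intro bexI[of _ "-[k] x"]) (simp_all add: k.l_neg)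
  qed (simp_all add: k.a_ac k.l_distr k.r_distr k.m_assoc)
qed

text \<open>The condition on the kernel makes \<open>f\<close> factor through the image of
  \<open>W\<close> under \<open>u\<close>, and the factored map is extended from there. Allowing a
  noninjective \<open>u\<close> avoids the formation of quotient modules later on.\<close>

corollary injective_extension:
  fixes k :: "'k ring" and E :: "('k, 'e) module" and M :: "('k, 'a) module" and P :: "('k, 'b) module"
  assumes E: "injective_module k E" and M: "module k M" and P: "module k P" and W: "subm k M W"
    and u: "lin_on k M P W u" and f: "lin_on k M E W f" and ker: "!!x. x \<in> W ==> u x = 0[P] ==> f x = 0[E]"
  shows "\<exists>h. lin_on k P E (carrier P) h & (\<forall>x\<in>W. h (u x) = f x)"
proof -
  interpret M: module k M by fact
  interpret P: module k P by fact
  interpret E: module k E using E unfolding injective_module_def by simp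
  note W' = submD[OF W] and u' = lin_onD[OF u] and f' = lin_onD[OF f]
  have eq: "f x = f y" if "x \<in> W" "y \<in> W" "u x = u y" for x y
  proof -
    have "u (x -[M] y) = 0[P]" using that u' M.lin_minus[OF u W P] P.minus_eq_zero by simp
    hence "f (x -[M] y) = 0[E]" using ker M.subm_minus[OF W] that by blast
    thus ?thesis using M.lin_minus[OF f W E.module_axioms] that E.minus_eq_zero f' by simp
  qed
  define g where "g z = f (SOME x. x \<in> W & u x = z)" for z
  have g: "g (u x) = f x" if x: "x \<in> W" for x using someI[of "%y. y \<in> W & u y = u x" x] x eq unfolding g_def by blast
  have sW: "subm k P (u ` W)"
  proof (rule submI)
    show "0[P] \<in> u ` W" using M.lin_zero[OF u W P] W'(2) by force
    show "x +[P] y \<in> u ` W" if "x \<in> u ` W" "y \<in> u ` W" for x y using that u'(2)[symmetric] W'(4) by auto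
    show "a .[P] x \<in> u ` W" if "a \<in> carrier k" "x \<in> u ` W" for a x using that u'(3)[symmetric] W'(5) by auto
  qed (use u' in auto)
  have "lin_on k P E (u ` W) g"
  proof (rule lin_onI)
    show "g x \<in> carrier E" if "x \<in> u ` W" for x using that g f' by auto
    fix x y assume "x \<in> u ` W" "y \<in> u ` W"
    then obtain v w where v: "v \<in> W" "x = u v" "w \<in> W" "y = u w" by blast
    show "g (x +[P] y) = g x +[E] g y" using v g[of "v +[M] w"] u'(2) W'(4) by (simp add: g f')
  next
    fix a x assume a: "a \<in> carrier k" "x \<in> u ` W"
    then obtain v where v: "v \<in> W" "x = u v" by blast
    show "g (a .[P] x) = a .[E] g x" using v a g[of "a .[M] v"] u'(3) W'(5) by (simp add: g f')
  qed
  from baer_extension[OF E P sW this] show ?thesis using g by fastforce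
qed

text \<open>Cogeneration is tested on the cyclic module \<open>k / J\<close>: a functional that does
  not kill the class of \<open>1\<close> takes it to the required element.\<close>

lemma cogenerator_ideal:
  fixes k :: "'k ring" and E :: "('k, 'e) module"
  assumes k: "cring k" and E: "cogenerator k E" and J: "idl k J" "1[k] \<notin> J"
  shows "\<exists>\<epsilon>\<in>carrier E. \<epsilon> ~= 0[E] & (\<forall>a\<in>J. a .[E] \<epsilon> = 0[E])"
proof -
  interpret k: cring k by fact
  interpret E: module k E using E unfolding cogenerator_def by simp
  note J' = idlD[OF J(1)]
  \<comment> \<open>The predicate under the choice operator depends on the residue class of
    \<open>x\<close> only, so the choice is constant on classes.\<close>
  define r where "r x = (SOME y. y \<in> carrier k & x -[k] y \<in> J)" for x
  have r1: "r x \<in> carrier k & x -[k] r x \<in> J" if "x \<in> carrier k" for x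
  proof -
    have "x \<in> carrier k & x -[k] x \<in> J" using that J'(2) by (simp add: a_minus_def k.r_neg)
    from someI[of "%y. y \<in> carrier k & x -[k] y \<in> J", OF this] show ?thesis unfolding r_def .
  qed
  have r2: "r x = r y" if "x \<in> carrier k" "y \<in> carrier k" "x -[k] y \<in> J" for x y
  proof -
    have "z \<in> carrier k & x -[k] z \<in> J <-> z \<in> carrier k & y -[k] z \<in> J" for z
    proof (cases "z \<in> carrier k")
      case True
      have "x -[k] z = (x -[k] y) +[k] (y -[k] z)" "y -[k] z = (x -[k] z) -[k] (x -[k] y)"
        using that True by (simp_all add: a_minus_def k.minus_add k.a_ac k.r_neg1 k.r_neg2)
      thus ?thesis using J'(3) k.idl_minus[OF J(1)] that(3) by metis
    qed simp
    thus ?thesis unfolding r_def by simp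
  qed
  have kk: "idl k (carrier k)" by (rule idlI) auto
  let ?Q = "idquot k (carrier k) r"
  have Q: "module k ?Q" by (rule k.idquot_module[OF kk J(1)]) (use J' r1 r2 in auto)
  let ?x = "{%_. r 1[k]}"
  have x: "?x \<in> carrier ?Q" by (auto simp: idquot_def)
  have m: "a .[?Q] ?x = {%_. r a}" if a: "a \<in> carrier k" for a
  proof -
    have "r (a *[k] r 1[k]) = r a"
    proof (rule r2)
      have "(-[k] a) *[k] (1[k] -[k] r 1[k]) \<in> J" using J'(4) r1[of "1[k]"] a by auto
      thus "a *[k] r 1[k] -[k] a \<in> J" using r1[of "1[k]"] a by (simp add: a_minus_def k.r_distr k.l_minus k.r_minus k.a_comm)
    qed (use r1[of "1[k]"] a in auto)
    thus ?thesis by (simp add: idquot_def)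
  qed
  have "?x ~= 0[?Q]"
  proof
    assume "?x = 0[?Q]"
    hence eq: "r 1[k] = r 0[k]" by (auto simp: idquot_def dest: fun_cong)
    have "-[k] (0[k] -[k] r 0[k]) \<in> J" using r1[of "0[k]"] k.idl_neg[OF J(1)] by blast
    hence "r 0[k] \<in> J" using r1[of "0[k]"] by (simp add: a_minus_def)
    moreover have "1[k] -[k] r 0[k] \<in> J" using r1[of "1[k]"] eq by simp
    ultimately have "(1[k] -[k] r 0[k]) +[k] r 0[k] \<in> J" using J'(3) by blast
    thus False using J(2) r1[of "0[k]"] by (simp add: a_minus_def k.a_assoc k.l_neg)
  qed
  then obtain f where f: "f \<in> lin_hom k ?Q E" "f ?x ~= 0[E]" using E Q x unfolding cogenerator_def by blast
  have fx: "f ?x \<in> carrier E" using f(1) x unfolding lin_hom_def by (auto dest: PiE_mem)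
  have "a .[E] f ?x = 0[E]" if a: "a \<in> J" for a
  proof -
    have "a .[E] f ?x = f (a .[?Q] ?x)" using f(1) x J'(1)[OF a] unfolding lin_hom_def by auto
    also have "a .[?Q] ?x = 0[k] .[?Q] ?x"
    proof -
      have "r a = r 0[k]" by (rule r2) (use a J' in \<open>auto simp: a_minus_def\<close>)
      thus ?thesis using m[of a] m[of "0[k]"] J'(1)[OF a] by simp
    qed
    also have "f (0[k] .[?Q] ?x) = 0[k] .[E] f ?x" using f(1) x unfolding lin_hom_def by auto
    finally show ?thesis using fx by simp
  qed
  thus ?thesis using f(2) fx by blast
qed

section \<open>Chain conditions, separation by functionals and simple submodules of E\<close>

text \<open>The class of sets is a parameter, so that one notion covers ideals, submodules and the
  submodules below a given one.\<close>

definition dcc :: "('a set => bool) => bool" where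
  "dcc P <-> (\<forall>I :: nat => 'a set. (\<forall>n. P (I n)) --> (\<forall>n. I (Suc n) \<subseteq> I n) -->
     (\<exists>N. \<forall>n\<ge>N. I n = I N))"

lemma dccD:
  assumes "dcc P" "!!n. P (I n)" "!!n. I (Suc n) \<subseteq> I n"
  shows "\<exists>N. \<forall>n\<ge>N. I n = I N" using assms unfolding dcc_def by blast

lemma dcc_minimal:
  assumes "dcc P" "Q W0" "!!W. Q W ==> P W"
  obtains W where "Q W" "!!V. Q V ==> V \<subseteq> W ==> V = W"
proof -
  have "\<exists>W. Q W & (\<forall>V. Q V --> V \<subseteq> W --> V = W)"
  proof (rule ccontr)
    assume "\<not> ?thesis"
    hence *: "!!W. Q W ==> \<exists>V. Q V & V \<subset> W" by blast
    have "\<exists>f. \<forall>n. Q (f n) & f (Suc n) \<subset> f n"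
      using dependent_nat_choice[of "%n W. Q W" "%n W V. V \<subset> W"] assms(2) * by blast
    then obtain f :: "nat => 'a set" where f: "!!n. Q (f n)" "!!n. f (Suc n) \<subset> f n" by blast
    have "\<exists>N. \<forall>n\<ge>N. f n = f N" by (rule dccD[OF assms(1)]) (use f assms(3) in blast)+
    then obtain N where "f (Suc N) = f N" by (meson le_SucI order_refl)
    thus False using f(2)[of N] by blast
  qed
  thus ?thesis using that by blast
qed

locale matlis =
  fixes k :: "'k ring" and E :: "('k, 'e) module"
  assumes artin: "artinian_cring k" and E_min: "minimal_injective_cogenerator k E"
begin

lemma k_cring: "cring k" using artin unfolding artinian_cring_def by simp
lemma E_inj: "injective_module k E" using E_min unfolding minimal_injective_cogenerator_def by simp
lemma E_cogen: "cogenerator k E" using E_min unfolding minimal_injective_cogenerator_def by simp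
lemma E_module: "module k E" using E_inj unfolding injective_module_def by simp

sublocale k: cring k by (rule k_cring)
sublocale E: module k E by (rule E_module)

lemma dcc_ideals: "dcc (idl k)"
proof (unfold dcc_def, intro allI impI)
  fix I :: "nat => 'k set" assume "\<forall>n. idl k (I n)" "\<forall>n. I (Suc n) \<subseteq> I n"
  thus "\<exists>N. \<forall>n\<ge>N. I n = I N" using artin k.idl_ideal unfolding artinian_cring_def by blast
qed

text \<open>The scalars that take \<open>x\<close> into \<open>W\<close> form a proper ideal, so
  they kill some nonzero \<open>\<epsilon>\<close> in \<open>E\<close>. Then
  \<open>w + a x \<mapsto> a \<epsilon>\<close> is well defined on \<open>W + k x\<close> and
  extends.\<close>

lemma separating_functional:
  fixes M :: "('k, 'a) module"
  assumes M: "module k M" and W: "subm k M W" and x: "x \<in> carrier M" "x \<notin> W"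
  shows "\<exists>h. lin_on k M E (carrier M) h & (\<forall>w\<in>W. h w = 0[E]) & h x ~= 0[E]"
proof -
  interpret M: module k M by fact
  note W' = submD[OF W]
  define J where "J = {a \<in> carrier k. a .[M] x \<in> W}"
  have J: "idl k J" unfolding J_def by (rule idlI) (use x W' in \<open>auto simp: M.smult_l_distr M.smult_assoc1\<close>)
  have "1[k] \<notin> J" using x unfolding J_def by simp
  then obtain \<epsilon> where e: "\<epsilon> \<in> carrier E" "\<epsilon> ~= 0[E]" "!!a. a \<in> J ==> a .[E] \<epsilon> = 0[E]"
    using cogenerator_ideal[OF k_cring E_cogen J] by blast
  \<comment> \<open>The submodule \<open>W + k x\<close> is parametrised by pairs; the kernel
    condition of \<open>injective_extension\<close> is then exactly well-definedness.\<close>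
  let ?P = "prod_mod M (ring_mod k)" and ?W = "W \<times> carrier k"
  have P: "module k ?P" by (rule prod_mod_module[OF M ring_mod_module[OF k_cring]])
  have "\<exists>h. lin_on k M E (carrier M) h & (\<forall>p\<in>?W. h (fst p +[M] snd p .[M] x) = snd p .[E] \<epsilon>)"
  proof (rule injective_extension[OF E_inj P M])
    show "subm k ?P ?W" by (rule submI) (use W' in auto)
    show "lin_on k ?P M ?W (%p. fst p +[M] snd p .[M] x)"
      by (rule lin_onI) (use W'(3) x in \<open>auto simp: M.smult_l_distr M.smult_r_distr M.smult_assoc1 M.M.a_ac\<close>)
    show "lin_on k ?P E ?W (%p. snd p .[E] \<epsilon>)"
      by (rule lin_onI) (use e(1) in \<open>auto simp: E.smult_l_distr E.smult_assoc1\<close>)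
    fix p assume p: "p \<in> ?W" "fst p +[M] snd p .[M] x = 0[M]"
    hence "-[M] fst p = snd p .[M] x" using W'(3) x M.M.minus_equality[of "snd p .[M] x" "fst p"] by (auto simp: M.a_comm)
    hence "snd p \<in> J" unfolding J_def using p(1) M.subm_neg[OF W, of "fst p"] by auto
    thus "snd p .[E] \<epsilon> = 0[E]" by (rule e(3))
  qed
  then obtain h where h: "lin_on k M E (carrier M) h"
    "!!w a. w \<in> W ==> a \<in> carrier k ==> h (w +[M] a .[M] x) = a .[E] \<epsilon>" by fastforce
  have "h w = 0[E]" if "w \<in> W" for w using h(2)[OF that k.zero_closed] W'(3)[OF that] x e(1) by simp
  moreover have "h x = \<epsilon>" using h(2)[OF W'(2) k.one_closed] x e(1) by simp
  ultimately show ?thesis using h(1) e(2) by auto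
qed

text \<open>The cyclic submodule generated by \<open>\<epsilon>\<close> is simple.\<close>

definition simple_elt :: "'e => bool" where
  "simple_elt \<epsilon> <-> \<epsilon> \<in> carrier E & \<epsilon> ~= 0[E] &
     (\<forall>c\<in>carrier k. c .[E] \<epsilon> ~= 0[E] --> (\<exists>c'\<in>carrier k. c' .[E] (c .[E] \<epsilon>) = \<epsilon>))"

text \<open>If \<open>\<epsilon>'\<close> were not in \<open>k \<epsilon>\<close>, a submodule \<open>N \<supseteq> k \<epsilon>\<close> of \<open>E\<close> maximal subject to
  \<open>N \<inter> k \<epsilon>' = 0\<close> would be a proper direct summand of \<open>E\<close> that is still a cogenerator,
  contradicting minimality.\<close>

lemma simple_elt_unique:
  assumes e: "simple_elt \<epsilon>" and e': "simple_elt \<epsilon>'"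
    and ann: "!!c. c \<in> carrier k ==> c .[E] \<epsilon>' = 0[E] ==> c .[E] \<epsilon> = 0[E]"
  shows "\<exists>c\<in>carrier k. \<epsilon>' = c .[E] \<epsilon>"
proof (rule ccontr)
  assume neg: "\<not> ?thesis"
  have eE: "\<epsilon> \<in> carrier E" "\<epsilon>' \<in> carrier E" "\<epsilon> ~= 0[E]" "\<epsilon>' ~= 0[E]" using e e' unfolding simple_elt_def by auto
  define A where "A = {c .[E] \<epsilon>' | c. c \<in> carrier k} - {0[E]}"
  have Ainv: "\<exists>c\<in>carrier k. c .[E] y = \<epsilon>'" if y: "y \<in> A" for y
  proof -
    obtain c where "c \<in> carrier k" "y = c .[E] \<epsilon>'" "y ~= 0[E]" using y unfolding A_def by blast
    thus ?thesis using e' unfolding simple_elt_def by blast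
  qed
  have Acl: "c .[E] y \<in> A" if y: "y \<in> A" "c \<in> carrier k" "c .[E] y ~= 0[E]" for c y
  proof -
    obtain d where "d \<in> carrier k" "y = d .[E] \<epsilon>'" using y(1) unfolding A_def by blast
    hence "c .[E] y = (c *[k] d) .[E] \<epsilon>'" using that eE by (simp add: E.smult_assoc1)
    thus ?thesis using that \<open>d \<in> carrier k\<close> unfolding A_def by blast
  qed
  have A0: "y ~= 0[E]" if "y \<in> A" for y using that unfolding A_def by blast
  have eA: "\<epsilon>' \<in> A" unfolding A_def using eE E.smult_one[of \<epsilon>'] by force
  define T where "T = {0[E] +[E] c .[E] \<epsilon> | w c. w \<in> {0[E]} & c \<in> carrier k}"
  have T: "subm k E T" using E.subm_sum1[OF E.subm_zero eE(1)] unfolding T_def by simp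
  have eT: "\<epsilon> \<in> T" using E.subm_sum1_sup(2)[OF E.subm_zero eE(1)] unfolding T_def by simp
  have "y \<notin> T" if y: "y \<in> A" for y
  proof
    assume "y \<in> T"
    then obtain c where c: "c \<in> carrier k" "y = c .[E] \<epsilon>" unfolding T_def using eE by auto
    obtain d where "d \<in> carrier k" "d .[E] y = \<epsilon>'" using Ainv[OF y] by blast
    hence "\<epsilon>' = (d *[k] c) .[E] \<epsilon>" using c eE by (simp add: E.smult_assoc1)
    thus False using neg c \<open>d \<in> carrier k\<close> by blast
  qed
  from E.maximal_subm_avoiding[of T A, OF T this] obtain N where N: "subm k E N" "T \<subseteq> N" "N \<inter> A = {}"
    "!!N'. subm k E N' ==> N \<subseteq> N' ==> N' \<inter> A = {} ==> N' = N" by blast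
  note N' = submD[OF N(1)]
  have "y \<notin> {0[E]}" if "y \<in> N - {0[E]}" for y using that by simp
  then obtain P
    where P: "subm k E P" "P \<inter> (N - {0[E]}) = {}"
    "!!P'. subm k E P' ==> P \<subseteq> P' ==> P' \<inter> (N - {0[E]}) = {} ==> P' = P"
    using E.maximal_subm_avoiding[OF E.subm_zero, of "N - {0[E]}"] by metis
  note P' = submD[OF P(1)]
  let ?Q = "prod_mod E E"
  \<comment> \<open>\<open>P\<close> is maximal among the submodules that meet \<open>N\<close>
    trivially. The projection of \<open>N + P\<close> onto \<open>N\<close> extends to an
    endomorphism \<open>h\<close> of \<open>E\<close>; its image still avoids \<open>A\<close>, so
    by maximality of \<open>N\<close> it equals \<open>N\<close>, and \<open>h\<close> is a
    retraction onto \<open>N\<close>.\<close>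
  have "\<exists>h. lin_on k E E (carrier E) h & (\<forall>q\<in>N \<times> P. h (fst q +[E] snd q) = fst q)"
  proof (rule injective_extension[OF E_inj prod_mod_module[OF E_module E_module] E_module])
    show "subm k ?Q (N \<times> P)" by (rule submI) (use N' P' in auto)
    show "lin_on k ?Q E (N \<times> P) (%q. fst q +[E] snd q)"
      by (rule lin_onI) (use N'(3) P'(3) in \<open>auto simp: E.smult_r_distr E.M.a_ac\<close>)
    show "lin_on k ?Q E (N \<times> P) fst" by (rule lin_onI) (use N'(3) in auto)
    fix q assume q: "q \<in> N \<times> P" "fst q +[E] snd q = 0[E]"
    hence "-[E] snd q = fst q" using N'(3) P'(3) E.M.minus_equality[of "fst q" "snd q"] by auto
    hence "fst q \<in> P" using q(1) E.subm_neg[OF P(1), of "snd q"] by auto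
    thus "fst q = 0[E]" using q(1) P(2) by auto
  qed
  then obtain h where h: "lin_on k E E (carrier E) h"
    "!!n p. n \<in> N ==> p \<in> P ==> h (n +[E] p) = n" by fastforce
  note h' = lin_onD[OF h(1)]
  have hN: "h n = n" if "n \<in> N" for n using h(2)[OF that P'(2)] N'(3)[OF that] by simp
  have hP: "h p = 0[E]" if "p \<in> P" for p using h(2)[OF N'(2) that] P'(3)[OF that] by simp
  have S: "subm k E (h ` carrier E)"
  proof (rule submI)
    show "0[E] \<in> h ` carrier E" using hP[OF P'(2)] P'(2,3) by force
    show "x +[E] y \<in> h ` carrier E" if "x \<in> h ` carrier E" "y \<in> h ` carrier E" for x y using that h'(2)[symmetric] by auto
    show "a .[E] x \<in> h ` carrier E" if "a \<in> carrier k" "x \<in> h ` carrier E" for a x using that h'(3)[symmetric] by auto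
  qed (use h' in auto)
  have NS: "N \<subseteq> h ` carrier E" using hN N'(3) by force
  have "h ` carrier E \<inter> A = {}"
  proof (rule ccontr)
    assume "h ` carrier E \<inter> A ~= {}"
    then obtain x where x: "x \<in> carrier E" "h x \<in> A" by blast
    hence "x \<notin> P" using hP A0 by blast
    \<comment> \<open>Maximality of \<open>P\<close> puts a nonzero element of \<open>N\<close> into
      \<open>P + k x\<close>. It is fixed by \<open>h\<close> while its \<open>P\<close>-part is
      killed, so it is a multiple of \<open>h x\<close> and lies in \<open>A\<close> as
      well.\<close>
    let ?P = "{p +[E] a .[E] x | p a. p \<in> P & a \<in> carrier k}"
    have "?P \<inter> (N - {0[E]}) ~= {}" using P(3)[OF E.subm_sum1[OF P(1) x(1)] E.subm_sum1_sup(1)[OF P(1) x(1)]]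
        E.subm_sum1_sup(2)[OF P(1) x(1)] \<open>x \<notin> P\<close> by blast
    then obtain p a where pa: "p \<in> P" "a \<in> carrier k" "p +[E] a .[E] x \<in> N" "p +[E] a .[E] x ~= 0[E]" by blast
    have "p +[E] a .[E] x = h (p +[E] a .[E] x)" using hN pa(3) by simp
    also have "\<dots> = a .[E] h x" using h' hP pa P'(3) x by simp
    finally have "a .[E] h x \<in> N" "a .[E] h x ~= 0[E]" using pa by auto
    thus False using Acl[OF x(2) pa(2)] N(3) by blast
  qed
  hence SN: "h ` carrier E = N" using N(4)[OF S NS] by blast
  \<comment> \<open>Cogeneration by \<open>N\<close> reduces to ideals \<open>J\<close>. If the
    element \<open>u\<close> killed by \<open>J\<close> lies outside \<open>N\<close>, then
    \<open>N + k u\<close> meets \<open>A\<close>; multiplying that element by \<open>J\<close>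
    lands in \<open>N\<close> and, unless zero, in \<open>A\<close>, so \<open>J\<close> kills
    \<open>\<epsilon>'\<close> and by the assumption on annihilators also \<open>\<epsilon>\<close>,
    which is in \<open>N\<close>.\<close>
  have ann_elt: "\<exists>\<nu>\<in>N. \<nu> ~= 0[E] & (\<forall>a\<in>J. a .[E] \<nu> = 0[E])" if J: "idl k J" "1[k] \<notin> J" for J
  proof -
    obtain u where n: "u \<in> carrier E" "u ~= 0[E]" "!!a. a \<in> J ==> a .[E] u = 0[E]"
      using cogenerator_ideal[OF k_cring E_cogen J] by blast
    note J' = idlD[OF J(1)]
    show ?thesis
    proof (cases "u \<in> N")
      case True thus ?thesis using n by blast
    next
      case False
      let ?P = "{p +[E] a .[E] u | p a. p \<in> N & a \<in> carrier k}"
      have "?P \<inter> A ~= {}" using N(4)[OF E.subm_sum1[OF N(1) n(1)] E.subm_sum1_sup(1)[OF N(1) n(1)]]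
          E.subm_sum1_sup(2)[OF N(1) n(1)] False by blast
      then obtain p a where pa: "p \<in> N" "a \<in> carrier k" "p +[E] a .[E] u \<in> A" by blast
      have "j .[E] \<epsilon> = 0[E]" if j: "j \<in> J" for j
      proof -
        have jk: "j \<in> carrier k" using J'(1) j .
        have "(a *[k] j) .[E] u = 0[E]" using n(3) J'(4) j pa(2) by blast
        hence "j .[E] (a .[E] u) = 0[E]" using n(1) pa jk by (simp add: E.smult_assoc1[symmetric] k.m_comm)
        hence "j .[E] (p +[E] a .[E] u) = j .[E] p" using N'(3) pa n(1) jk by (simp add: E.smult_r_distr)
        hence "j .[E] (p +[E] a .[E] u) \<in> N" using N'(5) pa(1) jk by simp
        hence z: "j .[E] (p +[E] a .[E] u) = 0[E]" using Acl[OF pa(3) jk] N(3) by blast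
        obtain c where c: "c \<in> carrier k" "c .[E] (p +[E] a .[E] u) = \<epsilon>'" using Ainv[OF pa(3)] by blast
        have "j .[E] \<epsilon>' = c .[E] (j .[E] (p +[E] a .[E] u))"
          unfolding c(2)[symmetric] using c(1) N'(3) pa n(1) jk by (simp add: E.smult_assoc1[symmetric] k.m_comm)
        thus ?thesis using z c ann jk by simp
      qed
      thus ?thesis using eT N(2) eE by blast
    qed
  qed
  let ?N = "E\<lparr>carrier := N\<rparr>"
  have Nsub: "submodule N k E" by (rule E.submoduleI) (use N' E.subm_neg[OF N(1)] in auto)
  have Nmod: "module k ?N" using submodule.submodule_is_module[OF Nsub E_module] .
  have "injective_module k ?N" unfolding injective_module_def
  proof (intro conjI Nmod allI impI ballI)
    fix A B :: "('k, (nat => 'k) set) module" and f g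
    assume AB: "module k A" "module k B" "f \<in> lin_hom k A B" "g \<in> lin_hom k A ?N" "inj_on f (carrier A)"
    have "g \<in> lin_hom k A E" using AB(4) N'(3) unfolding lin_hom_def by auto
    then obtain r where r: "r \<in> lin_hom k B E" "\<forall>a\<in>carrier A. r (f a) = g a"
      using E_inj AB unfolding injective_module_def by blast
    interpret B: module k B by (rule AB)
    have "(\<lambda>b\<in>carrier B. h (r b)) \<in> lin_hom k B ?N" using r(1) h' SN unfolding lin_hom_def by (auto simp: PiE_iff)
    moreover have "(\<lambda>b\<in>carrier B. h (r b)) (f a) = g a" if "a \<in> carrier A" for a
    proof -
      have "g a \<in> N" using AB(4) that unfolding lin_hom_def by auto
      moreover have "f a \<in> carrier B" using AB(3) that unfolding lin_hom_def by auto
      ultimately show ?thesis using r(2) that hN by simp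
    qed
    ultimately show "\<exists>h\<in>lin_hom k B ?N. \<forall>a\<in>carrier A. h (f a) = g a" by blast
  qed
  moreover have "cogenerator k ?N" unfolding cogenerator_def
  proof (intro conjI Nmod allI impI ballI)
    fix M :: "('k, (nat => 'k) set) module" and x
    assume M: "module k M" and x: "x \<in> carrier M" "x ~= 0[M]"
    interpret M: module k M by fact
    define J where "J = {a \<in> carrier k. a .[M] x = 0[M]}"
    have J: "idl k J" unfolding J_def by (rule idlI) (use x in \<open>auto simp: M.smult_l_distr M.smult_assoc1\<close>)
    have "1[k] \<notin> J" using x unfolding J_def by simp
    then obtain \<nu> where v: "\<nu> \<in> N" "\<nu> ~= 0[E]" "!!a. a \<in> J ==> a .[E] \<nu> = 0[E]" using ann_elt[OF J] by blast
    have vE: "\<nu> \<in> carrier E" using v N'(3) by blast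
    let ?K = "ring_mod k"
    have kK: "subm k ?K (carrier k)" by (rule submI) auto
    have "\<exists>r. lin_on k M E (carrier M) r & (\<forall>a\<in>carrier k. r (a .[M] x) = a .[E] \<nu>)"
    proof (rule injective_extension[OF E_inj ring_mod_module[OF k_cring] M kK])
      show "lin_on k ?K M (carrier k) (%a. a .[M] x)"
        by (rule lin_onI) (use x in \<open>simp_all add: M.smult_l_distr M.smult_assoc1\<close>)
      show "lin_on k ?K E (carrier k) (%a. a .[E] \<nu>)"
        by (rule lin_onI) (use vE in \<open>simp_all add: E.smult_l_distr E.smult_assoc1\<close>)
      fix a assume "a \<in> carrier k" "a .[M] x = 0[M]"
      thus "a .[E] \<nu> = 0[E]" using v(3) unfolding J_def by blast
    qed
    then obtain r where r: "lin_on k M E (carrier M) r" "r (1[k] .[M] x) = 1[k] .[E] \<nu>" by blast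
    have "(\<lambda>b\<in>carrier M. h (r b)) \<in> lin_hom k M ?N"
      using lin_onD[OF r(1)] h' SN unfolding lin_hom_def by (auto simp: PiE_iff)
    moreover have "(\<lambda>b\<in>carrier M. h (r b)) x ~= 0[?N]" using r(2) x vE v hN by simp
    ultimately show "\<exists>f\<in>lin_hom k M ?N. f x ~= 0[?N]" by blast
  qed
  ultimately have "N = carrier E" using E_min Nsub unfolding minimal_injective_cogenerator_def by blast
  thus False using eA eE N(3) by blast
qed

end

section \<open>Finitely generated modules and dual modules\<close>

text \<open>Generation is phrased through submodules instead of linear combinations, so that images
  and induction over the generators involve no finite sums.\<close>

definition fgen :: "'k ring => ('k, 'a) module => bool" where
  "fgen k M <-> (\<exists>S. finite S & S \<subseteq> carrier M & (\<forall>W. subm k M W --> S \<subseteq> W --> W = carrier M))"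

lemma fg_module_fgen:
  assumes "module k M" "fg_module k M"
  shows "fgen k M"
proof -
  interpret module k M by fact
  obtain S where S: "finite S" "S \<subseteq> carrier M"
    "!!x. x \<in> carrier M ==> \<exists>c\<in>S \<rightarrow> carrier k. x = (\<Oplus>\<^bsub>M\<^esub>s\<in>S. c s .[M] s)"
    using assms(2) unfolding fg_module_def by blast
  have "W = carrier M" if W: "subm k M W" "S \<subseteq> W" for W
  proof
    note W' = submD[OF W(1)]
    have sum: "(\<Oplus>\<^bsub>M\<^esub>s\<in>F. c s .[M] s) \<in> W" if "c \<in> S \<rightarrow> carrier k" "F \<subseteq> S" for c F
      using finite_subset[OF that(2) S(1)] that(2)
    proof (induction F rule: finite_induct)
      case (insert s F)
      have s: "s \<in> W" "c s \<in> carrier k" and F: "!!t. t \<in> F ==> t \<in> carrier M & c t \<in> carrier k"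
        using insert.prems W(2) W'(3) that(1) by auto
      have "(\<Oplus>\<^bsub>M\<^esub>s\<in>insert s F. c s .[M] s) = c s .[M] s +[M] (\<Oplus>\<^bsub>M\<^esub>s\<in>F. c s .[M] s)"
        by (rule M.finsum_insert) (use insert.hyps s F W'(3) in auto)
      thus ?case using insert s W'(4,5) by simp
    qed (simp add: W'(2))
    show "carrier M \<subseteq> W"
    proof
      fix x assume "x \<in> carrier M"
      then obtain c where "c \<in> S \<rightarrow> carrier k" "x = (\<Oplus>\<^bsub>M\<^esub>s\<in>S. c s .[M] s)" using S(3) by blast
      thus "x \<in> W" using sum[of c S] by simp
    qed
  qed (use submD[OF W(1)] in blast)
  thus ?thesis unfolding fgen_def using S(1,2) by blast
qed

lemma lin_hom_lin_on: "f \<in> lin_hom k M N ==> lin_on k M N (carrier M) f" unfolding lin_hom_def lin_on_def by auto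

lemma lin_on_lin_hom:
  assumes "module k M" "lin_on k M N (carrier M) f"
  shows "(\<lambda>x\<in>carrier M. f x) \<in> lin_hom k M N"
proof -
  interpret module k M by fact
  show ?thesis using lin_onD[OF assms(2)] unfolding lin_hom_def by auto
qed

lemma lin_homD:
  assumes "f \<in> lin_hom k M N"
  shows "!!x. x \<in> carrier M ==> f x \<in> carrier N"
    "!!x y. [| x \<in> carrier M; y \<in> carrier M |] ==> f (x +[M] y) = f x +[N] f y"
    "!!a x. [| a \<in> carrier k; x \<in> carrier M |] ==> f (a .[M] x) = a .[N] f x"
    "f \<in> extensional (carrier M)" using assms unfolding lin_hom_def by (auto simp: PiE_iff)

lemma lin_hom_eqI:
  assumes "f \<in> lin_hom k M N" "g \<in> lin_hom k M N" "!!x. x \<in> carrier M ==> f x = g x"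
  shows "f = g" using assms lin_homD(4) by (metis extensionalityI)

lemma lin_homI:
  assumes "f \<in> extensional (carrier M)" "!!x. x \<in> carrier M ==> f x \<in> carrier N"
    "!!x y. [| x \<in> carrier M; y \<in> carrier M |] ==> f (x +[M] y) = f x +[N] f y"
    "!!a x. [| a \<in> carrier k; x \<in> carrier M |] ==> f (a .[M] x) = a .[N] f x"
  shows "f \<in> lin_hom k M N" using assms unfolding lin_hom_def by (auto simp: PiE_iff)

lemma dual_simps:
  shows "carrier (dual_module k E M) = lin_hom k M E"
    "0[dual_module k E M] = (\<lambda>x\<in>carrier M. 0[E])"
    "f +[dual_module k E M] g = (\<lambda>x\<in>carrier M. f x +[E] g x)"
    "a .[dual_module k E M] f = (\<lambda>x\<in>carrier M. a .[E] f x)" by (simp_all add: dual_module_def)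

lemma dual_is_module:
  assumes M: "module k M" and E: "module k E"
  shows "module k (dual_module k E M)"
proof -
  let ?D = "dual_module k E M"
  interpret M: module k M by fact
  interpret E: module k E by fact
  have cl0: "(\<lambda>x\<in>carrier M. 0[E]) \<in> lin_hom k M E" by (rule lin_homI) auto
  have cla: "(\<lambda>x\<in>carrier M. f x +[E] g x) \<in> lin_hom k M E" if "f \<in> lin_hom k M E" "g \<in> lin_hom k M E" for f g
    by (rule lin_homI) (use lin_homD[OF that(1)] lin_homD[OF that(2)] in \<open>auto simp: E.smult_r_distr E.M.a_ac\<close>)
  have cls: "(\<lambda>x\<in>carrier M. a .[E] f x) \<in> lin_hom k M E" if "f \<in> lin_hom k M E" "a \<in> carrier k" for f a
    by (rule lin_homI) (use lin_homD[OF that(1)] that(2) in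
        \<open>auto simp: E.smult_r_distr E.smult_assoc1[symmetric] M.m_comm\<close>)
  have ext: "(\<lambda>x\<in>carrier M. f x) = f" if "f \<in> lin_hom k M E" for f
    using lin_homD(4)[OF that] by (simp add: extensional_restrict)
  show ?thesis
  proof (intro moduleI M.is_cring abelian_groupI)
    show "\<exists>y\<in>carrier (?D). y +[?D] x = 0[?D]" if x: "x \<in> carrier (?D)" for x
    proof (rule bexI)
      show "(\<lambda>y\<in>carrier M. (-[k] 1[k]) .[E] x y) +[?D] x = 0[?D]"
        using lin_homD(1)[of x k M E] x by (auto simp: dual_simps E.smult_l_minus E.M.l_neg intro!: restrict_ext)
    qed (use x cls in \<open>auto simp: dual_simps\<close>)
    show "x +[?D] y +[?D] z = x +[?D] (y +[?D] z)" if "x \<in> carrier (?D)" "y \<in> carrier (?D)" "z \<in> carrier (?D)" for x y z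
      using that lin_homD(1)[of _ k M E] by (auto simp: dual_simps E.M.a_assoc intro!: restrict_ext)
    show "x +[?D] y = y +[?D] x" if "x \<in> carrier (?D)" "y \<in> carrier (?D)" for x y
      using that lin_homD(1)[of _ k M E] by (auto simp: dual_simps E.M.a_comm intro!: restrict_ext)
    show "0[?D] +[?D] x = x" if "x \<in> carrier (?D)" for x
    proof -
      have "(\<lambda>y\<in>carrier M. 0[E] +[E] x y) = (\<lambda>y\<in>carrier M. x y)"
        using that lin_homD(1)[of x k M E] by (intro restrict_ext) (simp add: dual_simps)
      thus ?thesis using that ext[of x] by (simp add: dual_simps cong: restrict_cong)
    qed
    show "1[k] .[?D] x = x" if "x \<in> carrier (?D)" for x
    proof -
      have "(\<lambda>y\<in>carrier M. 1[k] .[E] x y) = (\<lambda>y\<in>carrier M. x y)"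
        using that lin_homD(1)[of x k M E] by (intro restrict_ext) (simp add: dual_simps)
      thus ?thesis using that ext[of x] by (simp add: dual_simps)
    qed
    fix a b x y assume a: "a \<in> carrier k" and x: "x \<in> carrier (?D)"
    show "a .[?D] x \<in> carrier (?D)" using cls a x by (simp add: dual_simps)
    { assume "y \<in> carrier (?D)"
      thus "a .[?D] (x +[?D] y) =
          a .[?D] x +[?D] a .[?D] y" using a x lin_homD(1)[of _ k M E] by (auto simp: dual_simps E.smult_r_distr intro!: restrict_ext) }
    assume b: "b \<in> carrier k"
    show "(a +[k] b) .[?D] x = a .[?D] x +[?D] b .[?D] x"
      using a b x lin_homD(1)[of _ k M E] by (auto simp: dual_simps E.smult_l_distr intro!: restrict_ext)
    show "a *[k] b .[?D] x = a .[?D] (b .[?D] x)"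
      using a b x lin_homD(1)[of _ k M E] by (auto simp: dual_simps E.smult_assoc1 intro!: restrict_ext)
  qed (use cl0 cla in \<open>auto simp: dual_simps\<close>)
qed

text \<open>A chain of submodules of \<open>V + k x\<close> is controlled by two others: its
  intersection with \<open>V\<close>, and the ideals of those \<open>a\<close> for which some
  \<open>v + a x\<close> belongs to it. Once both are stationary, so is the chain.\<close>

lemma dcc_step:
  fixes k :: "'k ring" and M :: "('k, 'a) module"
  assumes M: "module k M" and k: "dcc (idl k)" and V: "subm k M V" "dcc (%W. subm k M W & W \<subseteq> V)" and x: "x \<in> carrier M"
  shows "dcc (%W. subm k M W & W \<subseteq> {v +[M] a .[M] x | v a. v \<in> V & a \<in> carrier k})" unfolding dcc_def
proof (intro allI impI)
  interpret M: module k M by fact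
  note V' = submD[OF V(1)]
  fix A assume A: "\<forall>n. subm k M (A n) & A n \<subseteq> {v +[M] a .[M] x | v a. v \<in> V & a \<in> carrier k}"
    and dec: "\<forall>n::nat. A (Suc n) \<subseteq> A n"
  have A': "subm k M (A n)" for n using A by blast
  note AD = submD[OF A']
  have mono: "A m \<subseteq> A n" if "n \<le> m" for m n using dec that by (metis lift_Suc_antimono_le)
  have "\<exists>N. \<forall>n\<ge>N. A n \<inter> V = A N \<inter> V"
    by (rule dccD[OF V(2)]) (use V' AD dec in \<open>auto simp: subm_def\<close>)
  then obtain N1 where N1: "!!n. n \<ge> N1 ==> A n \<inter> V = A N1 \<inter> V" by blast
  define I where "I n = {a \<in> carrier k. \<exists>v\<in>V. v +[M] a .[M] x \<in> A n}" for n
  have "idl k (I n)" for n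
  proof (rule idlI)
    show "0[k] \<in> I n" unfolding I_def using x V'(2) AD(2)[of n] by (auto intro!: bexI[of _ "0[M]"])
    show "a +[k] b \<in> I n" if ab: "a \<in> I n" "b \<in> I n" for a b
    proof -
      obtain v w where "v \<in> V" "v +[M] a .[M] x \<in> A n" "w \<in> V" "w +[M] b .[M] x \<in> A n" using ab unfolding I_def by blast
      moreover have "(v +[M] w) +[M] (a +[k] b) .[M] x = (v +[M] a .[M] x) +[M] (w +[M] b .[M] x)"
        using calculation(1,3) V'(3) ab x unfolding I_def by (simp add: M.smult_l_distr M.a_ac)
      ultimately have "v +[M] w \<in> V" "(v +[M] w) +[M] (a +[k] b) .[M] x \<in> A n" using V'(4) AD(4) by auto
      thus ?thesis using ab unfolding I_def by auto
    qed
    show "c *[k] a \<in> I n" if ca: "c \<in> carrier k" "a \<in> I n" for c a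
    proof -
      obtain v where "v \<in> V" "v +[M] a .[M] x \<in> A n" using ca unfolding I_def by blast
      moreover have "(c .[M] v) +[M] (c *[k] a) .[M] x = c .[M] (v +[M] a .[M] x)"
        using calculation(1) V'(3) ca x unfolding I_def by (simp add: M.smult_r_distr M.smult_assoc1)
      ultimately have "c .[M] v \<in> V" "(c .[M] v) +[M] (c *[k] a) .[M] x \<in> A n" using V'(5) AD(5) ca(1) by auto
      thus ?thesis using ca unfolding I_def by auto
    qed
  qed (simp add: I_def)
  moreover have "I (Suc n) \<subseteq> I n" for n unfolding I_def using dec by blast
  ultimately obtain N2 where N2: "!!n. n \<ge> N2 ==> I n = I N2" using dccD[OF k, of I] by blast
  define N where "N = max N1 N2"
  have "A n = A N" if n: "n \<ge> N" for n
  proof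
    show "A n \<subseteq> A N" using mono n .
    show "A N \<subseteq> A n"
    proof
      fix y assume y: "y \<in> A N"
      then obtain v a where va: "y = v +[M] a .[M] x" "v \<in> V" "a \<in> carrier k" using A by blast
      hence "a \<in> I N" unfolding I_def using y by blast
      hence "a \<in> I n" using N2[of n] N2[of N] n unfolding N_def by simp
      then obtain w where w: "w \<in> V" "w +[M] a .[M] x \<in> A n" unfolding I_def by blast
      \<comment> \<open>Both elements have the coefficient \<open>a\<close>, so their difference
        lies in \<open>V\<close>, where the chain is already constant.\<close>
      have "y -[M] (w +[M] a .[M] x) \<in> A N" using y w mono[OF n] M.subm_minus[OF A'] by blast
      moreover have "y -[M] (w +[M] a .[M] x) = v -[M] w" using va w V'(3) x M.add_cancel_swap[of "w" "a .[M] x" "w +[M] a .[M] x" "0[M]"]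
        by (simp add: a_minus_def M.minus_add M.a_ac M.r_neg1 M.r_neg2 M.r_neg)
      ultimately have "v -[M] w \<in> A N \<inter> V" using M.subm_minus[OF V(1)] va(2) w(1) by simp
      hence "v -[M] w \<in> A n" using N1[of n] N1[of N] n unfolding N_def by auto
      hence "(v -[M] w) +[M] (w +[M] a .[M] x) \<in> A n" using w AD(4) by blast
      moreover have "(v -[M] w) +[M] (w +[M] a .[M] x) = y" using va w V'(3) x by (simp add: M.a_assoc[symmetric] M.minus_add_cancel)
      ultimately show "y \<in> A n" by simp
    qed
  qed
  thus "\<exists>N. \<forall>n\<ge>N. A n = A N" by blast
qed

text \<open>The generators are adjoined to the zero submodule one at a time, and
  \<open>dcc_step\<close> preserves the chain condition below the submodule reached.\<close>

lemma fgen_dcc: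
  fixes k :: "'k ring" and M :: "('k, 'a) module"
  assumes M: "module k M" and k: "dcc (idl k)" and fg: "fgen k M"
  shows "dcc (subm k M)"
proof -
  interpret M: module k M by fact
  obtain S where S: "finite S" "S \<subseteq> carrier M" "!!W. subm k M W ==> S \<subseteq> W ==> W = carrier M"
    using fg unfolding fgen_def by blast
  have "\<exists>V. subm k M V & F \<subseteq> V & dcc (%W. subm k M W & W \<subseteq> V)" if "F \<subseteq> S" for F
    using finite_subset[OF that S(1)] that
  proof (induction F rule: finite_induct)
    case empty
    have "W = {0[M]}" if "subm k M W" "W \<subseteq> {0[M]}" for W using that submD(2)[OF that(1)] by blast
    hence "dcc (%W. subm k M W & W \<subseteq> {0[M]})" unfolding dcc_def by blast
    thus ?case using M.subm_zero by blast
  next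
    case (insert x F)
    then obtain V where V: "subm k M V" "F \<subseteq> V" "dcc (%W. subm k M W & W \<subseteq> V)" by blast
    have x: "x \<in> carrier M" using insert.prems S(2) by blast
    show ?case using M.subm_sum1[OF V(1) x] M.subm_sum1_sup[OF V(1) x] V(2) dcc_step[OF M k V(1,3) x] by blast
  qed
  then obtain V where V: "subm k M V" "S \<subseteq> V" "dcc (%W. subm k M W & W \<subseteq> V)" by blast
  have "V = carrier M" using S(3) V by blast
  thus ?thesis using V(3) submD(1) unfolding dcc_def by metis
qed

section \<open>Every endomorphism of E is multiplication by a scalar\<close>

context matlis begin

definition torsion :: "'k set => 'e set" where
  "torsion I = {e \<in> carrier E. \<forall>b\<in>I. b .[E] e = 0[E]}"

lemma torsion_subm: "I \<subseteq> carrier k ==> subm k E (torsion I)"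
proof (rule submI)
  assume I: "I \<subseteq> carrier k"
  fix c e assume ce: "c \<in> carrier k" "e \<in> torsion I"
  have "b .[E] (c .[E] e) = c .[E] (b .[E] e)" if "b \<in> I" for b
    using E.smult_assoc1[of b c e] E.smult_assoc1[of c b e] k.m_comm[of b c] ce that I unfolding torsion_def by auto
  thus "c .[E] e \<in> torsion I" using ce I unfolding torsion_def by auto
qed (auto simp: torsion_def E.smult_r_distr subset_iff)

text \<open>An ideal \<open>I\<close> is called good here if every linear map from \<open>torsion I\<close>, the dual of
  \<open>k / I\<close>, to \<open>E\<close> is multiplication by a scalar. If \<open>I\<close> is good and \<open>I / J\<close> is simple then \<open>J\<close> is
  good, so a minimal good ideal is zero; the simple quotients of \<open>I \<noteq> 0\<close> come from functionals
  \<open>w \<mapsto> w u\<close> on \<open>I\<close> whose annihilator is maximal.\<close>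

theorem endo_scalar:
  assumes "lin_on k E E (carrier E) \<theta>"
  shows "\<exists>a\<in>carrier k. \<forall>e\<in>carrier E. \<theta> e = a .[E] e"
proof -
  define good where "good I <-> idl k I & (\<forall>\<theta>. lin_on k E E (torsion I) \<theta> -->
    (\<exists>a\<in>carrier k. \<forall>e\<in>torsion I. \<theta> e = a .[E] e))" for I
  have "good (carrier k)" unfolding good_def
  proof (intro conjI allI impI)
    show "idl k (carrier k)" by (rule idlI) auto
    fix \<theta> assume t: "lin_on k E E (torsion (carrier k)) \<theta>"
    have "e = 0[E]" if "e \<in> torsion (carrier k)" for e using that E.smult_one[of e] unfolding torsion_def by force
    moreover have "\<theta> 0[E] = 0[E]" using E.lin_zero[OF t torsion_subm E_module] by simp
    ultimately show "\<exists>a\<in>carrier k. \<forall>e\<in>torsion (carrier k). \<theta> e = a .[E] e"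
      using E.smult_l_null[OF E.M.zero_closed] k.zero_closed by metis
  qed
  then obtain I where I: "good I" and Imin: "!!J. good J ==> J \<subseteq> I ==> J = I"
    using dcc_minimal[OF dcc_ideals, of good] unfolding good_def by blast
  have Ik: "idl k I" using I unfolding good_def by simp
  note I' = idlD[OF Ik]
  have "I = {0[k]}"
  proof (rule ccontr)
    assume "I ~= {0[k]}"
    then obtain x where x: "x \<in> I" "x ~= 0[k]" using I'(2) by blast
    \<comment> \<open>A functional on \<open>k\<close> that does not vanish at \<open>x\<close> is
      multiplication into its value at \<open>1\<close>, and this value is
      \<open>u0\<close>.\<close>
    obtain u0 where e0: "u0 \<in> carrier E" "x .[E] u0 ~= 0[E]"
    proof -
      have xk: "x \<in> carrier k" using I'(1) x by blast
      interpret K: module k "ring_mod k" by (rule ring_mod_module[OF k_cring])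
      obtain h where h: "lin_on k (ring_mod k) E (carrier k) h" "h x ~= 0[E]"
        using separating_functional[OF K.module_axioms K.subm_zero, of x] xk x(2) by auto
      have "h x = x .[E] h 1[k]" using lin_onD(3)[OF h(1) xk k.one_closed] xk by simp
      thus ?thesis using that lin_onD(1)[OF h(1) k.one_closed] h(2) by simp
    qed
    \<comment> \<open>\<open>B\<close> will be minimal with \<open>B I u0 \<noteq> 0\<close>, and
      \<open>u = b0 u0\<close> with \<open>b0\<close> in \<open>B\<close>. Whenever
      \<open>c w u \<noteq> 0\<close> for some \<open>w\<close> in \<open>I\<close>, minimality
      gives \<open>b0\<close> as a multiple of \<open>c b0\<close>, so \<open>u\<close> is recovered
      from \<open>c u\<close>; hence every nonzero \<open>w u\<close> is simple.\<close>
    define Q where "Q B <-> idl k B & (\<exists>b\<in>B. \<exists>w\<in>I. (b *[k] w) .[E] u0 ~= 0[E])" for B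
    have "Q (carrier k)" unfolding Q_def
    proof
      show "idl k (carrier k)" by (rule idlI) auto
      show "\<exists>b\<in>carrier k. \<exists>w\<in>I. (b *[k] w) .[E] u0 ~= 0[E]"
        using e0 x I'(1)[OF x(1)] by (intro bexI[of _ "1[k]"] bexI[of _ x]) auto
    qed
    then obtain B where B: "Q B" "!!J. Q J ==> J \<subseteq> B ==> J = B" using dcc_minimal[OF dcc_ideals, of Q] unfolding Q_def by blast
    obtain b0 w0 where b0: "b0 \<in> B" "w0 \<in> I" "(b0 *[k] w0) .[E] u0 ~= 0[E]" using B(1) unfolding Q_def by blast
    have Bk: "idl k B" using B(1) unfolding Q_def by simp
    note B' = idlD[OF Bk]
    have b0k: "b0 \<in> carrier k" using b0(1) B'(1) by blast
    define u where "u = b0 .[E] u0"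
    have nE: "u \<in> carrier E" unfolding u_def using b0k e0 by simp
    have Ik: "w \<in> carrier k" if "w \<in> I" for w using I'(1) that .
    have cl: "w .[E] u \<in> carrier E" if "w \<in> carrier k" for w using that nE by simp
    have inv: "\<exists>c'\<in>carrier k. c' .[E] (c .[E] u) = u" if c: "c \<in> carrier k" "w \<in> I" "c .[E] (w .[E] u) ~= 0[E]" for c w
    proof -
      let ?X = "{a *[k] (c *[k] b0) | a. a \<in> carrier k}"
      have "idl k ?X"
      proof (rule idlI)
        show "0[k] \<in> ?X" using b0k c by (intro CollectI exI[of _ "0[k]"]) simp
        show "y +[k] z \<in> ?X" if "y \<in> ?X" "z \<in> ?X" for y z using that b0k c k.l_distr[of _ _ "c *[k] b0", symmetric] by force
        show "d *[k] y \<in> ?X" if "d \<in> carrier k" "y \<in> ?X" for d y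
          using that b0k c k.m_assoc[of _ _ "c *[k] b0", symmetric] by force
      qed (use b0k c in auto)
      moreover have "1[k] *[k] (c *[k] b0) \<in> ?X" by blast
      moreover have "((1[k] *[k] (c *[k] b0)) *[k] w) .[E] u0 ~= 0[E]"
      proof -
        have "((1[k] *[k] (c *[k] b0)) *[k] w) = (c *[k] w) *[k] b0" using c b0k Ik by (simp add: k.m_ac)
        thus ?thesis using c b0k Ik e0 by (simp add: u_def E.smult_assoc1)
      qed
      ultimately have "Q ?X" unfolding Q_def using c(2) by blast
      moreover have "?X \<subseteq> B" using B'(4) b0(1) c(1) by blast
      ultimately have "b0 \<in> ?X" using B(2) b0(1) by blast
      then obtain a where a: "a \<in> carrier k" "b0 = a *[k] (c *[k] b0)" by blast
      have "a .[E] (c .[E] u) = (a *[k] (c *[k] b0)) .[E] u0" using a(1) c b0k e0 by (simp add: u_def E.smult_assoc1)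
      thus ?thesis using a unfolding u_def by metis
    qed
    have scal: "c' .[E] (c .[E] (w .[E] u)) = w .[E] (c' .[E] (c .[E] u))"
      if "c \<in> carrier k" "c' \<in> carrier k" "w \<in> carrier k" for c c' w
      using that nE by (simp add: E.smult_assoc1[symmetric] k.m_ac)
    have simp_val: "simple_elt (w .[E] u)" if w: "w \<in> I" "w .[E] u ~= 0[E]" for w
      unfolding simple_elt_def using w cl Ik inv[OF _ w(1)] scal by metis
    obtain b where b: "b \<in> I" "b .[E] u ~= 0[E]" using b0 b0k Ik e0 by (auto simp: u_def E.smult_assoc1[symmetric] k.m_comm)
    have bk: "b \<in> carrier k" using Ik b by blast
    \<comment> \<open>Every \<open>c\<close> that kills \<open>w u\<close> also kills
      \<open>b u\<close>, so \<open>simple_elt_unique\<close> applies. Thus \<open>w u\<close> is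
      always a multiple of \<open>b u\<close>, which means \<open>I = J + k b\<close> for the
      annihilator \<open>J\<close> of \<open>u\<close> in \<open>I\<close>.\<close>
    have multb: "\<exists>c\<in>carrier k. w .[E] u = c .[E] (b .[E] u)" if w: "w \<in> I" for w
    proof (cases "w .[E] u = 0[E]")
      case True
      thus ?thesis using bk nE by (intro bexI[of _ "0[k]"]) auto
    next
      case False
      have "c .[E] (b .[E] u) = 0[E]" if c: "c \<in> carrier k" "c .[E] (w .[E] u) = 0[E]" for c
      proof (rule ccontr)
        assume "c .[E] (b .[E] u) ~= 0[E]"
        then obtain c' where "c' \<in> carrier k" "c' .[E] (c .[E] u) = u" using inv[OF c(1) b(1)] by blast
        hence "w .[E] u = c' .[E] (c .[E] (w .[E] u))" using scal[OF c(1) _ Ik[OF w]] by simp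
        thus False using c False \<open>c' \<in> carrier k\<close> by simp
      qed
      thus ?thesis using simple_elt_unique[OF simp_val[OF b] simp_val[OF w False]] by blast
    qed
    define J where "J = {w \<in> I. w .[E] u = 0[E]}"
    have J: "idl k J" unfolding J_def by (rule idlI) (use I' nE in \<open>auto simp: E.smult_l_distr E.smult_assoc1\<close>)
    have JI: "J \<subseteq> I" unfolding J_def by blast
    have Jk: "J \<subseteq> carrier k" using JI Ik by blast
    have "b \<notin> J" using b unfolding J_def by simp
    have Jmul: "c *[k] b \<in> J" if "c \<in> carrier k" "c .[E] (b .[E] u) = 0[E]" for c
      using that I'(4) b bk nE unfolding J_def by (simp add: E.smult_assoc1)
    have torJ: "e \<in> carrier E" "!!w. w \<in> J ==> w .[E] e = 0[E]" if "e \<in> torsion J" for e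
      using that unfolding torsion_def by auto
    \<comment> \<open>As \<open>I = J + k b\<close>, an element already killed by \<open>J\<close>
      has only to be tested against \<open>b\<close>.\<close>
    have torI: "e \<in> torsion I" if e: "e \<in> torsion J" "b .[E] e = 0[E]" for e
    proof -
      have "w .[E] e = 0[E]" if w: "w \<in> I" for w
      proof -
        obtain c where c: "c \<in> carrier k" "w .[E] u = c .[E] (b .[E] u)" using multb[OF w] by blast
        have "(w -[k] c *[k] b) .[E] u = 0[E]" using c w Ik bk nE by (simp add: E.smult_l_minus2 E.smult_assoc1 E.minus_eq_zero)
        hence "w -[k] c *[k] b \<in> J" unfolding J_def using k.idl_minus[OF \<open>idl k I\<close> w] I'(4)[OF c(1) b(1)] by simp
        hence "(w -[k] c *[k] b) .[E] e = 0[E]" using torJ(2)[OF e(1)] by blast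
        hence "w .[E] e = (c *[k] b) .[E] e" using c w Ik bk torJ(1)[OF e(1)] by (simp add: E.smult_l_minus2 E.minus_eq_zero)
        thus ?thesis using e(2) c(1) bk torJ(1)[OF e(1)] by (simp add: E.smult_assoc1)
      qed
      thus ?thesis using torJ(1)[OF e(1)] unfolding torsion_def by blast
    qed
    have "good J" unfolding good_def
    proof (intro conjI allI impI J)
      fix \<theta> assume t: "lin_on k E E (torsion J) \<theta>"
      note t' = lin_onD[OF t]
      have sub: "torsion I \<subseteq> torsion J" using JI unfolding torsion_def by blast
      obtain a where a: "a \<in> carrier k" "!!e. e \<in> torsion I ==> \<theta> e = a .[E] e"
        using I lin_on_subset[OF t sub] unfolding good_def by blast
      \<comment> \<open>The scalar \<open>a\<close> is right on \<open>torsion I\<close>. The error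
        \<open>\<psi>\<close> vanishes there, that is, on the kernel of multiplication by
        \<open>b\<close> on \<open>torsion J\<close>, so it factors as \<open>d\<close> after
        multiplication by \<open>b\<close>.\<close>
      define \<psi> where "\<psi> e = \<theta> e -[E] a .[E] e" for e
      note TJ = torsion_subm[OF Jk]
      have "\<exists>d. lin_on k E E (carrier E) d & (\<forall>e\<in>torsion J. d (b .[E] e) = \<psi> e)"
      proof (rule injective_extension[OF E_inj E_module E_module TJ])
        show "lin_on k E E (torsion J) (%e. b .[E] e)"
          by (rule lin_onI) (use torJ(1) bk in \<open>auto simp: E.smult_r_distr E.smult_assoc1[symmetric] k.m_comm\<close>)
        show "lin_on k E E (torsion J) \<psi>"
        proof (rule lin_onI)
          fix e e' assume e: "e \<in> torsion J" "e' \<in> torsion J"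
          show "\<psi> (e +[E] e') = \<psi> e +[E] \<psi> e'"
            using e t' torJ(1) a(1) unfolding \<psi>_def by (simp add: a_minus_def E.smult_r_distr E.M.minus_add E.M.a_ac)
        next
          fix c e assume e: "c \<in> carrier k" "e \<in> torsion J"
          hence "a .[E] (c .[E] e) = c .[E] (a .[E] e)" using a(1) torJ(1) by (simp add: E.smult_assoc1[symmetric] k.m_comm)
          thus "\<psi> (c .[E] e) = c .[E] \<psi> e" using e t' torJ(1) a(1) unfolding \<psi>_def by (simp add: E.smult_r_minus2)
        qed (use t' torJ(1) a(1) in \<open>auto simp: \<psi>_def\<close>)
        fix e assume "e \<in> torsion J" "b .[E] e = 0[E]"
        thus "\<psi> e = 0[E]" using a torI torJ(1) unfolding \<psi>_def by (simp add: E.minus_eq_zero)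
      qed
      then obtain d where d: "lin_on k E E (carrier E) d" "!!e. e \<in> torsion J ==> d (b .[E] e) = \<psi> e" by blast
      note d' = lin_onD[OF d(1)]
      have d0: "d 0[E] = 0[E]" using E.lin_zero[OF d(1) E.subm_carrier E_module] .
      have kill: "c .[E] (b .[E] e) = 0[E]" if "c \<in> carrier k" "c .[E] (b .[E] u) = 0[E]" "e \<in> torsion J" for c e
        using torJ(2)[OF that(3) Jmul[OF that(1,2)]] torJ(1)[OF that(3)] that bk by (simp add: E.smult_assoc1)
      have inv2: "\<exists>c'\<in>carrier k. \<forall>e\<in>torsion J. c' .[E] (c .[E] (b .[E] e)) = b .[E] e"
        if c: "c \<in> carrier k" "c .[E] (b .[E] u) ~= 0[E]" for c
      proof -
        obtain c' where c': "c' \<in> carrier k" "c' .[E] (c .[E] u) = u" using inv[OF c(1) b(1) c(2)] by blast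
        have "((c' *[k] c) -[k] 1[k]) .[E] (b .[E] u) = 0[E]"
          using c c' bk nE scal[OF c(1) c'(1) bk] by (simp add: E.smult_l_minus2 E.smult_assoc1 E.minus_eq_zero)
        hence "((c' *[k] c) -[k] 1[k]) .[E] (b .[E] e) = 0[E]" if "e \<in> torsion J" for e using kill[OF _ _ that] c c' by simp
        hence "c' .[E] (c .[E] (b .[E] e)) = b .[E] e" if "e \<in> torsion J" for e
          using that c c' bk torJ(1) by (simp add: E.smult_l_minus2 E.smult_assoc1 E.minus_eq_zero)
        thus ?thesis using c'(1) by blast
      qed
      \<comment> \<open>All nonzero \<open>b e\<close> are simple with the same annihilator, so each
        is a multiple of a fixed \<open>b e0\<close>. If \<open>d\<close> does not kill
        \<open>b e0\<close>, the image is again simple with that annihilator and so a multiple of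
        \<open>b e0\<close>; the scalar found at \<open>b e0\<close> then serves for all
        \<open>e\<close>.\<close>
      have "\<exists>c0\<in>carrier k. \<forall>e\<in>torsion J. d (b .[E] e) = c0 .[E] (b .[E] e)"
      proof (cases "\<exists>e0\<in>torsion J. b .[E] e0 ~= 0[E]")
        case False
        thus ?thesis using d0 by (intro bexI[of _ "0[k]"]) auto
      next
        case True
        then obtain e0 where e0: "e0 \<in> torsion J" "b .[E] e0 ~= 0[E]" by blast
        have beE: "b .[E] e \<in> carrier E" if "e \<in> torsion J" for e using torJ(1) bk that by simp
        have simp_be: "simple_elt (b .[E] e)" if "e \<in> torsion J" "b .[E] e ~= 0[E]" for e
          unfolding simple_elt_def using that beE inv2 kill by metis
        have annb: "c .[E] (b .[E] u) = 0[E]"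
          if c: "c \<in> carrier k" "c .[E] (b .[E] e) = 0[E]" "e \<in> torsion J" "b .[E] e ~= 0[E]" for c e
          using inv2[OF c(1)] c E.smult_r_null by metis
        have dmul: "d (c .[E] (b .[E] e)) = c .[E] d (b .[E] e)" if "c \<in> carrier k" "e \<in> torsion J" for c e
          using that d'(3) beE by blast
        have "\<exists>c0\<in>carrier k. d (b .[E] e0) = c0 .[E] (b .[E] e0)"
        proof (cases "d (b .[E] e0) = 0[E]")
          case True
          thus ?thesis using beE[OF e0(1)] by (intro bexI[of _ "0[k]"]) auto
        next
          case False
          have inv3: "\<exists>c'\<in>carrier k. c' .[E] (c .[E] d (b .[E] e0)) = d (b .[E] e0)"
            if c: "c \<in> carrier k" "c .[E] (b .[E] e0) ~= 0[E]" for c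
          proof -
            have "c .[E] (b .[E] u) ~= 0[E]" using kill[OF c(1) _ e0(1)] c(2) by blast
            then obtain c' where c': "c' \<in> carrier k" "c' .[E] (c .[E] (b .[E] e0)) = b .[E] e0" using inv2[OF c(1)] e0(1) by blast
            have "d (c' .[E] (c .[E] (b .[E] e0))) = c' .[E] (c .[E] d (b .[E] e0))" using d'(3) beE[OF e0(1)] c(1) c'(1) by simp
            thus ?thesis using c' by metis
          qed
          have nz: "c .[E] (b .[E] e0) ~= 0[E]" if "c \<in> carrier k" "c .[E] d (b .[E] e0) ~= 0[E]" for c
            using dmul[OF that(1) e0(1)] that(2) d0 by auto
          have "simple_elt (d (b .[E] e0))" unfolding simple_elt_def using False d'(1) beE[OF e0(1)] inv3 nz by metis
          moreover have "c .[E] (b .[E] e0) = 0[E]" if "c \<in> carrier k" "c .[E] d (b .[E] e0) = 0[E]" for c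
            using inv3[OF that(1)] that(2) False E.smult_r_null by metis
          ultimately show ?thesis using simple_elt_unique[OF simp_be[OF e0]] by blast
        qed
        then obtain c0 where c0: "c0 \<in> carrier k" "d (b .[E] e0) = c0 .[E] (b .[E] e0)" by blast
        have "d (b .[E] e) = c0 .[E] (b .[E] e)" if e: "e \<in> torsion J" for e
        proof (cases "b .[E] e = 0[E]")
          case True thus ?thesis using d0 c0 by simp
        next
          case False
          have "c .[E] (b .[E] e0) = 0[E]" if "c \<in> carrier k" "c .[E] (b .[E] e) = 0[E]" for c
            using kill[OF that(1) annb[OF that e False] e0(1)] .
          then obtain c where c: "c \<in> carrier k" "b .[E] e = c .[E] (b .[E] e0)"
            using simple_elt_unique[OF simp_be[OF e0] simp_be[OF e False]] by blast
          have "c .[E] (c0 .[E] (b .[E] e0)) = c0 .[E] (c .[E] (b .[E] e0))"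
            using c(1) c0(1) beE[OF e0(1)] by (simp add: E.smult_assoc1[symmetric] k.m_comm)
          thus ?thesis using dmul[OF c(1) e0(1)] c(2) c0(2) by simp
        qed
        thus ?thesis using c0(1) by blast
      qed
      then obtain c0 where c0: "c0 \<in> carrier k" "!!e. e \<in> torsion J ==> \<psi> e = c0 .[E] (b .[E] e)" using d(2) by metis
      have "\<theta> e = (c0 *[k] b +[k] a) .[E] e" if e: "e \<in> torsion J" for e
      proof -
        have "\<theta> e = \<psi> e +[E] a .[E] e" unfolding \<psi>_def using e t'(1) a(1) torJ(1) by (simp add: E.minus_add_cancel)
        thus ?thesis using c0 e a(1) bk torJ(1) by (simp add: E.smult_l_distr E.smult_assoc1)
      qed
      thus "\<exists>a\<in>carrier k. \<forall>e\<in>torsion J. \<theta> e = a .[E] e" using a(1) bk c0(1) by blast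
    qed
    thus False using Imin JI \<open>b \<notin> J\<close> b(1) by blast
  qed
  moreover have "torsion {0[k]} = carrier E" unfolding torsion_def by auto
  ultimately show ?thesis using I assms unfolding good_def by auto
qed

end

section \<open>Reflexivity of finitely generated modules and perfect pairings\<close>

context matlis begin

lemma eval_linear:
  assumes "module k N" "n \<in> carrier N"
  shows "lin_on k (dual_module k E N) E (carrier (dual_module k E N)) (%d. d n)"
  by (rule lin_onI) (use assms(2) in \<open>auto simp: dual_simps lin_homD\<close>)

lemma lin_on_diff:
  fixes M :: "('k, 'a) module"
  assumes "lin_on k M E W f" "lin_on k M E W g"
  shows "lin_on k M E W (%x. f x -[E] g x)"
proof (rule lin_onI)
  note f = lin_onD[OF assms(1)] and g = lin_onD[OF assms(2)]
  show "f x -[E] g x \<in> carrier E" if "x \<in> W" for x using f g that by simp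
  show "f (x +[M] y) -[E] g (x +[M] y) = f x -[E] g x +[E] (f y -[E] g y)" if "x \<in> W" "y \<in> W" for x y
    using f g that by (simp add: a_minus_def E.M.minus_add E.M.a_ac)
  show "f (c .[M] x) -[E] g (c .[M] x) = c .[E] (f x -[E] g x)" if "c \<in> carrier k" "x \<in> W" for c x
    using f g that by (simp add: E.smult_r_minus2)
qed

text \<open>Induction over the elements of \<open>S\<close>. On the functionals that vanish at
  \<open>s\<close> the induction hypothesis provides \<open>n\<close>; the defect
  \<open>\<psi> d - d n\<close> then depends on the value \<open>d s\<close> alone, so it is an
  endomorphism of \<open>E\<close> applied to it, hence \<open>a (d s) = d (a s)\<close> for some
  scalar \<open>a\<close>.\<close>

lemma reflexive_aux:
  fixes N :: "('k, 'a) module"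
  assumes N: "module k N" and S: "finite S" "S \<subseteq> carrier N"
  shows "subm k (dual_module k E N) W ==> lin_on k (dual_module k E N) E W \<psi> ==>
    (!!d. d \<in> W ==> (!!s. s \<in> S ==> d s = 0[E]) ==> \<psi> d = 0[E]) ==>
    \<exists>n\<in>carrier N. \<forall>d\<in>W. \<psi> d = d n" using S
proof (induction S arbitrary: W \<psi> rule: finite_induct)
  interpret N: module k N by fact
  let ?D = "dual_module k E N"
  interpret D: module k ?D by (rule dual_is_module[OF N E_module])
  {
    case empty
    have "d 0[N] = 0[E]" if "d \<in> W" for d
    proof -
      have "d \<in> lin_hom k N E" using submD(3)[OF empty.prems(1) that] by (simp add: dual_simps)
      from N.lin_zero[OF lin_hom_lin_on[OF this] N.subm_carrier E_module] show ?thesis .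
    qed
    thus ?case using empty.prems(3) by force
  next
    case (insert s S)
    note W' = submD[OF insert.prems(1)] and psi = lin_onD[OF insert.prems(2)]
    have s: "s \<in> carrier N" using insert.prems(4) by blast
    define W1 where "W1 = {d \<in> W. d s = 0[E]}"
    have W1: "subm k ?D W1" by (rule submI) (use W' s in \<open>auto simp: W1_def dual_simps\<close>)
    have "\<exists>n\<in>carrier N. \<forall>d\<in>W1. \<psi> d = d n"
    proof (rule insert.IH[OF W1])
      show "lin_on k ?D E W1 \<psi>" by (rule lin_on_subset[OF insert.prems(2)]) (auto simp: W1_def)
    qed (use insert.prems(3,4) in \<open>auto simp: W1_def\<close>)
    then obtain n where n: "n \<in> carrier N" "!!d. d \<in> W1 ==> \<psi> d = d n" by blast
    have ev: "lin_on k ?D E W (%d. d t)" if "t \<in> carrier N" for t by (rule lin_on_subset[OF eval_linear[OF N that] W'(1)])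
    have "\<exists>h. lin_on k E E (carrier E) h & (\<forall>d\<in>W. h (d s) = \<psi> d -[E] d n)"
    proof (rule injective_extension[OF E_inj D.module_axioms E_module insert.prems(1) ev[OF s]])
      show "lin_on k ?D E W (%d. \<psi> d -[E] d n)" by (rule lin_on_diff[OF insert.prems(2) ev[OF n(1)]])
      fix d assume "d \<in> W" "d s = 0[E]"
      thus "\<psi> d -[E] d n = 0[E]" using n(2)[of d] psi(1)[of d] E.minus_eq_zero unfolding W1_def by auto
    qed
    then obtain h where h: "lin_on k E E (carrier E) h" "!!d. d \<in> W ==> h (d s) = \<psi> d -[E] d n" by blast
    obtain a where a: "a \<in> carrier k" "!!e. e \<in> carrier E ==> h e = a .[E] e" using endo_scalar[OF h(1)] by blast
    have "\<psi> d = d (a .[N] s +[N] n)" if d: "d \<in> W" for d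
    proof -
      have dl: "d \<in> lin_hom k N E" using W'(3)[OF d] by (simp add: dual_simps)
      note d' = lin_homD[OF dl]
      have "\<psi> d = (\<psi> d -[E] d n) +[E] d n" using psi(1)[OF d] d' n(1) by (simp add: E.minus_add_cancel)
      also have "\<dots> = a .[E] d s +[E] d n" using h(2)[OF d] a(2) d'(1)[OF s] by simp
      also have "\<dots> = d (a .[N] s +[N] n)" using d' s n(1) a(1) by simp
      finally show ?thesis .
    qed
    thus ?case using a(1) s n(1) by blast
  }
qed

text \<open>A functional that vanishes on a generating set is zero, which is the hypothesis of
  \<open>reflexive_aux\<close> for such a set.\<close>

theorem reflexive:
  fixes N :: "('k, 'a) module"
  assumes N: "module k N" "fgen k N" and \<psi>: "lin_on k (dual_module k E N) E (lin_hom k N E) \<psi>"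
  shows "\<exists>n\<in>carrier N. \<forall>d\<in>lin_hom k N E. \<psi> d = d n"
proof -
  interpret N: module k N by fact
  let ?D = "dual_module k E N"
  interpret D: module k ?D by (rule dual_is_module[OF N(1) E_module])
  obtain S where S: "finite S" "S \<subseteq> carrier N" "!!W. subm k N W ==> S \<subseteq> W ==> W = carrier N"
    using N(2) unfolding fgen_def by blast
  have "\<psi> d = 0[E]" if d: "d \<in> lin_hom k N E" "!!s. s \<in> S ==> d s = 0[E]" for d
  proof -
    note d' = lin_homD[OF d(1)]
    have "d 0[N] = 0[E]" using N.lin_zero[OF lin_hom_lin_on[OF d(1)] N.subm_carrier E_module] .
    hence "subm k N {x \<in> carrier N. d x = 0[E]}" by (intro submI) (use d' in auto)
    hence "{x \<in> carrier N. d x = 0[E]} = carrier N" by (rule S(3)) (use S(2) d(2) in auto)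
    hence "d x = 0[E]" if "x \<in> carrier N" for x using that by blast
    hence "d = 0[?D]" using d'(4) by (auto simp: dual_simps fun_eq_iff extensional_def)
    thus ?thesis using D.lin_zero[OF \<psi> _ E_module] D.subm_carrier by (simp add: dual_simps)
  qed
  thus ?thesis using reflexive_aux[OF N(1) S(1,2), of "lin_hom k N E" \<psi>] \<psi> D.subm_carrier by (simp add: dual_simps)
qed

lemma dual_separates:
  fixes M :: "('k, 'a) module"
  assumes M: "module k M" and W: "subm k M W" and x: "x \<in> carrier M" "x \<notin> W"
  shows "\<exists>d\<in>lin_hom k M E. (\<forall>w\<in>W. d w = 0[E]) & d x ~= 0[E]"
proof -
  obtain h where h: "lin_on k M E (carrier M) h" "\<forall>w\<in>W. h w = 0[E]" "h x ~= 0[E]" using separating_functional[OF M W x] by blast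
  show ?thesis by (rule bexI[OF _ lin_on_lin_hom[OF M h(1)]]) (use h x submD(3)[OF W] in auto)
qed

text \<open>Nondegeneracy embeds \<open>M\<close> into the dual of \<open>N\<close>. By injectivity
  of \<open>E\<close> the functional \<open>\<theta>\<close> extends to that dual, and reflexivity
  of \<open>N\<close> turns the extension into evaluation at some \<open>n\<close>. In the
  application \<open>M\<close> is an \<open>Ext\<close> module and \<open>N\<close> a
  \<open>Hom\<close> module.\<close>

theorem pairing_perfect:
  fixes M :: "('k, 'a) module" and N :: "('k, 'b) module"
  assumes M: "module k M" and N: "module k N" "fgen k N"
    and bM: "!!n. n \<in> carrier N ==> lin_on k M E (carrier M) (%m. \<beta> m n)"
    and bN: "!!m. m \<in> carrier M ==> lin_on k N E (carrier N) (\<beta> m)"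
    and nondeg: "!!m. m \<in> carrier M ==> (!!n. n \<in> carrier N ==> \<beta> m n = 0[E]) ==> m = 0[M]"
    and \<theta>: "\<theta> \<in> lin_hom k M E"
  shows "\<exists>n\<in>carrier N. \<forall>m\<in>carrier M. \<theta> m = \<beta> m n"
proof -
  interpret M: module k M by fact
  interpret N: module k N by fact
  let ?D = "dual_module k E N"
  let ?u = "%m. \<lambda>n\<in>carrier N. \<beta> m n"
  interpret D: module k ?D by (rule dual_is_module[OF N(1) E_module])
  have u: "lin_on k M ?D (carrier M) ?u"
  proof (rule lin_onI)
    show "?u m \<in> carrier ?D" if "m \<in> carrier M" for m using lin_on_lin_hom[OF N(1) bN[OF that]] by (simp add: dual_simps)
    show "?u (m +[M] m') = ?u m +[?D] ?u m'" if "m \<in> carrier M" "m' \<in> carrier M" for m m'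
      using lin_onD(2)[OF bM] that by (auto simp: dual_simps intro!: restrict_ext)
    show "?u (a .[M] m) = a .[?D] ?u m" if "a \<in> carrier k" "m \<in> carrier M" for a m
      using lin_onD(3)[OF bM] that by (auto simp: dual_simps intro!: restrict_ext)
  qed
  have "\<exists>h. lin_on k ?D E (carrier ?D) h & (\<forall>m\<in>carrier M. h (?u m) = \<theta> m)"
  proof (rule injective_extension[OF E_inj M D.module_axioms M.subm_carrier u lin_hom_lin_on[OF \<theta>]])
    fix m assume m: "m \<in> carrier M" "?u m = 0[?D]"
    hence "\<beta> m n = 0[E]" if "n \<in> carrier N" for n using that by (auto simp: dual_simps dest!: fun_cong[where x=n])
    hence "m = 0[M]" using nondeg m(1) by blast
    thus "\<theta> m = 0[E]" using M.lin_zero[OF lin_hom_lin_on[OF \<theta>] M.subm_carrier E_module] by simp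
  qed
  then obtain h where h: "lin_on k ?D E (carrier ?D) h" "!!m. m \<in> carrier M ==> h (?u m) = \<theta> m" by blast
  obtain n where n: "n \<in> carrier N" "!!d. d \<in> lin_hom k N E ==> h d = d n"
    using reflexive[OF N, of h] h(1) by (auto simp: dual_simps)
  have "\<theta> m = \<beta> m n" if m: "m \<in> carrier M" for m using h(2)[OF m] n lin_onD(1)[OF u m] by (simp add: dual_simps)
  thus ?thesis using n(1) by blast
qed

text \<open>Among the annihilators in the dual of finite subsets of \<open>M\<close> there is a
  minimal one; adjoining a further element does not shrink it, so it is zero. The finite set then
  generates, since a proper submodule is killed by some nonzero functional.\<close>

theorem fgen_from_dual:
  fixes M :: "('k, 'a) module"
  assumes M: "module k M" and D: "fgen k (dual_module k E M)"
  shows "fgen k M"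
proof -
  interpret M: module k M by fact
  let ?D = "dual_module k E M"
  have Dm: "module k ?D" by (rule dual_is_module[OF M E_module])
  have dcc: "dcc (subm k ?D)" by (rule fgen_dcc[OF Dm dcc_ideals D])
  define ann where "ann S = {d \<in> lin_hom k M E. \<forall>s\<in>S. d s = 0[E]}" for S
  interpret D: module k ?D by fact
  have sub: "subm k ?D (ann S)" if S: "S \<subseteq> carrier M" for S
  proof (rule submI)
    show "x \<in> carrier ?D" if "x \<in> ann S" for x using that by (simp add: ann_def dual_simps)
    show "0[?D] \<in> ann S" using D.M.zero_closed S by (auto simp: ann_def dual_simps)
    show "x +[?D] y \<in> ann S" if "x \<in> ann S" "y \<in> ann S" for x y
      using that S D.M.a_closed[of x y] by (auto simp: ann_def dual_simps)
    show "a .[?D] x \<in> ann S" if "a \<in> carrier k" "x \<in> ann S" for a x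
      using that S D.smult_closed[of a x] by (auto simp: ann_def dual_simps)
  qed
  define Q where "Q W <-> (\<exists>S. finite S & S \<subseteq> carrier M & W = ann S)" for W
  have "Q (ann {})" unfolding Q_def by blast
  moreover have "subm k ?D W" if "Q W" for W using sub that unfolding Q_def by blast
  ultimately obtain W where "Q W" and min: "!!V. Q V ==> V \<subseteq> W ==> V = W" using dcc_minimal[OF dcc, of Q "ann {}"] by metis
  then obtain S where S: "finite S" "S \<subseteq> carrier M" "W = ann S" unfolding Q_def by blast
  have W0: "d m = 0[E]" if "d \<in> W" "m \<in> carrier M" for d m
  proof -
    have "ann (insert m S) = W" by (rule min) (use S that in \<open>auto simp: Q_def ann_def intro!: exI[of _ "insert m S"]\<close>)
    thus ?thesis using that unfolding ann_def by blast
  qed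
  have "V = carrier M" if V: "subm k M V" "S \<subseteq> V" for V
  proof (rule ccontr)
    assume "V ~= carrier M"
    then obtain x where x: "x \<in> carrier M" "x \<notin> V" using submD(1)[OF V(1)] by blast
    obtain d where d: "d \<in> lin_hom k M E" "\<forall>w\<in>V. d w = 0[E]" "d x ~= 0[E]" using dual_separates[OF M V(1) x] by blast
    hence "d \<in> W" unfolding S(3) ann_def using V(2) by blast
    thus False using W0 x d by blast
  qed
  thus ?thesis unfolding fgen_def using S by blast
qed

lemma fgen_iso:
  fixes M :: "('k, 'a) module" and N :: "('k, 'b) module"
  assumes M: "module k M" and fg: "fgen k M" and N: "module k N"
    and f: "lin_on k M N (carrier M) f" and onto: "carrier N \<subseteq> f ` carrier M"
  shows "fgen k N"
proof -
  interpret M: module k M by fact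
  note f' = lin_onD[OF f]
  obtain S where S: "finite S" "S \<subseteq> carrier M" "!!W. subm k M W ==> S \<subseteq> W ==> W = carrier M"
    using fg unfolding fgen_def by blast
  have "W = carrier N" if W: "subm k N W" "f ` S \<subseteq> W" for W
  proof -
    note W' = submD[OF W(1)]
    have "subm k M {x \<in> carrier M. f x \<in> W}" by (rule submI) (use W' f' M.lin_zero[OF f M.subm_carrier N] in auto)
    hence "{x \<in> carrier M. f x \<in> W} = carrier M" by (rule S(3)) (use S(2) W(2) in auto)
    thus ?thesis using onto W'(1) by blast
  qed
  thus ?thesis unfolding fgen_def using S f'(1) by (intro exI[of _ "f ` S"]) auto
qed

end

section \<open>Linear categories with graded arrows\<close>

definition hom_mod :: "('a => bool) => ('a => 'o) => ('a => 'o) => ('a => nat) => ('a => 'a => 'a) =>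
    (nat => 'o => 'o => 'a) => ('k => 'a => 'a) => nat => 'o => 'o => ('k, 'a) module" where
  "hom_mod ar src trg deg pls zer scl d X Y =
     \<lparr>carrier = {f. ar f & src f = X & trg f = Y & deg f = d}, monoid.mult = undefined, one = undefined,
      ring.zero = zer d X Y, ring.add = pls, module.smult = scl\<rparr>"

text \<open>A linear category whose arrows carry a degree bounded by \<open>D\<close>; the composite of two arrows is
  only meaningful if the total degree is at most \<open>D\<close>. With \<open>D = 0\<close> this is a linear category with
  disjoint hom sets; with \<open>D = 1\<close> the arrows of degree one will be the classes in \<open>Ext\<^sup>1\<close>, so that
  the bimodule laws of \<open>Ext\<^sup>1\<close> and the category laws are the same axioms.\<close>

locale gcat =
  fixes k :: "'k ring" and D :: nat and Ob :: "'o set" and ar :: "'a => bool"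
    and src trg :: "'a => 'o" and deg :: "'a => nat" and ide :: "'o => 'a"
    and cmp :: "'a => 'a => 'a" (infixl \<open>**\<close> 75)
    and pls :: "'a => 'a => 'a" (infixl \<open>+++\<close> 65)
    and zer :: "nat => 'o => 'o => 'a"
    and scl :: "'k => 'a => 'a" (infixr \<open>\<star>\<close> 80)
  assumes k_cring: "cring k"
    and src_ob [simp]: "ar f ==> src f \<in> Ob"
    and trg_ob [simp]: "ar f ==> trg f \<in> Ob"
    and deg_le [simp]: "ar f ==> deg f \<le> D"
    and ide_arr [simp]: "X \<in> Ob ==> ar (ide X)"
    and ide_src [simp]: "X \<in> Ob ==> src (ide X) = X"
    and ide_trg [simp]: "X \<in> Ob ==> trg (ide X) = X"
    and ide_deg [simp]: "X \<in> Ob ==> deg (ide X) = 0"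
    and cmp_arr [simp]: "[| ar f; ar g; src g = trg f; deg g + deg f \<le> D |] ==> ar (g ** f)"
    and cmp_src [simp]: "[| ar f; ar g; src g = trg f; deg g + deg f \<le> D |] ==> src (g ** f) = src f"
    and cmp_trg [simp]: "[| ar f; ar g; src g = trg f; deg g + deg f \<le> D |] ==> trg (g ** f) = trg g"
    and cmp_deg [simp]: "[| ar f; ar g; src g = trg f; deg g + deg f \<le> D |] ==> deg (g ** f) = deg g + deg f"
    and cmp_ide_right [simp]: "[| ar f; src f = X |] ==> f ** ide X = f"
    and cmp_ide_left [simp]: "[| ar f; trg f = Y |] ==> ide Y ** f = f"
    and assoc [simp]: "[| ar f; ar g; ar h; src g = trg f; src h = trg g; deg h + deg g + deg f \<le> D |]
          ==> (h ** g) ** f = h ** (g ** f)"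
    and hom_module: "[| X \<in> Ob; Y \<in> Ob; d \<le> D |] ==> module k (hom_mod ar src trg deg pls zer scl d X Y)"
    and cmp_add_right: "[| ar f; ar f'; ar g; src f' = src f; trg f' = trg f; deg f' = deg f; src g = trg f;
          deg g + deg f \<le> D |] ==> g ** (f +++ f') = g ** f +++ g ** f'"
    and cmp_add_left: "[| ar f; ar g; ar g'; src g' = src g; trg g' = trg g; deg g' = deg g; src g = trg f;
          deg g + deg f \<le> D |] ==> (g +++ g') ** f = g ** f +++ g' ** f"
    and cmp_scl_right: "[| ar f; ar g; a \<in> carrier k; src g = trg f; deg g + deg f \<le> D |]
          ==> g ** (a \<star> f) = a \<star> (g ** f)"
    and cmp_scl_left: "[| ar f; ar g; a \<in> carrier k; src g = trg f; deg g + deg f \<le> D |]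
          ==> (a \<star> g) ** f = a \<star> (g ** f)"
begin

abbreviation HM :: "nat => 'o => 'o => ('k, 'a) module" where
  "HM \<equiv> hom_mod ar src trg deg pls zer scl"

lemma HM_simps:
  "carrier (HM d X Y) = {f. ar f & src f = X & trg f = Y & deg f = d}"
  "0[HM d X Y] = zer d X Y" "f +[HM d X Y] g = f +++ g" "a .[HM d X Y] f = a \<star> f" by (simp_all add: hom_mod_def)

lemma HM_mod: "ar f ==> module k (HM (deg f) (src f) (trg f))" by (rule hom_module) auto

lemma op_hom_mod: "hom_mod ar trg src deg pls (%d X Y. zer d Y X) scl d X Y = HM d Y X" unfolding hom_mod_def by auto

text \<open>The axioms, including those about degrees, are symmetric in source and target. Mirror
  statements below are instances of their originals at this interpretation, rewritten with
  \<open>op_simps\<close>.\<close>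

lemma op_gcat: "gcat k D Ob ar trg src deg ide (%g f. f ** g) pls (%d X Y. zer d Y X) scl"
proof (rule gcat.intro)
  show "module k (hom_mod ar trg src deg pls (%d X Y. zer d Y X) scl d X Y)" if "X \<in> Ob" "Y \<in> Ob" "d \<le> D" for d X Y
    using hom_module[OF that(2,1,3)] unfolding op_hom_mod .
qed (simp_all add: k_cring cmp_add_right cmp_add_left cmp_scl_right cmp_scl_left ac_simps)

lemma add_closed [simp]:
  assumes "ar f" "ar g" "src g = src f" "trg g = trg f" "deg g = deg f"
  shows "ar (f +++ g)" "src (f +++ g) = src f" "trg (f +++ g) = trg f" "deg (f +++ g) = deg f"
proof -
  interpret M: module k "HM (deg f) (src f) (trg f)" using HM_mod assms(1) .
  show "ar (f +++ g)" "src (f +++ g) = src f" "trg (f +++ g) = trg f" "deg (f +++ g) = deg f"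
    using M.M.a_closed[of f g] assms by (simp_all add: HM_simps)
qed

lemma zer_closed [simp]:
  assumes "X \<in> Ob" "Y \<in> Ob" "d \<le> D"
  shows "ar (zer d X Y)" "src (zer d X Y) = X" "trg (zer d X Y) = Y" "deg (zer d X Y) = d"
proof -
  interpret M: module k "HM d X Y" using hom_module assms .
  show "ar (zer d X Y)" "src (zer d X Y) = X" "trg (zer d X Y) = Y" "deg (zer d X Y) = d" using M.M.zero_closed by (simp_all add: HM_simps)
qed

lemma scl_closed [simp]:
  assumes "ar f" "a \<in> carrier k"
  shows "ar (a \<star> f)" "src (a \<star> f) = src f" "trg (a \<star> f) = trg f" "deg (a \<star> f) = deg f"
proof -
  interpret M: module k "HM (deg f) (src f) (trg f)" using HM_mod assms(1) .
  show "ar (a \<star> f)" "src (a \<star> f) = src f" "trg (a \<star> f) = trg f" "deg (a \<star> f) = deg f"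
    using M.smult_closed[of a f] assms by (simp_all add: HM_simps)
qed

lemma add_assoc:
  assumes "ar f" "ar g" "src g = src f" "trg g = trg f" "deg g = deg f"
    "ar h" "src h = src f" "trg h = trg f" "deg h = deg f"
  shows "(f +++ g) +++ h = f +++ (g +++ h)"
proof -
  interpret M: module k "HM (deg f) (src f) (trg f)" using HM_mod assms(1) .
  show ?thesis using M.M.a_assoc[of f g h] assms by (simp_all add: HM_simps)
qed

lemma add_comm:
  assumes "ar f" "ar g" "src g = src f" "trg g = trg f" "deg g = deg f"
  shows "f +++ g = g +++ f"
proof -
  interpret M: module k "HM (deg f) (src f) (trg f)" using HM_mod assms(1) .
  show ?thesis using M.M.a_comm[of f g] assms by (simp_all add: HM_simps)
qed

lemma add_zer [simp]:
  assumes "ar f" "src f = X" "trg f = Y" "deg f = d"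
  shows "zer d X Y +++ f = f" "f +++ zer d X Y = f"
proof -
  interpret M: module k "HM (deg f) (src f) (trg f)" using HM_mod assms(1) .
  show "zer d X Y +++ f = f" "f +++ zer d X Y = f" using M.M.l_zero[of f] M.M.r_zero[of f] assms by (simp_all add: HM_simps)
qed

text \<open>Negation through the scalar minus one carries no degree or end terms as arguments, and
  its compatibility with composition is a case of the scalar laws.\<close>

definition neg :: "'a => 'a" where "neg f = (-[k] 1[k]) \<star> f"

lemma m1_closed: "-[k] 1[k] \<in> carrier k"
  using k_cring by (simp add: abelian_group.a_inv_closed cring.axioms(1) ring.ring_simprules(6) ring.is_abelian_group)

lemma neg_closed [simp]:
  assumes "ar f"
  shows "ar (neg f)" "src (neg f) = src f" "trg (neg f) = trg f" "deg (neg f) = deg f" using assms m1_closed unfolding neg_def by auto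

lemma neg_zer [simp]:
  assumes "X \<in> Ob" "Y \<in> Ob" "d \<le> D"
  shows "neg (zer d X Y) = zer d X Y"
proof -
  interpret M: module k "HM d X Y" using hom_module assms .
  show ?thesis unfolding neg_def using M.smult_r_null[OF m1_closed] by (simp add: HM_simps)
qed

lemma neg_eq:
  assumes "ar f"
  shows "neg f = -[HM (deg f) (src f) (trg f)] f"
proof -
  interpret M: module k "HM (deg f) (src f) (trg f)" using HM_mod assms(1) .
  show ?thesis using M.smult_l_minus[of "1[k]" f] assms M.smult_one[of f] unfolding neg_def by (simp add: HM_simps)
qed

lemma add_neg [simp]:
  assumes "ar f" "src f = X"
  shows "f +++ neg f = zer (deg f) (src f) (trg f)" "neg f +++ f = zer (deg f) (src f) (trg f)"
proof -
  interpret M: module k "HM (deg f) (src f) (trg f)" using HM_mod assms(1) .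
  show "f +++ neg f = zer (deg f) (src f) (trg f)" "neg f +++ f = zer (deg f) (src f) (trg f)"
    using M.M.r_neg[of f] M.M.l_neg[of f] assms neg_eq[OF assms(1)] by (simp_all add: HM_simps)
qed

lemma eq_iff_diff:
  assumes "ar f" "ar g" "src g = src f" "trg g = trg f" "deg g = deg f"
  shows "f = g <-> f +++ neg g = zer (deg f) (src f) (trg f)"
proof -
  interpret M: module k "HM (deg f) (src f) (trg f)" using HM_mod assms(1) .
  show ?thesis using M.minus_eq_zero[of f g] assms neg_eq[of g] by (simp add: HM_simps a_minus_def)
qed

lemma add_eq_swap:
  assumes "ar f" "ar g" "src g = src f" "trg g = trg f" "deg g = deg f"
    "ar h" "src h = src f" "trg h = trg f" "deg h = deg f"
  shows "f +++ g = h <-> f = h +++ neg g"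
proof -
  interpret M: module k "HM (deg f) (src f) (trg f)" using HM_mod assms(1) .
  show ?thesis using M.M.add.inv_solve_right[of f h g] assms neg_eq[of g] by (auto simp add: HM_simps)
qed

lemma cmp_zer [simp]:
  assumes "ar g" "src g = Y" "X \<in> Ob" "deg g + d \<le> D"
  shows "g ** zer d X Y = zer (deg g + d) X (trg g)"
proof -
  let ?z = "zer d X Y"
  have t: "ar ?z" "src ?z = X" "trg ?z = Y" "deg ?z = d" using assms by auto
  have "g ** ?z = g ** ?z +++ g ** ?z" using cmp_add_right[of ?z ?z g] t assms by simp
  hence "g ** ?z = g ** ?z +++ neg (g ** ?z)" using add_eq_swap[of "g ** ?z" "g ** ?z" "g ** ?z"] t assms by simp
  thus ?thesis using t assms by simp
qed

end

context gcat begin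

lemma zer_cmp [simp]:
  assumes "ar f" "trg f = X" "Y \<in> Ob" "d + deg f \<le> D"
  shows "zer d X Y ** f = zer (d + deg f) (src f) Y"
proof -
  have "zer d X Y ** f = zer (deg f + d) (src f) Y" using gcat.cmp_zer[OF op_gcat, of f X Y d] assms by (simp add: add.commute)
  thus ?thesis by (simp add: add.commute)
qed

lemma cmp_neg:
  assumes "ar f" "ar g" "src g = trg f" "deg g + deg f \<le> D"
  shows "g ** neg f = neg (g ** f)" "neg g ** f = neg (g ** f)"
  unfolding neg_def using assms m1_closed by (simp_all add: cmp_scl_left cmp_scl_right)

lemma add_lcomm:
  assumes "ar f" "ar g" "src g = src f" "trg g = trg f" "deg g = deg f"
    "ar h" "src h = src f" "trg h = trg f" "deg h = deg f"
  shows "f +++ (g +++ h) = g +++ (f +++ h)" using assms add_assoc[of f g h] add_assoc[of g f h] add_comm[of f g] by simp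

lemmas dist = cmp_add_right cmp_add_left cmp_neg cmp_scl_left cmp_scl_right

abbreviation hm :: "'a => 'o => 'o => bool" where
  "hm f X Y \<equiv> ar f & deg f = 0 & src f = X & trg f = Y"

text \<open>The simplifier nests composites to the right, where a known equation for
  \<open>a ** b\<close> no longer matches inside \<open>a ** (b ** z)\<close>; this lemma supplies
  the matching form.\<close>

lemma pre_cancel: "[| a ** b = c; ar a; ar b; ar z; src b = trg z; src a = trg b; deg a + deg b + deg z \<le> D |] ==> a ** (b ** z) = c ** z"
  using assoc[of z b a] by simp

text \<open>Cancellation is tested at zero and against arrows of degree zero;
  \<open>mono_cancel\<close> recovers the usual form.\<close>

definition mono :: "'a => bool" where
  "mono i <-> ar i & deg i = 0 & (\<forall>u. ar u & deg u = 0 & trg u = src i &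
     i ** u = zer 0 (src u) (trg i) --> u = zer 0 (src u) (src i))"

definition epi :: "'a => bool" where
  "epi p <-> ar p & deg p = 0 & (\<forall>u. ar u & deg u = 0 & src u = trg p &
     u ** p = zer 0 (src p) (trg u) --> u = zer 0 (trg p) (trg u))"

definition ker :: "'a => 'a => bool" where
  "ker f i <-> mono i & trg i = src f & f ** i = zer 0 (src i) (trg f) &
     (\<forall>g. ar g & deg g = 0 & trg g = src f & f ** g = zer 0 (src g) (trg f) -->
       (\<exists>h. hm h (src g) (src i) & i ** h = g))"

definition coker :: "'a => 'a => bool" where
  "coker f p <-> epi p & src p = trg f & p ** f = zer 0 (src f) (trg p) &
     (\<forall>g. ar g & deg g = 0 & src g = trg f & g ** f = zer 0 (src f) (trg g) -->
       (\<exists>h. hm h (trg p) (trg g) & h ** p = g))"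

definition inv_pair :: "'a => 'a => bool" where
  "inv_pair f g <-> hm f (src f) (trg f) & hm g (trg f) (src f) & g ** f = ide (src f) & f ** g = ide (trg f)"

definition bip :: "'a => 'a => 'a => 'a => bool" where
  "bip i1 i2 p1 p2 <-> hm i1 (src i1) (trg i1) & hm i2 (src i2) (trg i1) & hm p1 (trg i1) (src i1) &
     hm p2 (trg i1) (src i2) & p1 ** i1 = ide (src i1) & p2 ** i2 = ide (src i2) &
     p2 ** i1 = zer 0 (src i1) (src i2) & p1 ** i2 = zer 0 (src i2) (src i1) &
     i1 ** p1 +++ i2 ** p2 = ide (trg i1)"

lemma op_mono: "gcat.mono ar trg src deg (%g f. f ** g) (%d X Y. zer d Y X) = epi"
  unfolding fun_eq_iff gcat.mono_def[OF op_gcat] epi_def by blast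

lemma op_epi: "gcat.epi ar trg src deg (%g f. f ** g) (%d X Y. zer d Y X) = mono"
  unfolding fun_eq_iff gcat.epi_def[OF op_gcat] mono_def by blast

lemma op_ker: "gcat.ker ar trg src deg (%g f. f ** g) (%d X Y. zer d Y X) = coker"
  unfolding fun_eq_iff gcat.ker_def[OF op_gcat] op_mono coker_def by blast

lemma op_coker: "gcat.coker ar trg src deg (%g f. f ** g) (%d X Y. zer d Y X) = ker"
  unfolding fun_eq_iff gcat.coker_def[OF op_gcat] op_epi ker_def by blast

lemma op_bip: "gcat.bip ar trg src deg ide (%g f. f ** g) pls (%d X Y. zer d Y X) i1 i2 p1 p2 = bip p1 p2 i1 i2"
  unfolding gcat.bip_def[OF op_gcat] bip_def by auto

lemma op_inv_pair: "gcat.inv_pair ar trg src deg ide (%g f. f ** g) f g = inv_pair f g"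
  unfolding gcat.inv_pair_def[OF op_gcat] inv_pair_def by auto

lemmas op_simps = op_mono op_epi op_ker op_coker op_bip op_inv_pair op_hom_mod

lemma monoD:
  assumes "mono i"
  shows "ar i" "deg i = 0" "!!u. [| ar u; deg u = 0; trg u = src i; i ** u = zer 0 (src u) (trg i) |] ==> u = zer 0 (src u) (src i)"
  using assms unfolding mono_def by auto

lemma epiD:
  assumes "epi p"
  shows "ar p" "deg p = 0" "!!u. [| ar u; deg u = 0; src u = trg p; u ** p = zer 0 (src p) (trg u) |] ==> u = zer 0 (trg p) (trg u)"
  using assms unfolding epi_def by auto

lemma mono_cancel:
  assumes "mono i" "ar u" "ar v" "deg u = 0" "deg v = 0" "trg u = src i" "trg v = src i" "src v = src u" "i ** u = i ** v"
  shows "u = v"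
proof -
  note i = monoD[OF assms(1)]
  have "i ** (u +++ neg v) = zer 0 (src u) (trg i)" using assms i by (simp add: dist)
  hence "u +++ neg v = zer 0 (src u) (src i)" using i(3)[of "u +++ neg v"] assms by simp
  thus ?thesis using eq_iff_diff[of u v] assms by simp
qed

lemma epi_cancel:
  assumes "epi p" "ar u" "ar v" "deg u = 0" "deg v = 0" "src u = trg p" "src v = trg p" "trg v = trg u" "u ** p = v ** p"
  shows "u = v" using gcat.mono_cancel[OF op_gcat, unfolded op_simps, of p u v] assms by simp

lemma monoI:
  assumes "ar i" "deg i = 0" "!!u. [| ar u; deg u = 0; trg u = src i; i ** u = zer 0 (src u) (trg i) |] ==> u = zer 0 (src u) (src i)"
  shows "mono i" using assms unfolding mono_def by auto

lemma kerD:
  assumes "ker f i"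
  shows "mono i" "ar i" "deg i = 0" "trg i = src f" "f ** i = zer 0 (src i) (trg f)"
   "!!g. [| ar g; deg g = 0; trg g = src f; f ** g = zer 0 (src g) (trg f) |] ==> \<exists>h. hm h (src g) (src i) & i ** h = g"
  using assms monoD unfolding ker_def by blast+

lemma cokerD:
  assumes "coker f p"
  shows "epi p" "ar p" "deg p = 0" "src p = trg f" "p ** f = zer 0 (src f) (trg p)"
   "!!g. [| ar g; deg g = 0; src g = trg f; g ** f = zer 0 (src f) (trg g) |] ==> \<exists>h. hm h (trg p) (trg g) & h ** p = g"
  using assms epiD unfolding coker_def by blast+

lemma bipD:
  assumes "bip i1 i2 p1 p2"
  shows "ar i1" "ar i2" "ar p1" "ar p2" "deg i1 = 0" "deg i2 = 0" "deg p1 = 0" "deg p2 = 0"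
    "trg i2 = trg i1" "src p1 = trg i1" "src p2 = trg i1" "trg p1 = src i1" "trg p2 = src i2"
    "p1 ** i1 = ide (src i1)" "p2 ** i2 = ide (src i2)"
    "p2 ** i1 = zer 0 (src i1) (src i2)" "p1 ** i2 = zer 0 (src i2) (src i1)"
    "i1 ** p1 +++ i2 ** p2 = ide (trg i1)"
    "!!z. [| ar z; trg z = src i1 |] ==> p1 ** (i1 ** z) = z"
    "!!z. [| ar z; trg z = src i2 |] ==> p2 ** (i2 ** z) = z"
    "!!z. [| ar z; trg z = src i1 |] ==> p2 ** (i1 ** z) = zer (deg z) (src z) (src i2)"
    "!!z. [| ar z; trg z = src i2 |] ==> p1 ** (i2 ** z) = zer (deg z) (src z) (src i1)"
proof -
  note a = assms[unfolded bip_def]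
  show "ar i1" "ar i2" "ar p1" "ar p2" "deg i1 = 0" "deg i2 = 0" "deg p1 = 0" "deg p2 = 0"
    "trg i2 = trg i1" "src p1 = trg i1" "src p2 = trg i1" "trg p1 = src i1" "trg p2 = src i2"
    "p1 ** i1 = ide (src i1)" "p2 ** i2 = ide (src i2)"
    "p2 ** i1 = zer 0 (src i1) (src i2)" "p1 ** i2 = zer 0 (src i2) (src i1)"
    "i1 ** p1 +++ i2 ** p2 = ide (trg i1)" using a by auto
  show "p1 ** (i1 ** z) = z" "p2 ** (i1 ** z) = zer (deg z) (src z) (src i2)" if "ar z" "trg z = src i1" for z
    using a that by (simp_all add: pre_cancel[of p1 i1 "ide (src i1)" z] pre_cancel[of p2 i1 "zer 0 (src i1) (src i2)" z])
  show "p2 ** (i2 ** z) = z" "p1 ** (i2 ** z) = zer (deg z) (src z) (src i1)" if "ar z" "trg z = src i2" for z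
    using a that by (simp_all add: pre_cancel[of p2 i2 "ide (src i2)" z] pre_cancel[of p1 i2 "zer 0 (src i2) (src i1)" z])
qed

lemma bip_decomp:
  assumes "bip i1 i2 p1 p2" "ar z" "trg z = trg i1"
  shows "z = i1 ** (p1 ** z) +++ i2 ** (p2 ** z)"
proof -
  note b = bipD[OF assms(1)]
  have "z = (i1 ** p1 +++ i2 ** p2) ** z" using b assms by simp
  also have "\<dots> = i1 ** (p1 ** z) +++ i2 ** (p2 ** z)" using b(1-13) assms(2,3) by (simp add: dist)
  finally show ?thesis .
qed

lemma bip_eqI:
  assumes "bip i1 i2 p1 p2" "ar z" "trg z = trg i1" "ar w" "trg w = trg i1"
    "p1 ** z = p1 ** w" "p2 ** z = p2 ** w"
  shows "z = w" using bip_decomp[OF assms(1,2,3)] bip_decomp[OF assms(1,4,5)] assms by simp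

lemma inv_pairD:
  assumes "inv_pair f g"
  shows "ar f" "ar g" "deg f = 0" "deg g = 0" "src g = trg f" "trg g = src f" "g ** f = ide (src f)" "f ** g = ide (trg f)"
   "!!z. [| ar z; trg z = src f |] ==> g ** (f ** z) = z" "!!z. [| ar z; trg z = trg f |] ==> f ** (g ** z) = z"
proof -
  note a = assms[unfolded inv_pair_def]
  show "ar f" "ar g" "deg f = 0" "deg g = 0" "src g = trg f" "trg g = src f" "g ** f = ide (src f)" "f ** g = ide (trg f)" using a by auto
  show "g ** (f ** z) = z" if "ar z" "trg z = src f" for z using a that by (simp add: pre_cancel[of g f "ide (src f)" z])
  show "f ** (g ** z) = z" if "ar z" "trg z = trg f" for z using a that by (simp add: pre_cancel[of f g "ide (trg f)" z])
qed

lemma inv_pair_sym: "inv_pair f g ==> inv_pair g f" unfolding inv_pair_def by auto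

end

section \<open>Abelian categories: short exact sequences, pushouts and pullbacks\<close>

locale abgcat = gcat +
  assumes zero_ob: "\<exists>Z\<in>Ob. \<forall>f. ar f & deg f = 0 & (src f = Z \<or> trg f = Z) --> f = zer 0 (src f) (trg f)"
    and bip_ex: "[| X \<in> Ob; Y \<in> Ob |] ==> \<exists>i1 i2 p1 p2. bip i1 i2 p1 p2 & src i1 = X & src i2 = Y"
    and ker_ex: "[| ar f; deg f = 0 |] ==> \<exists>i. ker f i"
    and coker_ex: "[| ar f; deg f = 0 |] ==> \<exists>p. coker f p"
    and mono_ker: "mono i ==> \<exists>f. ar f & deg f = 0 & ker f i"
    and epi_coker: "epi p ==> \<exists>f. ar f & deg f = 0 & coker f p"
begin

lemma op_abgcat: "abgcat k D Ob ar trg src deg ide (%g f. f ** g) pls (%d X Y. zer d Y X) scl"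
proof (rule abgcat.intro[OF op_gcat], unfold abgcat_axioms_def op_simps, intro conjI allI impI)
  show "\<exists>Z\<in>Ob. \<forall>f. ar f & deg f = 0 & (trg f = Z \<or> src f = Z) --> f = zer 0 (src f) (trg f)" using zero_ob by blast
  fix X Y assume "X \<in> Ob" "Y \<in> Ob"
  then obtain i1 i2 p1 p2 where "bip i1 i2 p1 p2" "src i1 = X" "src i2 = Y" using bip_ex by blast
  thus "\<exists>i1 i2 p1 p2. bip p1 p2 i1 i2 & trg i1 = X & trg i2 = Y" using bipD(12,13) by blast
qed (use ker_ex coker_ex mono_ker epi_coker in auto)

text \<open>The arrow \<open>f\<close> whose kernel is \<open>i\<close> factors through the cokernel
  \<open>p\<close>, so whatever \<open>p\<close> kills is killed by \<open>f\<close>.\<close>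

lemma mono_ker_coker:
  assumes i: "mono i" and p: "coker i p"
  shows "ker p i"
proof -
  obtain f where f: "ar f" "deg f = 0" "ker f i" using mono_ker[OF i] by blast
  note fi = kerD[OF f(3)] and p' = cokerD[OF p]
  obtain h where h: "hm h (trg p) (trg f)" "h ** p = f" using p'(6)[of f] f fi by auto
  show ?thesis unfolding ker_def
  proof (intro conjI allI impI i)
    fix g assume g: "ar g & deg g = 0 & trg g = src p & p ** g = zer 0 (src g) (trg p)"
    have "f ** g = h ** (p ** g)" unfolding h(2)[symmetric] using h(1) g p' by simp
    also have "\<dots> = zer 0 (src g) (trg f)" using g h(1) p' by simp
    finally show "\<exists>h. hm h (src g) (src i) & i ** h = g" using fi(6)[of g] g p'(4) fi(4) by auto
  qed (use p' in auto)
qed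

lemma epi_coker_ker:
  assumes "epi p" "ker p i"
  shows "coker i p" using abgcat.mono_ker_coker[OF op_abgcat, unfolded op_simps, OF assms] .

text \<open>If \<open>h\<close> is a kernel of \<open>f\<close> and an epimorphism, then
  \<open>f = 0\<close>, so the identity factors through \<open>h\<close>.\<close>

lemma mono_epi_iso:
  assumes h: "mono h" "epi h"
  shows "\<exists>r. inv_pair h r"
proof -
  obtain f where f: "ar f" "deg f = 0" "ker f h" using mono_ker[OF h(1)] by blast
  note k = kerD[OF f(3)]
  have "f = zer 0 (trg h) (trg f)" using epiD(3)[OF h(2), of f] f k by auto
  hence "f ** ide (trg h) = zer 0 (trg h) (trg f)" using f k by simp
  then obtain r where r: "hm r (trg h) (src h)" "h ** r = ide (trg h)" using k(6)[of "ide (trg h)"] k f(1,2) by auto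
  have "r ** h = ide (src h)" by (rule mono_cancel[OF h(1)]) (use k r pre_cancel[of h r "ide (trg h)" h] in auto)
  thus ?thesis unfolding inv_pair_def using r k by auto
qed

definition sexact :: "'c \<times> 'c => bool" where
  "sexact s <-> ker (snd s) (fst s) & coker (fst s) (snd s)"

text \<open>The middle arrow is quantified away because Yoneda classes see only the outer
  components; with two identities this is the equivalence of extensions.\<close>

definition mor :: "'c \<times> 'c => 'c \<times> 'c => 'c => 'c => bool" where
  "mor s s' g f <-> sexact s & sexact s' & hm g (src (fst s)) (src (fst s')) & hm f (trg (snd s)) (trg (snd s')) &
     (\<exists>h. hm h (trg (fst s)) (trg (fst s')) & h ** fst s = fst s' ** g & snd s' ** h = f ** snd s)"

abbreviation sub :: "'c \<times> 'c => 'b" where "sub s \<equiv> src (fst s)"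
abbreviation quo :: "'c \<times> 'c => 'b" where "quo s \<equiv> trg (snd s)"

definition split :: "'c \<times> 'c => bool" where
  "split s <-> sexact s & (\<exists>\<sigma>. hm \<sigma> (trg (snd s)) (src (snd s)) & snd s ** \<sigma> = ide (trg (snd s)))"

lemma sexactI: "mono i ==> coker i p ==> sexact (i, p)" unfolding sexact_def using mono_ker_coker by simp

lemma sexactI': "epi p ==> ker p i ==> sexact (i, p)" unfolding sexact_def using epi_coker_ker by simp

lemma sexactD:
  assumes "sexact (i, p)"
  shows "ar i" "ar p" "deg i = 0" "deg p = 0" "src p = trg i" "mono i" "epi p" "p ** i = zer 0 (src i) (trg p)"
    "!!g. [| ar g; deg g = 0; trg g = trg i; p ** g = zer 0 (src g) (trg p) |] ==> \<exists>h. hm h (src g) (src i) & i ** h = g"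
    "!!g. [| ar g; deg g = 0; src g = trg i; g ** i = zer 0 (src i) (trg g) |] ==> \<exists>h. hm h (trg p) (trg g) & h ** p = g"
    "!!z. [| ar z; trg z = src i |] ==> p ** (i ** z) = zer (deg z) (src z) (trg p)"
proof -
  have k: "ker p i" and c: "coker i p" using assms unfolding sexact_def by auto
  note k' = kerD[OF k] and c' = cokerD[OF c]
  show a: "ar i" "ar p" "deg i = 0" "deg p = 0" "src p = trg i" "mono i" "epi p" "p ** i = zer 0 (src i) (trg p)" using k' c' by auto
  show "\<exists>h. hm h (src g) (src i) & i ** h = g" if "ar g" "deg g = 0" "trg g = trg i" "p ** g = zer 0 (src g) (trg p)" for g
    using k'(6)[of g] that a by simp
  show "\<exists>h. hm h (trg p) (trg g) & h ** p = g" if "ar g" "deg g = 0" "src g = trg i" "g ** i = zer 0 (src i) (trg g)" for g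
    using c'(6)[of g] that a by simp
  show "p ** (i ** z) = zer (deg z) (src z) (trg p)" if "ar z" "trg z = src i" for z using that a(1-5) pre_cancel[OF a(8), of z] by simp
qed

lemma morI:
  assumes "sexact (i, p)" "sexact (i', p')" "hm g (src i) (src i')" "hm f (trg p) (trg p')"
    "hm h (trg i) (trg i')" "h ** i = i' ** g" "p' ** h = f ** p"
  shows "mor (i, p) (i', p') g f" using assms unfolding mor_def by auto

lemma morE:
  assumes "mor (i, p) (i', p') g f"
  obtains h where "sexact (i, p)" "sexact (i', p')" "ar g" "deg g = 0" "src g = src i" "trg g = src i'"
    "ar f" "deg f = 0" "src f = trg p" "trg f = trg p'" "ar h" "deg h = 0" "src h = trg i" "trg h = trg i'"
    "h ** i = i' ** g" "p' ** h = f ** p" using assms unfolding mor_def by auto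

lemma morD:
  assumes "mor s s' g f"
  shows "sexact s" "sexact s'" "ar g" "deg g = 0" "src g = sub s" "trg g = sub s'" "ar f" "deg f = 0" "src f = quo s" "trg f = quo s'"
  using assms unfolding mor_def by auto

lemma ses_ob:
  assumes "sexact s"
  shows "sub s \<in> Ob" "quo s \<in> Ob" using assms sexactD(1,2)[of "fst s" "snd s"] by auto

text \<open>In the opposite category a sequence is read backwards, hence \<open>prod.swap\<close>.
  Morphisms change direction and exchange their outer components (\<open>op_mor\<close>), so
  pushouts become pullbacks.\<close>

lemma op_sexact: "abgcat.sexact ar trg src deg (%g f. f ** g) (%d X Y. zer d Y X) (prod.swap s) = sexact s"
  unfolding abgcat.sexact_def[OF op_abgcat] op_simps sexact_def by auto

lemma op_mor: "abgcat.mor ar trg src deg (%g f. f ** g) (%d X Y. zer d Y X) (prod.swap s') (prod.swap s) f g = mor s s' g f"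
proof (cases "sexact s & sexact s'")
  case True
  note a = sexactD[of "fst s" "snd s", simplified] sexactD[of "fst s'" "snd s'", simplified]
  show ?thesis
    unfolding abgcat.mor_def[OF op_abgcat] op_sexact mor_def using True a(5)[OF conjunct1[OF True]] sexactD(5)[of "fst s'" "snd s'"] by auto
next
  case False
  thus ?thesis unfolding abgcat.mor_def[OF op_abgcat] op_sexact mor_def by auto
qed

lemma mor_comp:
  assumes "mor s s' g f" "mor s' s'' g' f'"
  shows "mor s s'' (g' ** g) (f' ** f)"
proof -
  obtain i p where s: "s = (i, p)" by (cases s)
  obtain i' p' where s': "s' = (i', p')" by (cases s')
  obtain i'' p'' where s'': "s'' = (i'', p'')" by (cases s'')
  obtain h where h: "sexact (i, p)" "sexact (i', p')" "ar g" "deg g = 0" "src g = src i" "trg g = src i'"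
    "ar f" "deg f = 0" "src f = trg p" "trg f = trg p'" "ar h" "deg h = 0" "src h = trg i" "trg h = trg i'"
    "h ** i = i' ** g" "p' ** h = f ** p" using assms(1) unfolding s s' by (rule morE)
  obtain h' where h': "sexact (i', p')" "sexact (i'', p'')" "ar g'" "deg g' = 0" "src g' = src i'" "trg g' = src i''"
    "ar f'" "deg f' = 0" "src f' = trg p'" "trg f' = trg p''" "ar h'" "deg h' = 0" "src h' = trg i'" "trg h' = trg i''"
    "h' ** i' = i'' ** g'" "p'' ** h' = f' ** p'" using assms(2) unfolding s' s'' by (rule morE)
  note a = sexactD(1-5)[OF h(1)] sexactD(1-5)[OF h(2)] sexactD(1-5)[OF h'(2)]
  show ?thesis unfolding s s''
  proof (rule morI[OF h(1) h'(2), where h="h' ** h"])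
    have "(h' ** h) ** i = h' ** (i' ** g)" using a h(3-16) h'(3-14) by simp
    also have "\<dots> = (h' ** i') ** g" using a h(3-14) h'(3-14) by simp
    also have "\<dots> = i'' ** (g' ** g)" unfolding h'(15) using a h(3-14) h'(3-14) by simp
    finally show "(h' ** h) ** i = i'' ** (g' ** g)" .
    have "p'' ** (h' ** h) = (p'' ** h') ** h" using a h(3-14) h'(3-14) by simp
    also have "\<dots> = f' ** (p' ** h)" unfolding h'(16) using a h(3-14) h'(3-14) by simp
    also have "\<dots> = (f' ** f) ** p" unfolding h(16) using a h(3-14) h'(3-14) by simp
    finally show "p'' ** (h' ** h) = (f' ** f) ** p" .
  qed (use a h(3-14) h'(3-14) in auto)
qed

lemma mor_ide:
  assumes "sexact s"
  shows "mor s s (ide (sub s)) (ide (quo s))"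
proof -
  obtain i p where s: "s = (i, p)" by (cases s)
  note a = sexactD(1-5)[OF assms[unfolded s]]
  show ?thesis unfolding s by (rule morI[where h="ide (trg i)"]) (use assms s a in auto)
qed

lemma five_lemma:
  assumes h: "sexact (i, p)" "sexact (i', p')" "src i' = src i" "trg p' = trg p" "hm h (trg i) (trg i')" "h ** i = i'" "p' ** h = p"
  shows "\<exists>r. inv_pair h r"
proof (rule mono_epi_iso)
  note a = sexactD[OF h(1)] and a' = sexactD[OF h(2)]
  show "mono h"
  proof (rule monoI)
    fix u assume u: "ar u" "deg u = 0" "trg u = src h" "h ** u = zer 0 (src u) (trg h)"
    have "p ** u = zer 0 (src u) (trg p)" unfolding h(7)[symmetric] using u h(5) a(1-5) a'(1-5) h(4) by simp
    then obtain v where v: "hm v (src u) (src i)" "i ** v = u" using a(9)[of u] u h(5) by auto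
    have "i' ** v = zer 0 (src u) (trg i')" unfolding h(6)[symmetric] using u h(5) v a(1-5) by simp
    hence "v = zer 0 (src v) (src i)" using monoD(3)[OF a'(6), of v] v h(3) by simp
    thus "u = zer 0 (src u) (src h)" using v a(1-5) h(5) by (metis add.right_neutral cmp_zer deg_le zer_closed(1) src_ob)
  qed (use h in auto)
  show "epi h" unfolding epi_def
  proof (intro conjI allI impI)
    fix u assume u: "ar u & deg u = 0 & src u = trg h & u ** h = zer 0 (src h) (trg u)"
    have "u ** i' = zer 0 (src i') (trg u)" unfolding h(6)[symmetric] using u h(5) a(1-5) a'(1-5) h(3) pre_cancel[of u h _ i] by simp
    then obtain v where v: "hm v (trg p) (trg u)" "v ** p' = u" using a'(10)[of u] u h(4,5) by auto
    have "v ** p = zer 0 (src p) (trg u)" unfolding h(7)[symmetric] using u h(4,5) v a(1-5) a'(1-5) pre_cancel[of v p' u h] by simp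
    hence "v = zer 0 (trg p) (trg v)" using epiD(3)[OF a(7), of v] v by simp
    thus "u = zer 0 (trg h) (trg u)" using v a'(1-5) h(4,5) by (metis add.right_neutral deg_le zer_cmp trg_ob)
  qed (use h in auto)
qed

text \<open>By the five lemma the middle arrow of an equivalence is invertible, and its inverse is
  the middle arrow in the other direction.\<close>

lemma mor_sym:
  assumes m: "mor s s' (ide (sub s)) (ide (quo s))"
  shows "mor s' s (ide (sub s)) (ide (quo s))"
proof -
  obtain i p where s: "s = (i, p)" by (cases s)
  obtain i' p' where s': "s' = (i', p')" by (cases s')
  obtain h where h: "sexact (i, p)" "sexact (i', p')" "ar (ide (src i))" "deg (ide (src i)) = 0" "src (ide (src i)) = src i" "trg (ide (src i)) = src i'"
    "ar (ide (trg p))" "deg (ide (trg p)) = 0" "src (ide (trg p)) = trg p" "trg (ide (trg p)) = trg p'" "ar h" "deg h = 0" "src h = trg i" "trg h = trg i'"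
    "h ** i = i' ** ide (src i)" "p' ** h = ide (trg p) ** p" using m unfolding s s' fst_conv snd_conv by (rule morE)
  note a = sexactD[OF h(1)] and a' = sexactD[OF h(2)]
  have e: "src i' = src i" "trg p' = trg p" using h(6,10) a(1,2) by simp_all
  have X: "h ** i = i'" "p' ** h = p" using h(15,16) e a(1-5) a'(1-5) by simp_all
  obtain r where "inv_pair h r" using five_lemma[OF h(1,2) e _ X] h(11-14) by blast
  note r = inv_pairD[OF this]
  show ?thesis unfolding s s' fst_conv snd_conv
  proof (rule morI[OF h(2,1), where h=r])
    show "r ** i' = i ** ide (src i)" unfolding X(1)[symmetric] using r(9)[of i] h(11-14) a(1-5) by simp
    have "p ** r = p'" unfolding X(2)[symmetric] using r(1-8) h(11-14) a'(1-5) by simp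
    thus "p ** r = ide (trg p) ** p'" using a'(1-5) e by simp
  qed (use h(11-14) r(1-6) e a(1,2) in auto)
qed

text \<open>The pushout of a short exact sequence along \<open>g\<close> is the cokernel of \<open>(i, - g)\<close>.\<close>

lemma push_ex_aux:
  assumes s: "sexact (i, p)" and g: "hm g (src i) Y"
  shows "\<exists>i1 p1. src i1 = Y & trg p1 = trg p & mor (i, p) (i1, p1) g (ide (trg p)) &
    (\<forall>i' p' f. mor (i, p) (i', p') g f --> mor (i1, p1) (i', p') (ide Y) f)"
proof -
  note a = sexactD[OF s]
  have YO: "Y \<in> Ob" using g trg_ob by blast
  obtain e1 e2 q1 q2 where b: "bip e1 e2 q1 q2" "src e1 = trg i" "src e2 = Y" using bip_ex[of "trg i" Y] a(1) g by auto
  note b' = bipD[OF b(1), unfolded b(2,3)]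
  define m where "m = e1 ** i +++ neg (e2 ** g)"
  have mt: "ar m" "deg m = 0" "src m = src i" "trg m = trg e1" unfolding m_def using a(1-5) b(2,3) b'(1-13) g by auto
  have qm: "q1 ** m = i" "q2 ** m = neg g" unfolding m_def using a(1-5) b(2,3) b' g by (simp_all add: dist)
  have mono_m: "mono m"
  proof (rule monoI[OF mt(1,2)])
    fix u assume u: "ar u" "deg u = 0" "trg u = src m" "m ** u = zer 0 (src u) (trg m)"
    have "i ** u = q1 ** (m ** u)" unfolding qm(1)[symmetric] using u(1-3) mt b'(1-13) by simp
    also have "\<dots> = zer 0 (src u) (trg i)" unfolding u(4) using u(1-3) mt b(2) b'(1-13) by simp
    finally show "u = zer 0 (src u) (src m)" using monoD(3)[OF a(6), of u] u(1-3) mt by simp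
  qed
  obtain \<pi> where pi: "coker m \<pi>" using coker_ex mt by blast
  note pi' = cokerD[OF pi]
  have km: "sexact (m, \<pi>)" by (rule sexactI[OF mono_m pi])
  note S = sexactD[OF km]
  define h where "h = \<pi> ** e1"
  define i1 where "i1 = \<pi> ** e2"
  have t: "ar h" "deg h = 0" "src h = trg i" "trg h = trg \<pi>" "ar i1" "deg i1 = 0" "src i1 = Y" "trg i1 = trg \<pi>"
    unfolding h_def i1_def using b(2,3) b'(1-13) pi'(1-4) mt by auto
  have hi: "h ** i = i1 ** g"
  proof -
    have "\<pi> ** m = h ** i +++ neg (i1 ** g)" unfolding m_def h_def i1_def using a(1-5) b(2,3) b'(1-13) pi'(1-4) mt g by (simp add: dist)
    hence "h ** i +++ neg (i1 ** g) = zer 0 (src i) (trg \<pi>)" using pi'(5) mt by simp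
    thus ?thesis using eq_iff_diff[of "h ** i" "i1 ** g"] t a(1-5) g by simp
  qed
  \<comment> \<open>The universal property of the pushout with legs \<open>h\<close> and
    \<open>i1\<close>; \<open>joint\<close> is its uniqueness half.\<close>
  have desc: "\<exists>w. hm w (trg \<pi>) (trg u) & w ** h = u & w ** i1 = v & w ** \<pi> = u ** q1 +++ v ** q2"
    if uv: "ar u" "deg u = 0" "src u = trg i" "hm v Y (trg u)" "u ** i = v ** g" for u v
  proof -
    have ut: "ar (u ** q1 +++ v ** q2)" "deg (u ** q1 +++ v ** q2) = 0" "src (u ** q1 +++ v ** q2) = trg m" "trg (u ** q1 +++ v ** q2) = trg u"
      using uv(1-4) b(2,3) b'(1-13) mt by auto
    have "(u ** q1 +++ v ** q2) ** m = u ** i +++ v ** neg g" using uv(1-4) b(2,3) b'(1-13) mt qm by (simp add: cmp_add_left)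
    also have "\<dots> = zer 0 (src m) (trg u)" unfolding uv(5) using uv(1-4) g mt by (simp add: dist)
    finally obtain w where w: "hm w (trg \<pi>) (trg u)" "w ** \<pi> = u ** q1 +++ v ** q2" using pi'(6)[OF ut(1-3)] ut(4) by auto
    have "w ** h = (w ** \<pi>) ** e1" "w ** i1 = (w ** \<pi>) ** e2"
      unfolding h_def i1_def using w(1) b(2,3) b'(1-13) mt pi'(1-4) by simp_all
    moreover have "(w ** \<pi>) ** e1 = u" "(w ** \<pi>) ** e2 = v"
      unfolding w(2) using uv(1-4) a(1) b(2,3) b' YO by (simp_all add: cmp_add_left)
    ultimately show ?thesis using w by auto
  qed
  have joint: "w = w'" if "hm w (trg \<pi>) Z" "hm w' (trg \<pi>) Z" "w ** h = w' ** h" "w ** i1 = w' ** i1" for w w' Z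
  proof (rule epi_cancel[OF pi'(1)])
    have d: "x ** \<pi> = (x ** h) ** q1 +++ (x ** i1) ** q2" if x: "hm x (trg \<pi>) Z" for x
    proof -
      have "x ** \<pi> = (x ** \<pi>) ** (e1 ** q1 +++ e2 ** q2)" using b'(18) x mt pi'(1-4) by simp
      thus ?thesis unfolding h_def i1_def using x b(2,3) b'(1-13) mt pi'(1-4) by (simp add: cmp_add_right)
    qed
    show "w ** \<pi> = w' ** \<pi>" unfolding d[OF that(1)] d[OF that(2)] that(3,4) ..
  qed (use that in auto)
  obtain p1 where p1: "hm p1 (trg \<pi>) (trg p)" "p1 ** h = p" "p1 ** i1 = zer 0 Y (trg p)"
    using desc[of p "zer 0 Y (trg p)"] a(1-5,8) g by auto
  have i1_mono: "mono i1"
  proof (rule monoI[OF t(5,6)])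
    fix u assume u: "ar u" "deg u = 0" "trg u = src i1" "i1 ** u = zer 0 (src u) (trg i1)"
    have "\<pi> ** (e2 ** u) = i1 ** u" unfolding i1_def using u(1-3) t(7) b(2,3) b'(1-13) mt pi'(1-4) by simp
    hence "\<pi> ** (e2 ** u) = zer 0 (src u) (trg \<pi>)" using u(4) t by simp
    then obtain v where v: "hm v (src u) (src i)" "m ** v = e2 ** u" using S(9)[of "e2 ** u"] u(1-3) t(7) b(2,3) b'(1-13) mt by auto
    have "i ** v = q1 ** (m ** v)" unfolding qm(1)[symmetric] using v(1) mt b'(1-13) by simp
    also have "\<dots> = zer 0 (src u) (trg i)" unfolding v(2) using u(1-3) t(7) b'(22)[of u] by simp
    finally have "v = zer 0 (src u) (src i)" using monoD(3)[OF a(6), of v] v(1) by simp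
    hence "e2 ** u = zer 0 (src u) (trg m)" using v(2) mt u(1) a(1) v(1) by (metis cmp_zer add.right_neutral deg_le src_ob)
    hence "q2 ** (e2 ** u) = zer 0 (src u) Y" using mt b(2,3) b'(1-13) u(1) by simp
    thus "u = zer 0 (src u) (src i1)" using b'(20)[of u] u(1-3) t(7) by simp
  qed
  have "coker i1 p1" unfolding coker_def
  proof (intro conjI allI impI)
    show "epi p1" unfolding epi_def
    proof (intro conjI allI impI)
      fix u assume u': "ar u & deg u = 0 & src u = trg p1 & u ** p1 = zer 0 (src p1) (trg u)"
      hence u: "ar u" "deg u = 0" "src u = trg p1" and uz: "u ** p1 = zer 0 (src p1) (trg u)" by auto
      have "u ** p = (u ** p1) ** h" unfolding p1(2)[symmetric] using u p1(1) t by simp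
      also have "\<dots> = zer 0 (src p) (trg u)" using u p1(1) t a(5) pre_cancel[OF uz, of h] by simp
      finally show "u = zer 0 (trg p1) (trg u)" using epiD(3)[OF a(7), of u] u p1(1) by simp
    qed (use p1 in auto)
    show "p1 ** i1 = zer 0 (src i1) (trg p1)" using p1 t by simp
    fix w assume "ar w & deg w = 0 & src w = trg i1 & w ** i1 = zer 0 (src i1) (trg w)"
    hence w: "ar w" "deg w = 0" "src w = trg i1" and wz: "w ** i1 = zer 0 (src i1) (trg w)" by auto
    have "(w ** h) ** i = (w ** i1) ** g" using w hi t a(1-5) g by simp
    also have "\<dots> = zer 0 (src i) (trg w)" using w t g pre_cancel[OF wz, of g] by simp
    finally obtain v where v: "hm v (trg p) (trg w)" "v ** p = w ** h" using a(10)[of "w ** h"] w t by auto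
    have "v ** p1 = w"
    proof (rule joint)
      show "hm (v ** p1) (trg \<pi>) (trg w)" "hm w (trg \<pi>) (trg w)" using v(1) w p1(1) t by simp_all
      show "(v ** p1) ** h = w ** h" using v w p1 t by simp
      show "(v ** p1) ** i1 = w ** i1" using v(1) w wz p1 t YO by simp
    qed
    thus "\<exists>h. hm h (trg p1) (trg w) & h ** p1 = w" using v p1 by auto
  qed (use p1 t in auto)
  hence s1: "sexact (i1, p1)" by (rule sexactI[OF i1_mono])
  have m1: "mor (i, p) (i1, p1) g (ide (trg p))" by (rule morI[OF s s1, where h=h]) (use g t p1 hi a(1-5) in auto)
  have "mor (i1, p1) (i', p') (ide Y) f" if mm: "mor (i, p) (i', p') g f" for i' p' f
  proof -
    obtain H where H: "sexact (i, p)" "sexact (i', p')" "ar g" "deg g = 0" "src g = src i" "trg g = src i'"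
    "ar f" "deg f = 0" "src f = trg p" "trg f = trg p'" "ar H" "deg H = 0" "src H = trg i" "trg H = trg i'"
    "H ** i = i' ** g" "p' ** H = f ** p" using mm by (rule morE)
    note a' = sexactD[OF H(2)]
    obtain w where w: "hm w (trg \<pi>) (trg H)" "w ** h = H" "w ** i1 = i'" using desc[of H i'] H(3-15) a'(1-5) g by auto
    have "p' ** w = f ** p1"
    proof (rule joint[of _ "trg p'"])
      have "(p' ** w) ** h = f ** p" using H(3-14,16) w a'(1-5) t by simp
      also have "\<dots> = (f ** p1) ** h" using H(3-14) p1 t by simp
      finally show "(p' ** w) ** h = (f ** p1) ** h" .
      show "(p' ** w) ** i1 = (f ** p1) ** i1" using H(3-14) w a'(1-5,8) t p1 g by simp
    qed (use H(3-14) w a'(1-5) p1 in auto)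
    thus ?thesis by (intro morI[OF s1 H(2), where h=w]) (use H(3-14) w t a'(1-5) p1 g in auto)
  qed
  thus ?thesis using m1 t p1 by blast
qed

lemma mor_eqv_trans_left:
  assumes "mor s s' g f" "mor s s1 (ide (sub s)) (ide (quo s))"
  shows "mor s1 s' g f" using mor_comp[OF mor_sym[OF assms(2)] assms(1)] morD[OF assms(1)] ses_ob[OF morD(1)[OF assms(1)]] by simp

lemma push_ex:
  assumes s: "sexact s" and g: "hm g (sub s) Y"
  obtains s1 where "mor s s1 g (ide (quo s))" using push_ex_aux[of "fst s" "snd s" g Y] assms by auto

text \<open>The factorisation is known for the pushout constructed in \<open>push_ex_aux\<close>;
  any other \<open>s1\<close> over the same \<open>g\<close> is equivalent to it.\<close>

lemma push_factor:
  assumes m: "mor s s' g f" and m1: "mor s s1 g (ide (quo s))"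
  shows "mor s1 s' (ide (trg g)) f"
proof -
  note t = morD[OF m] and t1 = morD[OF m1]
  obtain i0 p0 where q: "src i0 = trg g" "trg p0 = quo s"
    "!!i' p' f. mor (fst s, snd s) (i', p') g f ==> mor (i0, p0) (i', p') (ide (trg g)) f"
    using push_ex_aux[of "fst s" "snd s" g "trg g"] t by auto
  have "mor (i0, p0) s' (ide (trg g)) f" "mor (i0, p0) s1 (ide (trg g)) (ide (quo s))"
    using q(3)[of "fst s'" "snd s'" f] q(3)[of "fst s1" "snd s1" "ide (quo s)"] m m1 by simp_all
  thus ?thesis using mor_eqv_trans_left[of "(i0, p0)" s' "ide (trg g)" f s1] q(1,2) by simp
qed

lemma pull_ex:
  assumes s: "sexact s" and f: "hm f X (quo s)"
  obtains s1 where "mor s1 s (ide (sub s)) f"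
proof -
  obtain s1 where "abgcat.mor ar trg src deg (%g f. f ** g) (%d X Y. zer d Y X) (prod.swap s) s1 f (ide (sub s))"
    using abgcat.push_ex[OF op_abgcat, of "prod.swap s" f X] f op_sexact[of s] s by auto
  thus thesis using that[of "prod.swap s1"] op_mor[of s "prod.swap s1"] by simp
qed

lemma pull_factor:
  assumes m: "mor s s' g f" and m1: "mor s1 s' (ide (sub s')) f"
  shows "mor s s1 g (ide (src f))" using abgcat.push_factor[OF op_abgcat, of "prod.swap s'" "prod.swap s" f g "prod.swap s1"] assms
  unfolding op_mor by (simp add: op_mor)

end

section \<open>Split sequences, direct sums of sequences and the Baer sum\<close>

context abgcat begin

lemma split_bip:
  assumes "bip i1 i2 p1 p2"
  shows "split (i1, p2)"
proof -
  note b = bipD[OF assms]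
  have m: "mono i1"
  proof (rule monoI)
    fix u assume u: "ar u" "deg u = 0" "trg u = src i1" "i1 ** u = zer 0 (src u) (trg i1)"
    have "u = p1 ** (i1 ** u)" using b u(1-3) by simp
    also have "\<dots> = zer 0 (src u) (src i1)" unfolding u(4) using b(1-13) u(1) by simp
    finally show "u = zer 0 (src u) (src i1)" .
  qed (use b in auto)
  have "epi p2" unfolding epi_def
  proof (intro conjI allI impI)
    fix u assume "ar u & deg u = 0 & src u = trg p2 & u ** p2 = zer 0 (src p2) (trg u)"
    hence u: "ar u" "deg u = 0" "src u = trg p2" "u ** p2 = zer 0 (src p2) (trg u)" by auto
    have "u = u ** (p2 ** i2)" using b(1-13,15) u(1-3) by simp
    also have "\<dots> = zer 0 (src p2) (trg u) ** i2" unfolding u(4)[symmetric] using b(1-13) u(1-3) by simp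
    also have "\<dots> = zer 0 (trg p2) (trg u)" using b(1-13) u(1) by simp
    finally show "u = zer 0 (trg p2) (trg u)" .
  qed (use b in auto)
  moreover have "ker p2 i1" unfolding ker_def
  proof (intro conjI allI impI m)
    fix g assume "ar g & deg g = 0 & trg g = src p2 & p2 ** g = zer 0 (src g) (trg p2)"
    hence g: "ar g" "deg g = 0" "trg g = src p2" "p2 ** g = zer 0 (src g) (trg p2)" by auto
    have "g = i1 ** (p1 ** g) +++ i2 ** (p2 ** g)" using bip_decomp[OF assms, of g] g b(11) by simp
    also have "\<dots> = i1 ** (p1 ** g)" unfolding g(4) using b(1-13) g(1-3) by simp
    finally show "\<exists>h. hm h (src g) (src i1) & i1 ** h = g" using b(1-13) g(1-3) by (intro exI[of _ "p1 ** g"]) simp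
  qed (use b in auto)
  ultimately have "sexact (i1, p2)" by (rule sexactI')
  thus ?thesis unfolding split_def using b(1-13,15) by (intro conjI exI[of _ i2]) auto
qed

lemma split_mor:
  assumes "split s" "mor s s' (ide (sub s)) (ide (quo s))"
  shows "split s'"
proof -
  obtain i p where s: "s = (i, p)" by (cases s)
  obtain i' p' where s': "s' = (i', p')" by (cases s')
  obtain \<sigma> where g: "hm \<sigma> (trg p) (src p)" "p ** \<sigma> = ide (trg p)" using assms(1) unfolding split_def s by auto
  obtain h where h: "sexact (i, p)" "sexact (i', p')" "ar (ide (trg p))" "trg (ide (trg p)) = trg p'"
    "ar h" "deg h = 0" "src h = trg i" "trg h = trg i'" "p' ** h = ide (trg p) ** p"
    using assms(2) unfolding s s' fst_conv snd_conv by (rule morE)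
  note a = sexactD(1-5)[OF h(1)] and a' = sexactD(1-5)[OF h(2)]
  have "trg p' = trg p" using h(4) a by simp
  moreover have "p' ** (h ** \<sigma>) = ide (trg p)"
  proof -
    have "p' ** h = p" using h(9) a by simp
    hence "p' ** (h ** \<sigma>) = p ** \<sigma>" using pre_cancel[of p' h p \<sigma>] a a' h(5-8) g by simp
    thus ?thesis using g by simp
  qed
  ultimately show ?thesis unfolding split_def s' using h(2,5-8) a a' g by (intro conjI exI[of _ "h ** \<sigma>"]) auto
qed

text \<open>A lift \<open>h\<close> of \<open>f\<close> gives the morphism with middle arrow
  \<open>i c1 + h c2\<close> from the split sequence on a biproduct to \<open>s\<close>, and by
  \<open>pull_factor\<close> that split sequence is equivalent to \<open>s1\<close>. Conversely a
  section of \<open>s1\<close> is carried to a lift of \<open>f\<close>.\<close>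

lemma pull_split:
  assumes m: "mor s1 s (ide (sub s)) f"
  shows "split s1 <-> (\<exists>h. hm h (src f) (trg (fst s)) & snd s ** h = f)"
proof -
  obtain i p where s: "s = (i, p)" by (cases s)
  obtain i1 p1 where s1: "s1 = (i1, p1)" by (cases s1)
  obtain H where H: "sexact (i1, p1)" "sexact (i, p)" "ar (ide (src i))" "deg (ide (src i)) = 0" "src (ide (src i)) = src i1"
    "ar f" "deg f = 0" "src f = trg p1" "trg f = trg p"
    "ar H" "deg H = 0" "src H = trg i1" "trg H = trg i" "H ** i1 = i ** ide (src i)" "p ** H = f ** p1"
    using m unfolding s s1 fst_conv snd_conv by (rule morE)
  note a = sexactD[OF H(2)] and a1 = sexactD[OF H(1)]
  have e: "src i1 = src i" using H(5) a(1) by simp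
  show ?thesis
  proof
    assume "split s1"
    then obtain \<sigma> where g: "hm \<sigma> (trg p1) (src p1)" "p1 ** \<sigma> = ide (trg p1)" unfolding split_def s1 by auto
    have "p ** (H ** \<sigma>) = (p ** H) ** \<sigma>" using a(1-5) a1(1-5) H(6-13) g(1) by simp
    also have "\<dots> = f" unfolding H(15) using a(1-5) a1(1-5) H(6-13) g by simp
    finally show "\<exists>h. hm h (src f) (trg (fst s)) & snd s ** h = f"
      unfolding s using a(1-5) a1(1-5) H(6-13) g by (intro exI[of _ "H ** \<sigma>"]) simp
  next
    assume "\<exists>h. hm h (src f) (trg (fst s)) & snd s ** h = f"
    then obtain h where h: "hm h (src f) (trg i)" "p ** h = f" unfolding s by auto
    obtain b1 b2 c1 c2 where b: "bip b1 b2 c1 c2" "src b1 = src i" "src b2 = src f" using bip_ex[of "src i" "src f"] a(1) H(6) by auto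
    note b' = bipD[OF b(1), unfolded b(2,3)]
    have sp: "split (b1, c2)" by (rule split_bip[OF b(1)])
    hence sx: "sexact (b1, c2)" unfolding split_def by simp
    have "mor (b1, c2) s (ide (src i)) f" unfolding s
    proof (rule morI[OF sx H(2), where h="i ** c1 +++ h ** c2"])
      show "(i ** c1 +++ h ** c2) ** b1 = i ** ide (src i)" using a(1-5) b(2,3) b' h(1) H(6,7) by (simp add: cmp_add_left)
      show "p ** (i ** c1 +++ h ** c2) = f ** c2"
        using a(1-5,11) b(2,3) b'(1-13) h(1) H(6-9) pre_cancel[OF h(2), of c2] by (simp add: cmp_add_right)
    qed (use a(1-5) b(2,3) b'(1-13) h(1) H(6-9) in auto)
    from pull_factor[OF this m] have "mor (b1, c2) s1 (ide (src i)) (ide (src f))" .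
    thus "split s1" using split_mor[OF sp, of s1] b(2,3) b'(13) by simp
  qed
qed

text \<open>\<open>1 - \<sigma> p\<close> is killed by \<open>p\<close> and so factors through
  \<open>i\<close>. This makes splitness a self-dual notion (\<open>op_split\<close>).\<close>

lemma split_retraction:
  assumes "split s"
  shows "\<exists>\<rho>. hm \<rho> (trg (fst s)) (src (fst s)) & \<rho> ** fst s = ide (src (fst s))"
proof -
  obtain i p where s: "s = (i, p)" by (cases s)
  obtain \<sigma> where g: "sexact (i, p)" "hm \<sigma> (trg p) (src p)" "p ** \<sigma> = ide (trg p)" using assms(1) unfolding split_def s by auto
  note a = sexactD[OF g(1)]
  define e where "e = ide (trg i) +++ neg (\<sigma> ** p)"
  have et: "ar e" "deg e = 0" "src e = trg i" "trg e = trg i" unfolding e_def using a(1-5) g(2) by auto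
  have "p ** e = zer 0 (src e) (trg p)" unfolding e_def using a(1-5) g(2) pre_cancel[OF g(3), of p] by (simp add: dist)
  then obtain \<rho> where r: "hm \<rho> (trg i) (src i)" "i ** \<rho> = e" using a(9)[of e] et by auto
  have "i ** (\<rho> ** i) = i ** ide (src i)"
  proof -
    have "i ** (\<rho> ** i) = e ** i" using pre_cancel[OF r(2), of i] r(1) a(1-5) by simp
    also have "\<dots> = i" unfolding e_def using a(1-5,8) g(2) by (simp add: dist)
    finally show ?thesis using a(1) by simp
  qed
  hence "\<rho> ** i = ide (src i)" by (rule mono_cancel[OF a(6), rotated -1]) (use r a(1-5) in auto)
  thus ?thesis unfolding s using r by auto
qed

lemma op_split: "abgcat.split ar trg src deg ide (%g f. f ** g) (%d X Y. zer d Y X) (prod.swap s) = split s"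
proof
  assume s: "split s"
  hence sx: "sexact s" unfolding split_def by simp
  hence "src (snd s) = trg (fst s)" using sexactD(5)[of "fst s" "snd s"] by simp
  thus "abgcat.split ar trg src deg ide (%g f. f ** g) (%d X Y. zer d Y X) (prod.swap s)"
    unfolding abgcat.split_def[OF op_abgcat] op_sexact using sx split_retraction[OF s] by auto
next
  assume s: "abgcat.split ar trg src deg ide (%g f. f ** g) (%d X Y. zer d Y X) (prod.swap s)"
  hence sx: "sexact s" unfolding abgcat.split_def[OF op_abgcat] op_sexact by simp
  have "src (snd s) = trg (fst s)" using sx sexactD(5)[of "fst s" "snd s"] by simp
  thus "split s" unfolding split_def using sx abgcat.split_retraction[OF op_abgcat s] by auto
qed

lemma push_split:
  assumes m: "mor s s1 g (ide (quo s))"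
  shows "split s1 <-> (\<exists>h. hm h (trg (fst s)) (trg g) & h ** fst s = g)"
proof -
  have "src (snd s) = trg (fst s)" using morD(1)[OF m] sexactD(5)[of "fst s" "snd s"] by simp
  thus ?thesis using abgcat.pull_split[OF op_abgcat, of "prod.swap s1" "prod.swap s" g] m unfolding op_mor op_split by (auto simp: op_mor)
qed

lemma split_unique:
  assumes "split s" "split s'" "sub s' = sub s" "quo s' = quo s"
  shows "mor s s' (ide (sub s)) (ide (quo s))"
proof -
  have s: "sexact s" "sexact s'" using assms unfolding split_def by auto
  note ob = ses_ob[OF s(1)] ses_ob[OF s(2)]
  obtain s1 where s1: "mor s1 s (ide (sub s)) (ide (quo s))" using mor_ide[OF s(1)] by blast
  obtain b1 b2 c1 c2 where b: "bip b1 b2 c1 c2" "src b1 = sub s" "src b2 = quo s" using bip_ex[OF ob(1,2)] by blast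
  note b' = bipD[OF b(1), unfolded b(2,3)]
  have sp: "split (b1, c2)" by (rule split_bip[OF b(1)])
  hence sx: "sexact (b1, c2)" unfolding split_def by simp
  have key: "mor (b1, c2) t (ide (sub t)) (ide (quo t))" if t: "split t" "sub t = sub s" "quo t = quo s" for t
  proof -
    obtain i p where ip: "t = (i, p)" by (cases t)
    obtain \<sigma> where g: "sexact (i, p)" "hm \<sigma> (trg p) (src p)" "p ** \<sigma> = ide (trg p)" using t(1) unfolding split_def ip by auto
    note a = sexactD[OF g(1)]
    have tt: "src i = sub s" "trg p = quo s" using t(2,3) ip by auto
    show ?thesis unfolding ip fst_conv snd_conv
    proof (rule morI[OF sx g(1), where h="i ** c1 +++ \<sigma> ** c2"])
      show "(i ** c1 +++ \<sigma> ** c2) ** b1 = i ** ide (src i)" using a(1-5) b(2,3) b' g(2) tt ob by (simp add: cmp_add_left)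
      show "p ** (i ** c1 +++ \<sigma> ** c2) = ide (trg p) ** c2"
        using a(1-5,11) b(2,3) b'(1-13) g(2) tt ob pre_cancel[OF g(3), of c2] by (simp add: cmp_add_right)
    qed (use a(1-5) b(2,3) b'(1-13) g(2) tt ob in auto)
  qed
  have k1: "mor (b1, c2) s (ide (sub s)) (ide (quo s))" using key[OF assms(1)] by simp
  have k2: "mor (b1, c2) s' (ide (sub s)) (ide (quo s))" using key[OF assms(2,3,4)] assms(3,4) by simp
  show ?thesis using mor_eqv_trans_left[of "(b1, c2)" s' "ide (sub s)" "ide (quo s)" s] k1 k2 b(2,3) b'(13) by simp
qed

text \<open>The biproduct arrows are arguments because \<open>baer_sum\<close> ranges over all
  choices of them; the bracketing to the left also follows \<open>baer_sum\<close>.\<close>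

definition dsum :: "'c \<times> 'c => 'c \<times> 'c => 'c => 'c => 'c => 'c => 'c => 'c => 'c => 'c => 'c \<times> 'c" where
  "dsum s1 s2 x1 x2 y1' y2' e1 e2 e1' e2' =
     ((e1 ** fst s1) ** y1' +++ (e2 ** fst s2) ** y2', (x1 ** snd s1) ** e1' +++ (x2 ** snd s2) ** e2')"

definition dsum_data :: "'c \<times> 'c => 'c \<times> 'c => 'c => 'c => 'c => 'c => 'c => 'c => 'c => 'c => 'c => 'c => 'c => 'c => bool" where
  "dsum_data s1 s2 x1 x2 x1' x2' y1 y2 y1' y2' e1 e2 e1' e2' <-> sexact s1 & sexact s2 &
     bip x1 x2 x1' x2' & src x1 = quo s1 & src x2 = quo s2 &
     bip y1 y2 y1' y2' & src y1 = sub s1 & src y2 = sub s2 &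
     bip e1 e2 e1' e2' & src e1 = trg (fst s1) & src e2 = trg (fst s2)"

text \<open>Only this half of exactness is computed; in the opposite category it reads as the
  statement about the cokernel, which \<open>dsum_sexact\<close> adds.\<close>

lemma dsum_ker:
  assumes d: "dsum_data s1 s2 x1 x2 x1' x2' y1 y2 y1' y2' e1 e2 e1' e2'"
  shows "ker (snd (dsum s1 s2 x1 x2 y1' y2' e1 e2 e1' e2')) (fst (dsum s1 s2 x1 x2 y1' y2' e1 e2 e1' e2'))"
proof -
  obtain i1 p1 where s1: "s1 = (i1, p1)" by (cases s1)
  obtain i2 p2 where s2: "s2 = (i2, p2)" by (cases s2)
  have D: "sexact (i1, p1)" "sexact (i2, p2)" "bip x1 x2 x1' x2'" "bip y1 y2 y1' y2'" "bip e1 e2 e1' e2'"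
    and O: "src x1 = trg p1" "src x2 = trg p2" "src y1 = src i1" "src y2 = src i2" "src e1 = trg i1" "src e2 = trg i2"
    using d unfolding dsum_data_def s1 s2 by auto
  note a1 = sexactD[OF D(1)] and a2 = sexactD[OF D(2)]
  note x = bipD[OF D(3), unfolded O(1,2)] and y = bipD[OF D(4), unfolded O(3,4)] and e = bipD[OF D(5), unfolded O(5,6)]
  define I where "I = (e1 ** i1) ** y1' +++ (e2 ** i2) ** y2'"
  define P where "P = (x1 ** p1) ** e1' +++ (x2 ** p2) ** e2'"
  have I: "I = e1 ** (i1 ** y1') +++ e2 ** (i2 ** y2')" unfolding I_def using a1(1-5) a2(1-5) O y(1-13) e(1-13) by simp
  have P: "P = x1 ** (p1 ** e1') +++ x2 ** (p2 ** e2')" unfolding P_def using a1(1-5) a2(1-5) O x(1-13) e(1-13) by simp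
  have t: "ar I" "deg I = 0" "src I = trg y1" "trg I = trg e1" "ar P" "deg P = 0" "src P = trg e1" "trg P = trg x1"
    unfolding I P using a1(1-5) a2(1-5) O x(1-13) y(1-13) e(1-13) by simp_all
  have eI: "e1' ** I = i1 ** y1'" "e2' ** I = i2 ** y2'" unfolding I using a1(1-5) a2(1-5) O y(1-13) e by (simp_all add: cmp_add_right)
  have xP: "x1' ** P = p1 ** e1'" "x2' ** P = p2 ** e2'" unfolding P using a1(1-5) a2(1-5) O x e(1-13) by (simp_all add: cmp_add_right)
  have "mono I"
  proof (rule monoI[OF t(1,2)])
    fix u assume u: "ar u" "deg u = 0" "trg u = src I" "I ** u = zer 0 (src u) (trg I)"
    have "i1 ** (y1' ** u) = e1' ** (I ** u)" using pre_cancel[OF eI(1), of u] u(1-3) t e(1-13) y(1-13) a1(1-5) O by simp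
    also have "\<dots> = zer 0 (src u) (trg i1)" unfolding u(4) using u(1) t e(1-13) O by simp
    finally have 1: "y1' ** u = zer 0 (src u) (src i1)" using monoD(3)[OF a1(6), of "y1' ** u"] u(1-3) t y(1-13) O by simp
    have "i2 ** (y2' ** u) = e2' ** (I ** u)" using pre_cancel[OF eI(2), of u] u(1-3) t e(1-13) y(1-13) a2(1-5) O by simp
    also have "\<dots> = zer 0 (src u) (trg i2)" unfolding u(4) using u(1) t e(1-13) O by simp
    finally have 2: "y2' ** u = zer 0 (src u) (src i2)" using monoD(3)[OF a2(6), of "y2' ** u"] u(1-3) t y(1-13) O by simp
    show "u = zer 0 (src u) (src I)" by (rule bip_eqI[OF D(4)]) (use u(1-3) t y(1-13) 1 2 O in auto)
  qed
  moreover have "P ** I = zer 0 (src I) (trg P)"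
  proof (rule bip_eqI[OF D(3)])
    show "x1' ** (P ** I) = x1' ** zer 0 (src I) (trg P)"
      using pre_cancel[OF xP(1), of I] eI(1) a1(1-5,11) t x(1-13) e(1-13) y(1-13) O by simp
    show "x2' ** (P ** I) = x2' ** zer 0 (src I) (trg P)"
      using pre_cancel[OF xP(2), of I] eI(2) a2(1-5,11) t x(1-13) e(1-13) y(1-13) O by simp
  qed (use t x(1-13) y(1-13) in auto)
  moreover have "\<exists>h. hm h (src g) (src I) & I ** h = g" if "ar g" "deg g = 0" "trg g = src P" "P ** g = zer 0 (src g) (trg P)" for g
  proof -
    note g = that
    have "p1 ** (e1' ** g) = x1' ** (P ** g)" using pre_cancel[OF xP(1), of g] g(1-3) t e(1-13) x(1-13) a1(1-5) O by simp
    also have "\<dots> = zer 0 (src g) (trg p1)" unfolding g(4) using g(1) t x(1-13) O by simp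
    finally obtain h1 where h1: "hm h1 (src g) (src i1)" "i1 ** h1 = e1' ** g" using a1(9)[of "e1' ** g"] g(1-3) t e(1-13) O by auto
    have "p2 ** (e2' ** g) = x2' ** (P ** g)" using pre_cancel[OF xP(2), of g] g(1-3) t e(1-13) x(1-13) a2(1-5) O by simp
    also have "\<dots> = zer 0 (src g) (trg p2)" unfolding g(4) using g(1) t x(1-13) O by simp
    finally obtain h2 where h2: "hm h2 (src g) (src i2)" "i2 ** h2 = e2' ** g" using a2(9)[of "e2' ** g"] g(1-3) t e(1-13) O by auto
    define h where "h = y1 ** h1 +++ y2 ** h2"
    have ht: "ar h" "deg h = 0" "src h = src g" "trg h = trg y1" unfolding h_def using h1(1) h2(1) y(1-13) O by auto
    have yh: "y1' ** h = h1" "y2' ** h = h2" unfolding h_def using h1(1) h2(1) y O by (simp_all add: cmp_add_right)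
    have "I ** h = g"
    proof (rule bip_eqI[OF D(5)])
      show "e1' ** (I ** h) = e1' ** g" using pre_cancel[OF eI(1), of h] yh(1) h1(2) ht t e(1-13) y(1-13) a1(1-5) O by simp
      show "e2' ** (I ** h) = e2' ** g" using pre_cancel[OF eI(2), of h] yh(2) h2(2) ht t e(1-13) y(1-13) a2(1-5) O by simp
    qed (use ht t g in auto)
    thus ?thesis using ht t by auto
  qed
  ultimately show ?thesis unfolding ker_def dsum_def s1 s2 fst_conv snd_conv I_def[symmetric] P_def[symmetric] using t by auto
qed

lemma op_dsum_data:
  assumes d: "dsum_data s1 s2 x1 x2 x1' x2' y1 y2 y1' y2' e1 e2 e1' e2'"
  shows "abgcat.dsum_data ar trg src deg ide (%g f. f ** g) pls (%d X Y. zer d Y X) (prod.swap s1) (prod.swap s2)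
      y1' y2' y1 y2 x1' x2' x1 x2 e1' e2' e1 e2"
proof -
  have D: "bip x1 x2 x1' x2'" "bip y1 y2 y1' y2'" "bip e1 e2 e1' e2'" "sexact (fst s1, snd s1)" "sexact (fst s2, snd s2)"
    using d unfolding dsum_data_def by auto
  show ?thesis using d bipD(12,13)[OF D(1)] bipD(12,13)[OF D(2)] bipD(12,13)[OF D(3)] sexactD(5)[OF D(4)] sexactD(5)[OF D(5)]
    unfolding abgcat.dsum_data_def[OF op_abgcat] dsum_data_def op_sexact op_simps by simp
qed

lemma op_dsum:
  assumes d: "dsum_data s1 s2 x1 x2 x1' x2' y1 y2 y1' y2' e1 e2 e1' e2'"
  shows "abgcat.dsum (%g f. f ** g) pls (prod.swap s1) (prod.swap s2) y1' y2' x1 x2 e1' e2' e1 e2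
    = prod.swap (dsum s1 s2 x1 x2 y1' y2' e1 e2 e1' e2')"
proof -
  have D: "bip x1 x2 x1' x2'" "bip y1 y2 y1' y2'" "bip e1 e2 e1' e2'" "sexact (fst s1, snd s1)" "sexact (fst s2, snd s2)"
    and O: "src x1 = quo s1" "src x2 = quo s2" "src y1 = sub s1" "src y2 = sub s2" "src e1 = trg (fst s1)" "src e2 = trg (fst s2)"
    using d unfolding dsum_data_def by auto
  show ?thesis unfolding abgcat.dsum_def[OF op_abgcat] dsum_def
    using bipD(1-13)[OF D(1)] bipD(1-13)[OF D(2)] bipD(1-13)[OF D(3)] sexactD(1-5)[OF D(4)] sexactD(1-5)[OF D(5)] O by simp
qed

lemma dsum_sexact:
  assumes d: "dsum_data s1 s2 x1 x2 x1' x2' y1 y2 y1' y2' e1 e2 e1' e2'"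
  shows "sexact (dsum s1 s2 x1 x2 y1' y2' e1 e2 e1' e2')" using dsum_ker[OF d] abgcat.dsum_ker[OF op_abgcat op_dsum_data[OF d]]
  unfolding op_dsum[OF d] op_simps sexact_def by simp

lemma dsum_typ:
  assumes d: "dsum_data s1 s2 x1 x2 x1' x2' y1 y2 y1' y2' e1 e2 e1' e2'"
  shows "sub (dsum s1 s2 x1 x2 y1' y2' e1 e2 e1' e2') = trg y1" "quo (dsum s1 s2 x1 x2 y1' y2' e1 e2 e1' e2') = trg x1"
    "trg (fst (dsum s1 s2 x1 x2 y1' y2' e1 e2 e1' e2')) = trg e1"
proof -
  have D: "bip x1 x2 x1' x2'" "bip y1 y2 y1' y2'" "bip e1 e2 e1' e2'" "sexact (fst s1, snd s1)" "sexact (fst s2, snd s2)"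
    and O: "src x1 = quo s1" "src x2 = quo s2" "src y1 = sub s1" "src y2 = sub s2" "src e1 = trg (fst s1)" "src e2 = trg (fst s2)"
    using d unfolding dsum_data_def by auto
  show "sub (dsum s1 s2 x1 x2 y1' y2' e1 e2 e1' e2') = trg y1" "quo (dsum s1 s2 x1 x2 y1' y2' e1 e2 e1' e2') = trg x1"
    "trg (fst (dsum s1 s2 x1 x2 y1' y2' e1 e2 e1' e2')) = trg e1" unfolding dsum_def
    using bipD(1-13)[OF D(1)] bipD(1-13)[OF D(2)] bipD(1-13)[OF D(3)] sexactD(1-5)[OF D(4)] sexactD(1-5)[OF D(5)] O by simp_all
qed

lemma dsum_to:
  assumes d: "dsum_data s1 s2 x1 x2 x1' x2' y1 y2 y1' y2' e1 e2 e1' e2'"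
    and m1: "mor z s1 g1 f1" and m2: "mor z s2 g2 f2"
  shows "mor z (dsum s1 s2 x1 x2 y1' y2' e1 e2 e1' e2') (y1 ** g1 +++ y2 ** g2) (x1 ** f1 +++ x2 ** f2)"
proof -
  obtain i1 p1 where s1: "s1 = (i1, p1)" by (cases s1)
  obtain i2 p2 where s2: "s2 = (i2, p2)" by (cases s2)
  obtain i p where z: "z = (i, p)" by (cases z)
  have D: "sexact (i1, p1)" "sexact (i2, p2)" "bip x1 x2 x1' x2'" "bip y1 y2 y1' y2'" "bip e1 e2 e1' e2'"
    and O: "src x1 = trg p1" "src x2 = trg p2" "src y1 = src i1" "src y2 = src i2" "src e1 = trg i1" "src e2 = trg i2"
    using d unfolding dsum_data_def s1 s2 by auto
  obtain h1 where h1: "sexact (i, p)" "ar g1" "deg g1 = 0" "src g1 = src i" "trg g1 = src i1"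
    "ar f1" "deg f1 = 0" "src f1 = trg p" "trg f1 = trg p1" "ar h1" "deg h1 = 0" "src h1 = trg i" "trg h1 = trg i1"
    "h1 ** i = i1 ** g1" "p1 ** h1 = f1 ** p" using m1 unfolding z s1 by (rule morE)
  obtain h2 where h2: "ar g2" "deg g2 = 0" "src g2 = src i" "trg g2 = src i2"
    "ar f2" "deg f2 = 0" "src f2 = trg p" "trg f2 = trg p2" "ar h2" "deg h2 = 0" "src h2 = trg i" "trg h2 = trg i2"
    "h2 ** i = i2 ** g2" "p2 ** h2 = f2 ** p" using m2 unfolding z s2 by (rule morE)
  note a = sexactD[OF h1(1)] and a1 = sexactD[OF D(1)] and a2 = sexactD[OF D(2)]
  note x = bipD[OF D(3), unfolded O(1,2)] and y = bipD[OF D(4), unfolded O(3,4)] and e = bipD[OF D(5), unfolded O(5,6)]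
  note T = dsum_typ[OF d] and S = dsum_sexact[OF d]
  define I where "I = fst (dsum s1 s2 x1 x2 y1' y2' e1 e2 e1' e2')"
  define P where "P = snd (dsum s1 s2 x1 x2 y1' y2' e1 e2 e1' e2')"
  have I: "I = e1 ** (i1 ** y1') +++ e2 ** (i2 ** y2')" unfolding I_def dsum_def s1 s2 using a1(1-5) a2(1-5) O y(1-13) e(1-13) by simp
  have P: "P = x1 ** (p1 ** e1') +++ x2 ** (p2 ** e2')" unfolding P_def dsum_def s1 s2 using a1(1-5) a2(1-5) O x(1-13) e(1-13) by simp
  have IP: "dsum s1 s2 x1 x2 y1' y2' e1 e2 e1' e2' = (I, P)" unfolding I_def P_def by simp
  show ?thesis unfolding IP z
  proof (rule morI[OF h1(1) S[unfolded IP], where h="e1 ** h1 +++ e2 ** h2"])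
    show "(e1 ** h1 +++ e2 ** h2) ** i = I ** (y1 ** g1 +++ y2 ** g2)"
    proof -
      have "I ** (y1 ** g1) = e1 ** (i1 ** g1)" "I ** (y2 ** g2) = e2 ** (i2 ** g2)"
        unfolding I using a(1-5) a1(1-5) a2(1-5) O y e(1-13) h1(2-5) h2(1-4) by (simp_all add: cmp_add_left)
      moreover have "ar I" "deg I = 0" "src I = trg y1" unfolding I using a1(1-5) a2(1-5) O y(1-13) e(1-13) by simp_all
      ultimately have "I ** (y1 ** g1 +++ y2 ** g2) = e1 ** (h1 ** i) +++ e2 ** (h2 ** i)"
        unfolding h1(14) h2(13) using O y(1-13) h1(2-5) h2(1-4) by (simp add: cmp_add_right)
      thus ?thesis using a(1-5) O e(1-13) h1(10-13) h2(9-12) by (simp add: cmp_add_left)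
    qed
    show "P ** (e1 ** h1 +++ e2 ** h2) = (x1 ** f1 +++ x2 ** f2) ** p"
    proof -
      have "P ** (e1 ** h1) = x1 ** (p1 ** h1)" "P ** (e2 ** h2) = x2 ** (p2 ** h2)"
        unfolding P using a(1-5) a1(1-5) a2(1-5) O x(1-13) e h1(10-13) h2(9-12) by (simp_all add: cmp_add_left)
      moreover have "ar P" "deg P = 0" "src P = trg e1" unfolding P using a1(1-5) a2(1-5) O x(1-13) e(1-13) by simp_all
      ultimately have "P ** (e1 ** h1 +++ e2 ** h2) = x1 ** (f1 ** p) +++ x2 ** (f2 ** p)"
        unfolding h1(15)[symmetric] h2(14)[symmetric] using O e(1-13) h1(10-13) h2(9-12) by (simp add: cmp_add_right)
      thus ?thesis using a(1-5) O x(1-13) h1(6-9) h2(5-8) by (simp add: cmp_add_left)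
    qed
  qed (use T[unfolded IP] a(1-5) O x(1-13) y(1-13) e(1-13) h1(2-13) h2(1-12) in auto)
qed

lemma dsum_from:
  assumes d: "dsum_data s1 s2 x1 x2 x1' x2' y1 y2 y1' y2' e1 e2 e1' e2'"
    and m1: "mor s1 z g1 f1" and m2: "mor s2 z g2 f2"
  shows "mor (dsum s1 s2 x1 x2 y1' y2' e1 e2 e1' e2') z (g1 ** y1' +++ g2 ** y2') (f1 ** x1' +++ f2 ** x2')"
  using abgcat.dsum_to[OF op_abgcat op_dsum_data[OF d], of "prod.swap z" f1 g1 f2 g2] m1 m2 unfolding op_mor op_dsum[OF d] by simp

lemma bip_add_eqs:
  assumes "bip y1 y2 y1' y2'" "ar g1" "trg g1 = src y1" "ar g2" "trg g2 = src y2" "deg g1 = 0" "deg g2 = 0" "src g2 = src g1"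
    and "ar a" "src a = src y1" "ar b" "src b = src y2" "deg a = 0" "deg b = 0" "trg b = trg a"
  shows "(a ** y1' +++ b ** y2') ** (y1 ** g1 +++ y2 ** g2) = a ** g1 +++ b ** g2"
proof -
  note y = bipD[OF assms(1)]
  have "(a ** y1' +++ b ** y2') ** (y1 ** g1) = a ** g1" "(a ** y1' +++ b ** y2') ** (y2 ** g2) = b ** g2"
    using y assms(2-) by (simp_all add: cmp_add_left)
  moreover have "ar (a ** y1' +++ b ** y2')" "deg (a ** y1' +++ b ** y2') = 0" "src (a ** y1' +++ b ** y2') = trg y1"
    using y(1-13) assms(2-) by simp_all
  ultimately show ?thesis using y(1-13) assms(2-) by (simp add: cmp_add_right)
qed

text \<open>Here \<open>s\<close> represents the Baer sum of \<open>s1\<close> and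
  \<open>s2\<close>: \<open>T\<close> is the pushout of the direct sum along the codiagonal, and
  \<open>s\<close> the pullback of \<open>T\<close> along the diagonal.\<close>

definition bsum :: "'c \<times> 'c => 'c \<times> 'c => 'c => 'c => 'c => 'c => 'c => 'c => 'c => 'c => 'c \<times> 'c => bool" where
  "bsum s1 s2 x1 x2 y1' y2' e1 e2 e1' e2' s <->
     (\<exists>T. mor (dsum s1 s2 x1 x2 y1' y2' e1 e2 e1' e2') T (y1' +++ y2') (ide (trg x1)) & mor s T (ide (sub s)) (x1 +++ x2))"

text \<open>The morphism from \<open>z\<close> to the direct sum with left component
  \<open>y1 g1 + y2 g2\<close>, followed by the codiagonal, has left component
  \<open>g1 + g2\<close>. This turns Baer addition of pushouts of one sequence into addition of
  arrows; with \<open>common_push\<close> all laws of Baer addition reduce to bilinearity of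
  composition.\<close>

lemma bsum_push:
  assumes d: "dsum_data s1 s2 x1 x2 x1' x2' y1 y2 y1' y2' e1 e2 e1' e2'"
    and X: "quo s1 = X" "quo s2 = X" and Y: "sub s1 = Y" "sub s2 = Y"
    and m1: "mor z s1 g1 (ide X)" and m2: "mor z s2 g2 (ide X)"
  shows "bsum s1 s2 x1 x2 y1' y2' e1 e2 e1' e2' s <-> mor z s (g1 +++ g2) (ide X)"
proof -
  let ?S = "dsum s1 s2 x1 x2 y1' y2' e1 e2 e1' e2'"
  have D: "bip x1 x2 x1' x2'" "bip y1 y2 y1' y2'" and O: "src x1 = X" "src x2 = X" "src y1 = Y" "src y2 = Y"
    using d X Y unfolding dsum_data_def by auto
  note x = bipD(1-13)[OF D(1), unfolded O(1,2)] and y = bipD(1-13)[OF D(2), unfolded O(3,4)]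
  have XY: "X \<in> Ob" "Y \<in> Ob" "trg x1 \<in> Ob" using O x(1) y(1) src_ob trg_ob by metis+
  note t1 = morD[OF m1] and t2 = morD[OF m2]
  have zq: "quo z = X" using t1(9) XY by simp
  have "mor z ?S (y1 ** g1 +++ y2 ** g2) (x1 ** ide X +++ x2 ** ide X)" by (rule dsum_to[OF d m1 m2])
  hence mz: "mor z ?S (y1 ** g1 +++ y2 ** g2) (x1 +++ x2)" using x O by simp
  have comp: "mor z T (g1 +++ g2) (x1 +++ x2)" if T: "mor ?S T (y1' +++ y2') (ide (trg x1))" for T
  proof -
    have "(ide Y ** y1' +++ ide Y ** y2') ** (y1 ** g1 +++ y2 ** g2) = ide Y ** g1 +++ ide Y ** g2"
      by (rule bip_add_eqs[OF D(2)]) (use t1 t2 O Y XY in auto)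
    hence "(y1' +++ y2') ** (y1 ** g1 +++ y2 ** g2) = g1 +++ g2" using y t1 t2 Y by simp
    thus ?thesis using mor_comp[OF mz T] x O by simp
  qed
  have g12: "hm (g1 +++ g2) (sub z) Y" using t1 t2 Y by simp
  show ?thesis
  proof
    assume "bsum s1 s2 x1 x2 y1' y2' e1 e2 e1' e2' s"
    then obtain T where T: "mor ?S T (y1' +++ y2') (ide (trg x1))" "mor s T (ide (sub s)) (x1 +++ x2)" unfolding bsum_def by blast
    have "sub T = Y" using morD(6)[OF T(1)] y O by simp
    moreover have "sub T = sub s" using morD(6)[OF T(2)] ses_ob[OF morD(1)[OF T(2)]] by simp
    ultimately have "mor s T (ide (sub T)) (x1 +++ x2)" using T(2) by simp
    from pull_factor[OF comp[OF T(1)] this] show "mor z s (g1 +++ g2) (ide X)" using x O by simp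
  next
    assume m: "mor z s (g1 +++ g2) (ide X)"
    have SS: "sexact ?S" "sub ?S = trg y1" "quo ?S = trg x1" using dsum_sexact[OF d] dsum_typ[OF d] by auto
    have "hm (y1' +++ y2') (sub ?S) Y" using SS(2) y O by simp
    from push_ex[OF SS(1) this] obtain T where T: "mor ?S T (y1' +++ y2') (ide (trg x1))" using SS(3) by auto
    from push_factor[OF comp[OF T], of s] m zq have "mor s T (ide (trg (g1 +++ g2))) (x1 +++ x2)" by simp
    moreover have "sub s = Y" using morD(6)[OF m] g12 by simp
    ultimately have "mor s T (ide (sub s)) (x1 +++ x2)" using g12 by simp
    thus "bsum s1 s2 x1 x2 y1' y2' e1 e2 e1' e2' s" using T unfolding bsum_def by blast
  qed
qed

text \<open>The mirror of \<open>bsum_push\<close>. It is proved directly, as \<open>bsum\<close>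
  pushes before it pulls and so is not literally its own dual.\<close>

lemma bsum_pull:
  assumes d: "dsum_data s1 s2 x1 x2 x1' x2' y1 y2 y1' y2' e1 e2 e1' e2'"
    and X: "quo s1 = X" "quo s2 = X" and Y: "sub s1 = Y" "sub s2 = Y"
    and m1: "mor s1 z (ide Y) f1" and m2: "mor s2 z (ide Y) f2"
  shows "bsum s1 s2 x1 x2 y1' y2' e1 e2 e1' e2' s <-> mor s z (ide Y) (f1 +++ f2)"
proof -
  let ?S = "dsum s1 s2 x1 x2 y1' y2' e1 e2 e1' e2'"
  have D: "bip x1 x2 x1' x2'" "bip y1 y2 y1' y2'" and O: "src x1 = X" "src x2 = X" "src y1 = Y" "src y2 = Y"
    using d X Y unfolding dsum_data_def by auto
  note x = bipD(1-13)[OF D(1), unfolded O(1,2)] and y = bipD(1-13)[OF D(2), unfolded O(3,4)]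
  have XY: "X \<in> Ob" "Y \<in> Ob" "trg x1 \<in> Ob" using O x(1) y(1) src_ob trg_ob by metis+
  note t1 = morD[OF m1] and t2 = morD[OF m2]
  have zs: "sub z = Y" using t1(6) XY by simp
  have "mor ?S z (ide Y ** y1' +++ ide Y ** y2') (f1 ** x1' +++ f2 ** x2')" by (rule dsum_from[OF d m1 m2])
  hence mz: "mor ?S z (y1' +++ y2') (f1 ** x1' +++ f2 ** x2')" using y O by simp
  have SS: "sexact ?S" "sub ?S = trg y1" "quo ?S = trg x1" using dsum_sexact[OF d] dsum_typ[OF d] by auto
  have y12: "trg (y1' +++ y2') = Y" using y O by simp
  have fx: "(f1 ** x1' +++ f2 ** x2') ** (x1 +++ x2) = f1 +++ f2"
  proof -
    have "(f1 ** x1' +++ f2 ** x2') ** (x1 ** ide X +++ x2 ** ide X) = f1 ** ide X +++ f2 ** ide X"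
      by (rule bip_add_eqs[OF D(1)]) (use t1 t2 O X XY in auto)
    thus ?thesis using x O t1 t2 X by simp
  qed
  have Tz: "mor T z (ide Y) (f1 ** x1' +++ f2 ** x2')" if T: "mor ?S T (y1' +++ y2') (ide (trg x1))" for T
    using push_factor[OF mz, of T] T SS(3) y12 by simp
  show ?thesis
  proof
    assume "bsum s1 s2 x1 x2 y1' y2' e1 e2 e1' e2' s"
    then obtain T where T: "mor ?S T (y1' +++ y2') (ide (trg x1))" "mor s T (ide (sub s)) (x1 +++ x2)" unfolding bsum_def by blast
    have "sub T = Y" using morD(6)[OF T(1)] y O by simp
    moreover have "sub T = sub s" using morD(6)[OF T(2)] ses_ob[OF morD(1)[OF T(2)]] by simp
    ultimately have "sub s = Y" by simp
    thus "mor s z (ide Y) (f1 +++ f2)" using mor_comp[OF T(2) Tz[OF T(1)]] fx XY by simp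
  next
    assume m: "mor s z (ide Y) (f1 +++ f2)"
    have "hm (y1' +++ y2') (sub ?S) Y" using SS(2) y O by simp
    from push_ex[OF SS(1) this] obtain T where T: "mor ?S T (y1' +++ y2') (ide (trg x1))" using SS(3) by auto
    have Tt: "sexact T" "sub T = Y" "quo T = trg x1" using morD[OF T] y O x XY by auto
    obtain s' where s': "mor s' T (ide (sub T)) (x1 +++ x2)" using pull_ex[OF Tt(1), of "x1 +++ x2" X] x O Tt(3) by auto
    have "mor s' z (ide Y) (f1 +++ f2)" using mor_comp[OF s' Tz[OF T]] fx XY Tt(2) by simp
    hence ss': "mor s s' (ide Y) (ide X)" using pull_factor[OF m, of s'] zs t1 t2 X by simp
    have "mor s T (ide Y) (x1 +++ x2)" using mor_comp[OF ss' s'] Tt(2) XY x O by simp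
    moreover have "sub s = Y" using morD(5)[OF m] XY by simp
    ultimately show "bsum s1 s2 x1 x2 y1' y2' e1 e2 e1' e2' s" using T unfolding bsum_def by blast
  qed
qed

lemma dsum_data_ex:
  assumes "sexact s1" "sexact s2"
  obtains x1 x2 x1' x2' y1 y2 y1' y2' e1 e2 e1' e2' where "dsum_data s1 s2 x1 x2 x1' x2' y1 y2 y1' y2' e1 e2 e1' e2'"
proof -
  have "trg (fst s1) \<in> Ob" "trg (fst s2) \<in> Ob" using assms sexactD(1)[of "fst s1" "snd s1"] sexactD(1)[of "fst s2" "snd s2"] by auto
  thus ?thesis using that bip_ex[OF ses_ob(1)[OF assms(1)] ses_ob(1)[OF assms(2)]] bip_ex[OF ses_ob(2)[OF assms(1)] ses_ob(2)[OF assms(2)]]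
      bip_ex[of "trg (fst s1)" "trg (fst s2)"] assms unfolding dsum_data_def by metis
qed

text \<open>\<open>z\<close> is the pullback of the direct sum along the diagonal; the two
  projections of the direct sum give back \<open>s1\<close> and \<open>s2\<close>, each with the
  identity on the right.\<close>

lemma common_push:
  assumes "sexact s1" "sexact s2" "quo s2 = quo s1"
  obtains z g1 g2 where "mor z s1 g1 (ide (quo s1))" "mor z s2 g2 (ide (quo s1))"
proof -
  obtain x1 x2 x1' x2' y1 y2 y1' y2' e1 e2 e1' e2' where d: "dsum_data s1 s2 x1 x2 x1' x2' y1 y2 y1' y2' e1 e2 e1' e2'"
    using dsum_data_ex[OF assms(1,2)] .
  let ?S = "dsum s1 s2 x1 x2 y1' y2' e1 e2 e1' e2'" and ?X = "quo s1"
  note S = dsum_sexact[OF d] dsum_typ[OF d]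
  have D: "bip x1 x2 x1' x2'" "bip y1 y2 y1' y2'" "bip e1 e2 e1' e2'" and O: "src x1 = ?X" "src x2 = ?X" "src y1 = sub s1" "src y2 = sub s2"
     "src e1 = trg (fst s1)" "src e2 = trg (fst s2)" using d assms unfolding dsum_data_def by auto
  note x = bipD[OF D(1), unfolded O(1,2)] and y = bipD[OF D(2), unfolded O(3,4)] and e = bipD[OF D(3), unfolded O(5,6)]
  have "hm (x1 +++ x2) ?X (quo ?S)" using x O S(3) by simp
  from pull_ex[OF S(1) this] obtain z where z: "mor z ?S (ide (sub ?S)) (x1 +++ x2)" .
  have XO: "?X \<in> Ob" using ses_ob assms by blast
  obtain i1 p1 where s1: "s1 = (i1, p1)" by (cases s1)
  obtain i2 p2 where s2: "s2 = (i2, p2)" by (cases s2)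
  note a1 = sexactD[OF assms(1)[unfolded s1]] and a2 = sexactD[OF assms(2)[unfolded s2]]
  have DS: "?S = (e1 ** (i1 ** y1') +++ e2 ** (i2 ** y2'), x1 ** (p1 ** e1') +++ x2 ** (p2 ** e2'))"
    unfolding dsum_def s1 s2 using a1(1-5) a2(1-5) O[unfolded s1 s2] x(1-13)[unfolded s1 s2] y(1-13)[unfolded s1 s2] e(1-13)[unfolded s1 s2] assms(3)[unfolded s1 s2] by simp
  have 1: "mor ?S s1 y1' x1'" unfolding DS unfolding s1
  proof (rule morI[OF S(1)[unfolded DS] assms(1)[unfolded s1], where h=e1'])
  qed (use a1(1-5) a2(1-5) O[unfolded s1 s2] x[unfolded s1 s2] y[unfolded s1 s2] e[unfolded s1 s2] assms(3)[unfolded s1 s2] in \<open>simp_all add: cmp_add_right\<close>)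
  have 2: "mor ?S s2 y2' x2'" unfolding DS unfolding s2
  proof (rule morI[OF S(1)[unfolded DS] assms(2)[unfolded s2], where h=e2'])
  qed (use a1(1-5) a2(1-5) O[unfolded s1 s2] x[unfolded s1 s2] y[unfolded s1 s2] e[unfolded s1 s2] assms(3)[unfolded s1 s2] in \<open>simp_all add: cmp_add_right\<close>)
  have "mor z s1 (y1' ** ide (sub ?S)) (x1' ** (x1 +++ x2))" by (rule mor_comp[OF z 1])
  moreover have "x1' ** (x1 +++ x2) = ide ?X" "x2' ** (x1 +++ x2) = ide ?X" using x O XO by (simp_all add: cmp_add_right)
  moreover have "mor z s2 (y2' ** ide (sub ?S)) (x2' ** (x1 +++ x2))" by (rule mor_comp[OF z 2])
  ultimately show ?thesis using that by simp
qed

lemma split_ex: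
  assumes "X \<in> Ob" "Y \<in> Ob"
  obtains s where "split s" "sub s = Y" "quo s = X"
proof -
  obtain b1 b2 c1 c2 where b: "bip b1 b2 c1 c2" "src b1 = Y" "src b2 = X" using bip_ex[OF assms(2,1)] by blast
  show ?thesis using that[OF split_bip[OF b(1)]] b bipD(13)[OF b(1)] by simp
qed

end

section \<open>Categories in which degree one classes are represented by sequences; determined
  epimorphisms\<close>

text \<open>A class \<open>c\<close> of degree one is represented by \<open>0 \<rightarrow> K \<rightarrow> M \<rightarrow> Y \<rightarrow> 0\<close> with arrows \<open>i\<close>, \<open>p\<close> if the
  associated sequences \<open>Hom(T, M) \<rightarrow> Hom(T, Y) \<rightarrow> Ext\<^sup>1(T, K)\<close> and \<open>Hom(K, T) \<rightarrow> Ext\<^sup>1(Y, T) \<rightarrow> Ext\<^sup>1(M, T)\<close> and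
  their duals are exact.\<close>

definition (in gcat) rep_right :: "'a => 'a => bool" where
  "rep_right c p <->
    (\<forall>f. ar f & deg f = 0 & trg f = src c -->
      (c ** f = zer 1 (src f) (trg c) <-> (\<exists>h. hm h (src f) (src p) & p ** h = f))) &
    (\<forall>e. ar e & deg e = 1 & src e = src c & e ** p = zer 1 (src p) (trg e) --> (\<exists>g. hm g (trg c) (trg e) & g ** c = e))"

definition (in gcat) rep_left :: "'a => 'a => bool" where
  "rep_left c i <->
    (\<forall>g. ar g & deg g = 0 & src g = trg c -->
      (g ** c = zer 1 (src c) (trg g) <-> (\<exists>h. hm h (trg i) (trg g) & h ** i = g))) &
    (\<forall>e. ar e & deg e = 1 & trg e = trg c & i ** e = zer 1 (src e) (trg i) --> (\<exists>f. hm f (src e) (src c) & c ** f = e))"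

definition (in gcat) rep :: "'a => 'a => 'a => bool" where
  "rep c i p <-> ar c & deg c = 1 & mono i & epi p & src i = trg c & src p = trg i & trg p = src c &
    rep_right c p & rep_left c i"

lemma (in gcat) op_rep_left: "gcat.rep_left ar trg src deg (%g f. f ** g) (%d X Y. zer d Y X) c p = rep_right c p"
proof -
  have *: "(ar h & deg h = 0 & trg h = X & src h = Y) = hm h Y X" for h X Y by blast
  show ?thesis unfolding gcat.rep_left_def[OF op_gcat] rep_right_def * ..
qed

lemma (in gcat) op_rep_right: "gcat.rep_right ar trg src deg (%g f. f ** g) (%d X Y. zer d Y X) c i = rep_left c i"
proof -
  have *: "(ar h & deg h = 0 & trg h = X & src h = Y) = hm h Y X" for h X Y by blast
  show ?thesis unfolding gcat.rep_right_def[OF op_gcat] rep_left_def * ..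
qed

lemma (in gcat) op_rep: "gcat.rep ar trg src deg (%g f. f ** g) (%d X Y. zer d Y X) c p i = rep c i p"
  unfolding gcat.rep_def[OF op_gcat] op_simps op_rep_left op_rep_right rep_def by auto

text \<open>The abelian structure is replaced by what the theory of determined morphisms draws from
  it: biproducts, split idempotents, and the passage between classes, epimorphisms and
  monomorphisms. These axioms are self-dual (\<open>op_excat\<close>).\<close>

locale excat = gcat k 1 Ob ar src trg deg ide cmp pls zer scl for k :: "'k ring" and Ob :: "'o set" and ar :: "'a => bool"
    and src trg :: "'a => 'o" and deg :: "'a => nat" and ide :: "'o => 'a"
    and cmp :: "'a => 'a => 'a" (infixl \<open>**\<close> 75)
    and pls :: "'a => 'a => 'a" (infixl \<open>+++\<close> 65)
    and zer :: "nat => 'o => 'o => 'a"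
    and scl :: "'k => 'a => 'a" (infixr \<open>\<star>\<close> 80) +
  assumes biproduct_ex: "[| X \<in> Ob; Y \<in> Ob |] ==> \<exists>i1 i2 p1 p2. bip i1 i2 p1 p2 & src i1 = X & src i2 = Y"
    and idem_split: "[| hm e X X; e ** e = e |] ==> \<exists>q j. hm q X (trg q) & hm j (trg q) X & q ** j = ide (trg q) & j ** q = e"
    and rep_ex: "[| ar c; deg c = 1 |] ==> \<exists>i p. rep c i p"
    and epi_rep: "epi p ==> \<exists>c i. rep c i p"
    and mono_rep: "mono i ==> \<exists>c p. rep c i p"
begin

lemma op_excat: "excat k Ob ar trg src deg ide (%g f. f ** g) pls (%d X Y. zer d Y X) scl"
proof (rule excat.intro[OF op_gcat], unfold excat_axioms_def op_simps op_rep, intro conjI allI impI)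
  fix X Y assume "X \<in> Ob" "Y \<in> Ob"
  then obtain i1 i2 p1 p2 where "bip i1 i2 p1 p2" "src i1 = X" "src i2 = Y" using biproduct_ex by blast
  thus "\<exists>i1 i2 p1 p2. bip p1 p2 i1 i2 & trg i1 = X & trg i2 = Y" using bipD(12,13) by blast
next
  fix e X assume e: "ar e & deg e = 0 & trg e = X & src e = X" "e ** e = e"
  then obtain q j where q: "hm q X (trg q)" "hm j (trg q) X" "q ** j = ide (trg q)" "j ** q = e" using idem_split[of e X] by blast
  show "\<exists>q j. (ar q & deg q = 0 & trg q = X & src q = src q) & (ar j & deg j = 0 & trg j = src q & src j = X) &
       j ** q = ide (src q) & q ** j = e" by (rule exI[of _ j], rule exI[of _ q]) (use q in auto)
qed (use rep_ex epi_rep mono_rep in \<open>blast+\<close>)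

lemma repD:
  assumes "rep c i p"
  shows "ar c" "deg c = 1" "mono i" "epi p" "src i = trg c" "src p = trg i" "trg p = src c" "ar i" "ar p" "deg i = 0" "deg p = 0"
    "!!f. [| ar f; deg f = 0; trg f = src c |] ==> c ** f = zer 1 (src f) (trg c) <-> (\<exists>h. hm h (src f) (trg i) & p ** h = f)"
    "!!g. [| ar g; deg g = 0; src g = trg c |] ==> g ** c = zer 1 (src c) (trg g) <-> (\<exists>h. hm h (trg i) (trg g) & h ** i = g)"
    "!!e. [| ar e; deg e = 1; src e = src c; e ** p = zer 1 (src p) (trg e) |] ==> \<exists>g. hm g (trg c) (trg e) & g ** c = e"
    "!!e. [| ar e; deg e = 1; trg e = trg c; i ** e = zer 1 (src e) (trg i) |] ==> \<exists>f. hm f (src e) (src c) & c ** f = e"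
proof -
  have a: "ar c" "deg c = 1" "mono i" "epi p" "src i = trg c" "src p = trg i" "trg p = src c"
    and r: "rep_right c p" and l: "rep_left c i" using assms unfolding rep_def by blast+
  show "ar c" "deg c = 1" "mono i" "epi p" "src i = trg c" "src p = trg i" "trg p = src c" "ar i" "ar p" "deg i = 0" "deg p = 0"
    using a monoD(1,2)[of i] epiD(1,2)[of p] by simp_all
  show "c ** f = zer 1 (src f) (trg c) <-> (\<exists>h. hm h (src f) (trg i) & p ** h = f)" if "ar f" "deg f = 0" "trg f = src c" for f
    using r that unfolding rep_right_def a(6) by blast
  show "g ** c = zer 1 (src c) (trg g) <-> (\<exists>h. hm h (trg i) (trg g) & h ** i = g)" if "ar g" "deg g = 0" "src g = trg c" for g
    using l that unfolding rep_left_def by blast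
  show "\<exists>g. hm g (trg c) (trg e) & g ** c = e" if "ar e" "deg e = 1" "src e = src c" "e ** p = zer 1 (src p) (trg e)" for e
    using r that unfolding rep_right_def by blast
  show "\<exists>f. hm f (src e) (src c) & c ** f = e" if "ar e" "deg e = 1" "trg e = trg c" "i ** e = zer 1 (src e) (trg i)" for e
    using l that unfolding rep_left_def by blast
qed

definition image_hom :: "'a => 'o => 'a set" where
  "image_hom p C = {p ** h | h. hm h C (src p)}"

definition rdet :: "'a => 'o => bool" where
  "rdet p C <-> (\<forall>t. ar t & deg t = 0 & trg t = trg p & (\<forall>h. hm h C (src t) --> t ** h \<in> image_hom p C) -->
     (\<exists>t'. hm t' (src t) (src p) & p ** t' = t))"

text \<open>The submodules of (REC2). Closure under negatives is contained in closure under
  endomorphisms of \<open>C\<close>.\<close>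

definition endsub :: "'o => 'o => 'a set => bool" where
  "endsub C Y H <-> (\<forall>h\<in>H. hm h C Y) & zer 0 C Y \<in> H & (\<forall>h\<in>H. \<forall>h'\<in>H. h +++ h' \<in> H) &
     (\<forall>h\<in>H. \<forall>a. hm a C C --> h ** a \<in> H)"

definition rec1 :: "'o => bool" where
  "rec1 Y <-> (\<forall>p. epi p & trg p = Y --> (\<exists>C\<in>Ob. rdet p C))"

definition rec2 :: "'o => bool" where
  "rec2 Y <-> (\<forall>C\<in>Ob. \<forall>H. endsub C Y H --> (\<exists>p. epi p & trg p = Y & rdet p C & H = image_hom p C))"

lemma rep_image:
  assumes "rep c i p" "C \<in> Ob"
  shows "f \<in> image_hom p C <-> hm f C (src c) & c ** f = zer 1 C (trg c)"
proof -
  note r = repD[OF assms(1)]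
  show ?thesis
  proof
    assume "f \<in> image_hom p C"
    then obtain h where h: "hm h C (src p)" "f = p ** h" unfolding image_hom_def by blast
    hence "hm f C (src c)" using r(5-11) by simp
    thus "hm f C (src c) & c ** f = zer 1 C (trg c)" using r(12)[of f] h r(6) by auto
  next
    assume f: "hm f C (src c) & c ** f = zer 1 C (trg c)"
    thus "f \<in> image_hom p C" using r(12)[of f] r(6) unfolding image_hom_def by auto
  qed
qed

lemma rep_cp:
  assumes "rep c i p"
  shows "c ** p = zer 1 (src p) (trg c)"
proof -
  note r = repD[OF assms]
  have "\<exists>h. hm h (src p) (trg i) & p ** h = p" using r(6-11) by (intro exI[of _ "ide (src p)"]) simp
  thus ?thesis using r(12)[of p] r(7,9,11) by simp
qed

lemma rep_factor:
  assumes "rep c i p" "ar t" "deg t = 0" "trg t = trg p"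
  shows "(\<exists>t'. hm t' (src t) (src p) & p ** t' = t) <-> c ** t = zer 1 (src t) (trg c)"
  using repD(6,7)[OF assms(1)] repD(12)[OF assms(1), of t] assms by auto

text \<open>The class \<open>c\<close> with components \<open>c1\<close> and \<open>c2\<close> in a
  biproduct of the two kernels is killed by \<open>f\<close> exactly when both components are, so
  the epimorphism that it represents takes the place of a fibre product of \<open>p1\<close> and
  \<open>p2\<close>.\<close>

lemma rdet_inter:
  assumes C: "C \<in> Ob" and p1: "epi p1" "rdet p1 C" and p2: "epi p2" "rdet p2 C" "trg p2 = trg p1"
  shows "\<exists>p. epi p & trg p = trg p1 & rdet p C & image_hom p C = image_hom p1 C \<inter> image_hom p2 C"
proof -
  obtain c1 i1 where r1: "rep c1 i1 p1" using epi_rep[OF p1(1)] by blast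
  obtain c2 i2 where r2: "rep c2 i2 p2" using epi_rep[OF p2(1)] by blast
  note r1' = repD[OF r1] and r2' = repD[OF r2]
  obtain k1 k2 q1 q2 where b: "bip k1 k2 q1 q2" "src k1 = trg c1" "src k2 = trg c2"
    using biproduct_ex[of "trg c1" "trg c2"] r1'(1) r2'(1) by auto
  note b' = bipD[OF b(1), unfolded b(2,3)]
  define c where "c = k1 ** c1 +++ k2 ** c2"
  have s12: "src c2 = src c1" using r1'(7) r2'(7) p2(3) by simp
  have t: "ar c" "deg c = 1" "src c = src c1" "trg c = trg k1" unfolding c_def using b(2,3) b'(1-13) r1'(1,2) r2'(1,2) s12 by simp_all
  have zero_iff: "c ** f = zer 1 (src f) (trg c) <-> c1 ** f = zer 1 (src f) (trg c1) & c2 ** f = zer 1 (src f) (trg c2)"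
    if f: "ar f" "deg f = 0" "trg f = src c1" for f
  proof
    have q: "q1 ** (c ** f) = c1 ** f" "q2 ** (c ** f) = c2 ** f"
      unfolding c_def using f b(2,3) b' r1'(1,2) r2'(1,2) s12 by (simp_all add: dist)
    assume z: "c ** f = zer 1 (src f) (trg c)"
    show "c1 ** f = zer 1 (src f) (trg c1) & c2 ** f = zer 1 (src f) (trg c2)" unfolding q[symmetric] z using f(1) t b(2,3) b'(1-13) by simp
  next
    assume z: "c1 ** f = zer 1 (src f) (trg c1) & c2 ** f = zer 1 (src f) (trg c2)"
    have "c ** f = k1 ** (c1 ** f) +++ k2 ** (c2 ** f)" unfolding c_def using f b(2,3) b'(1-13) r1'(1,2) r2'(1,2) s12 by (simp add: dist)
    thus "c ** f = zer 1 (src f) (trg c)" using z t f(1) b(2,3) b'(1-13) r1'(1,2) r2'(1,2) by simp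
  qed
  obtain i p where r: "rep c i p" using rep_ex[OF t(1,2)] by blast
  note r' = repD[OF r]
  have tp: "trg p = trg p1" using r'(7) t(3) r1'(7) by simp
  have im: "image_hom p C = image_hom p1 C \<inter> image_hom p2 C"
    using rep_image[OF r C] rep_image[OF r1 C] rep_image[OF r2 C] zero_iff t(3) s12 by auto
  moreover have "rdet p C" unfolding rdet_def
  proof (intro allI impI)
    fix u assume u: "ar u & deg u = 0 & trg u = trg p & (\<forall>h. hm h C (src u) --> u ** h \<in> image_hom p C)"
    have "\<exists>t'. hm t' (src u) (src p1) & p1 ** t' = u" using p1(2) u im tp unfolding rdet_def by auto
    hence 1: "c1 ** u = zer 1 (src u) (trg c1)" using rep_factor[OF r1, of u] u tp by simp
    have "\<exists>t'. hm t' (src u) (src p2) & p2 ** t' = u" using p2(2,3) u im tp unfolding rdet_def by auto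
    hence 2: "c2 ** u = zer 1 (src u) (trg c2)" using rep_factor[OF r2, of u] u tp p2(3) by simp
    show "\<exists>t'. hm t' (src u) (src p) & p ** t' = u" using rep_factor[OF r, of u] zero_iff[of u] 1 2 u tp r1'(7) by simp
  qed
  ultimately show ?thesis using r'(4) tp by blast
qed

lemma rdet_ide:
  assumes "Y \<in> Ob"
  shows "epi (ide Y) & trg (ide Y) = Y & rdet (ide Y) C & image_hom (ide Y) C = {f. hm f C Y}"
proof -
  have "rdet (ide Y) C" unfolding rdet_def using assms by auto
  moreover have "epi (ide Y)" unfolding epi_def using assms by auto
  moreover have "image_hom (ide Y) C = {f. hm f C Y}" unfolding image_hom_def
  proof (intro equalityI subsetI)
    fix x assume "x \<in> {f. hm f C Y}"
    thus "x \<in> {ide Y ** h |h. hm h C (src (ide Y))}" using assms by (intro CollectI exI[of _ x]) simp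
  qed (use assms in auto)
  ultimately show ?thesis using assms by simp
qed

lemma endsub_subm:
  assumes "endsub C Y H" "C \<in> Ob"
  shows "subm k (HM 0 C Y) H"
proof (rule submI)
  show "x \<in> carrier (HM 0 C Y)" if "x \<in> H" for x using assms that unfolding endsub_def by (auto simp: HM_simps)
  show "a .[HM 0 C Y] x \<in> H" if "a \<in> carrier k" "x \<in> H" for a x
  proof -
    have x: "hm x C Y" using assms that(2) unfolding endsub_def by blast
    hence "a \<star> x = x ** (a \<star> ide C)" using that(1) assms(2) by (simp add: dist)
    moreover have "hm (a \<star> ide C) C C" using that(1) assms(2) by simp
    ultimately show ?thesis using assms(1) that(2) unfolding endsub_def by (auto simp: HM_simps)
  qed
qed (use assms in \<open>auto simp: endsub_def HM_simps\<close>)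

end

section \<open>Serre pairings and how they classify epimorphisms\<close>

locale serre = excat k Ob ar src trg deg ide cmp pls zer scl + matlis k E for k :: "'k ring" and Ob :: "'o set" and ar :: "'a => bool"
    and src trg :: "'a => 'o" and deg :: "'a => nat" and ide :: "'o => 'a"
    and cmp :: "'a => 'a => 'a" (infixl \<open>**\<close> 75)
    and pls :: "'a => 'a => 'a" (infixl \<open>+++\<close> 65)
    and zer :: "nat => 'o => 'o => 'a"
    and scl :: "'k => 'a => 'a" (infixr \<open>\<star>\<close> 80)
    and E :: "('k, 'e) module" +
  assumes hom_fgen: "[| X \<in> Ob; Y \<in> Ob |] ==> fgen k (HM 0 X Y)"
begin

lemma op_serre: "serre k Ob ar trg src deg ide (%g f. f ** g) pls (%d X Y. zer d Y X) scl E"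
  by (rule serre.intro[OF op_excat matlis_axioms], unfold serre_axioms_def op_simps) (use hom_fgen in auto)

lemma ext_mod: "X \<in> Ob ==> Y \<in> Ob ==> module k (HM 1 X Y)" by (rule hom_module) auto

lemma hom_mod0: "X \<in> Ob ==> Y \<in> Ob ==> module k (HM 0 X Y)" by (rule hom_module) auto

abbreviation func :: "'o => 'o => ('a => 'e) set" where
  "func X Y \<equiv> lin_hom k (HM 1 X Y) E"

lemma funcD:
  assumes "t \<in> func X Y" "X \<in> Ob" "Y \<in> Ob"
  shows "!!e. [| ar e; deg e = 1; src e = X; trg e = Y |] ==> t e \<in> carrier E"
    "!!e e'. [| ar e; deg e = 1; src e = X; trg e = Y; ar e'; deg e' = 1; src e' = X; trg e' = Y |] ==> t (e +++ e') = t e +[E] t e'"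
    "!!a e. [| a \<in> carrier k; ar e; deg e = 1; src e = X; trg e = Y |] ==> t (a \<star> e) = a .[E] t e"
    "t (zer 1 X Y) = 0[E]"
proof -
  note t = lin_homD[OF assms(1)]
  show "t e \<in> carrier E" if "ar e" "deg e = 1" "src e = X" "trg e = Y" for e using t(1)[of e] that by (simp add: HM_simps)
  show "t (e +++ e') = t e +[E] t e'" if "ar e" "deg e = 1" "src e = X" "trg e = Y" "ar e'" "deg e' = 1" "src e' = X" "trg e' = Y" for e e'
    using t(2)[of e e'] that by (simp add: HM_simps)
  show "t (a \<star> e) = a .[E] t e" if "a \<in> carrier k" "ar e" "deg e = 1" "src e = X" "trg e = Y" for a e
    using t(3)[of a e] that by (simp add: HM_simps)
  interpret M: module k "HM 1 X Y" by (rule ext_mod[OF assms(2,3)])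
  show "t (zer 1 X Y) = 0[E]" using M.lin_zero[OF lin_hom_lin_on[OF assms(1)] M.subm_carrier E_module] by (simp add: HM_simps)
qed

lemma func_eqI:
  assumes "d \<in> func X Y" "d' \<in> func X Y" "!!e. [| ar e; deg e = 1; src e = X; trg e = Y |] ==> d e = d' e"
  shows "d = d'" by (rule lin_hom_eqI[OF assms(1,2)]) (use assms(3) in \<open>auto simp: HM_simps\<close>)

lemma func_sep:
  assumes "ar e" "deg e = 1" "e ~= zer 1 (src e) (trg e)"
  shows "\<exists>d\<in>func (src e) (trg e). d e ~= 0[E]"
proof -
  interpret M: module k "HM 1 (src e) (trg e)" by (rule ext_mod) (use assms in auto)
  show ?thesis using dual_separates[OF M.module_axioms M.subm_zero, of e] assms by (auto simp: HM_simps)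
qed

definition push_func :: "'o => 'o => ('a => 'e) => 'a => 'a => 'e" where
  "push_func X Y t g = (\<lambda>e\<in>carrier (HM 1 X Y). t (g ** e))"

lemma push_func_val: "[| ar e; deg e = 1; src e = X; trg e = Y |] ==> push_func X Y t g e = t (g ** e)"
  unfolding push_func_def by (simp add: HM_simps)

lemma push_func:
  assumes t: "t \<in> func X K" and X: "X \<in> Ob" and g: "hm g Y K"
  shows "push_func X Y t g \<in> func X Y"
proof -
  have Y: "Y \<in> Ob" "K \<in> Ob" using g by auto
  note t' = funcD[OF t X Y(2)]
  have "lin_on k (HM 1 X Y) E (carrier (HM 1 X Y)) (%e. t (g ** e))"
    by (rule lin_onI) (use g t' in \<open>simp_all add: HM_simps dist\<close>)
  from lin_on_lin_hom[OF ext_mod[OF X Y(1)] this] show ?thesis unfolding push_func_def .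
qed

text \<open>In the language of Yoneda: \<open>K\<close> represents the contravariant functor that
  takes \<open>Y\<close> to the dual of \<open>Ext(X, Y)\<close>, and \<open>t\<close> is the
  universal element.\<close>

definition SPl :: "'o => 'o => ('a => 'e) => bool" where
  "SPl X K t <-> X \<in> Ob & K \<in> Ob & t \<in> func X K &
     (\<forall>Y\<in>Ob. \<forall>d\<in>func X Y. \<exists>g. hm g Y K & push_func X Y t g = d) &
     (\<forall>g g'. ar g & ar g' & deg g = 0 & deg g' = 0 & trg g = K & trg g' = K & src g' = src g &
        push_func X (src g) t g = push_func X (src g) t g' --> g = g')"

text \<open>The same condition in the opposite category: \<open>X\<close> represents the covariant
  functor that takes \<open>Y\<close> to the dual of \<open>Ext(Y, K)\<close>.\<close>

definition SPr :: "'o => 'o => ('a => 'e) => bool" where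
  "SPr X K t = serre.SPl k Ob ar trg src deg (%g f. f ** g) pls (%d X Y. zer d Y X) scl E K X t"

definition SP :: "'o => 'o => ('a => 'e) => bool" where
  "SP X K t <-> SPl X K t & SPr X K t"

lemma SPlD:
  assumes "SPl X K t"
  shows "X \<in> Ob" "K \<in> Ob" "t \<in> func X K"
   "!!Y d. [| Y \<in> Ob; d \<in> func X Y |] ==> \<exists>g. hm g Y K & push_func X Y t g = d"
   "!!g g' Y. [| hm g Y K; hm g' Y K; push_func X Y t g = push_func X Y t g' |] ==> g = g'" using assms unfolding SPl_def by blast+

lemma op_SPl: "serre.SPl k Ob ar trg src deg (%g f. f ** g) pls (%d X Y. zer d Y X) scl E K X t = SPr X K t" unfolding SPr_def ..

lemma op_SPr: "serre.SPr k Ob ar trg src deg (%g f. f ** g) pls (%d X Y. zer d Y X) scl E K X t = SPl X K t"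
  unfolding serre.SPr_def[OF op_serre] ..

lemma op_SP: "serre.SP k Ob ar trg src deg (%g f. f ** g) pls (%d X Y. zer d Y X) scl E K X t = SP X K t"
  unfolding serre.SP_def[OF op_serre] op_SPl op_SPr SP_def by auto

definition pull_func :: "'o => 'o => ('a => 'e) => 'a => 'a => 'e" where
  "pull_func Y K t n = (\<lambda>e\<in>carrier (HM 1 Y K). t (e ** n))"

lemma pull_func_val: "[| ar e; deg e = 1; src e = Y; trg e = K |] ==> pull_func Y K t n e = t (e ** n)"
  unfolding pull_func_def by (simp add: HM_simps)

lemma op_push_func: "serre.push_func ar trg src deg (%g f. f ** g) pls (%d X Y. zer d Y X) scl K Y t n = pull_func Y K t n"
  unfolding serre.push_func_def[OF op_serre] pull_func_def op_simps ..

lemma pull_func: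
  assumes t: "t \<in> func X K" and K: "K \<in> Ob" and n: "hm n X Y"
  shows "pull_func Y K t n \<in> func Y K" using serre.push_func[OF op_serre, of t K X n Y] assms unfolding op_simps op_push_func by auto

lemma SPrD:
  assumes "SPr X K t"
  shows "X \<in> Ob" "K \<in> Ob" "t \<in> func X K"
   "!!Y d. [| Y \<in> Ob; d \<in> func Y K |] ==> \<exists>n. hm n X Y & pull_func Y K t n = d"
   "!!n n' Y. [| hm n X Y; hm n' X Y; pull_func Y K t n = pull_func Y K t n' |] ==> n = n'"
  using serre.SPlD[OF op_serre, of K X t] assms unfolding op_SPl op_simps op_push_func by blast+

text \<open>A nonzero class is detected by a functional on its \<open>Ext\<close> module, and every
  such functional has the form \<open>e \<mapsto> t (e ** n)\<close> with \<open>n\<close> starting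
  at \<open>X\<close>.\<close>

lemma SPr_sep:
  assumes s: "SPr X K t" and e: "ar e" "deg e = 1" "trg e = K" and z: "!!h. hm h X (src e) ==> t (e ** h) = 0[E]"
  shows "e = zer 1 (src e) K"
proof (rule ccontr)
  assume "e ~= zer 1 (src e) K"
  then obtain d where d: "d \<in> func (src e) K" "d e ~= 0[E]" using func_sep[OF e(1,2)] e(3) by auto
  have "src e \<in> Ob" using e by simp
  then obtain n where n: "hm n X (src e)" "pull_func (src e) K t n = d" using SPrD(4)[OF s _ d(1)] by blast
  have "d e = t (e ** n)" unfolding n(2)[symmetric] by (rule pull_func_val) (use e in auto)
  thus False using z[OF n(1)] d(2) by simp
qed

lemma SPr_rdet:
  assumes s: "SPr C K t" and r: "rep c i p" "trg c = K"
  shows "rdet p C" unfolding rdet_def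
proof (intro allI impI)
  note r' = repD[OF r(1)]
  have C: "C \<in> Ob" "K \<in> Ob" "t \<in> func C K" using SPrD[OF s] by auto
  fix u assume u: "ar u & deg u = 0 & trg u = trg p & (\<forall>h. hm h C (src u) --> u ** h \<in> image_hom p C)"
  have "c ** u = zer 1 (src (c ** u)) K"
  proof (rule SPr_sep[OF s])
    fix h assume h: "hm h C (src (c ** u))"
    hence h': "hm h C (src u)" using u r'(1,2,7) by simp
    hence "c ** (u ** h) = zer 1 C K" using u rep_image[OF r(1) C(1), of "u ** h"] r(2) by simp
    thus "t ((c ** u) ** h) = 0[E]" using h' u r'(1,2,7) funcD(4)[OF C(3,1,2)] by simp
  qed (use u r' r(2) in auto)
  hence "c ** u = zer 1 (src u) (trg c)" using u r' r(2) by simp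
  thus "\<exists>t'. hm t' (src u) (src p) & p ** t' = u" using rep_factor[OF r(1), of u] u by simp
qed

text \<open>The pairing maps \<open>Hom(X, Y)\<close> onto the dual of \<open>Ext(Y, K)\<close>, so
  this dual is finitely generated, and \<open>fgen_from_dual\<close> descends to
  \<open>Ext(Y, K)\<close> itself.\<close>

lemma SPr_fgen:
  assumes s: "SPr X K t" and Y: "Y \<in> Ob"
  shows "fgen k (HM 1 Y K)"
proof -
  have C: "X \<in> Ob" "K \<in> Ob" "t \<in> func X K" using SPrD[OF s] by auto
  note t = funcD[OF C(3,1,2)]
  have M: "module k (HM 1 Y K)" by (rule ext_mod[OF Y C(2)])
  have "fgen k (dual_module k E (HM 1 Y K))"
  proof (rule fgen_iso[OF hom_mod0[OF C(1) Y] hom_fgen[OF C(1) Y] dual_is_module[OF M E_module]])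
    show "lin_on k (HM 0 X Y) (dual_module k E (HM 1 Y K)) (carrier (HM 0 X Y)) (pull_func Y K t)"
    proof (rule lin_onI)
      show "pull_func Y K t n \<in> carrier (dual_module k E (HM 1 Y K))" if "n \<in> carrier (HM 0 X Y)" for n
        using pull_func[OF C(3,2), of n Y] that by (simp add: dual_simps HM_simps)
      show "pull_func Y K t (n +[HM 0 X Y] n') = pull_func Y K t n +[dual_module k E (HM 1 Y K)] pull_func Y K t n'"
        if "n \<in> carrier (HM 0 X Y)" "n' \<in> carrier (HM 0 X Y)" for n n'
        using that t unfolding pull_func_def by (auto simp: dual_simps HM_simps dist intro!: restrict_ext)
      show "pull_func Y K t (a .[HM 0 X Y] n) = a .[dual_module k E (HM 1 Y K)] pull_func Y K t n"
        if "a \<in> carrier k" "n \<in> carrier (HM 0 X Y)" for a n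
        using that t unfolding pull_func_def by (auto simp: dual_simps HM_simps dist intro!: restrict_ext)
    qed
    show "carrier (dual_module k E (HM 1 Y K)) \<subseteq> pull_func Y K t ` carrier (HM 0 X Y)"
      using SPrD(4)[OF s Y] by (auto simp: dual_simps HM_simps)
  qed
  thus ?thesis by (rule fgen_from_dual[OF M])
qed

text \<open>Under the isomorphism of \<open>Hom(X, Y)\<close> with the dual of
  \<open>Ext(Y, K)\<close>, the functional \<open>\<xi>\<close> becomes an element of a double dual.
  Reflexivity, available by \<open>SPr_fgen\<close>, makes it evaluation at a class
  \<open>c\<close>.\<close>

lemma SPr_realize:
  assumes s: "SPr X K t" and Y: "Y \<in> Ob" and \<xi>: "\<xi> \<in> lin_hom k (HM 0 X Y) E"
  shows "\<exists>c. ar c & deg c = 1 & src c = Y & trg c = K & (\<forall>n. hm n X Y --> \<xi> n = t (c ** n))"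
proof -
  have C: "X \<in> Ob" "K \<in> Ob" "t \<in> func X K" using SPrD[OF s] by auto
  note t = funcD[OF C(3,1,2)] and x = lin_homD[OF \<xi>]
  have M: "module k (HM 1 Y K)" by (rule ext_mod[OF Y C(2)])
  define \<nu> where "\<nu> d = (THE n. hm n X Y & pull_func Y K t n = d)" for d
  have nu: "\<nu> (pull_func Y K t n) = n" if "hm n X Y" for n unfolding \<nu>_def by (rule the_equality) (use that SPrD(5)[OF s] in blast)+
  have sum: "pull_func Y K t n +[dual_module k E (HM 1 Y K)] pull_func Y K t n' = pull_func Y K t (n +++ n')"
    if "hm n X Y" "hm n' X Y" for n n' using that t unfolding pull_func_def by (auto simp: dual_simps HM_simps dist intro!: restrict_ext)
  have mul: "a .[dual_module k E (HM 1 Y K)] pull_func Y K t n = pull_func Y K t (a \<star> n)" if "a \<in> carrier k" "hm n X Y" for a n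
    using that t unfolding pull_func_def by (auto simp: dual_simps HM_simps dist intro!: restrict_ext)
  have "lin_on k (dual_module k E (HM 1 Y K)) E (func Y K) (%d. \<xi> (\<nu> d))"
  proof (rule lin_onI)
    fix d assume "d \<in> func Y K"
    then obtain n where n: "hm n X Y" "d = pull_func Y K t n" using SPrD(4)[OF s Y] by blast
    thus "\<xi> (\<nu> d) \<in> carrier E" using nu x(1)[of n] by (simp add: HM_simps)
    fix d' assume "d' \<in> func Y K"
    then obtain n' where n': "hm n' X Y" "d' = pull_func Y K t n'" using SPrD(4)[OF s Y] by blast
    show "\<xi> (\<nu> (d +[dual_module k E (HM 1 Y K)] d')) = \<xi> (\<nu> d) +[E] \<xi> (\<nu> d')"
      unfolding n(2) n'(2) sum[OF n(1) n'(1)] using nu[OF n(1)] nu[OF n'(1)] nu[of "n +++ n'"] n(1) n'(1) x(2)[of n n']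
      by (simp add: HM_simps)
  next
    fix a d assume a: "a \<in> carrier k" and "d \<in> func Y K"
    then obtain n where n: "hm n X Y" "d = pull_func Y K t n" using SPrD(4)[OF s Y] by blast
    show "\<xi> (\<nu> (a .[dual_module k E (HM 1 Y K)] d)) = a .[E] \<xi> (\<nu> d)"
      unfolding n(2) mul[OF a n(1)] using nu[OF n(1)] nu[of "a \<star> n"] n(1) a x(3)[of a n] by (simp add: HM_simps)
  qed
  from reflexive[OF M SPr_fgen[OF s Y] this] obtain c where c: "c \<in> carrier (HM 1 Y K)" "!!d. d \<in> func Y K ==> \<xi> (\<nu> d) = d c" by blast
  have "\<xi> n = t (c ** n)" if n: "hm n X Y" for n
    using c(2)[OF pull_func[OF C(3,2) n]] nu[OF n] pull_func_val[of c Y K t n] c(1) by (simp add: HM_simps)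
  thus ?thesis using c(1) by (auto simp: HM_simps)
qed

text \<open>Since \<open>Hom(C, Y)\<close> satisfies the descending chain condition, it suffices to realise for each
  \<open>n \<notin> H\<close> a submodule containing \<open>H\<close> but not \<open>n\<close>.\<close>

theorem SP_rec:
  assumes all: "!!C. C \<in> Ob ==> \<exists>K t. SP C K t" "!!K. K \<in> Ob ==> \<exists>C t. SP C K t" and Y: "Y \<in> Ob"
  shows "rec1 Y" "rec2 Y"
proof -
  show "rec1 Y" unfolding rec1_def
  proof (intro allI impI)
    fix p assume p: "epi p & trg p = Y"
    then obtain c i where r: "rep c i p" using epi_rep by blast
    obtain C t where "SP C (trg c) t" using all(2)[of "trg c"] repD(1)[OF r] by auto
    hence s: "SPr C (trg c) t" unfolding SP_def by simp
    show "\<exists>C\<in>Ob. rdet p C" using SPr_rdet[OF s r refl] SPrD(1)[OF s] by blast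
  qed
  show "rec2 Y" unfolding rec2_def
  proof (intro ballI allI impI)
    fix C H assume C: "C \<in> Ob" and H: "endsub C Y H"
    obtain K t where "SP C K t" using all(1)[OF C] by blast
    hence s: "SPr C K t" unfolding SP_def by simp
    have K: "K \<in> Ob" "t \<in> func C K" using SPrD[OF s] by auto
    interpret N: module k "HM 0 C Y" by (rule hom_mod0[OF C Y])
    have dccN: "dcc (subm k (HM 0 C Y))" by (rule fgen_dcc[OF N.module_axioms dcc_ideals hom_fgen[OF C Y]])
    have Hh: "!!h. h \<in> H ==> hm h C Y" using H unfolding endsub_def by blast
    have separate: "\<exists>p. epi p & trg p = Y & rdet p C & H \<subseteq> image_hom p C & n \<notin> image_hom p C"
      if n: "hm n C Y" "n \<notin> H" for n
    proof -
      obtain \<xi> where x: "\<xi> \<in> lin_hom k (HM 0 C Y) E" "!!h. h \<in> H ==> \<xi> h = 0[E]" "\<xi> n ~= 0[E]"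
        using dual_separates[OF N.module_axioms endsub_subm[OF H C], of n] n by (auto simp: HM_simps)
      obtain c where c: "ar c" "deg c = 1" "src c = Y" "trg c = K" "!!n. hm n C Y ==> \<xi> n = t (c ** n)"
        using SPr_realize[OF s Y x(1)] by blast
      obtain i p where r: "rep c i p" using rep_ex[OF c(1,2)] by blast
      have p: "epi p" "trg p = Y" using repD(4,7)[OF r] c(3) by auto
      have "h \<in> image_hom p C" if h: "h \<in> H" for h
      proof -
        have h': "hm h C Y" using Hh h .
        \<comment> \<open>Since \<open>H\<close> is closed under endomorphisms of \<open>C\<close>,
          the class \<open>c h\<close> pairs to zero with all of \<open>Hom(C, C)\<close> and
          vanishes.\<close>
        have "c ** h = zer 1 (src (c ** h)) K"
        proof (rule SPr_sep[OF s])
          fix a assume "hm a C (src (c ** h))"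
          hence a: "hm a C C" using h' c by simp
          hence "h ** a \<in> H" using H h unfolding endsub_def by blast
          thus "t ((c ** h) ** a) = 0[E]" using x(2)[of "h ** a"] c(5)[of "h ** a"] Hh a h' c(1-4) by simp
        qed (use h' c(1-4) in auto)
        thus ?thesis using rep_image[OF r C, of h] h' c(1-4) by simp
      qed
      moreover have "n \<notin> image_hom p C"
      proof
        assume "n \<in> image_hom p C"
        hence "c ** n = zer 1 C K" using rep_image[OF r C, of n] c by simp
        thus False using c(5)[OF n(1)] x(3) funcD(4)[OF K(2) C K(1)] by simp
      qed
      ultimately show ?thesis using p SPr_rdet[OF s r c(4)] by blast
    qed
    \<comment> \<open>These images are closed under intersection by \<open>rdet_inter\<close>, so a
      minimal one is contained in all the others; by \<open>separate\<close> it is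
      \<open>H\<close>.\<close>
    define Q where "Q W <-> H \<subseteq> W & (\<exists>p. epi p & trg p = Y & rdet p C & W = image_hom p C)" for W
    have Q0: "Q {f. hm f C Y}" unfolding Q_def using rdet_ide[OF Y, of C] Hh by (intro conjI exI[of _ "ide Y"]) auto
    have sub: "subm k (HM 0 C Y) W" if QW: "Q W" for W
    proof -
      obtain p where p: "epi p" "trg p = Y" "W = image_hom p C" using QW unfolding Q_def by blast
      note e = epiD(1,2)[OF p(1)]
      show ?thesis unfolding p(3)
      proof (rule submI)
        show "x \<in> carrier (HM 0 C Y)" if "x \<in> image_hom p C" for x
          using that e p(2) unfolding image_hom_def by (auto simp: HM_simps)
        show "0[HM 0 C Y] \<in> image_hom p C" unfolding image_hom_def HM_simps using e p(2) C by (auto intro!: exI[of _ "zer 0 C (src p)"])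
        fix x assume "x \<in> image_hom p C"
        then obtain h where h: "hm h C (src p)" "x = p ** h" unfolding image_hom_def by blast
        show "a .[HM 0 C Y] x \<in> image_hom p C" if "a \<in> carrier k" for a
          using h e that unfolding image_hom_def HM_simps by (auto intro!: exI[of _ "a \<star> h"] simp: dist)
        fix y assume "y \<in> image_hom p C"
        then obtain h' where h': "hm h' C (src p)" "y = p ** h'" unfolding image_hom_def by blast
        show "x +[HM 0 C Y] y \<in> image_hom p C"
          using h h' e unfolding image_hom_def HM_simps by (auto intro!: exI[of _ "h +++ h'"] simp: dist)
      qed
    qed
    obtain W where W: "Q W" "!!V. Q V ==> V \<subseteq> W ==> V = W" using dcc_minimal[OF dccN, of Q, OF Q0 sub] by blast
    obtain p where p: "epi p" "trg p = Y" "rdet p C" "W = image_hom p C" "H \<subseteq> W" using W(1) unfolding Q_def by blast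
    have "W \<subseteq> H"
    proof
      fix n assume n: "n \<in> W"
      show "n \<in> H"
      proof (rule ccontr)
        assume nH: "n \<notin> H"
        have "hm n C Y" using n p epiD(1,2)[OF p(1)] unfolding image_hom_def by auto
        from separate[OF this nH] obtain p2 where p2: "epi p2" "trg p2 = Y" "rdet p2 C" "H \<subseteq> image_hom p2 C" "n \<notin> image_hom p2 C" by blast
        obtain p3 where p3: "epi p3" "trg p3 = trg p" "rdet p3 C" "image_hom p3 C = image_hom p C \<inter> image_hom p2 C"
          using rdet_inter[OF C p(1,3) p2(1,3)] p(2) p2(2) by auto
        have "Q (W \<inter> image_hom p2 C)" unfolding Q_def using p3 p p2 by auto
        hence "W \<inter> image_hom p2 C = W" using W(2) by blast
        thus False using n p2(5) by blast
      qed
    qed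
    hence "H = W" using p(5) by blast
    thus "\<exists>p. epi p & trg p = Y & rdet p C & H = image_hom p C" using p by blast
  qed
qed

end

section \<open>Indecomposable objects, Fitting's lemma and almost split classes\<close>

context gcat begin

primrec pw :: "'a => nat => 'a" where
  "pw f 0 = ide (src f)"
| "pw f (Suc n) = f ** pw f n"

lemma pw_hm: "hm f X X ==> hm (pw f n) X X" by (induction n) auto

lemma pw_add: "hm f X X ==> pw f (m + n) = pw f m ** pw f n"
proof (induction m)
  case 0
  thus ?case using pw_hm[of f X n] by simp
next
  case (Suc m)
  thus ?case using pw_hm[of f X m] pw_hm[of f X n] by simp
qed

lemma pw_Suc_right: "hm f X X ==> pw f (Suc n) = pw f n ** f" using pw_add[of f X n 1] by simp

definition iso :: "'a => bool" where "iso f <-> (\<exists>g. inv_pair f g)"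

definition split_epi :: "'a => bool" where
  "split_epi f <-> (\<exists>s. hm s (trg f) (src f) & f ** s = ide (trg f))"

definition indec :: "'o => bool" where
  "indec X <-> X \<in> Ob & ide X ~= zer 0 X X & (\<forall>e. hm e X X & e ** e = e --> e = ide X \<or> e = zer 0 X X)"

text \<open>Formulated for the class instead of the sequence: the epimorphism of a nonsplit sequence
  with class \<open>z\<close> is right almost split.\<close>

definition ras :: "'a => bool" where
  "ras z <-> ar z & deg z = 1 & z ~= zer 1 (src z) (trg z) &
     (\<forall>f. ar f & deg f = 0 & trg f = src z & \<not> split_epi f --> z ** f = zer 1 (src f) (trg z))"

definition lmin :: "'a => bool" where
  "lmin z <-> (\<forall>g. hm g (trg z) (trg z) & g ** z = z --> iso g)"

lemma isoI:
  assumes "hm f X Y" "hm g Y X" "g ** f = ide X" "f ** g = ide Y"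
  shows "iso f" unfolding iso_def inv_pair_def using assms by auto

lemma indec_right_inv:
  assumes X: "indec X" and f: "hm f X X" "hm r X X" "f ** r = ide X"
  shows "iso f"
proof -
  have XO: "X \<in> Ob" using X unfolding indec_def by simp
  have "(r ** f) ** (r ** f) = r ** f" using f pre_cancel[OF f(3), of f] XO by simp
  hence "r ** f = ide X \<or> r ** f = zer 0 X X" using X f unfolding indec_def by auto
  moreover have "r ** f ~= zer 0 X X"
  proof
    assume z: "r ** f = zer 0 X X"
    have "f ** (r ** f) = f" using pre_cancel[OF f(3), of f] f by simp
    hence "f = zer 0 X X" using z f XO by simp
    hence "f ** r = zer 0 X X ** r" by (simp only:)
    hence "f ** r = zer 0 X X" using f(2) XO by simp
    thus False using f(3) X unfolding indec_def by simp
  qed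
  ultimately show ?thesis using isoI[of f X X r] f by blast
qed

lemma indec_split_epi_iso:
  assumes X: "indec X" and f: "hm f X Y" "split_epi f" "f ~= zer 0 X Y"
  shows "iso f"
proof -
  obtain s where s: "hm s Y X" "f ** s = ide Y" using f unfolding split_epi_def by auto
  have XO: "X \<in> Ob" "Y \<in> Ob" using f by auto
  have "(s ** f) ** (s ** f) = s ** f" using f(1) s pre_cancel[OF s(2), of f] XO by simp
  hence "s ** f = ide X \<or> s ** f = zer 0 X X" using X f(1) s(1) unfolding indec_def by auto
  moreover have "s ** f ~= zer 0 X X"
  proof
    assume z: "s ** f = zer 0 X X"
    have "f ** (s ** f) = f" using pre_cancel[OF s(2), of f] f(1) s(1) by simp
    thus False using z f(1,3) XO by simp
  qed
  ultimately show ?thesis using isoI[of f X Y s] f(1) s by blast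
qed

lemma iso_cancel_left:
  assumes "iso (g ** f)" "hm f X X" "hm g X X"
  shows "\<exists>r. hm r X X & r ** f = ide X" "\<exists>r. hm r X X & g ** r = ide X"
proof -
  obtain h where "inv_pair (g ** f) h" using assms(1) unfolding iso_def by blast
  note h = inv_pairD[OF this]
  have t: "hm h X X" "h ** (g ** f) = ide X" "(g ** f) ** h = ide X" using h assms(2,3) by auto
  show "\<exists>r. hm r X X & r ** f = ide X" by (rule exI[of _ "h ** g"]) (use t assms(2,3) in auto)
  show "\<exists>r. hm r X X & g ** r = ide X" by (rule exI[of _ "f ** h"]) (use t assms(2,3) in auto)
qed

end

context serre begin

text \<open>The sets \<open>f^n End(X)\<close> and \<open>End(X) f^n\<close> are descending chains
  of \<open>k\<close>-submodules of \<open>End(X)\<close>, hence stationary; comparing the exponents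
  \<open>n\<close> and \<open>2 n\<close> gives the two equations.\<close>

lemma fitting_stab:
  assumes f: "hm f X X"
  shows "\<exists>n>0. \<exists>r r'. hm r X X & hm r' X X & pw f n = pw f (n + n) ** r & pw f n = r' ** pw f (n + n)"
proof -
  have X: "X \<in> Ob" using f by auto
  interpret R: module k "HM 0 X X" by (rule hom_mod0[OF X X])
  have dccR: "dcc (subm k (HM 0 X X))" by (rule fgen_dcc[OF R.module_axioms dcc_ideals hom_fgen[OF X X]])
  note p = pw_hm[OF f]
  define I where "I n = {pw f n ** r | r. hm r X X}" for n
  define J where "J n = {r ** pw f n | r. hm r X X}" for n
  have I: "subm k (HM 0 X X) (I n)" for n
  proof (rule submI)
    show "0[HM 0 X X] \<in> I n" unfolding I_def HM_simps using p[of n] X by (auto intro!: exI[of _ "zer 0 X X"])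
    fix x assume "x \<in> I n"
    then obtain r where r: "hm r X X" "x = pw f n ** r" unfolding I_def by blast
    show "x \<in> carrier (HM 0 X X)" using r p[of n] by (simp add: HM_simps)
    show "a .[HM 0 X X] x \<in> I n" if "a \<in> carrier k" for a
      unfolding I_def HM_simps using r p[of n] that by (auto intro!: exI[of _ "a \<star> r"] simp: dist)
    fix y assume "y \<in> I n"
    then obtain r' where r': "hm r' X X" "y = pw f n ** r'" unfolding I_def by blast
    show "x +[HM 0 X X] y \<in> I n" unfolding I_def HM_simps using r r' p[of n] by (auto intro!: exI[of _ "r +++ r'"] simp: dist)
  qed
  have J: "subm k (HM 0 X X) (J n)" for n
  proof (rule submI)
    show "0[HM 0 X X] \<in> J n" unfolding J_def HM_simps using p[of n] X by (auto intro!: exI[of _ "zer 0 X X"])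
    fix x assume "x \<in> J n"
    then obtain r where r: "hm r X X" "x = r ** pw f n" unfolding J_def by blast
    show "x \<in> carrier (HM 0 X X)" using r p[of n] by (simp add: HM_simps)
    show "a .[HM 0 X X] x \<in> J n" if "a \<in> carrier k" for a
      unfolding J_def HM_simps using r p[of n] that by (auto intro!: exI[of _ "a \<star> r"] simp: dist)
    fix y assume "y \<in> J n"
    then obtain r' where r': "hm r' X X" "y = r' ** pw f n" unfolding J_def by blast
    show "x +[HM 0 X X] y \<in> J n" unfolding J_def HM_simps using r r' p[of n] by (auto intro!: exI[of _ "r +++ r'"] simp: dist)
  qed
  have "I (Suc n) \<subseteq> I n" for n
  proof
    fix x assume "x \<in> I (Suc n)"
    then obtain r where r: "hm r X X" "x = pw f (Suc n) ** r" unfolding I_def by blast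
    hence "x = pw f n ** (f ** r)" unfolding pw_Suc_right[OF f] using p[of n] f by simp
    thus "x \<in> I n" unfolding I_def using r(1) f by (intro CollectI exI[of _ "f ** r"]) simp
  qed
  hence "\<exists>N. \<forall>n\<ge>N. I n = I N" by (rule dccD[where I = I, OF dccR I])
  then obtain N1 where N1: "!!n. n \<ge> N1 ==> I n = I N1" by blast
  have "J (Suc n) \<subseteq> J n" for n
  proof
    fix x assume "x \<in> J (Suc n)"
    then obtain r where r: "hm r X X" "x = r ** pw f (Suc n)" unfolding J_def by blast
    hence "x = (r ** f) ** pw f n" using p[of n] f by simp
    thus "x \<in> J n" unfolding J_def using r(1) f by (intro CollectI exI[of _ "r ** f"]) simp
  qed
  hence "\<exists>N. \<forall>n\<ge>N. J n = J N" by (rule dccD[where I = J, OF dccR J])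
  then obtain N2 where N2: "!!n. n \<ge> N2 ==> J n = J N2" by blast
  \<comment> \<open>A positive exponent, so that \<open>iso_from_fitting\<close> can split one
    factor \<open>f\<close> off the power.\<close>
  obtain n where n_def: "n = Suc (N1 + N2)" by blast
  have "pw f n \<in> I n" unfolding I_def using p[of n] X by (intro CollectI exI[of _ "ide X"]) simp
  hence "pw f n \<in> I (n + n)" using N1[of n] N1[of "n + n"] unfolding n_def by simp
  then obtain r where r: "hm r X X" "pw f n = pw f (n + n) ** r" unfolding I_def by blast
  have "pw f n \<in> J n" unfolding J_def using p[of n] X by (intro CollectI exI[of _ "ide X"]) simp
  hence "pw f n \<in> J (n + n)" using N2[of n] N2[of "n + n"] unfolding n_def by simp
  then obtain r' where r': "hm r' X X" "pw f n = r' ** pw f (n + n)" unfolding J_def by blast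
  have n0: "n > 0" unfolding n_def by simp
  have "\<exists>r r'. hm r X X & hm r' X X & pw f n = pw f (n + n) ** r & pw f n = r' ** pw f (n + n)"
    by (rule exI[of _ r], rule exI[of _ r'], rule conjI[OF r(1) conjI[OF r'(1) conjI[OF r(2) r'(2)]]])
  thus ?thesis using n0 by blast
qed

text \<open>For \<open>a = f^n\<close> with \<open>a = a^2 r = r' a^2\<close> one finds
  \<open>a r = r' a\<close>. This element is idempotent and acts as the identity on \<open>a\<close>
  from both sides.\<close>

lemma fitting:
  assumes f: "hm f X X"
  obtains n \<pi> r r' where "n > 0" "hm \<pi> X X" "hm r X X" "hm r' X X" "\<pi> ** \<pi> = \<pi>"
    "\<pi> = pw f n ** r" "\<pi> = r' ** pw f n" "\<pi> ** pw f n = pw f n" "pw f n ** \<pi> = pw f n"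
proof -
  obtain n r r' where n: "n > 0" "hm r X X" "hm r' X X" "pw f n = pw f (n + n) ** r" "pw f n = r' ** pw f (n + n)"
    using fitting_stab[OF f] by blast
  define a where "a = pw f n"
  have a1: "hm a X X" unfolding a_def by (rule pw_hm[OF f])
  have aa: "a = (a ** a) ** r" "a = r' ** (a ** a)" using n(4,5) unfolding a_def pw_add[OF f, of n n] .
  have a: "hm a X X" "a = a ** (a ** r)" "a = r' ** (a ** a)"
  proof -
    show "a = a ** (a ** r)" using aa(1) assoc[of r a a] a1 n(2) by simp
  qed (use a1 aa(2) in auto)
  define \<pi> where "\<pi> = a ** r"
  have p: "hm \<pi> X X" unfolding \<pi>_def using a n by simp
  have "a ** r = r' ** a"
  proof -
    have "a ** r = (r' ** (a ** a)) ** r" using a(3) by simp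
    also have "\<dots> = r' ** (a ** (a ** r))" using a(1) n by simp
    also have "\<dots> = r' ** a" using a(2) by simp
    finally show ?thesis .
  qed
  hence p2: "\<pi> = r' ** a" unfolding \<pi>_def .
  have p3: "\<pi> ** a = a" unfolding p2 using a n by simp
  have p4: "a ** \<pi> = a" unfolding \<pi>_def using a by simp
  have "\<pi> ** \<pi> = (\<pi> ** a) ** r" unfolding \<pi>_def using a(1) n p by (simp add: \<pi>_def)
  hence "\<pi> ** \<pi> = \<pi>" unfolding p3 unfolding \<pi>_def .
  thus ?thesis using that[OF n(1) p n(2,3)] p2 p3 p4 unfolding a_def \<pi>_def by blast
qed

lemma iso_from_fitting:
  assumes f: "hm f X X" and n: "n > 0" "hm r X X" "hm r' X X" "pw f n ** r = ide X" "r' ** pw f n = ide X"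
  shows "iso f"
proof -
  obtain m where m: "n = Suc m" using n(1) by (cases n) auto
  note p = pw_hm[OF f, of m]
  have 1: "f ** (pw f m ** r) = ide X" using n m p f by simp
  have 2: "(r' ** pw f m) ** f = ide X" using n pw_Suc_right[OF f, of m] m p f by simp
  have "r' ** pw f m = (r' ** pw f m) ** (f ** (pw f m ** r))" using 1 p n by simp
  also have "\<dots> = ((r' ** pw f m) ** f) ** (pw f m ** r)" using p n f by simp
  also have "\<dots> = pw f m ** r" using 2 p n by simp
  finally show ?thesis using isoI[OF f, of "pw f m ** r"] 1 2 p n by simp
qed

lemma indec_iso_or_nilpotent:
  assumes X: "indec X" and f: "hm f X X"
  shows "iso f \<or> (\<exists>n. pw f n = zer 0 X X)"
proof -
  obtain n \<pi> r r' where n: "n > 0" "hm \<pi> X X" "hm r X X" "hm r' X X" "\<pi> ** \<pi> = \<pi>"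
    "\<pi> = pw f n ** r" "\<pi> = r' ** pw f n" "\<pi> ** pw f n = pw f n" "pw f n ** \<pi> = pw f n" using fitting[OF f] .
  have "\<pi> = ide X \<or> \<pi> = zer 0 X X" using X n unfolding indec_def by blast
  thus ?thesis
  proof
    assume "\<pi> = ide X"
    hence "iso f" using iso_from_fitting[OF f n(1,3,4)] n(6,7) by simp
    thus ?thesis ..
  next
    assume "\<pi> = zer 0 X X"
    hence "pw f n = zer 0 X X" using n(9) pw_hm[OF f, of n] by (metis cmp_zer add.right_neutral deg_le src_ob)
    thus ?thesis by blast
  qed
qed

text \<open>Otherwise both summands are nilpotent. If \<open>b x = 0\<close> then
  \<open>x = a x\<close>, so \<open>x = a^m x = 0\<close>; cancelling one factor after another, no
  power of \<open>b\<close> can vanish.\<close>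

lemma indec_local:
  assumes X: "indec X" and ab: "hm a X X" "hm b X X" "a +++ b = ide X"
  shows "iso a \<or> iso b"
proof (rule ccontr)
  assume "\<not> ?thesis"
  then obtain m n where mn: "pw a m = zer 0 X X" "pw b n = zer 0 X X" using indec_iso_or_nilpotent[OF X] ab by blast
  have XO: "X \<in> Ob" and ne: "ide X ~= zer 0 X X" using X unfolding indec_def by auto
  have inj: "x = zer 0 X X" if x: "hm x X X" "b ** x = zer 0 X X" for x
  proof -
    have "x = (a +++ b) ** x" using ab x by simp
    also have "\<dots> = a ** x +++ b ** x" using ab(1,2) x(1) by (simp add: dist)
    finally have ax: "x = a ** x" using x ab XO by simp
    have "x = pw a j ** x" for j
    proof (induction j)
      case 0 thus ?case using ab x by simp
    next
      case (Suc j)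
      have "pw a (Suc j) ** x = a ** (pw a j ** x)" using ab(1) x(1) pw_hm[OF ab(1), of j] by simp
      thus ?case using Suc ax by simp
    qed
    from this[of m] show ?thesis unfolding mn(1) using x(1) XO by simp
  qed
  have "pw b j = zer 0 X X ==> False" for j
  proof (induction j)
    case 0 thus ?case using ne ab by simp
  next
    case (Suc j)
    thus ?case using inj[of "pw b j"] pw_hm[OF ab(2), of j] by simp
  qed
  thus False using mn(2) by blast
qed

text \<open>The radical of the local ring \<open>End(X)\<close>. Closure under sums is
  \<open>indec_local\<close> after multiplication by the inverse of a supposedly invertible
  sum.\<close>

lemma nonunits_endsub:
  assumes X: "indec X"
  shows "endsub X X {f. hm f X X & \<not> iso f}" unfolding endsub_def
proof (intro conjI ballI allI impI)
  have XO: "X \<in> Ob" and ne: "ide X ~= zer 0 X X" using X unfolding indec_def by auto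
  show "zer 0 X X \<in> {f. hm f X X & \<not> iso f}"
  proof -
    have "\<not> iso (zer 0 X X)"
    proof
      assume "iso (zer 0 X X)"
      then obtain g where "inv_pair (zer 0 X X) g" unfolding iso_def by blast
      note g = inv_pairD[OF this]
      have "ide X = g ** zer 0 X X" using g XO by simp
      also have "\<dots> = zer 0 X X" using g(1-6) XO by simp
      finally show False using ne by simp
    qed
    thus ?thesis using XO by simp
  qed
  fix h assume h: "h \<in> {f. hm f X X & \<not> iso f}"
  { fix h' assume h': "h' \<in> {f. hm f X X & \<not> iso f}"
    have "\<not> iso (h +++ h')"
    proof
      assume "iso (h +++ h')"
      then obtain v where "inv_pair (h +++ h') v" unfolding iso_def by blast
      note v = inv_pairD[OF this]
      have vt: "hm v X X" using v h h' by auto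
      have "v ** h +++ v ** h' = ide X" using v(7) vt h h' by (simp add: dist)
      hence "iso (v ** h) \<or> iso (v ** h')" using indec_local[OF X, of "v ** h" "v ** h'"] vt h h' by simp
      moreover have False if u: "iso (v ** u)" "hm u X X" "\<not> iso u" for u
      proof -
        obtain r where r: "hm r X X" "v ** r = ide X" using iso_cancel_left(2)[OF u(1,2) vt] by blast
        obtain r' where r': "hm r' X X" "r' ** u = ide X" using iso_cancel_left(1)[OF u(1,2) vt] by blast
        have "iso r'" using indec_right_inv[OF X r'(1) that(2) r'(2)] .
        then obtain w where "inv_pair r' w" unfolding iso_def by blast
        note w = inv_pairD[OF this]
        have wt: "hm w X X" using w r' by auto
        have "u = w" using w(7) pre_cancel[of w r' "ide X" u] r' that(2) wt by simp
        thus False using that(3) inv_pair_sym[OF \<open>inv_pair r' w\<close>] unfolding iso_def by blast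
      qed
      ultimately show False using h h' by blast
    qed
    thus "h +++ h' \<in> {f. hm f X X & \<not> iso f}" using h h' by simp }
  fix a assume a: "hm a X X"
  have "\<not> iso (h ** a)"
  proof
    assume "iso (h ** a)"
    from iso_cancel_left(2)[OF this a] h obtain r where "hm r X X" "h ** r = ide X" by auto
    hence "iso h" using indec_right_inv[OF X] h by blast
    thus False using h by simp
  qed
  thus "h ** a \<in> {f. hm f X X & \<not> iso f}" using h a by simp
qed auto

lemma rasD:
  assumes "ras z"
  shows "ar z" "deg z = 1" "z ~= zer 1 (src z) (trg z)"
    "!!f. [| ar f; deg f = 0; trg f = src z; \<not> split_epi f |] ==> z ** f = zer 1 (src f) (trg z)" using assms unfolding ras_def by auto

text \<open>The epimorphism of a nonzero class \<open>e\<close> does not split, so it is killed by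
  \<open>z\<close>; exactness of the represented sequence then writes \<open>z\<close> as a pushout
  of \<open>e\<close>.\<close>

lemma ras_lift:
  assumes z: "ras z" and e: "ar e" "deg e = 1" "src e = src z" "e ~= zer 1 (src e) (trg e)"
  shows "\<exists>g. hm g (trg e) (trg z) & g ** e = z"
proof -
  note n = rasD[OF z]
  obtain i p where r: "rep e i p" using rep_ex[OF e(1,2)] by blast
  note r' = repD[OF r]
  have "\<not> split_epi p"
  proof
    assume "split_epi p"
    then obtain s where s: "hm s (trg p) (src p)" "p ** s = ide (trg p)" unfolding split_epi_def by blast
    have "e = e ** (p ** s)" using s(2) r'(1,2,7) by simp
    also have "\<dots> = zer 1 (src p) (trg e) ** s" using pre_cancel[OF rep_cp[OF r], of s] s(1) r'(1-11) by simp
    also have "\<dots> = zer 1 (src e) (trg e)" using s(1) r'(1-11) by simp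
    finally show False using e(4) by simp
  qed
  hence "z ** p = zer 1 (src p) (trg z)" using n(4)[of p] r'(7,9,11) e(3) by simp
  thus ?thesis using r'(14)[of z] n(1,2) e(3) by auto
qed

text \<open>Let \<open>p\<close> be the epimorphism that (REC2) attaches to the radical of
  \<open>End(X)\<close>. If \<open>f\<close> is not a split epimorphism, every \<open>f h\<close>
  with \<open>h\<close> from \<open>X\<close> is a non-unit and factors through \<open>p\<close>; as
  \<open>p\<close> is determined by \<open>X\<close>, so does \<open>f\<close>, and the class of
  \<open>p\<close> kills \<open>f\<close>.\<close>

lemma ras_ex:
  assumes X: "indec X" and R: "rec2 X"
  shows "\<exists>z. ras z & src z = X"
proof -
  have XO: "X \<in> Ob" using X unfolding indec_def by simp
  obtain p where p: "epi p" "trg p = X" "rdet p X" "{f. hm f X X & \<not> iso f} = image_hom p X"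
    using R XO nonunits_endsub[OF X] unfolding rec2_def by blast
  obtain z i where r: "rep z i p" using epi_rep[OF p(1)] by blast
  note r' = repD[OF r]
  have sx: "src z = X" using r'(7) p(2) by simp
  have "z ~= zer 1 (src z) (trg z)"
  proof
    assume "z = zer 1 (src z) (trg z)"
    hence "ide X \<in> image_hom p X" using rep_image[OF r XO, of "ide X"] sx XO r'(1) by simp
    moreover have "iso (ide X)" using isoI[of "ide X" X X "ide X"] XO by simp
    ultimately show False using p(4) by blast
  qed
  moreover have "z ** f = zer 1 (src f) (trg z)" if f: "ar f" "deg f = 0" "trg f = src z" "\<not> split_epi f" for f
  proof -
    have "f ** h \<in> image_hom p X" if h: "hm h X (src f)" for h
    proof -
      have "\<not> iso (f ** h)"
      proof
        assume "iso (f ** h)"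
        then obtain w where "inv_pair (f ** h) w" unfolding iso_def by blast
        note w = inv_pairD[OF this]
        have "hm (h ** w) X (src f)" "f ** (h ** w) = ide X" using w h f sx by auto
        thus False using f(3,4) sx unfolding split_epi_def by auto
      qed
      hence "f ** h \<in> {f. hm f X X & \<not> iso f}" using h f(1-3) sx by simp
      thus ?thesis unfolding p(4) .
    qed
    hence "\<exists>t'. hm t' (src f) (src p) & p ** t' = f" using p(2,3) f sx unfolding rdet_def by auto
    thus ?thesis using rep_factor[OF r f(1,2)] f(3) r'(7) by simp
  qed
  ultimately show ?thesis using r'(1,2) sx unfolding ras_def by blast
qed

lemma ras_push:
  assumes z: "ras z" and q: "hm q (trg z) Z" "q ** z ~= zer 1 (src z) Z"
  shows "ras (q ** z)"
proof -
  note n = rasD[OF z]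
  have Z: "Z \<in> Ob" using q by auto
  have "(q ** z) ** f = zer 1 (src f) Z" if "ar f" "deg f = 0" "trg f = src z" "\<not> split_epi f" for f
    using n(4)[OF that] that n(1,2) q(1) Z by simp
  thus ?thesis unfolding ras_def using n q by auto
qed

text \<open>By the descending chain condition on right ideals, the retracts of \<open>X\<close> with a given property
  include one in which no proper retract has the property.\<close>

lemma minimal_retract:
  assumes X: "X \<in> Ob" and P: "P (ide X) (ide X)"
  obtains q j where "hm q X (trg q)" "hm j (trg q) X" "q ** j = ide (trg q)" "P q j"
    "!!q' j'. [| hm q' (trg q) (trg q'); hm j' (trg q') (trg q); q' ** j' = ide (trg q'); P (q' ** q) (j ** j') |]
      ==> j' ** q' = ide (trg q)"
proof -
  interpret R: module k "HM 0 X X" by (rule hom_mod0[OF X X])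
  have dccR: "dcc (subm k (HM 0 X X))" by (rule fgen_dcc[OF R.module_axioms dcc_ideals hom_fgen[OF X X]])
  define retr where "retr q j <-> hm q X (trg q) & hm j (trg q) X & q ** j = ide (trg q)" for q j
  \<comment> \<open>The right ideal generated by the idempotent \<open>j q\<close>; passing to a
    retract of the retract shrinks it.\<close>
  define ran where "ran q j = {(j ** q) ** r | r. hm r X X}" for q j
  define Q where "Q W <-> (\<exists>q j. retr q j & P q j & W = ran q j)" for W
  have sub: "subm k (HM 0 X X) W" if QW: "Q W" for W
  proof -
    obtain q j where q: "hm q X (trg q)" "hm j (trg q) X" "W = ran q j" using QW unfolding Q_def retr_def by blast
    define e where "e = j ** q"
    have e: "hm e X X" unfolding e_def using q by simp
    show ?thesis unfolding q(3) ran_def e_def[symmetric]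
    proof (rule submI)
      show "0[HM 0 X X] \<in> {e ** r | r. hm r X X}" unfolding HM_simps using e X by (intro CollectI exI[of _ "zer 0 X X"]) simp
      fix x assume "x \<in> {e ** r | r. hm r X X}"
      then obtain r where r: "hm r X X" "x = e ** r" by blast
      show "x \<in> carrier (HM 0 X X)" using r e by (simp add: HM_simps)
      show "a .[HM 0 X X] x \<in> {e ** r | r. hm r X X}" if "a \<in> carrier k" for a
        unfolding HM_simps using r e that by (intro CollectI exI[of _ "a \<star> r"]) (simp add: dist)
      fix y assume "y \<in> {e ** r | r. hm r X X}"
      then obtain r' where r': "hm r' X X" "y = e ** r'" by blast
      show "x +[HM 0 X X] y \<in> {e ** r | r. hm r X X}"
        unfolding HM_simps using r r' e by (intro CollectI exI[of _ "r +++ r'"]) (simp add: dist)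
    qed
  qed
  have Q0: "Q (ran (ide X) (ide X))" unfolding Q_def retr_def using X P by (intro exI[of _ "ide X"]) simp
  obtain W where W: "Q W" "!!V. Q V ==> V \<subseteq> W ==> V = W" using dcc_minimal[OF dccR, of Q, OF Q0 sub] by blast
  obtain q j where q: "retr q j" "P q j" "W = ran q j" using W(1) unfolding Q_def by blast
  obtain Z where Z: "Z = trg q" by blast
  have qj: "hm q X Z" "hm j Z X" "q ** j = ide Z" using q(1) unfolding retr_def Z by auto
  have ZO: "Z \<in> Ob" using qj by auto
  have "j' ** q' = ide Z" if r: "hm q' Z (trg q')" "hm j' (trg q') Z" "q' ** j' = ide (trg q')" "P (q' ** q) (j ** j')" for q' j'
  proof -
    define \<pi> where "\<pi> = j' ** q'"
    have p: "hm \<pi> Z Z" unfolding \<pi>_def using r by simp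
    have A: "trg q' \<in> Ob" using r(1) by simp
    have "q' ** (q ** (j ** j')) = ide (trg q')" using pre_cancel[OF qj(3), of j'] qj r(1-3) by simp
    hence "retr (q' ** q) (j ** j')" unfolding retr_def using qj r(1,2) A by simp
    hence "Q (ran (q' ** q) (j ** j'))" unfolding Q_def using r(4) by blast
    moreover have ran': "ran (q' ** q) (j ** j') = {j ** (\<pi> ** (q ** u)) | u. hm u X X}"
    proof -
      have "((j ** j') ** (q' ** q)) ** u = j ** (\<pi> ** (q ** u))" if "hm u X X" for u
        unfolding \<pi>_def using that qj(1,2) r(1,2) by simp
      thus ?thesis unfolding ran_def by (intro Collect_cong) metis
    qed
    moreover have "ran (q' ** q) (j ** j') \<subseteq> W"
    proof
      fix x assume "x \<in> ran (q' ** q) (j ** j')"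
      then obtain u where u: "hm u X X" "x = j ** (\<pi> ** (q ** u))" unfolding ran' by blast
      have "(j ** q) ** x = x" unfolding u(2) using pre_cancel[OF qj(3), of "\<pi> ** (q ** u)"] u(1) qj(1,2) p by simp
      moreover have "hm x X X" unfolding u(2) using u(1) qj(1,2) p by simp
      ultimately show "x \<in> W" unfolding q(3) ran_def by (intro CollectI exI[of _ x]) simp
    qed
    ultimately have "ran (q' ** q) (j ** j') = W" using W(2) by blast
    moreover have "j ** q \<in> W" unfolding q(3) ran_def using qj(1,2) X by (intro CollectI exI[of _ "ide X"]) simp
    ultimately have "j ** q \<in> {j ** (\<pi> ** (q ** u)) | u. hm u X X}" unfolding ran' by simp
    then obtain s where s: "hm s X X" "j ** q = j ** (\<pi> ** (q ** s))" by blast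
    \<comment> \<open>Equality of the two ideals gives \<open>j q = j \<pi> q s\<close>. Read on
      \<open>Z\<close> this is \<open>1 = \<pi> w\<close>, and an idempotent with a right inverse is
      the identity.\<close>
    define w where "w = q ** (s ** j)"
    have w: "hm w Z Z" unfolding w_def using qj s(1) by simp
    have "ide Z = q ** ((j ** q) ** j)" using qj ZO by simp
    also have "\<dots> = q ** (j ** (\<pi> ** w))" unfolding s(2) w_def using s(1) qj(1,2) p by simp
    also have "\<dots> = \<pi> ** w" using pre_cancel[OF qj(3), of "\<pi> ** w"] qj(1,2) p w by simp
    finally have 1: "\<pi> ** w = ide Z" by simp
    have pp: "\<pi> ** \<pi> = \<pi>" unfolding \<pi>_def using pre_cancel[OF r(3), of q'] r(1,2) by simp
    have "\<pi> = \<pi> ** (\<pi> ** w)" unfolding 1 using p by simp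
    also have "\<dots> = ide Z" using pre_cancel[OF pp, of w] p w 1 by simp
    finally show ?thesis unfolding \<pi>_def .
  qed
  thus ?thesis using that[of q j] qj q(2) unfolding Z by blast
qed

text \<open>Cutting the end term of an almost split class down to a minimal retract makes it left minimal, by
  Fitting's lemma.\<close>

lemma lmin_ex:
  assumes z: "ras z"
  shows "\<exists>z'. ras z' & src z' = src z & lmin z'"
proof -
  note n = rasD[OF z]
  define K where "K = trg z"
  have K: "K \<in> Ob" unfolding K_def using n by simp
  have nt: "ar z" "deg z = 1" "trg z = K" using n K_def by auto
  \<comment> \<open>The property handed to \<open>minimal_retract\<close> is
    \<open>j (q z) = z\<close>: the class survives the cut. The identity retract has it.\<close>
  have "ide K ** (ide K ** z) = z" using nt by simp
  then obtain q j where q: "hm q K (trg q)" "hm j (trg q) K" "q ** j = ide (trg q)" "j ** (q ** z) = z"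
    and qmin: "!!q' j'. [| hm q' (trg q) (trg q'); hm j' (trg q') (trg q); q' ** j' = ide (trg q');
      (j ** j') ** ((q' ** q) ** z) = z |] ==> j' ** q' = ide (trg q)" by (rule minimal_retract[OF K, of "%q j. j ** (q ** z) = z"]) blast
  obtain K1 where tq: "trg q = K1" by blast
  have q: "hm q K K1" "hm j K1 K" "q ** j = ide K1" "j ** (q ** z) = z" using q unfolding tq by auto
  note qmin = qmin[unfolded tq]
  have K1: "K1 \<in> Ob" using q by auto
  define z1 where "z1 = q ** z"
  have t1: "ar z1" "deg z1 = 1" "src z1 = src z" "trg z1 = K1" unfolding z1_def using q nt by auto
  have j1: "j ** z1 = z" unfolding z1_def by (rule q(4))
  have ne: "z1 ~= zer 1 (src z) K1"
  proof
    assume "z1 = zer 1 (src z) K1"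
    hence "z = j ** zer 1 (src z) K1" using j1 by simp
    hence "z = zer 1 (src z) K" using q(2) nt(1) K1 by simp
    thus False using n(3) nt by simp
  qed
  have "ras z1" using ras_push[OF z, of q K1] q ne nt unfolding z1_def by simp
  moreover have "iso g" if g: "hm g K1 K1" "g ** z1 = z1" for g
  proof -
    obtain m \<pi> r r' where m: "m > 0" "hm \<pi> K1 K1" "hm r K1 K1" "hm r' K1 K1" "\<pi> ** \<pi> = \<pi>"
      "\<pi> = pw g m ** r" "\<pi> = r' ** pw g m" "\<pi> ** pw g m = pw g m" "pw g m ** \<pi> = pw g m" using fitting[OF g(1)] .
    have gp: "pw g l ** z1 = z1" for l
    proof (induction l)
      case 0 thus ?case using g t1 by simp
    next
      case (Suc l)
      thus ?case using g t1 pw_hm[OF g(1), of l] by simp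
    qed
    \<comment> \<open>All powers of \<open>g\<close> fix \<open>z1\<close>, hence so does the
      Fitting idempotent. Its image is then a retract through which \<open>z\<close> survives, and
      minimality forces \<open>\<pi> = 1\<close>, which makes a power of \<open>g\<close>
      invertible.\<close>
    have p1: "\<pi> ** z1 = z1" using pre_cancel[OF m(8), of z1] gp[of m] m(2) pw_hm[OF g(1), of m] t1 by simp
    obtain q' j' where q': "hm q' K1 (trg q')" "hm j' (trg q') K1" "q' ** j' = ide (trg q')" "j' ** q' = \<pi>"
      using idem_split[OF m(2,5)] by blast
    have "(j ** j') ** ((q' ** q) ** z) = j ** ((j' ** q') ** z1)" unfolding z1_def using q(1,2) q'(1,2) nt by simp
    hence "(j ** j') ** ((q' ** q) ** z) = z" unfolding q'(4) p1 j1 .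
    hence "\<pi> = ide K1" using qmin[OF q'(1-3)] q'(4) by simp
    thus "iso g" using iso_from_fitting[OF g(1) m(1,3,4)] m(6,7) by simp
  qed
  ultimately show ?thesis using t1 unfolding lmin_def by blast
qed

text \<open>Let \<open>e\<close> be idempotent on \<open>trg z\<close>. If
  \<open>e z \<noteq> 0\<close>, some \<open>g\<close> takes it back to \<open>z\<close>, so
  \<open>g e\<close> is invertible and \<open>e = 1\<close>. If \<open>e z = 0\<close>, then
  \<open>1 - e\<close> fixes \<open>z\<close>, so it is invertible and \<open>e = 0\<close>.\<close>

lemma lmin_indec:
  assumes z: "ras z" "lmin z"
  shows "indec (trg z)" unfolding indec_def
proof (intro conjI allI impI)
  note n = rasD[OF z(1)]
  let ?K = "trg z"
  show K: "?K \<in> Ob" using n by simp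
  show "ide ?K ~= zer 0 ?K ?K"
  proof
    assume a: "ide ?K = zer 0 ?K ?K"
    have "z = ide ?K ** z" using n(1) by simp
    also have "\<dots> = zer 1 (src z) ?K" unfolding a using n(1,2) K by simp
    finally show False using n(3) by simp
  qed
  fix e assume e: "hm e ?K ?K & e ** e = e"
  show "e = ide ?K \<or> e = zer 0 ?K ?K"
  proof (cases "e ** z = zer 1 (src z) ?K")
    case False
    have "\<exists>g. hm g (trg (e ** z)) ?K & g ** (e ** z) = z" by (rule ras_lift[OF z(1)]) (use e n(1,2) False in auto)
    then obtain g where g: "hm g ?K ?K" "g ** (e ** z) = z" using e n(1,2) by auto
    hence "iso (g ** e)" using z(2) e n(1,2) unfolding lmin_def by simp
    then obtain r where r: "hm r ?K ?K" "r ** e = ide ?K" using iso_cancel_left(1)[of g e ?K] e g(1) by blast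
    have "e = ide ?K ** e" using e by simp
    also have "\<dots> = r ** (e ** e)" unfolding r(2)[symmetric] using r(1) e by (metis assoc add.right_neutral deg_le)
    also have "\<dots> = ide ?K" using r e by simp
    finally show ?thesis by simp
  next
    case True
    define f where "f = ide ?K +++ neg e"
    have ft: "hm f ?K ?K" unfolding f_def using e K by simp
    have "f ** z = z" unfolding f_def using e n(1,2) True K by (simp add: dist)
    hence "iso f" using z(2) ft unfolding lmin_def by blast
    then obtain w where "inv_pair f w" unfolding iso_def by blast
    note w = inv_pairD[OF this]
    have "f ** e = zer 0 ?K ?K" unfolding f_def using e K by (simp add: dist)
    hence "w ** (f ** e) = zer 0 ?K ?K" using w(1-6) ft K by simp
    hence "e = zer 0 ?K ?K" using w(9)[of e] e ft by simp
    thus ?thesis ..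
  qed
qed

text \<open>(REC2) for the zero submodule of \<open>Hom(X, Y)\<close> yields an epimorphism whose
  class kills no nonzero arrow from \<open>X\<close>. Its dual gives uniqueness in the
  pairing.\<close>

lemma rec2_faithful:
  assumes R: "rec2 Y" and f: "hm f X Y" "f ~= zer 0 X Y"
  shows "\<exists>c. ar c & deg c = 1 & src c = Y & c ** f ~= zer 1 X (trg c)"
proof -
  have O: "X \<in> Ob" "Y \<in> Ob" using f by auto
  have "endsub X Y {zer 0 X Y}" unfolding endsub_def using O by auto
  then obtain p where p: "epi p" "trg p = Y" "{zer 0 X Y} = image_hom p X" using R O unfolding rec2_def by metis
  obtain c i where r: "rep c i p" using epi_rep[OF p(1)] by blast
  note r' = repD[OF r]
  have "c ** f ~= zer 1 X (trg c)" using rep_image[OF r O(1), of f] f p(2,3) r'(7) by auto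
  thus ?thesis using r'(1,2,7) p(2) by auto
qed

abbreviation op_rec1 :: "'o => bool" where
  "op_rec1 \<equiv> excat.rec1 Ob ar trg src deg (%g f. f ** g) (%d X Y. zer d Y X)"

abbreviation op_rec2 :: "'o => bool" where
  "op_rec2 \<equiv> excat.rec2 Ob ar trg src deg (%g f. f ** g) pls (%d X Y. zer d Y X)"

abbreviation op_ras :: "'a => bool" where
  "op_ras \<equiv> gcat.ras ar trg src deg ide (%g f. f ** g) (%d X Y. zer d Y X)"

abbreviation op_lmin :: "'a => bool" where
  "op_lmin \<equiv> gcat.lmin ar trg src deg ide (%g f. f ** g)"

lemma op_indec: "gcat.indec Ob ar trg src deg ide (%g f. f ** g) (%d X Y. zer d Y X) X = indec X"
  unfolding gcat.indec_def[OF op_gcat] indec_def by auto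

text \<open>Left minimality makes \<open>trg z\<close> indecomposable, so the dual condition
  provides a class \<open>z1\<close> with the same end \<open>trg z\<close> that lifts along every
  nonzero class, in particular \<open>z1 = z f\<close>. As \<open>z f \<noteq> 0\<close>, the arrow
  \<open>f\<close> is a split epimorphism, and it starts at an indecomposable object, so it is an
  isomorphism; \<open>z\<close> thus inherits the lifting property of \<open>z1\<close>.\<close>

lemma almost_split:
  assumes X: "indec X" and R: "!!Y. Y \<in> Ob ==> rec2 Y" and L: "!!Y. Y \<in> Ob ==> op_rec2 Y"
  obtains z where "ar z" "deg z = 1" "src z = X" "z ~= zer 1 (src z) (trg z)"
    "!!e. [| ar e; deg e = 1; src e = X; e ~= zer 1 (src e) (trg e) |] ==> \<exists>g. hm g (trg e) (trg z) & g ** e = z"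
    "!!e. [| ar e; deg e = 1; trg e = trg z; e ~= zer 1 (src e) (trg e) |] ==> \<exists>f. hm f X (src e) & e ** f = z"
proof -
  have XO: "X \<in> Ob" using X unfolding indec_def by simp
  obtain z0 where "ras z0" "src z0 = X" using ras_ex[OF X R[OF XO]] by blast
  then obtain z where n: "ras z" "src z = X" "lmin z" using lmin_ex by metis
  note n' = rasD[OF n(1)]
  have K: "indec (trg z)" by (rule lmin_indec[OF n(1,3)])
  have KO: "trg z \<in> Ob" using n' by simp
  obtain z1' where "op_ras z1'" "trg z1' = trg z" using serre.ras_ex[OF op_serre, of "trg z"] K L[OF KO] unfolding op_indec by blast
  then obtain z1 where n1: "op_ras z1" "trg z1 = trg z" "op_lmin z1" using serre.lmin_ex[OF op_serre] by metis
  note n1' = serre.rasD[OF op_serre n1(1)]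
  have X1: "indec (src z1)" using serre.lmin_indec[OF op_serre n1(1,3)] unfolding op_indec .
  have l1: "\<exists>f. hm f (src z1) (src e) & e ** f = z1" if e: "ar e" "deg e = 1" "trg e = trg z" "e ~= zer 1 (src e) (trg e)" for e
    using serre.ras_lift[OF op_serre n1(1) e(1,2)] e(3,4) n1(2) by auto
  obtain f where f: "hm f (src z1) X" "z ** f = z1" using l1[OF n'(1,2) refl n'(3)] n(2) by auto
  have "f ~= zer 0 (src z1) X"
  proof
    assume "f = zer 0 (src z1) X"
    hence "z1 = zer 1 (src z1) (trg z)" using f n'(1,2) n(2) n1'(1) by (metis add.right_neutral cmp_zer deg_le src_ob)
    thus False using n1'(3) n1(2) by simp
  qed
  moreover have "split_epi f"
  proof (rule ccontr)
    assume "\<not> split_epi f"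
    hence "z ** f = zer 1 (src z1) (trg z)" using n'(4)[of f] f(1) n(2) by auto
    thus False using f(2) n1'(3) n1(2) by simp
  qed
  ultimately have "iso f" using indec_split_epi_iso[OF X1 f(1)] by blast
  then obtain w where "inv_pair f w" unfolding iso_def by blast
  note w = inv_pairD[OF this]
  have wt: "hm w X (src z1)" using w(1-6) f(1) by simp
  have bk: "\<exists>h. hm h X (src e) & e ** h = z" if e: "ar e" "deg e = 1" "trg e = trg z" "e ~= zer 1 (src e) (trg e)" for e
  proof -
    obtain u where u: "hm u (src z1) (src e)" "e ** u = z1" using l1[OF e] by blast
    have "e ** (u ** w) = z1 ** w" using pre_cancel[OF u(2), of w] u(1) e wt by simp
    also have "\<dots> = z ** (f ** w)" unfolding f(2)[symmetric] using f(1) wt n'(1,2) n(2) by simp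
    also have "\<dots> = z" using w(8) f(1) n'(1) n(2) by simp
    finally show ?thesis using u(1) wt by (intro exI[of _ "u ** w"]) simp
  qed
  show ?thesis
  proof (rule that[OF n'(1,2) n(2) n'(3)])
    show "\<exists>g. hm g (trg e) (trg z) & g ** e = z" if "ar e" "deg e = 1" "src e = X" "e ~= zer 1 (src e) (trg e)" for e
      using ras_lift[OF n(1)] that n(2) by simp
    show "\<exists>f. hm f X (src e) & e ** f = z" if "ar e" "deg e = 1" "trg e = trg z" "e ~= zer 1 (src e) (trg e)" for e
      using bk[OF that] by blast
  qed
qed

end

section \<open>From almost split classes to Serre pairings for all objects\<close>

context serre begin

text \<open>A nonzero class \<open>m\<close> can be pushed to \<open>z\<close>, where
  \<open>t\<close> does not vanish; so the pairing is nondegenerate on the \<open>Ext\<close> side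
  and \<open>pairing_perfect\<close> gives existence. For uniqueness, a nonzero difference
  \<open>f\<close> of two arrows has \<open>f c \<noteq> 0\<close> for some class \<open>c\<close>,
  and some \<open>h\<close> gives \<open>f c h = z\<close>; equal functionals would force
  \<open>t z = 0\<close>.\<close>

lemma SPl_from_almost_split:
  assumes z: "ar z" "deg z = 1" "src z = X" "trg z = K" and t: "t \<in> func X K" "t z ~= 0[E]"
    and A: "!!e. [| ar e; deg e = 1; src e = X; e ~= zer 1 (src e) (trg e) |] ==> \<exists>g. hm g (trg e) K & g ** e = z"
    and B: "!!e. [| ar e; deg e = 1; trg e = K; e ~= zer 1 (src e) (trg e) |] ==> \<exists>f. hm f X (src e) & e ** f = z"
    and L: "!!Y. Y \<in> Ob ==> op_rec2 Y"
  shows "SPl X K t"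
proof -
  have X: "X \<in> Ob" "K \<in> Ob" using z by auto
  note t' = funcD[OF t(1) X]
  have ex: "\<exists>g. hm g Y K & push_func X Y t g = d" if Y: "Y \<in> Ob" and d: "d \<in> func X Y" for Y d
  proof -
    have "\<exists>n\<in>carrier (HM 0 Y K). \<forall>m\<in>carrier (HM 1 X Y). d m = t (n ** m)"
    proof (rule pairing_perfect[OF ext_mod[OF X(1) Y] hom_mod0[OF Y X(2)] hom_fgen[OF Y X(2)] _ _ _ d])
      show "lin_on k (HM 1 X Y) E (carrier (HM 1 X Y)) (%m. t (n ** m))" if "n \<in> carrier (HM 0 Y K)" for n
        by (rule lin_onI) (use that t' in \<open>simp_all add: HM_simps dist\<close>)
      show "lin_on k (HM 0 Y K) E (carrier (HM 0 Y K)) (%n. t (n ** m))" if "m \<in> carrier (HM 1 X Y)" for m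
        by (rule lin_onI) (use that t' in \<open>simp_all add: HM_simps dist\<close>)
      show "m = 0[HM 1 X Y]" if m: "m \<in> carrier (HM 1 X Y)" "!!n. n \<in> carrier (HM 0 Y K) ==> t (n ** m) = 0[E]" for m
      proof (rule ccontr)
        assume "m ~= 0[HM 1 X Y]"
        then obtain g where "hm g Y K" "g ** m = z" using A[of m] m(1) by (auto simp: HM_simps)
        thus False using m(2)[of g] t(2) by (simp add: HM_simps)
      qed
    qed
    then obtain n where n: "hm n Y K" "!!m. m \<in> carrier (HM 1 X Y) ==> d m = t (n ** m)" by (auto simp: HM_simps)
    have "push_func X Y t n = d"
      by (rule func_eqI[OF push_func[OF t(1) X(1) n(1)] d]) (use n(2) in \<open>simp add: push_func_val HM_simps\<close>)
    thus ?thesis using n(1) by blast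
  qed
  moreover have "g = g'" if g: "hm g Y K" "hm g' Y K" "push_func X Y t g = push_func X Y t g'" for g g' Y
  proof (rule ccontr)
    assume ne: "g ~= g'"
    define f where "f = g +++ neg g'"
    have Y: "Y \<in> Ob" using g by auto
    have f: "hm f Y K" unfolding f_def using g by simp
    have fz: "f ~= zer 0 Y K" using eq_iff_diff[of g g'] g ne unfolding f_def by auto
    then obtain c where c: "ar c" "deg c = 1" "trg c = Y" "f ** c ~= zer 1 (src c) K"
      using serre.rec2_faithful[OF op_serre L[OF Y], of f K] f by auto
    then obtain h where h: "hm h X (src c)" "(f ** c) ** h = z" using B[of "f ** c"] f by auto
    have ch: "ar (c ** h)" "deg (c ** h) = 1" "src (c ** h) = X" "trg (c ** h) = Y" using c h(1) by auto
    have "t (g ** (c ** h)) = t (g' ** (c ** h))" using push_func_val[OF ch, of t g] push_func_val[OF ch, of t g'] g(3) by simp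
    moreover have "g ** (c ** h) = z +++ g' ** (c ** h)"
    proof -
      have "f ** (c ** h) = z" using h(2) assoc[of h c f] h(1) f c by simp
      hence "z = g ** (c ** h) +++ neg (g' ** (c ** h))" unfolding f_def using g(1,2) ch by (simp add: dist del: assoc)
      hence "z +++ g' ** (c ** h) = g ** (c ** h)"
        by (rule add_eq_swap[THEN iffD2, rotated -1]) (use g(1,2) ch z in \<open>simp_all del: assoc\<close>)
      thus ?thesis by (rule sym)
    qed
    ultimately have "t z +[E] t (g' ** (c ** h)) = t (g' ** (c ** h))" using t'(2)[of z "g' ** (c ** h)"] z g(2) ch by (simp del: assoc)
    moreover have "t z \<in> carrier E" "t (g' ** (c ** h)) \<in> carrier E" using t'(1) z g(2) ch by (auto simp del: assoc)
    ultimately show False using t(2) by (simp add: E.M.add.r_cancel_one)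
  qed
  ultimately show ?thesis unfolding SPl_def using X t(1) by blast
qed

lemma indec_SP:
  assumes X: "indec X" and R: "!!Y. Y \<in> Ob ==> rec2 Y" and L: "!!Y. Y \<in> Ob ==> op_rec2 Y"
  shows "\<exists>K t. SP X K t"
proof -
  obtain z where z: "ar z" "deg z = 1" "src z = X" "z ~= zer 1 (src z) (trg z)"
    "!!e. [| ar e; deg e = 1; src e = X; e ~= zer 1 (src e) (trg e) |] ==> \<exists>g. hm g (trg e) (trg z) & g ** e = z"
    "!!e. [| ar e; deg e = 1; trg e = trg z; e ~= zer 1 (src e) (trg e) |] ==> \<exists>f. hm f X (src e) & e ** f = z"
    using almost_split[OF X R L] by blast
  obtain t where t: "t \<in> func X (trg z)" "t z ~= 0[E]" using func_sep[OF z(1,2,4)] z(3) by blast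
  have "SPl X (trg z) t" by (rule SPl_from_almost_split[OF z(1-3) refl t z(5,6) L])
  moreover have "serre.SPl k Ob ar trg src deg (%g f. f ** g) pls (%d X Y. zer d Y X) scl E (trg z) X t"
    by (rule serre.SPl_from_almost_split[OF op_serre, of z, unfolded op_simps])
      (use z t R in auto)
  ultimately show ?thesis unfolding SP_def SPr_def by blast
qed

text \<open>The functional \<open>t\<close> sees only the two diagonal components of a class between
  the sums. Composing with the injections and projections of the biproducts reduces existence and
  uniqueness to the summands.\<close>

lemma SPl_sum:
  assumes x: "bip x1 x2 x1' x2'" and k: "bip k1 k2 k1' k2'"
    and s1: "SPl (src x1) (src k1) t1" and s2: "SPl (src x2) (src k2) t2" and t: "t \<in> func (trg x1) (trg k1)"
    and val: "!!e. [| ar e; deg e = 1; src e = trg x1; trg e = trg k1 |] ==>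
      t e = t1 (k1' ** (e ** x1)) +[E] t2 (k2' ** (e ** x2))"
  shows "SPl (trg x1) (trg k1) t"
proof -
  note x' = bipD[OF x] and k' = bipD[OF k]
  note s1' = SPlD[OF s1] and s2' = SPlD[OF s2]
  have X: "trg x1 \<in> Ob" "trg k1 \<in> Ob" using x' k' by auto
  note f1 = funcD[OF s1'(3,1,2)] and f2 = funcD[OF s2'(3,1,2)] and f = funcD[OF t X]
  have "\<exists>g. hm g Y (trg k1) & push_func (trg x1) Y t g = d" if Y: "Y \<in> Ob" and d: "d \<in> func (trg x1) Y" for Y d
  proof -
    note dd = funcD[OF d X(1) Y]
    have d1: "pull_func (src x1) Y d x1' \<in> func (src x1) Y" by (rule pull_func[OF d Y]) (use x' in auto)
    have d2: "pull_func (src x2) Y d x2' \<in> func (src x2) Y" by (rule pull_func[OF d Y]) (use x' in auto)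
    obtain g1 where g1: "hm g1 Y (src k1)" "push_func (src x1) Y t1 g1 = pull_func (src x1) Y d x1'" using s1'(4)[OF Y d1] by blast
    obtain g2 where g2: "hm g2 Y (src k2)" "push_func (src x2) Y t2 g2 = pull_func (src x2) Y d x2'" using s2'(4)[OF Y d2] by blast
    have v1: "t1 (g1 ** e) = d (e ** x1')" if "ar e" "deg e = 1" "src e = src x1" "trg e = Y" for e
      using push_func_val[OF that, of t1 g1] pull_func_val[OF that, of d x1'] g1(2) by simp
    have v2: "t2 (g2 ** e) = d (e ** x2')" if "ar e" "deg e = 1" "src e = src x2" "trg e = Y" for e
      using push_func_val[OF that, of t2 g2] pull_func_val[OF that, of d x2'] g2(2) by simp
    define g where "g = k1 ** g1 +++ k2 ** g2"
    have g: "hm g Y (trg k1)" unfolding g_def using g1(1) g2(1) k'(1-13) by simp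
    have kg: "k1' ** g = g1" "k2' ** g = g2" unfolding g_def using g1(1) g2(1) k' by (simp_all add: dist)
    have "push_func (trg x1) Y t g = d"
    proof (rule func_eqI[OF push_func[OF t X(1) g] d])
      fix e assume e: "ar e" "deg e = 1" "src e = trg x1" "trg e = Y"
      have "push_func (trg x1) Y t g e = t (g ** e)" by (rule push_func_val[OF e])
      also have "\<dots> = t1 (k1' ** ((g ** e) ** x1)) +[E] t2 (k2' ** ((g ** e) ** x2))" by (rule val) (use e g in auto)
      also have "k1' ** ((g ** e) ** x1) = g1 ** (e ** x1)" using pre_cancel[OF kg(1), of "e ** x1"] e g x'(1-13) k'(1-13) by simp
      also have "k2' ** ((g ** e) ** x2) = g2 ** (e ** x2)" using pre_cancel[OF kg(2), of "e ** x2"] e g x'(1-13) k'(1-13) by simp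
      also have "t1 (g1 ** (e ** x1)) = d ((e ** x1) ** x1')" by (rule v1) (use e x' in auto)
      also have "t2 (g2 ** (e ** x2)) = d ((e ** x2) ** x2')" by (rule v2) (use e x' in auto)
      also have "d ((e ** x1) ** x1') +[E] d ((e ** x2) ** x2') = d ((e ** x1) ** x1' +++ (e ** x2) ** x2')"
        by (rule dd(2)[symmetric]) (use e x' in auto)
      also have "(e ** x1) ** x1' +++ (e ** x2) ** x2' = e ** (x1 ** x1' +++ x2 ** x2')" using e x'(1-13) by (simp add: dist)
      also have "\<dots> = e" using x'(18) e by simp
      finally show "push_func (trg x1) Y t g e = d e" .
    qed
    thus ?thesis using g by blast
  qed
  moreover have "g = g'" if g: "hm g Y (trg k1)" "hm g' Y (trg k1)" "push_func (trg x1) Y t g = push_func (trg x1) Y t g'" for g g' Y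
  proof (rule bip_eqI[OF k])
    have Y: "Y \<in> Ob" using g by auto
    have v: "t (g ** e) = t (g' ** e)" if "ar e" "deg e = 1" "src e = trg x1" "trg e = Y" for e
      using push_func_val[OF that, of t g] push_func_val[OF that, of t g'] g(3) by simp
    have w1: "t (h ** (e ** x1')) = t1 ((k1' ** h) ** e)"
      if e: "ar e" "deg e = 1" "src e = src x1" "trg e = Y" and h: "hm h Y (trg k1)" for e h
    proof -
      have "t (h ** (e ** x1')) = t1 (k1' ** ((h ** (e ** x1')) ** x1)) +[E] t2 (k2' ** ((h ** (e ** x1')) ** x2))"
        by (rule val) (use e h x' in auto)
      also have "k1' ** ((h ** (e ** x1')) ** x1) = (k1' ** h) ** e" using e h x' k'(1-13) by simp
      also have "k2' ** ((h ** (e ** x1')) ** x2) = zer 1 (src x2) (src k2)" using e h x' k'(1-13) Y by simp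
      finally show ?thesis using f2(4) f1(1)[of "(k1' ** h) ** e"] e h k'(1-13) by simp
    qed
    have w2: "t (h ** (e ** x2')) = t2 ((k2' ** h) ** e)"
      if e: "ar e" "deg e = 1" "src e = src x2" "trg e = Y" and h: "hm h Y (trg k1)" for e h
    proof -
      have "t (h ** (e ** x2')) = t1 (k1' ** ((h ** (e ** x2')) ** x1)) +[E] t2 (k2' ** ((h ** (e ** x2')) ** x2))"
        by (rule val) (use e h x' in auto)
      also have "k2' ** ((h ** (e ** x2')) ** x2) = (k2' ** h) ** e" using e h x' k'(1-13) by simp
      also have "k1' ** ((h ** (e ** x2')) ** x1) = zer 1 (src x1) (src k1)" using e h x' k'(1-13) Y by simp
      finally show ?thesis using f1(4) f2(1)[of "(k2' ** h) ** e"] e h k'(1-13) by simp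
    qed
    show "k1' ** g = k1' ** g'"
    proof (rule s1'(5))
      show a: "hm (k1' ** g) Y (src k1)" "hm (k1' ** g') Y (src k1)" using g k' by auto
      show "push_func (src x1) Y t1 (k1' ** g) = push_func (src x1) Y t1 (k1' ** g')"
      proof (rule func_eqI[OF push_func[OF s1'(3,1) a(1)] push_func[OF s1'(3,1) a(2)]])
        fix e assume e: "ar e" "deg e = 1" "src e = src x1" "trg e = Y"
        have "t (g ** (e ** x1')) = t (g' ** (e ** x1'))" by (rule v) (use e x' in auto)
        thus "push_func (src x1) Y t1 (k1' ** g) e = push_func (src x1) Y t1 (k1' ** g') e"
          unfolding push_func_val[OF e] w1[OF e g(1)] w1[OF e g(2)] .
      qed
    qed
    show "k2' ** g = k2' ** g'"
    proof (rule s2'(5))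
      show a: "hm (k2' ** g) Y (src k2)" "hm (k2' ** g') Y (src k2)" using g k' by auto
      show "push_func (src x2) Y t2 (k2' ** g) = push_func (src x2) Y t2 (k2' ** g')"
      proof (rule func_eqI[OF push_func[OF s2'(3,1) a(1)] push_func[OF s2'(3,1) a(2)]])
        fix e assume e: "ar e" "deg e = 1" "src e = src x2" "trg e = Y"
        have "t (g ** (e ** x2')) = t (g' ** (e ** x2'))" by (rule v) (use e x' in auto)
        thus "push_func (src x2) Y t2 (k2' ** g) e = push_func (src x2) Y t2 (k2' ** g') e"
          unfolding push_func_val[OF e] w2[OF e g(1)] w2[OF e g(2)] .
      qed
    qed
  qed (use g in auto)
  ultimately show ?thesis unfolding SPl_def using X t by blast
qed

lemma SP_sum:
  assumes x: "bip x1 x2 x1' x2'" and s1: "\<exists>K t. SP (src x1) K t" and s2: "\<exists>K t. SP (src x2) K t"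
  shows "\<exists>K t. SP (trg x1) K t"
proof -
  obtain K1 t1 where s1: "SP (src x1) K1 t1" using s1 by blast
  obtain K2 t2 where s2: "SP (src x2) K2 t2" using s2 by blast
  have l: "SPl (src x1) K1 t1" "SPl (src x2) K2 t2" and r: "SPr (src x1) K1 t1" "SPr (src x2) K2 t2" using s1 s2 unfolding SP_def by auto
  note l1 = SPlD[OF l(1)] and l2 = SPlD[OF l(2)]
  obtain k1 k2 k1' k2' where k: "bip k1 k2 k1' k2'" and ks: "src k1 = K1" "src k2 = K2" using biproduct_ex[OF l1(2) l2(2)] by blast
  note x' = bipD[OF x] and k' = bipD[OF k]
  have X: "trg x1 \<in> Ob" "trg k1 \<in> Ob" using x' k' by auto
  note f1 = funcD[OF l1(3,1,2)] and f2 = funcD[OF l2(3,1,2)]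
  let ?H = "carrier (HM 1 (trg x1) (trg k1))"
  define t where "t = (\<lambda>e\<in>?H. t1 (k1' ** (e ** x1)) +[E] t2 (k2' ** (e ** x2)))"
  have "lin_on k (HM 1 (trg x1) (trg k1)) E ?H (%e. t1 (k1' ** (e ** x1)) +[E] t2 (k2' ** (e ** x2)))"
    by (rule lin_onI) (use x'(1-13) k'(1-13) ks f1 f2 in \<open>simp_all add: HM_simps dist E.M.a_ac E.smult_r_distr\<close>)
  from lin_on_lin_hom[OF ext_mod[OF X] this] have t: "t \<in> func (trg x1) (trg k1)" unfolding t_def .
  have val: "t e = t1 (k1' ** (e ** x1)) +[E] t2 (k2' ** (e ** x2))" if "ar e" "deg e = 1" "src e = trg x1" "trg e = trg k1" for e
    using that unfolding t_def by (simp add: HM_simps)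
  have "SPl (trg x1) (trg k1) t" by (rule SPl_sum[OF x k _ _ t val]) (use l ks in auto)
  moreover have "serre.SPl k Ob ar trg src deg (%g f. f ** g) pls (%d X Y. zer d Y X) scl E (trg k1) (trg x1) t"
  proof -
    note rule = serre.SPl_sum[OF op_serre, of k1' k2' k1 k2 x1' x2' x1 x2 t1 t2 t, unfolded op_simps op_SPl]
    show ?thesis
    proof -
      have "SPr (src x1') (src k1') t" by (rule rule) (use k x r ks t val x'(1-13) k'(1-13) in \<open>simp_all\<close>)
      thus ?thesis unfolding SPr_def using x' k' by simp
    qed
  qed
  ultimately show ?thesis unfolding SP_def SPr_def by blast
qed

text \<open>All arrows of either degree that touch \<open>X\<close> vanish, so \<open>X\<close> is
  paired with itself. In \<open>SP_all\<close> this keeps a minimal counterexample from being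
  zero.\<close>

lemma SP_zero:
  assumes X: "X \<in> Ob" "ide X = zer 0 X X"
  shows "\<exists>K t. SP X K t"
proof -
  have z: "e = zer d X Y" if e: "ar e" "src e = X" "trg e = Y" "deg e = d" for e d Y
  proof -
    have "e = e ** zer 0 X X" unfolding X(2)[symmetric] using e by simp
    also have "\<dots> = zer d X Y" using e X(1) by (metis add.right_neutral cmp_zer deg_le)
    finally show ?thesis .
  qed
  have z': "e = zer d Y X" if e: "ar e" "src e = Y" "trg e = X" "deg e = d" for e d Y
  proof -
    have "e = zer 0 X X ** e" unfolding X(2)[symmetric] using e by simp
    also have "\<dots> = zer d Y X" using e X(1) by (metis add_0 zer_cmp deg_le)
    finally show ?thesis .
  qed
  obtain t where t: "t \<in> func X X"
  proof -
    have "lin_on k (HM 1 X X) E (carrier (HM 1 X X)) (%_. 0[E])" by (rule lin_onI) (auto simp: E.smult_r_null)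
    from lin_on_lin_hom[OF ext_mod[OF X(1) X(1)] this] show ?thesis using that by blast
  qed
  have l: "SPl X X t" unfolding SPl_def
  proof (intro conjI ballI allI impI)
    fix Y d assume Y: "Y \<in> Ob" "d \<in> func X Y"
    have g: "hm (zer 0 Y X) Y X" using X Y by simp
    have "push_func X Y t (zer 0 Y X) = d"
    proof (rule func_eqI[OF push_func[OF t X(1) g] Y(2)])
      fix e assume e: "ar e" "deg e = 1" "src e = X" "trg e = Y"
      have "e = zer 1 X Y" using z e by simp
      thus "push_func X Y t (zer 0 Y X) e = d e" using funcD(4)[OF push_func[OF t X(1) g] X(1) Y(1)] funcD(4)[OF Y(2) X(1) Y(1)] by simp
    qed
    thus "\<exists>g. hm g Y X & push_func X Y t g = d" using g by blast
  next
    fix g g' assume "ar g & ar g' & deg g = 0 & deg g' = 0 & trg g = X & trg g' = X & src g' = src g &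
      push_func X (src g) t g = push_func X (src g) t g'"
    hence "g = zer 0 (src g) X" "g' = zer 0 (src g) X" using z' by blast+
    thus "g = g'" by (rule trans[OF _ sym])
  qed (use X t in auto)
  moreover have "SPr X X t" unfolding SPr_def serre.SPl_def[OF op_serre] op_simps op_push_func
  proof (intro conjI ballI allI impI)
    fix Y d assume Y: "Y \<in> Ob" "d \<in> func Y X"
    have g: "hm (zer 0 X Y) X Y" using X Y by simp
    have "pull_func Y X t (zer 0 X Y) = d"
    proof (rule func_eqI[OF pull_func[OF t X(1) g] Y(2)])
      fix e assume e: "ar e" "deg e = 1" "src e = Y" "trg e = X"
      have "e = zer 1 Y X" using z' e by simp
      thus "pull_func Y X t (zer 0 X Y) e = d e" using funcD(4)[OF pull_func[OF t X(1) g] Y(1) X(1)] funcD(4)[OF Y(2) Y(1) X(1)] by simp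
    qed
    thus "\<exists>g. (ar g & deg g = 0 & trg g = Y & src g = X) & pull_func Y X t g = d" using g by blast
  next
    fix g g' assume "ar g & ar g' & deg g = 0 & deg g' = 0 & src g = X & src g' = X & trg g' = trg g &
      pull_func (trg g) X t g = pull_func (trg g) X t g'"
    hence "g = zer 0 X (trg g)" "g' = zer 0 X (trg g)" using z by blast+
    thus "g = g'" by (rule trans[OF _ sym])
  qed (use X t in auto)
  ultimately show ?thesis unfolding SP_def by blast
qed

lemma idem_bip:
  assumes e: "hm e X X" "e ** e = e"
  obtains x1 x2 x1' x2' where "bip x1 x2 x1' x2'" "trg x1 = X" "x1 ** x1' = e" "x2 ** x2' = ide X +++ neg e"
proof -
  have X: "X \<in> Ob" using e by auto
  define f where "f = ide X +++ neg e"
  have f: "hm f X X" unfolding f_def using e X by simp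
  have ef: "e ** f = zer 0 X X" "f ** e = zer 0 X X" unfolding f_def using e X by (simp_all add: dist)
  have "(ide X +++ neg e) ** f = ide X ** f +++ neg e ** f" by (rule cmp_add_left) (use f e(1) X in simp_all)
  hence "f ** f = ide X ** f +++ neg e ** f" unfolding f_def[symmetric] .
  hence ff: "f ** f = f" using f e(1) X ef by (simp add: dist)
  obtain q1 j1 where 1: "hm q1 X (trg q1)" "hm j1 (trg q1) X" "q1 ** j1 = ide (trg q1)" "j1 ** q1 = e" using idem_split[OF e] by blast
  obtain q2 j2 where 2: "hm q2 X (trg q2)" "hm j2 (trg q2) X" "q2 ** j2 = ide (trg q2)" "j2 ** q2 = f" using idem_split[OF f ff] by blast
  have cross: "qb ** ja = zer 0 (trg qa) (trg qb)" if a: "hm qa X (trg qa)" "hm ja (trg qa) X" "qa ** ja = ide (trg qa)" "ja ** qa = a"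
      and b: "hm qb X (trg qb)" "hm jb (trg qb) X" "qb ** jb = ide (trg qb)" "jb ** qb = b" and ba: "b ** a = zer 0 X X" for qa ja qb jb a b
  proof -
    have o: "trg qa \<in> Ob" "trg qb \<in> Ob" using a b by auto
    have ah: "hm a X X" "hm b X X" unfolding a(4)[symmetric] b(4)[symmetric] using a(1,2) b(1,2) by simp_all
    have "qb ** b = qb" unfolding b(4)[symmetric] using pre_cancel[OF b(3), of qb] b(1,2) by simp
    moreover have "a ** ja = ja" unfolding a(4)[symmetric] using a(1-3) o by simp
    ultimately have "qb ** ja = (qb ** b) ** (a ** ja)" by simp
    also have "\<dots> = qb ** ((b ** a) ** ja)" using ah a(1,2) b(1,2) by simp
    also have "\<dots> = zer 0 (trg qa) (trg qb)" unfolding ba using a(1,2) b(1,2) X o by simp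
    finally show ?thesis .
  qed
  have "e +++ f = ide X" unfolding f_def using e(1) X add_lcomm[of e "ide X" "neg e"] by simp
  hence "bip j1 j2 q1 q2" unfolding bip_def using 1 2 cross[OF 1 2 ef(2)] cross[OF 2 1 ef(1)] by simp
  thus ?thesis using that[of j1 j2 q1 q2] 1 2 unfolding f_def by simp
qed

text \<open>A minimal retract without Serre pairing would be indecomposable.\<close>

theorem SP_all:
  assumes X: "X \<in> Ob" and R: "!!Y. Y \<in> Ob ==> rec2 Y" and L: "!!Y. Y \<in> Ob ==> op_rec2 Y"
  shows "\<exists>K t. SP X K t"
proof (rule ccontr)
  assume "\<not> (\<exists>K t. SP X K t)"
  hence "\<nexists>K t. SP (trg (ide X)) K t" using X by simp
  then obtain q j where q: "hm q X (trg q)" "hm j (trg q) X" "q ** j = ide (trg q)" "\<nexists>K t. SP (trg q) K t"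
    and qmin: "!!q' j'. [| hm q' (trg q) (trg q'); hm j' (trg q') (trg q); q' ** j' = ide (trg q');
      \<nexists>K t. SP (trg (q' ** q)) K t |] ==> j' ** q' = ide (trg q)"
    by (rule minimal_retract[OF X, of "%q j. \<nexists>K t. SP (trg q) K t"]) blast
  define Z where "Z = trg q"
  have ZO: "Z \<in> Ob" unfolding Z_def using q(1) by simp
  have "indec Z" unfolding indec_def
  proof (intro conjI allI impI)
    show "ide Z ~= zer 0 Z Z" using SP_zero[OF ZO] q(4) unfolding Z_def by blast
    fix e assume "hm e Z Z & e ** e = e"
    hence e: "hm e Z Z" "e ** e = e" by auto
    obtain x1 x2 x1' x2' where x: "bip x1 x2 x1' x2'" "trg x1 = Z" "x1 ** x1' = e" "x2 ** x2' = ide Z +++ neg e" using idem_bip[OF e] .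
    note x' = bipD[OF x(1)]
    \<comment> \<open>By \<open>SP_sum\<close> one of the two complementary summands has no pairing.
      Minimality makes its inclusion followed by nothing smaller than all of \<open>Z\<close>, so
      \<open>e\<close> or \<open>1 - e\<close> is the identity.\<close>
    show "e = ide Z \<or> e = zer 0 Z Z"
    proof (cases "\<exists>K t. SP (src x1) K t")
      case True
      have n: "\<nexists>K t. SP (src x2) K t"
      proof
        assume "\<exists>K t. SP (src x2) K t"
        from SP_sum[OF x(1) True this] show False using q(4) unfolding x(2) Z_def by (rule notE[rotated])
      qed
      have "x2 ** x2' = ide Z" unfolding Z_def by (rule qmin) (use x' x(2) n q(1) in \<open>simp_all add: Z_def\<close>)
      hence "ide Z +++ neg e = ide Z" using x(4) by simp
      hence "ide Z = ide Z +++ e" using add_eq_swap[of "ide Z" e "ide Z"] e(1) ZO by auto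
      hence "e +++ ide Z = ide Z" using add_comm[of e "ide Z"] e(1) ZO by simp
      hence "e = ide Z +++ neg (ide Z)" using add_eq_swap[of e "ide Z" "ide Z"] e(1) ZO by simp
      thus ?thesis using ZO by simp
    next
      case False
      have "x1 ** x1' = ide Z" unfolding Z_def by (rule qmin) (use x' x(2) False q(1) in \<open>simp_all add: Z_def\<close>)
      thus ?thesis using x(3) by simp
    qed
  qed (rule ZO)
  thus False using indec_SP[OF _ R L] q(4) unfolding Z_def by blast
qed

theorem SP_all_op:
  assumes X: "X \<in> Ob" and R: "!!Y. Y \<in> Ob ==> rec2 Y" and L: "!!Y. Y \<in> Ob ==> op_rec2 Y"
  shows "\<exists>K t. SP K X t" using serre.SP_all[OF op_serre X, unfolded op_SP] R L by blast

end

section \<open>The graded category of an abelian category: typed arrows and Yoneda classes\<close>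

lemma module_transfer:
  fixes M :: "('k, 'a) module" and N :: "('k, 'b) module"
  assumes M: "module k M" and b: "bij_betw \<phi> (carrier M) (carrier N)" and z: "\<phi> 0[M] = 0[N]"
    and add: "!!x y. [| x \<in> carrier M; y \<in> carrier M |] ==> \<phi> x +[N] \<phi> y = \<phi> (x +[M] y)"
    and scl: "!!a x. [| a \<in> carrier k; x \<in> carrier M |] ==> a .[N] \<phi> x = \<phi> (a .[M] x)"
  shows "module k N"
proof -
  interpret M: module k M by fact
  have N: "carrier N = \<phi> ` carrier M" using b unfolding bij_betw_def by simp
  have ex: "\<exists>x\<in>carrier M. y = \<phi> x" if "y \<in> carrier N" for y using that N by blast
  have mem: "\<phi> x \<in> carrier N" if "x \<in> carrier M" for x using that N by blast
  have ag: "abelian_group N"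
  proof (rule abelian_groupI)
    show "0[N] \<in> carrier N" using mem[of "0[M]"] z by simp
    fix u assume "u \<in> carrier N"
    then obtain x where x: "x \<in> carrier M" "u = \<phi> x" using ex by blast
    show "0[N] +[N] u = u" unfolding x(2) z[symmetric] using x(1) add by simp
    have "\<phi> (-[M] x) +[N] u = 0[N]" unfolding x(2) using x(1) add z by (simp add: M.l_neg)
    thus "\<exists>v\<in>carrier N. v +[N] u = 0[N]" using mem x(1) by blast
    fix v assume "v \<in> carrier N"
    then obtain y where y: "y \<in> carrier M" "v = \<phi> y" using ex by blast
    show "u +[N] v \<in> carrier N" unfolding x(2) y(2) using x(1) y(1) add mem by simp
    show "u +[N] v = v +[N] u" unfolding x(2) y(2) using x(1) y(1) add M.a_comm[of x y] by simp
    fix w assume "w \<in> carrier N"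
    then obtain r where r: "r \<in> carrier M" "w = \<phi> r" using ex by blast
    show "(u +[N] v) +[N] w = u +[N] (v +[N] w)" unfolding x(2) y(2) r(2) using x(1) y(1) r(1) add by (simp add: M.a_assoc)
  qed
  show ?thesis
  proof (rule moduleI[OF M.R.is_cring ag])
    fix a u assume a: "a \<in> carrier k" and "u \<in> carrier N"
    then obtain x where x: "x \<in> carrier M" "u = \<phi> x" using ex by blast
    show "a .[N] u \<in> carrier N" unfolding x(2) using scl a x(1) mem by simp
    fix b assume b: "b \<in> carrier k"
    show "(a +[k] b) .[N] u = a .[N] u +[N] b .[N] u" unfolding x(2) using scl a b x(1) add by (simp add: M.smult_l_distr)
    show "(a *[k] b) .[N] u = a .[N] (b .[N] u)" unfolding x(2) using scl a b x(1) by (simp add: M.smult_assoc1)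
  next
    fix a u v assume a: "a \<in> carrier k" and "u \<in> carrier N" "v \<in> carrier N"
    then obtain x y where x: "x \<in> carrier M" "u = \<phi> x" "y \<in> carrier M" "v = \<phi> y" using ex by blast
    show "a .[N] (u +[N] v) = a .[N] u +[N] a .[N] v" unfolding x(2,4) using scl a x(1,3) add by (simp add: M.smult_r_distr)
  next
    fix u assume "u \<in> carrier N"
    then obtain x where x: "x \<in> carrier M" "u = \<phi> x" using ex by blast
    show "1[k] .[N] u = u" unfolding x(2) using scl x(1) by simp
  qed
qed

text \<open>Source and target are stored in the arrow since the hom sets of \<open>C\<close> need
  not be disjoint. \<open>Inl\<close> carries morphisms, \<open>Inr\<close> classes of
  extensions.\<close>

type_synonym ('o, 'm) garrow = "'o \<times> ('m + ('o \<times> 'm \<times> 'm) set) \<times> 'o"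

fun g_arr :: "('k, 'o, 'm) lincat => ('o, 'm) garrow => bool" where
  "g_arr C (X, Inl u, Y) <-> X \<in> Ob C & Y \<in> Ob C & u \<in> arr C X Y"
| "g_arr C (X, Inr c, Y) <-> X \<in> Ob C & Y \<in> Ob C & c \<in> carrier (Ext1 C X Y)"

fun g_deg :: "('o, 'm) garrow => nat" where
  "g_deg (X, Inl u, Y) = 0"
| "g_deg (X, Inr c, Y) = 1"

fun g_src :: "('o, 'm) garrow => 'o" where "g_src (X, a, Y) = X"
fun g_trg :: "('o, 'm) garrow => 'o" where "g_trg (X, a, Y) = Y"

definition g_ide :: "('k, 'o, 'm) lincat => 'o => ('o, 'm) garrow" where
  "g_ide C X = (X, Inl (Ident C X), X)"

text \<open>Two classes would compose to degree two, above the degree bound, where the axioms of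
  \<open>gcat\<close> make no claim; hence \<open>undefined\<close> in the last clause.\<close>

fun g_cmp :: "('k, 'o, 'm) lincat => ('o, 'm) garrow => ('o, 'm) garrow => ('o, 'm) garrow" where
  "g_cmp C (_, Inl u, Z) (X, Inl v, _) = (X, Inl (u \<cdot>\<^bsub>C\<^esub> v), Z)"
| "g_cmp C (_, Inl u, Z) (X, Inr c, _) = (X, Inr (ext_push C X Z u c), Z)"
| "g_cmp C (_, Inr c, Z) (X, Inl v, _) = (X, Inr (ext_pull C X Z v c), Z)"
| "g_cmp C (_, Inr c, Z) (X, Inr d, _) = (X, Inr undefined, Z)"

fun g_add :: "('k, 'o, 'm) lincat => ('o, 'm) garrow => ('o, 'm) garrow => ('o, 'm) garrow" where
  "g_add C (X, Inl u, Y) (_, Inl v, _) = (X, Inl (u +[Hom C X Y] v), Y)"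
| "g_add C (X, Inr c, Y) (_, Inr d, _) = (X, Inr (c +[Ext1 C X Y] d), Y)"
| "g_add C f g = undefined"

definition g_zer :: "('k, 'o, 'm) lincat => nat => 'o => 'o => ('o, 'm) garrow" where
  "g_zer C d X Y = (X, if d = 0 then Inl 0[Hom C X Y] else Inr 0[Ext1 C X Y], Y)"

fun g_scl :: "('k, 'o, 'm) lincat => 'k => ('o, 'm) garrow => ('o, 'm) garrow" where
  "g_scl C a (X, Inl u, Y) = (X, Inl (a .[Hom C X Y] u), Y)"
| "g_scl C a (X, Inr c, Y) = (X, Inr (a .[Ext1 C X Y] c), Y)"

text \<open>The arrows of degree zero form a graded category of their own, with bound zero. It has
  to come first, because the laws for classes are derived from its abelian structure.\<close>

definition g_hom :: "('k, 'o, 'm) lincat => ('o, 'm) garrow => bool" where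
  "g_hom C f <-> g_arr C f & g_deg f = 0"

lemma g_hom_Inl: "g_hom C (X, Inl u, Y) <-> X \<in> Ob C & Y \<in> Ob C & u \<in> arr C X Y" unfolding g_hom_def by simp

lemma g_homE:
  assumes "g_hom C f"
  obtains X u Y where "f = (X, Inl u, Y)" "X \<in> Ob C" "Y \<in> Ob C" "u \<in> arr C X Y"
  using assms unfolding g_hom_def by (cases f rule: g_deg.cases) auto

lemma (in linear_category) g_hom_module:
  assumes "X \<in> Ob C" "Y \<in> Ob C"
  shows "module k (hom_mod (g_hom C) g_src g_trg g_deg (g_add C) (g_zer C) (g_scl C) 0 X Y)"
proof (rule module_transfer[OF hom_module[OF assms], of "%u. (X, Inl u, Y)"])
  have "carrier (hom_mod (g_hom C) g_src g_trg g_deg (g_add C) (g_zer C) (g_scl C) 0 X Y) = (%u. (X, Inl u, Y)) ` arr C X Y"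
    unfolding hom_mod_def using assms by (auto elim!: g_homE simp: g_hom_Inl)
  thus "bij_betw (%u. (X, Inl u, Y)) (arr C X Y) (carrier (hom_mod (g_hom C) g_src g_trg g_deg (g_add C) (g_zer C) (g_scl C) 0 X Y))"
    unfolding bij_betw_def by (auto intro: inj_onI)
qed (auto simp: hom_mod_def g_zer_def)

sublocale linear_category \<subseteq> h: gcat k 0 "Ob C" "g_hom C" g_src g_trg g_deg "g_ide C" "g_cmp C" "g_add C" "g_zer C" "g_scl C"
proof (rule gcat.intro)
  show "module k (hom_mod (g_hom C) g_src g_trg g_deg (g_add C) (g_zer C) (g_scl C) d X Y)"
    if "X \<in> Ob C" "Y \<in> Ob C" "d \<le> 0" for d X Y using g_hom_module[OF that(1,2)] that(3) by simp
qed (auto elim!: g_homE simp: base_cring g_hom_Inl g_ide_def ident_closed comp_closed comp_ident_right comp_ident_left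
    comp_assoc comp_add_right comp_add_left comp_smult_right comp_smult_left)

context linear_category begin

lemma g_mono:
  assumes "X \<in> Ob C" "Y \<in> Ob C"
  shows "h.mono (X, Inl u, Y) <-> u \<in> mono_arr C X Y"
proof
  assume m: "h.mono (X, Inl u, Y)"
  have "a = b" if "Z \<in> Ob C" "a \<in> arr C Z X" "b \<in> arr C Z X" "u \<cdot> a = u \<cdot> b" for Z a b
    using h.mono_cancel[OF m, of "(Z, Inl a, X)" "(Z, Inl b, X)"] that assms by (simp add: g_hom_Inl)
  thus "u \<in> mono_arr C X Y" using h.monoD(1)[OF m] unfolding mono_arr_def by (auto simp: g_hom_Inl)
next
  assume m: "u \<in> mono_arr C X Y"
  hence u: "g_hom C (X, Inl u, Y)" using assms unfolding mono_arr_def by (simp add: g_hom_Inl)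
  show "h.mono (X, Inl u, Y)"
  proof (rule h.monoI[OF u])
    fix f assume f: "g_hom C f" "g_deg f = 0" "g_trg f = g_src (X, Inl u, Y)"
      "g_cmp C (X, Inl u, Y) f = g_zer C 0 (g_src f) (g_trg (X, Inl u, Y))"
    obtain Z v where v: "f = (Z, Inl v, X)" "Z \<in> Ob C" "v \<in> arr C Z X" using f(1,3) by (auto elim!: g_homE)
    have z: "0[Hom C Z X] \<in> arr C Z X" using h.zer_closed(1)[of Z X 0] v(2) assms by (simp add: g_zer_def g_hom_Inl)
    have "u \<cdot> 0[Hom C Z X] = 0[Hom C Z Y]" using h.cmp_zer[OF u, of X Z 0] v(2) by (simp add: g_zer_def)
    hence "v = 0[Hom C Z X]" using m v f(4) z unfolding mono_arr_def by (auto simp: g_zer_def)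
    thus "f = g_zer C 0 (g_src f) (g_src (X, Inl u, Y))" using v(1) by (simp add: g_zer_def)
  qed simp
qed

lemma g_epi:
  assumes "X \<in> Ob C" "Y \<in> Ob C"
  shows "h.epi (X, Inl u, Y) <-> u \<in> epi_arr C X Y"
proof
  assume m: "h.epi (X, Inl u, Y)"
  have "a = b" if "Z \<in> Ob C" "a \<in> arr C Y Z" "b \<in> arr C Y Z" "a \<cdot> u = b \<cdot> u" for Z a b
    using h.epi_cancel[OF m, of "(Y, Inl a, Z)" "(Y, Inl b, Z)"] that assms by (simp add: g_hom_Inl)
  thus "u \<in> epi_arr C X Y" using h.epiD(1)[OF m] unfolding epi_arr_def by (auto simp: g_hom_Inl)
next
  assume m: "u \<in> epi_arr C X Y"
  hence u: "g_hom C (X, Inl u, Y)" using assms unfolding epi_arr_def by (simp add: g_hom_Inl)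
  show "h.epi (X, Inl u, Y)" unfolding h.epi_def
  proof (intro conjI allI impI u)
    fix f assume f: "g_hom C f & g_deg f = 0 & g_src f = g_trg (X, Inl u, Y) &
      g_cmp C f (X, Inl u, Y) = g_zer C 0 (g_src (X, Inl u, Y)) (g_trg f)"
    then obtain Z v where v: "f = (Y, Inl v, Z)" "Z \<in> Ob C" "v \<in> arr C Y Z" by (auto elim!: g_homE)
    have z: "0[Hom C Y Z] \<in> arr C Y Z" using h.zer_closed(1)[of Y Z 0] v(2) assms by (simp add: g_zer_def g_hom_Inl)
    have "0[Hom C Y Z] \<cdot> u = 0[Hom C X Z]" using h.zer_cmp[OF u, of Y Z 0] v(2) by (simp add: g_zer_def)
    hence "v = 0[Hom C Y Z]" using m v f z unfolding epi_arr_def by (auto simp: g_zer_def)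
    thus "f = g_zer C 0 (g_trg (X, Inl u, Y)) (g_trg f)" using v(1) by (simp add: g_zer_def)
  qed simp
qed

lemma g_ker:
  assumes "X \<in> Ob C" "Y \<in> Ob C" "f \<in> arr C X Y"
  shows "h.ker (X, Inl f, Y) (K, Inl i, X) <-> is_kernel C X Y f K i"
proof
  assume k: "h.ker (X, Inl f, Y) (K, Inl i, X)"
  note k' = h.kerD[OF k]
  have K: "K \<in> Ob C" "i \<in> arr C K X" using k'(2) by (auto simp: g_hom_Inl)
  have m: "i \<in> mono_arr C K X" using k'(1) g_mono K assms by simp
  have "\<exists>!h. h \<in> arr C Z K & i \<cdot> h = g" if Z: "Z \<in> Ob C" "g \<in> arr C Z X" "f \<cdot> g = 0[Hom C Z Y]" for Z g
  proof -
    have "\<exists>w. h.hm w Z K & g_cmp C (K, Inl i, X) w = (Z, Inl g, X)"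
      using k'(6)[of "(Z, Inl g, X)"] Z assms by (simp add: g_hom_Inl g_zer_def)
    then obtain w where "h.hm w Z K" "g_cmp C (K, Inl i, X) w = (Z, Inl g, X)" by blast
    hence "\<exists>h. h \<in> arr C Z K & i \<cdot> h = g" by (auto elim!: g_homE)
    thus ?thesis using m Z(1) unfolding mono_arr_def by blast
  qed
  thus "is_kernel C X Y f K i" unfolding is_kernel_def using K k'(5) by (auto simp: g_zer_def)
next
  assume k: "is_kernel C X Y f K i"
  hence K: "K \<in> Ob C" "i \<in> arr C K X" "f \<cdot> i = 0[Hom C K Y]" unfolding is_kernel_def by auto
  have "i \<in> mono_arr C K X" unfolding mono_arr_def
  proof (intro CollectI conjI ballI impI K)
    fix Z u v assume Z: "Z \<in> Ob C" and u: "u \<in> arr C Z K" "v \<in> arr C Z K" "i \<cdot> u = i \<cdot> v"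
    have g: "g_hom C (X, Inl f, Y)" using assms by (simp add: g_hom_Inl)
    have z: "f \<cdot> 0[Hom C Z X] = 0[Hom C Z Y]" using h.cmp_zer[OF g, of X Z 0] Z by (simp add: g_zer_def)
    have z0: "g_hom C (K, Inl u, K)" if "Z = K" using u that Z by (simp add: g_hom_Inl)
    have a: "i \<cdot> u \<in> arr C Z X" using comp_closed[of Z K X u i] Z K u assms by simp
    have "f \<cdot> (i \<cdot> u) = (f \<cdot> i) \<cdot> u" using comp_assoc[of Z K X Y u i f] Z K u assms by simp
    also have "\<dots> = 0[Hom C Z Y]" unfolding K(3)
      using h.zer_cmp[of "(Z, Inl u, K)" K Y 0] Z K u assms by (simp add: g_zer_def g_hom_Inl)
    finally have "\<exists>!h. h \<in> arr C Z K & i \<cdot> h = i \<cdot> u" using k Z a unfolding is_kernel_def by blast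
    thus "u = v" using u by metis
  qed
  hence m: "h.mono (K, Inl i, X)" using g_mono K assms by simp
  show "h.ker (X, Inl f, Y) (K, Inl i, X)" unfolding h.ker_def
  proof (intro conjI allI impI m)
    show "g_cmp C (X, Inl f, Y) (K, Inl i, X) = g_zer C 0 (g_src (K, Inl i, X)) (g_trg (X, Inl f, Y))" using K(3) by (simp add: g_zer_def)
    fix g assume g: "g_hom C g & g_deg g = 0 & g_trg g = g_src (X, Inl f, Y) &
      g_cmp C (X, Inl f, Y) g = g_zer C 0 (g_src g) (g_trg (X, Inl f, Y))"
    then obtain Z v where v: "g = (Z, Inl v, X)" "Z \<in> Ob C" "v \<in> arr C Z X" by (auto elim!: g_homE)
    hence "f \<cdot> v = 0[Hom C Z Y]" using g by (simp add: g_zer_def)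
    then obtain w where "w \<in> arr C Z K" "i \<cdot> w = v" using k v unfolding is_kernel_def by blast
    thus "\<exists>h. h.hm h (g_src g) (g_src (K, Inl i, X)) & g_cmp C (K, Inl i, X) h = g"
      using v K by (intro exI[of _ "(Z, Inl w, K)"]) (simp add: g_hom_Inl)
  qed simp
qed

lemma g_coker:
  assumes "X \<in> Ob C" "Y \<in> Ob C" "f \<in> arr C X Y"
  shows "h.coker (X, Inl f, Y) (Y, Inl p, Q) <-> is_cokernel C X Y f Q p"
proof
  assume k: "h.coker (X, Inl f, Y) (Y, Inl p, Q)"
  note k' = h.cokerD[OF k]
  have K: "Q \<in> Ob C" "p \<in> arr C Y Q" using k'(2) by (auto simp: g_hom_Inl)
  have m: "p \<in> epi_arr C Y Q" using k'(1) g_epi K assms by simp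
  have "\<exists>!h. h \<in> arr C Q Z & h \<cdot> p = g" if Z: "Z \<in> Ob C" "g \<in> arr C Y Z" "g \<cdot> f = 0[Hom C X Z]" for Z g
  proof -
    have "\<exists>w. h.hm w Q Z & g_cmp C w (Y, Inl p, Q) = (Y, Inl g, Z)"
      using k'(6)[of "(Y, Inl g, Z)"] Z assms by (simp add: g_hom_Inl g_zer_def)
    then obtain w where "h.hm w Q Z" "g_cmp C w (Y, Inl p, Q) = (Y, Inl g, Z)" by blast
    hence "\<exists>h. h \<in> arr C Q Z & h \<cdot> p = g" by (auto elim!: g_homE)
    thus ?thesis using m Z(1) unfolding epi_arr_def by blast
  qed
  thus "is_cokernel C X Y f Q p" unfolding is_cokernel_def using K k'(5) by (auto simp: g_zer_def)
next
  assume k: "is_cokernel C X Y f Q p"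
  hence K: "Q \<in> Ob C" "p \<in> arr C Y Q" "p \<cdot> f = 0[Hom C X Q]" unfolding is_cokernel_def by auto
  have "p \<in> epi_arr C Y Q" unfolding epi_arr_def
  proof (intro CollectI conjI ballI impI K)
    fix Z u v assume Z: "Z \<in> Ob C" and u: "u \<in> arr C Q Z" "v \<in> arr C Q Z" "u \<cdot> p = v \<cdot> p"
    have a: "u \<cdot> p \<in> arr C Y Z" using comp_closed[of Y Q Z p u] Z K u assms by simp
    have "(u \<cdot> p) \<cdot> f = u \<cdot> (p \<cdot> f)" using comp_assoc[of X Y Q Z f p u] Z K u assms by simp
    also have "\<dots> = 0[Hom C X Z]" unfolding K(3)
      using h.cmp_zer[of "(Q, Inl u, Z)" Q X 0] Z K u assms by (simp add: g_zer_def g_hom_Inl)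
    finally have "\<exists>!h. h \<in> arr C Q Z & h \<cdot> p = u \<cdot> p" using k Z a unfolding is_cokernel_def by blast
    thus "u = v" using u by metis
  qed
  hence m: "h.epi (Y, Inl p, Q)" using g_epi K assms by simp
  show "h.coker (X, Inl f, Y) (Y, Inl p, Q)" unfolding h.coker_def
  proof (intro conjI allI impI m)
    show "g_cmp C (Y, Inl p, Q) (X, Inl f, Y) = g_zer C 0 (g_src (X, Inl f, Y)) (g_trg (Y, Inl p, Q))" using K(3) by (simp add: g_zer_def)
    fix g assume g: "g_hom C g & g_deg g = 0 & g_src g = g_trg (X, Inl f, Y) &
      g_cmp C g (X, Inl f, Y) = g_zer C 0 (g_src (X, Inl f, Y)) (g_trg g)"
    then obtain Z v where v: "g = (Y, Inl v, Z)" "Z \<in> Ob C" "v \<in> arr C Y Z" by (auto elim!: g_homE)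
    hence "v \<cdot> f = 0[Hom C X Z]" using g by (simp add: g_zer_def)
    then obtain w where "w \<in> arr C Q Z" "w \<cdot> p = v" using k v unfolding is_cokernel_def by blast
    thus "\<exists>h. h.hm h (g_trg (Y, Inl p, Q)) (g_trg g) & g_cmp C h (Y, Inl p, Q) = g"
      using v K by (intro exI[of _ "(Q, Inl w, Z)"]) (simp add: g_hom_Inl)
  qed simp
qed

lemma g_bip:
  assumes "A \<in> Ob C" "B \<in> Ob C"
  shows "h.bip (A, Inl i1, P) (B, Inl i2, P) (P, Inl p1, A) (P, Inl p2, B) <-> is_biproduct C A B P i1 i2 p1 p2"
  unfolding h.bip_def is_biproduct_def using assms by (auto simp: g_hom_Inl g_ide_def g_zer_def)

end

sublocale abelian_category \<subseteq> h: abgcat k 0 "Ob C" "g_hom C" g_src g_trg g_deg "g_ide C" "g_cmp C" "g_add C" "g_zer C" "g_scl C"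
proof
  obtain Z where "is_zero_object C Z" using zero_object by blast
  thus "\<exists>Z\<in>Ob C. \<forall>f. g_hom C f & g_deg f = 0 & (g_src f = Z \<or> g_trg f = Z) --> f = g_zer C 0 (g_src f) (g_trg f)"
    unfolding is_zero_object_def by (intro bexI[of _ Z]) (auto elim!: g_homE simp: g_zer_def)
next
  fix X Y assume X: "X \<in> Ob C" "Y \<in> Ob C"
  then obtain P i1 i2 p1 p2 where "is_biproduct C X Y P i1 i2 p1 p2" using biproducts by blast
  hence "h.bip (X, Inl i1, P) (Y, Inl i2, P) (P, Inl p1, X) (P, Inl p2, Y)" using g_bip[OF X] by simp
  thus "\<exists>i1 i2 p1 p2. h.bip i1 i2 p1 p2 & g_src i1 = X & g_src i2 = Y" by force
next
  fix f :: "('b, 'c) garrow" assume "g_hom C f"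
  then obtain X u Y where f: "f = (X, Inl u, Y)" "X \<in> Ob C" "Y \<in> Ob C" "u \<in> arr C X Y" by (rule g_homE)
  obtain K i where "is_kernel C X Y u K i" using kernels f by blast
  thus "\<exists>i. h.ker f i" using g_ker[OF f(2-4)] f(1) by blast
  obtain Q p where "is_cokernel C X Y u Q p" using cokernels f by blast
  thus "\<exists>p. h.coker f p" using g_coker[OF f(2-4)] f(1) by blast
next
  fix i assume i: "h.mono i"
  then obtain X u Y where f: "i = (X, Inl u, Y)" "X \<in> Ob C" "Y \<in> Ob C" "u \<in> arr C X Y" using h.monoD(1) by (blast elim: g_homE)
  hence "u \<in> mono_arr C X Y" using i g_mono by simp
  then obtain Z v where "Z \<in> Ob C" "v \<in> arr C Y Z" "is_kernel C Y Z v X u" using mono_is_kernel f by blast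
  thus "\<exists>f. g_hom C f & g_deg f = 0 & h.ker f i"
    using f g_ker[of Y Z v X u] by (intro exI[of _ "(Y, Inl v, Z)"]) (simp add: g_hom_Inl)
next
  fix p assume p: "h.epi p"
  then obtain X u Y where f: "p = (X, Inl u, Y)" "X \<in> Ob C" "Y \<in> Ob C" "u \<in> arr C X Y" using h.epiD(1) by (blast elim: g_homE)
  hence "u \<in> epi_arr C X Y" using p g_epi by simp
  then obtain Z v where "Z \<in> Ob C" "v \<in> arr C Z X" "is_cokernel C Z X v Y u" using epi_is_cokernel f by blast
  thus "\<exists>f. g_hom C f & g_deg f = 0 & h.coker f p"
    using f g_coker[of Z X v u Y] by (intro exI[of _ "(Z, Inl v, X)"]) (simp add: g_hom_Inl)
qed

context abelian_category begin

text \<open>A triple in \<open>ses C X Y\<close> does not record its end terms, so they are supplied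
  as arguments.\<close>

definition up :: "'b => 'b => 'b \<times> 'c \<times> 'c => ('b, 'c) garrow \<times> ('b, 'c) garrow" where
  "up X Y = (%(E, i, p). ((Y, Inl i, E), (E, Inl p, X)))"

lemma up_simps [simp]:
  "up X Y (E, i, p) = ((Y, Inl i, E), (E, Inl p, X))"
  "h.sub (up X Y t) = Y" "h.quo (up X Y t) = X" unfolding up_def by (auto split: prod.splits)

lemma up_sexact: "[| X \<in> Ob C; Y \<in> Ob C |] ==> h.sexact (up X Y t) <-> t \<in> ses C X Y"
proof -
  assume X: "X \<in> Ob C" "Y \<in> Ob C"
  obtain E i p where t: "t = (E, i, p)" by (cases t)
  show ?thesis
  proof
    assume s: "h.sexact (up X Y t)"
    have "E \<in> Ob C" "i \<in> arr C Y E" "p \<in> arr C E X" using h.sexactD(1,2)[OF s[unfolded t up_simps]] by (auto simp: g_hom_Inl)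
    thus "t \<in> ses C X Y" using s g_ker[of E X p Y i] g_coker[of Y E i p X] X unfolding t ses_def h.sexact_def by simp
  next
    assume s: "t \<in> ses C X Y"
    hence "E \<in> Ob C" "i \<in> arr C Y E" "p \<in> arr C E X" unfolding t ses_def by auto
    thus "h.sexact (up X Y t)" using s g_ker[of E X p Y i] g_coker[of Y E i p X] X unfolding t ses_def h.sexact_def by simp
  qed
qed

lemma sexact_up:
  assumes "h.sexact s"
  obtains t where "s = up (h.quo s) (h.sub s) t" "t \<in> ses C (h.quo s) (h.sub s)"
proof -
  obtain i p where s: "s = (i, p)" by (cases s)
  note a = h.sexactD[OF assms[unfolded s]]
  obtain Y u E where i: "i = (Y, Inl u, E)" using a(1) by (auto elim!: g_homE)
  obtain X v where p: "p = (E, Inl v, X)" using a(2,5) i by (auto elim!: g_homE)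
  have 1: "s = up (h.quo s) (h.sub s) (E, u, v)" unfolding s i p by simp
  thus ?thesis using that[OF 1] up_sexact[OF h.ses_ob(2,1)[OF assms]] assms by metis
qed

lemma mor_up:
  assumes "X \<in> Ob C" "Y \<in> Ob C" "X' \<in> Ob C" "Y' \<in> Ob C"
  shows "h.mor (up X Y (E, i, p)) (up X' Y' (E', i', p')) (Y, Inl g, Y') (X, Inl f, X') <->
    (E, i, p) \<in> ses C X Y & (E', i', p') \<in> ses C X' Y' & g \<in> arr C Y Y' & f \<in> arr C X X' &
    (\<exists>h\<in>arr C E E'. h \<cdot> i = i' \<cdot> g & p' \<cdot> h = f \<cdot> p)"
proof -
  have *: "(\<exists>h. h.hm h E E' & g_cmp C h (Y, Inl i, E) = g_cmp C (Y', Inl i', E') (Y, Inl g, Y') &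
      g_cmp C (E', Inl p', X') h = g_cmp C (X, Inl f, X') (E, Inl p, X)) <->
    (\<exists>h\<in>arr C E E'. h \<cdot> i = i' \<cdot> g & p' \<cdot> h = f \<cdot> p)" (is "?L <-> ?R") if "E \<in> Ob C" "E' \<in> Ob C"
  proof
    assume ?L thus ?R by (auto elim!: g_homE)
  next
    assume ?R
    then obtain h where "h \<in> arr C E E'" "h \<cdot> i = i' \<cdot> g" "p' \<cdot> h = f \<cdot> p" by blast
    thus ?L using that by (intro exI[of _ "(E, Inl h, E')"]) (simp add: g_hom_Inl)
  qed
  have o: "E \<in> Ob C" if "(E, i, p) \<in> ses C X Y" for E i p X Y using that unfolding ses_def by auto
  show ?thesis
  proof (cases "(E, i, p) \<in> ses C X Y & (E', i', p') \<in> ses C X' Y'")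
    case True
    hence "E \<in> Ob C" "E' \<in> Ob C" using o by auto
    from *[OF this] show ?thesis
      unfolding h.mor_def up_sexact[OF assms(1,2)] up_sexact[OF assms(3,4)] using True assms by (simp add: g_hom_Inl)
  next
    case False
    thus ?thesis unfolding h.mor_def up_sexact[OF assms(1,2)] up_sexact[OF assms(3,4)] by blast
  qed
qed

text \<open>The class of a typed sequence as a set of untyped triples. By the five lemma, morphisms
  with identities at both ends are exactly the pairs in \<open>ses_equiv\<close>
  (\<open>ses_equiv_up\<close>).\<close>

definition cls :: "('b, 'c) garrow \<times> ('b, 'c) garrow => ('b \<times> 'c \<times> 'c) set" where
  "cls s = {t. h.mor s (up (h.quo s) (h.sub s) t) (g_ide C (h.sub s)) (g_ide C (h.quo s))}"

lemma mor_ide_ends: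
  assumes "h.mor s s' (g_ide C (h.sub s)) (g_ide C (h.quo s))"
  shows "h.sub s' = h.sub s" "h.quo s' = h.quo s" using h.morD[OF assms] h.ses_ob[OF h.morD(1)[OF assms]] by simp_all

lemma mor_ide_trans:
  assumes "h.mor s s' (g_ide C (h.sub s)) (g_ide C (h.quo s))" "h.mor s' s'' g f"
  shows "h.mor s s'' g f" using h.mor_comp[OF assms] h.morD[OF assms(2)] mor_ide_ends[OF assms(1)] by simp

lemma mor_trans_ide:
  assumes "h.mor s s' g f" "h.mor s' s'' (g_ide C (h.sub s')) (g_ide C (h.quo s'))"
  shows "h.mor s s'' g f" using h.mor_comp[OF assms] h.morD[OF assms(1)] by simp

lemma cls_eq:
  assumes "h.sexact s" "h.sexact s'" "h.sub s' = h.sub s" "h.quo s' = h.quo s"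
  shows "cls s = cls s' <-> h.mor s s' (g_ide C (h.sub s)) (g_ide C (h.quo s))"
proof
  assume e: "cls s = cls s'"
  obtain t where t: "s' = up (h.quo s) (h.sub s) t" using sexact_up[OF assms(2)] assms(3,4) by metis
  have "h.mor s' s' (g_ide C (h.sub s)) (g_ide C (h.quo s))" using h.mor_ide[OF assms(2)] assms(3,4) by simp
  hence "t \<in> cls s'" unfolding cls_def using assms(3,4) t by simp
  hence "t \<in> cls s" using e by simp
  thus "h.mor s s' (g_ide C (h.sub s)) (g_ide C (h.quo s))" unfolding cls_def using t by simp
next
  assume m: "h.mor s s' (g_ide C (h.sub s)) (g_ide C (h.quo s))"
  show "cls s = cls s'" unfolding cls_def assms(3,4) using mor_ide_trans[OF m] h.mor_eqv_trans_left[OF _ m] by blast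
qed

lemma ses_equiv_up:
  assumes X: "X \<in> Ob C" "Y \<in> Ob C"
  shows "(t, t') \<in> ses_equiv C X Y <-> h.mor (up X Y t) (up X Y t') (g_ide C Y) (g_ide C X)"
proof -
  obtain E i p where t: "t = (E, i, p)" by (cases t)
  obtain E' i' p' where t': "t' = (E', i', p')" by (cases t')
  have red: "(\<exists>h\<in>arr C E E'. h \<cdot> i = i' \<cdot> Ident C Y & p' \<cdot> h = Ident C X \<cdot> p) <-> (\<exists>h\<in>iso_arr C E E'. h \<cdot> i = i' & p' \<cdot> h = p)"
    if s: "(E, i, p) \<in> ses C X Y" "(E', i', p') \<in> ses C X Y"
  proof -
    have a: "E \<in> Ob C" "i \<in> arr C Y E" "p \<in> arr C E X" "E' \<in> Ob C" "i' \<in> arr C Y E'" "p' \<in> arr C E' X"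
      using s unfolding ses_def by auto
    have "h \<in> iso_arr C E E'" if hh: "h \<in> arr C E E'" "h \<cdot> i = i'" "p' \<cdot> h = p" for h
    proof -
      have "\<exists>r. h.inv_pair (E, Inl h, E') r"
        by (rule h.five_lemma[of "(Y, Inl i, E)" "(E, Inl p, X)" "(Y, Inl i', E')" "(E', Inl p', X)"])
          (use s hh up_sexact[OF X, of "(E, i, p)"] up_sexact[OF X, of "(E', i', p')"] a in \<open>simp_all add: g_hom_Inl\<close>)
      then obtain r where "h.inv_pair (E, Inl h, E') r" by blast
      note r = h.inv_pairD[OF this]
      obtain v where "r = (E', Inl v, E)" "v \<in> arr C E' E" using r(2,5,6) by (auto elim!: g_homE)
      thus ?thesis unfolding iso_arr_def using r(7,8) hh(1) by (auto simp: g_ide_def)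
    qed
    thus ?thesis using a X comp_ident_right comp_ident_left unfolding iso_arr_def by auto
  qed
  have I: "Ident C X \<in> arr C X X" "Ident C Y \<in> arr C Y Y" using X ident_closed by auto
  show ?thesis unfolding t t' g_ide_def mor_up[OF X X] unfolding ses_equiv_def using red I by auto
qed

lemma ext_carrier:
  assumes X: "X \<in> Ob C" "Y \<in> Ob C"
  shows "c \<in> carrier (Ext1 C X Y) <-> (\<exists>s. h.sexact s & h.sub s = Y & h.quo s = X & c = cls s)"
proof -
  have im: "ses_equiv C X Y `` {t} = cls (up X Y t)" for t
    by (rule Set.set_eqI) (simp only: cls_def Image_singleton_iff ses_equiv_up[OF X] up_simps mem_Collect_eq)
  have "c \<in> carrier (Ext1 C X Y) <-> (\<exists>t\<in>ses C X Y. c = cls (up X Y t))" unfolding Ext1_def by (auto simp: quotient_def im)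
  also have "\<dots> <-> (\<exists>s. h.sexact s & h.sub s = Y & h.quo s = X & c = cls s)"
  proof
    assume "\<exists>t\<in>ses C X Y. c = cls (up X Y t)"
    then obtain t where "t \<in> ses C X Y" "c = cls (up X Y t)" by blast
    thus "\<exists>s. h.sexact s & h.sub s = Y & h.quo s = X & c = cls s" using up_sexact[OF X] by (intro exI[of _ "up X Y t"]) simp
  next
    assume "\<exists>s. h.sexact s & h.sub s = Y & h.quo s = X & c = cls s"
    then obtain s where s: "h.sexact s" "h.sub s = Y" "h.quo s = X" "c = cls s" by blast
    thus "\<exists>t\<in>ses C X Y. c = cls (up X Y t)" using sexact_up[OF s(1)] by metis
  qed
  finally show ?thesis .
qed

text \<open>By \<open>push_factor\<close>, the extensions that receive a morphism over
  \<open>g\<close> from a member of the class are those equivalent to the single pushout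
  \<open>s'\<close>.\<close>

lemma ext_push_cls:
  assumes m: "h.mor s s' (Y, Inl g, Y') (g_ide C X)" and q: "h.quo s = X"
  shows "ext_push C X Y' g (cls s) = cls s'"
proof -
  note d = h.morD[OF m]
  have X: "X \<in> Ob C" "Y \<in> Ob C" "Y' \<in> Ob C" "g \<in> arr C Y Y'" using d(3) h.ses_ob(2)[OF d(1)] q by (auto simp: g_hom_Inl)
  have e: "h.sub s = Y" "h.sub s' = Y'" "h.quo s' = X" using d(5,6,10) X by simp_all
  have I: "Ident C X \<in> arr C X X" using X ident_closed by auto
  have "t \<in> ext_push C X Y' g (cls s) <-> (\<exists>u\<in>cls s. h.mor (up X Y u) (up X Y' t) (Y, Inl g, Y') (g_ide C X))" for t
  proof -
    obtain E' i' p' where t: "t = (E', i', p')" by (cases t)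
    have k: "(E', i', p') \<in> ses C X Y' & (\<exists>h\<in>arr C E E'. h \<cdot> i = i' \<cdot> g & p' \<cdot> h = p) <->
        h.mor (up X Y (E, i, p)) (up X Y' t) (Y, Inl g, Y') (g_ide C X)" if "(E, i, p) \<in> cls s" for E i p
    proof -
      have "(E, i, p) \<in> ses C X Y" using that h.morD(2) up_sexact[OF X(1,2)] unfolding cls_def e q by blast
      thus ?thesis unfolding g_ide_def t mor_up[OF X(1,2) X(1,3)] using X I comp_ident_left[of E X p] unfolding ses_def by auto
    qed
    have "t \<in> ext_push C X Y' g (cls s) <-> (\<exists>E i p. (E, i, p) \<in> cls s & ((E', i', p') \<in> ses C X Y' & (\<exists>h\<in>arr C E E'. h \<cdot> i = i' \<cdot> g & p' \<cdot> h = p)))"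
      unfolding t ext_push_def by auto
    also have "\<dots> <-> (\<exists>E i p. (E, i, p) \<in> cls s & h.mor (up X Y (E, i, p)) (up X Y' t) (Y, Inl g, Y') (g_ide C X))" using k by blast
    also have "\<dots> <-> (\<exists>u\<in>cls s. h.mor (up X Y u) (up X Y' t) (Y, Inl g, Y') (g_ide C X))" by (simp only: Bex_def split_paired_Ex)
    finally show ?thesis .
  qed
  moreover have "(\<exists>u\<in>cls s. h.mor (up X Y u) (up X Y' t) (Y, Inl g, Y') (g_ide C X)) <-> t \<in> cls s'" for t
  proof
    assume "\<exists>u\<in>cls s. h.mor (up X Y u) (up X Y' t) (Y, Inl g, Y') (g_ide C X)"
    then obtain u where u: "h.mor s (up X Y u) (g_ide C (h.sub s)) (g_ide C (h.quo s))"
      "h.mor (up X Y u) (up X Y' t) (Y, Inl g, Y') (g_ide C X)" unfolding cls_def e q by blast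
    have "h.mor s (up X Y' t) (Y, Inl g, Y') (g_ide C X)" by (rule mor_ide_trans[OF u])
    hence "h.mor s' (up X Y' t) (g_ide C (g_trg (Y, Inl g, Y'))) (g_ide C X)" by (rule h.push_factor) (use m q in simp)
    thus "t \<in> cls s'" unfolding cls_def e by simp
  next
    assume t: "t \<in> cls s'"
    obtain u where u: "s = up X Y u" using sexact_up[OF d(1)] e q by metis
    have "u \<in> cls s" using h.mor_ide[OF d(1)] u unfolding cls_def by simp
    moreover have "h.mor s (up X Y' t) (Y, Inl g, Y') (g_ide C X)"
      by (rule mor_trans_ide[OF m]) (use t e in \<open>simp add: cls_def\<close>)
    ultimately show "\<exists>u\<in>cls s. h.mor (up X Y u) (up X Y' t) (Y, Inl g, Y') (g_ide C X)" using u by blast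
  qed
  ultimately show ?thesis by blast
qed

lemma ext_pull_cls:
  assumes m: "h.mor s' s (g_ide C Y) (X', Inl f, X)" and q: "h.sub s = Y"
  shows "ext_pull C X' Y f (cls s) = cls s'"
proof -
  note d = h.morD[OF m]
  have X: "X \<in> Ob C" "Y \<in> Ob C" "X' \<in> Ob C" "f \<in> arr C X' X" using d(7) h.ses_ob(1)[OF d(2)] q by (auto simp: g_hom_Inl)
  have e: "h.quo s = X" "h.quo s' = X'" "h.sub s' = Y" using d(9,10,5) X by simp_all
  have I: "Ident C Y \<in> arr C Y Y" using X ident_closed by auto
  have "t \<in> ext_pull C X' Y f (cls s) <-> (\<exists>u\<in>cls s. h.mor (up X' Y t) (up X Y u) (g_ide C Y) (X', Inl f, X))" for t
  proof -
    obtain E' i' p' where t: "t = (E', i', p')" by (cases t)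
    have k: "(E', i', p') \<in> ses C X' Y & (\<exists>h\<in>arr C E' E. h \<cdot> i' = i & p \<cdot> h = f \<cdot> p') <->
        h.mor (up X' Y t) (up X Y (E, i, p)) (g_ide C Y) (X', Inl f, X)" if "(E, i, p) \<in> cls s" for E i p
    proof -
      have "(E, i, p) \<in> ses C X Y" using that h.morD(2) up_sexact[OF X(1,2)] unfolding cls_def e q by blast
      thus ?thesis unfolding g_ide_def t mor_up[OF X(3,2) X(1,2)] using X I comp_ident_right[of Y E i] unfolding ses_def by auto
    qed
    have "t \<in> ext_pull C X' Y f (cls s) <-> (\<exists>E i p. (E, i, p) \<in> cls s & ((E', i', p') \<in> ses C X' Y & (\<exists>h\<in>arr C E' E. h \<cdot> i' = i & p \<cdot> h = f \<cdot> p')))"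
      unfolding t ext_pull_def by auto
    also have "\<dots> <-> (\<exists>E i p. (E, i, p) \<in> cls s & h.mor (up X' Y t) (up X Y (E, i, p)) (g_ide C Y) (X', Inl f, X))" using k by blast
    also have "\<dots> <-> (\<exists>u\<in>cls s. h.mor (up X' Y t) (up X Y u) (g_ide C Y) (X', Inl f, X))" by (simp only: Bex_def split_paired_Ex)
    finally show ?thesis .
  qed
  moreover have "(\<exists>u\<in>cls s. h.mor (up X' Y t) (up X Y u) (g_ide C Y) (X', Inl f, X)) <-> t \<in> cls s'" for t
  proof
    assume "\<exists>u\<in>cls s. h.mor (up X' Y t) (up X Y u) (g_ide C Y) (X', Inl f, X)"
    then obtain u where u: "h.mor s (up X Y u) (g_ide C (h.sub s)) (g_ide C (h.quo s))"
      "h.mor (up X' Y t) (up X Y u) (g_ide C Y) (X', Inl f, X)" unfolding cls_def e q by blast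
    have "h.mor (up X' Y t) s (g_ide C Y) (X', Inl f, X)" using mor_trans_ide[OF u(2), of s] h.mor_sym[OF u(1)] e q by simp
    hence "h.mor (up X' Y t) s' (g_ide C Y) (g_ide C (g_src (X', Inl f, X)))" by (rule h.pull_factor) (use m q in simp)
    hence "h.mor s' (up X' Y t) (g_ide C Y) (g_ide C X')" using h.mor_sym[of "up X' Y t" s'] by simp
    thus "t \<in> cls s'" unfolding cls_def e by simp
  next
    assume t: "t \<in> cls s'"
    obtain u where u: "s = up X Y u" using sexact_up[OF d(2)] e q by metis
    have "u \<in> cls s" using h.mor_ide[OF d(2)] u unfolding cls_def by simp
    moreover have "h.mor (up X' Y t) s (g_ide C Y) (X', Inl f, X)"
      by (rule mor_ide_trans[OF _ m]) (use t e h.mor_sym[of s' "up X' Y t"] in \<open>simp add: cls_def\<close>)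
    ultimately show "\<exists>u\<in>cls s. h.mor (up X' Y t) (up X Y u) (g_ide C Y) (X', Inl f, X)" using u by blast
  qed
  ultimately show ?thesis by blast
qed

lemma ext_zero_cls:
  assumes s: "h.split s" "h.sub s = Y" "h.quo s = X"
  shows "0[Ext1 C X Y] = cls s"
proof -
  have sx: "h.sexact s" using s(1) unfolding h.split_def by simp
  have X: "X \<in> Ob C" "Y \<in> Ob C" using h.ses_ob[OF sx] s by auto
  have sp: "h.split (up X Y (E, i, p)) <-> (E, i, p) \<in> ses C X Y & (\<exists>\<sigma>\<in>arr C X E. p \<cdot> \<sigma> = Ident C X)" (is "?L <-> ?R") for E i p
  proof
    assume ?L
    thus ?R unfolding h.split_def up_sexact[OF X] by (auto elim!: g_homE simp: g_ide_def)
  next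
    assume r: ?R
    then obtain \<sigma> where "\<sigma> \<in> arr C X E" "p \<cdot> \<sigma> = Ident C X" by blast
    moreover have "E \<in> Ob C" using r unfolding ses_def by auto
    ultimately show ?L unfolding h.split_def up_sexact[OF X] using r X
      by (intro conjI exI[of _ "(X, Inl \<sigma>, E)"]) (simp_all add: g_hom_Inl g_ide_def)
  qed
  have "0[Ext1 C X Y] = {t. h.split (up X Y t)}" unfolding Ext1_def using sp by auto
  also have "\<dots> = cls s" unfolding cls_def s(2,3) using h.split_unique[OF s(1)] h.split_mor[OF s(1)] s(2,3) by auto
  finally show ?thesis .
qed

end

section \<open>Baer addition on classes\<close>

context abelian_category begin

lemma baer_mem:
  assumes X: "X \<in> Ob C" "Y \<in> Ob C"
  shows "t \<in> baer_sum C X Y c1 c2 <-> (\<exists>t1\<in>c1. \<exists>t2\<in>c2. \<exists>XX x1 x2 x1' x2' YY y1 y2 y1' y2' EE e1 e2 e1' e2'.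
     is_biproduct C X X XX x1 x2 x1' x2' & is_biproduct C Y Y YY y1 y2 y1' y2' &
     is_biproduct C (fst t1) (fst t2) EE e1 e2 e1' e2' &
     t \<in> ext_pull C X Y (x1 +[Hom C X XX] x2) (ext_push C XX Y (y1' +[Hom C YY Y] y2')
       {(EE, e1 \<cdot> fst (snd t1) \<cdot> y1' +[Hom C YY EE] e2 \<cdot> fst (snd t2) \<cdot> y2',
         x1 \<cdot> snd (snd t1) \<cdot> e1' +[Hom C EE XX] x2 \<cdot> snd (snd t2) \<cdot> e2')}))"
  unfolding baer_sum_def Let_def mem_Collect_eq Bex_def split_paired_Ex split_conv fst_conv snd_conv by (rule refl)

lemma dsum_up:
  assumes x: "is_biproduct C X X XX x1 x2 x1' x2'" and y: "is_biproduct C Y Y YY y1 y2 y1' y2'"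
    and e: "is_biproduct C (fst t1) (fst t2) EE e1 e2 e1' e2'" and t: "t1 \<in> ses C X Y" "t2 \<in> ses C X Y" and O: "X \<in> Ob C" "Y \<in> Ob C"
  shows "h.dsum_data (up X Y t1) (up X Y t2) (X, Inl x1, XX) (X, Inl x2, XX) (XX, Inl x1', X) (XX, Inl x2', X)
      (Y, Inl y1, YY) (Y, Inl y2, YY) (YY, Inl y1', Y) (YY, Inl y2', Y)
      (fst t1, Inl e1, EE) (fst t2, Inl e2, EE) (EE, Inl e1', fst t1) (EE, Inl e2', fst t2)" (is ?A)
    and "h.dsum (up X Y t1) (up X Y t2) (X, Inl x1, XX) (X, Inl x2, XX) (YY, Inl y1', Y) (YY, Inl y2', Y)
      (fst t1, Inl e1, EE) (fst t2, Inl e2, EE) (EE, Inl e1', fst t1) (EE, Inl e2', fst t2) =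
     up XX YY (EE, e1 \<cdot> fst (snd t1) \<cdot> y1' +[Hom C YY EE] e2 \<cdot> fst (snd t2) \<cdot> y2',
         x1 \<cdot> snd (snd t1) \<cdot> e1' +[Hom C EE XX] x2 \<cdot> snd (snd t2) \<cdot> e2')" (is ?B)
proof -
  obtain E1 i1 p1 where t1: "t1 = (E1, i1, p1)" by (cases t1)
  obtain E2 i2 p2 where t2: "t2 = (E2, i2, p2)" by (cases t2)
  have E: "E1 \<in> Ob C" "E2 \<in> Ob C" using t unfolding t1 t2 ses_def by auto
  show ?A unfolding h.dsum_data_def up_sexact[OF O] using t x y e E g_bip[OF O(1,1)] g_bip[OF O(2,2)] g_bip[OF E] unfolding t1 t2 by simp
  show ?B unfolding h.dsum_def t1 t2 by simp
qed

text \<open>The definition of \<open>baer_sum\<close> chooses representatives and biproducts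
  existentially, so membership has to be shown independent of them. Hypothesis \<open>B\<close> asks
  for this in terms of \<open>bsum\<close>, for all choices at once.\<close>

lemma baer_cls:
  assumes s1: "h.sexact s1" "h.sub s1 = Y" "h.quo s1 = X" and s2: "h.sexact s2" "h.sub s2 = Y" "h.quo s2 = X"
    and s: "h.sexact s" "h.sub s = Y" "h.quo s = X"
    and B: "!!r1 r2 x1 x2 x1' x2' y1 y2 y1' y2' e1 e2 e1' e2' r.
      [| h.dsum_data r1 r2 x1 x2 x1' x2' y1 y2 y1' y2' e1 e2 e1' e2'; h.quo r1 = X; h.quo r2 = X; h.sub r1 = Y; h.sub r2 = Y;
        h.sub r = Y; h.quo r = X;
        h.mor s1 r1 (g_ide C Y) (g_ide C X); h.mor s2 r2 (g_ide C Y) (g_ide C X) |] ==>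
      h.bsum r1 r2 x1 x2 y1' y2' e1 e2 e1' e2' r <-> h.mor s r (g_ide C Y) (g_ide C X)"
  shows "baer_sum C X Y (cls s1) (cls s2) = cls s"
proof (rule Set.set_eqI)
  fix t
  have O: "X \<in> Ob C" "Y \<in> Ob C" using h.ses_ob[OF s(1)] s by auto
  have key: "t \<in> ext_pull C X Y (x1 +[Hom C X XX] x2) (ext_push C XX Y (y1' +[Hom C YY Y] y2')
       {(EE, e1 \<cdot> fst (snd t1) \<cdot> y1' +[Hom C YY EE] e2 \<cdot> fst (snd t2) \<cdot> y2',
         x1 \<cdot> snd (snd t1) \<cdot> e1' +[Hom C EE XX] x2 \<cdot> snd (snd t2) \<cdot> e2')}) <-> t \<in> cls s"
    if t1: "t1 \<in> cls s1" and t2: "t2 \<in> cls s2" and b: "is_biproduct C X X XX x1 x2 x1' x2'"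
      "is_biproduct C Y Y YY y1 y2 y1' y2'" "is_biproduct C (fst t1) (fst t2) EE e1 e2 e1' e2'"
    for t1 t2 XX x1 x2 x1' x2' YY y1 y2 y1' y2' EE e1 e2 e1' e2'
  proof -
    have m: "h.mor s1 (up X Y t1) (g_ide C Y) (g_ide C X)" "h.mor s2 (up X Y t2) (g_ide C Y) (g_ide C X)"
      using t1 t2 unfolding cls_def s1(2,3) s2(2,3) by auto
    have u: "t1 \<in> ses C X Y" "t2 \<in> ses C X Y" using h.morD(2)[OF m(1)] h.morD(2)[OF m(2)] up_sexact[OF O] by auto
    note D = dsum_up[OF b u O]
    let ?i = "e1 \<cdot> fst (snd t1) \<cdot> y1' +[Hom C YY EE] e2 \<cdot> fst (snd t2) \<cdot> y2'"
    let ?p = "x1 \<cdot> snd (snd t1) \<cdot> e1' +[Hom C EE XX] x2 \<cdot> snd (snd t2) \<cdot> e2'"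
    let ?dg = "x1 +[Hom C X XX] x2" and ?cd = "y1' +[Hom C YY Y] y2'"
    have XX: "XX \<in> Ob C" "YY \<in> Ob C" using b unfolding is_biproduct_def by auto
    have S: "(EE, ?i, ?p) \<in> ses C XX YY" using h.dsum_sexact[OF D(1)] up_sexact[OF XX] unfolding D(2) by blast
    have I: "Ident C XX \<in> arr C XX XX" "Ident C Y \<in> arr C Y Y" using XX O ident_closed by auto
    have dgh: "?dg \<in> arr C X XX" "?cd \<in> arr C YY Y"
      using h.add_closed(1)[of "(X, Inl x1, XX)" "(X, Inl x2, XX)"] h.add_closed(1)[of "(YY, Inl y1', Y)" "(YY, Inl y2', Y)"]
        b(1,2) O XX unfolding is_biproduct_def by (simp_all add: g_hom_Inl)
    have push: "T \<in> ext_push C XX Y ?cd {(EE, ?i, ?p)} <-> h.mor (up XX YY (EE, ?i, ?p)) (up XX Y T) (YY, Inl ?cd, Y) (g_ide C XX)" for T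
    proof -
      obtain E' i' p' where T: "T = (E', i', p')" by (cases T)
      show ?thesis unfolding T g_ide_def mor_up[OF XX XX(1) O(2)] ext_push_def
        using S I dgh(2) comp_ident_left[of EE XX ?p] XX unfolding ses_def by auto
    qed
    have pull: "t \<in> ext_pull C X Y ?dg c <-> (\<exists>T\<in>c. h.mor (up X Y t) (up XX Y T) (g_ide C Y) (X, Inl ?dg, XX))"
      if c: "!!T. T \<in> c ==> T \<in> ses C XX Y" for c
    proof -
      obtain E' i' p' where t: "t = (E', i', p')" by (cases t)
      have k: "(E', i', p') \<in> ses C X Y & (\<exists>h\<in>arr C E' E. h \<cdot> i' = i & p \<cdot> h = ?dg \<cdot> p') <->
          h.mor (up X Y t) (up XX Y (E, i, p)) (g_ide C Y) (X, Inl ?dg, XX)" if "(E, i, p) \<in> c" for E i p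
        unfolding t g_ide_def mor_up[OF O XX(1) O(2)] using c[OF that] I dgh(1) comp_ident_right[of Y E i] O unfolding ses_def by auto
      have "t \<in> ext_pull C X Y ?dg c <-> (\<exists>E i p. (E, i, p) \<in> c & ((E', i', p') \<in> ses C X Y & (\<exists>h\<in>arr C E' E. h \<cdot> i' = i & p \<cdot> h = ?dg \<cdot> p')))"
        unfolding t ext_pull_def by auto
      also have "\<dots> <-> (\<exists>E i p. (E, i, p) \<in> c & h.mor (up X Y t) (up XX Y (E, i, p)) (g_ide C Y) (X, Inl ?dg, XX))" using k by blast
      also have "\<dots> <-> (\<exists>T\<in>c. h.mor (up X Y t) (up XX Y T) (g_ide C Y) (X, Inl ?dg, XX))" by (simp only: Bex_def split_paired_Ex)
      finally show ?thesis .
    qed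
    have "t \<in> ext_pull C X Y ?dg (ext_push C XX Y ?cd {(EE, ?i, ?p)}) <->
      (\<exists>T. h.mor (up XX YY (EE, ?i, ?p)) (up XX Y T) (YY, Inl ?cd, Y) (g_ide C XX) & h.mor (up X Y t) (up XX Y T) (g_ide C Y) (X, Inl ?dg, XX))"
    proof (subst pull)
      show "T \<in> ses C XX Y" if "T \<in> ext_push C XX Y ?cd {(EE, ?i, ?p)}" for T using that unfolding ext_push_def by auto
    qed (use push in blast)
    also have "\<dots> <-> h.bsum (up X Y t1) (up X Y t2) (X, Inl x1, XX) (X, Inl x2, XX) (YY, Inl y1', Y) (YY, Inl y2', Y)
      (fst t1, Inl e1, EE) (fst t2, Inl e2, EE) (EE, Inl e1', fst t1) (EE, Inl e2', fst t2) (up X Y t)" unfolding h.bsum_def D(2)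
    proof
      assume "\<exists>T. h.mor (up XX YY (EE, ?i, ?p)) T (g_add C (YY, Inl y1', Y) (YY, Inl y2', Y)) (g_ide C (g_trg (X, Inl x1, XX))) &
         h.mor (up X Y t) T (g_ide C (h.sub (up X Y t))) (g_add C (X, Inl x1, XX) (X, Inl x2, XX))"
      then obtain T where T: "h.mor (up XX YY (EE, ?i, ?p)) T (YY, Inl ?cd, Y) (g_ide C XX)"
         "h.mor (up X Y t) T (g_ide C Y) (X, Inl ?dg, XX)" by auto
      have "h.sub T = Y" "h.quo T = XX" using h.morD(6,10)[OF T(2)] O by simp_all
      then obtain T' where "T = up XX Y T'" using sexact_up[OF h.morD(2)[OF T(2)]] by metis
      thus "\<exists>T. h.mor (up XX YY (EE, ?i, ?p)) (up XX Y T) (YY, Inl ?cd, Y) (g_ide C XX) & h.mor (up X Y t) (up XX Y T) (g_ide C Y) (X, Inl ?dg, XX)"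
        using T by blast
    next
      assume "\<exists>T. h.mor (up XX YY (EE, ?i, ?p)) (up XX Y T) (YY, Inl ?cd, Y) (g_ide C XX) & h.mor (up X Y t) (up XX Y T) (g_ide C Y) (X, Inl ?dg, XX)"
      then obtain T where "h.mor (up XX YY (EE, ?i, ?p)) (up XX Y T) (YY, Inl ?cd, Y) (g_ide C XX)"
        "h.mor (up X Y t) (up XX Y T) (g_ide C Y) (X, Inl ?dg, XX)" by blast
      thus "\<exists>T. h.mor (up XX YY (EE, ?i, ?p)) T (g_add C (YY, Inl y1', Y) (YY, Inl y2', Y)) (g_ide C (g_trg (X, Inl x1, XX))) &
         h.mor (up X Y t) T (g_ide C (h.sub (up X Y t))) (g_add C (X, Inl x1, XX) (X, Inl x2, XX))" by (intro exI[of _ "up XX Y T"]) simp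
    qed
    also have "\<dots> <-> t \<in> cls s" unfolding cls_def s(2,3) mem_Collect_eq by (rule B[OF D(1)]) (use m in simp_all)
    finally show ?thesis .
  qed
  show "t \<in> baer_sum C X Y (cls s1) (cls s2) <-> t \<in> cls s"
  proof
    assume "t \<in> baer_sum C X Y (cls s1) (cls s2)"
    thus "t \<in> cls s" unfolding baer_mem[OF O] using key by blast
  next
    assume t: "t \<in> cls s"
    obtain t1 where t1: "s1 = up X Y t1" using sexact_up[OF s1(1)] s1(2,3) by metis
    obtain t2 where t2: "s2 = up X Y t2" using sexact_up[OF s2(1)] s2(2,3) by metis
    have c: "t1 \<in> cls s1" "t2 \<in> cls s2" using h.mor_ide[OF s1(1)] h.mor_ide[OF s2(1)] t1 t2 unfolding cls_def by auto
    have "t1 \<in> ses C X Y" "t2 \<in> ses C X Y" using s1(1) s2(1) t1 t2 up_sexact[OF O] by auto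
    hence E: "fst t1 \<in> Ob C" "fst t2 \<in> Ob C" unfolding ses_def by auto
    obtain XX x1 x2 x1' x2' where x: "is_biproduct C X X XX x1 x2 x1' x2'" using biproducts[OF O(1,1)] by blast
    obtain YY y1 y2 y1' y2' where y: "is_biproduct C Y Y YY y1 y2 y1' y2'" using biproducts[OF O(2,2)] by blast
    obtain EE e1 e2 e1' e2' where e: "is_biproduct C (fst t1) (fst t2) EE e1 e2 e1' e2'" using biproducts[OF E] by blast
    show "t \<in> baer_sum C X Y (cls s1) (cls s2)" unfolding baer_mem[OF O] using key[OF c x y e] t c x y e by blast
  qed
qed

definition ext :: "('b, 'c) garrow \<times> ('b, 'c) garrow => ('b, 'c) garrow" where
  "ext s = (h.quo s, Inr (cls s), h.sub s)"

lemma ext_typ [simp]: "g_src (ext s) = h.quo s" "g_trg (ext s) = h.sub s" "g_deg (ext s) = 1" unfolding ext_def by simp_all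

lemma ext_arr: "h.sexact s ==> g_arr C (ext s)"
  unfolding ext_def g_arr.simps using h.ses_ob[of s] ext_carrier[of "h.quo s" "h.sub s" "cls s"] by blast

lemma extE:
  assumes "g_arr C e" "g_deg e = 1"
  obtains s where "h.sexact s" "e = ext s"
proof -
  obtain X c Y where e: "e = (X, Inr c, Y)" "X \<in> Ob C" "Y \<in> Ob C" "c \<in> carrier (Ext1 C X Y)"
    using assms by (cases e rule: g_deg.cases) auto
  thus ?thesis using that ext_carrier[OF e(2,3)] unfolding ext_def by blast
qed

lemma ext_eq:
  assumes "h.sexact s" "h.sexact s'"
  shows "ext s = ext s' <-> h.mor s s' (g_ide C (h.sub s)) (g_ide C (h.quo s))"
proof
  assume "ext s = ext s'"
  hence e: "h.sub s' = h.sub s" "h.quo s' = h.quo s" "cls s = cls s'" unfolding ext_def by simp_all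
  show "h.mor s s' (g_ide C (h.sub s)) (g_ide C (h.quo s))" using cls_eq[OF assms e(1,2)] e(3) by (rule iffD1)
next
  assume m: "h.mor s s' (g_ide C (h.sub s)) (g_ide C (h.quo s))"
  note e = mor_ide_ends[OF m]
  show "ext s = ext s'" unfolding ext_def using cls_eq[OF assms e] m e by simp
qed

lemma push_ext:
  assumes "h.mor s s' g (g_ide C (h.quo s))"
  shows "g_cmp C g (ext s) = ext s'"
proof -
  note d = h.morD[OF assms]
  obtain u where g: "g = (h.sub s, Inl u, h.sub s')" using d(3,4,5,6) by (auto elim!: g_homE)
  have "h.quo s' = h.quo s" using d(10) h.ses_ob(2)[OF d(1)] by simp
  thus ?thesis using ext_push_cls[OF assms[unfolded g] refl] unfolding ext_def g by simp
qed

lemma pull_ext: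
  assumes "h.mor s' s (g_ide C (h.sub s)) f"
  shows "g_cmp C (ext s) f = ext s'"
proof -
  note d = h.morD[OF assms]
  obtain u where f: "f = (h.quo s', Inl u, h.quo s)" using d(7,8,9,10) by (auto elim!: g_homE)
  have "h.sub s' = h.sub s" using d(5) h.ses_ob(1)[OF d(2)] by simp
  thus ?thesis using ext_pull_cls[OF assms[unfolded f] refl] unfolding ext_def f by simp
qed

text \<open>A morphism over \<open>g\<close> and \<open>f\<close> factors through the pushout of
  \<open>s\<close> along \<open>g\<close> and through the pullback of \<open>s'\<close> along
  \<open>f\<close>, so it exists exactly when these two are equivalent. This is the source of
  \<open>(g e) f = g (e f)\<close>.\<close>

lemma mor_iff_ext:
  assumes s: "h.sexact s" "h.sexact s'" and g: "h.hm g (h.sub s) (h.sub s')" and f: "h.hm f (h.quo s) (h.quo s')"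
  shows "h.mor s s' g f <-> g_cmp C g (ext s) = g_cmp C (ext s') f"
proof -
  obtain s1 where s1: "h.mor s s1 g (g_ide C (h.quo s))" using h.push_ex[OF s(1) g] .
  obtain s2 where s2: "h.mor s2 s' (g_ide C (h.sub s')) f" using h.pull_ex[OF s(2) f] .
  note d1 = h.morD[OF s1] and d2 = h.morD[OF s2]
  have ends: "h.sub s1 = h.sub s'" "h.quo s1 = h.quo s" "h.sub s2 = h.sub s'" "h.quo s2 = h.quo s"
    using d1(6,10) d2(5,9) g f h.ses_ob[OF s(1)] h.ses_ob[OF s(2)] by simp_all
  show ?thesis
  proof
    assume m: "h.mor s s' g f"
    from h.push_factor[OF m s1] have "h.mor s1 s' (g_ide C (h.sub s')) f" using g by simp
    thus "g_cmp C g (ext s) = g_cmp C (ext s') f" using push_ext[OF s1] pull_ext by simp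
  next
    assume "g_cmp C g (ext s) = g_cmp C (ext s') f"
    hence "ext s1 = ext s2" using push_ext[OF s1] pull_ext[OF s2] by simp
    hence "h.mor s1 s2 (g_ide C (h.sub s1)) (g_ide C (h.quo s1))" using ext_eq d1(2) d2(1) by blast
    from mor_ide_trans[OF this s2] have "h.mor s1 s' (g_ide C (h.sub s')) f" .
    from h.mor_comp[OF s1 this] show "h.mor s s' g f" using g f h.ses_ob(2)[OF s(1)] by simp
  qed
qed

text \<open>Morphisms out of \<open>z\<close> may be continued to any equivalent representatives, so
  \<open>bsum_push\<close> yields the condition of \<open>baer_cls\<close> for every choice.\<close>

lemma add_ext_push:
  assumes m1: "h.mor z s1 g1 (g_ide C (h.quo z))" and m2: "h.mor z s2 g2 (g_ide C (h.quo z))"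
    and m: "h.mor z s (g_add C g1 g2) (g_ide C (h.quo z))" and Y: "g_trg g2 = g_trg g1"
  shows "g_add C (ext s1) (ext s2) = ext s"
proof -
  note d1 = h.morD[OF m1] and d2 = h.morD[OF m2] and d = h.morD[OF m]
  define X where "X = h.quo z"
  define Y where "Y = h.sub s1"
  have gs: "h.hm (g_add C g1 g2) (h.sub z) (g_trg g1)" using d1 d2 Y by simp
  have O: "X \<in> Ob C" unfolding X_def using h.ses_ob(2)[OF d1(1)] .
  have E: "h.sub s1 = Y" "h.sub s2 = Y" "h.sub s = Y" "h.quo s1 = X" "h.quo s2 = X" "h.quo s = X"
    using d1(6,10) d2(6,10) d(6,10) gs Y h.ses_ob(2)[OF d1(1)] unfolding X_def Y_def by simp_all
  note m1 = m1[folded X_def] and m2 = m2[folded X_def] and m = m[folded X_def]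
  have "baer_sum C X Y (cls s1) (cls s2) = cls s"
  proof (rule baer_cls[OF d1(2) E(1,4) d2(2) E(2,5) d(2) E(3,6)])
    fix r1 r2 x1 x2 x1' x2' y1 y2 y1' y2' e1 e2 e1' e2' r
    assume dd: "h.dsum_data r1 r2 x1 x2 x1' x2' y1 y2 y1' y2' e1 e2 e1' e2'" "h.quo r1 = X" "h.quo r2 = X" "h.sub r1 = Y" "h.sub r2 = Y"
      "h.sub r = Y" "h.quo r = X"
      and r: "h.mor s1 r1 (g_ide C Y) (g_ide C X)" "h.mor s2 r2 (g_ide C Y) (g_ide C X)"
    have 1: "h.mor z r1 g1 (g_ide C X)" by (rule mor_trans_ide[OF m1]) (use r E in simp)
    have 2: "h.mor z r2 g2 (g_ide C X)" by (rule mor_trans_ide[OF m2]) (use r E in simp)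
    have "h.bsum r1 r2 x1 x2 y1' y2' e1 e2 e1' e2' r <-> h.mor z r (g_add C g1 g2) (g_ide C X)" by (rule h.bsum_push[OF dd(1-5) 1 2])
    also have "\<dots> <-> h.mor s r (g_ide C Y) (g_ide C X)"
    proof
      assume "h.mor z r (g_add C g1 g2) (g_ide C X)"
      from h.push_factor[OF this] m show "h.mor s r (g_ide C Y) (g_ide C X)" using gs d1(6) unfolding X_def Y_def by simp
    next
      assume "h.mor s r (g_ide C Y) (g_ide C X)"
      thus "h.mor z r (g_add C g1 g2) (g_ide C X)" by (intro mor_trans_ide[OF m]) (simp add: E)
    qed
    finally show "h.bsum r1 r2 x1 x2 y1' y2' e1 e2 e1' e2' r <-> h.mor s r (g_ide C Y) (g_ide C X)" .
  qed
  thus ?thesis unfolding ext_def using E by (simp add: Ext1_def)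
qed

lemma add_ext_pull:
  assumes m1: "h.mor s1 z (g_ide C (h.sub z)) f1" and m2: "h.mor s2 z (g_ide C (h.sub z)) f2"
    and m: "h.mor s z (g_ide C (h.sub z)) (g_add C f1 f2)" and X: "g_src f2 = g_src f1"
  shows "g_add C (ext s1) (ext s2) = ext s"
proof -
  note d1 = h.morD[OF m1] and d2 = h.morD[OF m2] and d = h.morD[OF m]
  define Y where "Y = h.sub z"
  define X' where "X' = h.quo s1"
  have fs: "h.hm (g_add C f1 f2) (g_src f1) (h.quo z)" using d1 d2 X by simp
  have O: "Y \<in> Ob C" unfolding Y_def using h.ses_ob(1)[OF d1(2)] .
  have E: "h.sub s1 = Y" "h.sub s2 = Y" "h.sub s = Y" "h.quo s1 = X'" "h.quo s2 = X'" "h.quo s = X'"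
    using d1(5,9) d2(5,9) d(5,9) fs X h.ses_ob(1)[OF d1(2)] unfolding X'_def Y_def by simp_all
  note m1 = m1[folded Y_def] and m2 = m2[folded Y_def] and m = m[folded Y_def]
  have "baer_sum C X' Y (cls s1) (cls s2) = cls s"
  proof (rule baer_cls[OF d1(1) E(1,4) d2(1) E(2,5) d(1) E(3,6)])
    fix r1 r2 x1 x2 x1' x2' y1 y2 y1' y2' e1 e2 e1' e2' r
    assume dd: "h.dsum_data r1 r2 x1 x2 x1' x2' y1 y2 y1' y2' e1 e2 e1' e2'" "h.quo r1 = X'" "h.quo r2 = X'" "h.sub r1 = Y" "h.sub r2 = Y"
      "h.sub r = Y" "h.quo r = X'"
      and r: "h.mor s1 r1 (g_ide C Y) (g_ide C X')" "h.mor s2 r2 (g_ide C Y) (g_ide C X')"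
    have r': "h.mor r1 s1 (g_ide C Y) (g_ide C X')" "h.mor r2 s2 (g_ide C Y) (g_ide C X')"
      using h.mor_sym[of s1 r1] h.mor_sym[of s2 r2] r E by simp_all
    have 1: "h.mor r1 z (g_ide C Y) f1" by (rule mor_ide_trans[OF _ m1]) (use r' dd in simp)
    have 2: "h.mor r2 z (g_ide C Y) f2" by (rule mor_ide_trans[OF _ m2]) (use r' dd in simp)
    have "h.bsum r1 r2 x1 x2 y1' y2' e1 e2 e1' e2' r <-> h.mor r z (g_ide C Y) (g_add C f1 f2)" by (rule h.bsum_pull[OF dd(1-5) 1 2])
    also have "\<dots> <-> h.mor s r (g_ide C Y) (g_ide C X')"
    proof
      assume "h.mor r z (g_ide C Y) (g_add C f1 f2)"
      from h.pull_factor[OF this] m have "h.mor r s (g_ide C Y) (g_ide C X')" using fs d1(9) unfolding X'_def Y_def by simp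
      thus "h.mor s r (g_ide C Y) (g_ide C X')" using h.mor_sym[of r s] dd(6,7) by simp
    next
      assume "h.mor s r (g_ide C Y) (g_ide C X')"
      hence "h.mor r s (g_ide C Y) (g_ide C X')" using h.mor_sym[of s r] E by simp
      thus "h.mor r z (g_ide C Y) (g_add C f1 f2)" by (intro mor_ide_trans[OF _ m]) (simp add: dd(6,7))
    qed
    finally show "h.bsum r1 r2 x1 x2 y1' y2' e1 e2 e1' e2' r <-> h.mor s r (g_ide C Y) (g_ide C X')" .
  qed
  thus ?thesis unfolding ext_def using E by (simp add: Ext1_def)
qed

lemma zero_ext:
  assumes "h.split s"
  shows "g_zer C 1 (h.quo s) (h.sub s) = ext s" unfolding g_zer_def ext_def ext_zero_cls[OF assms refl refl] by simp

end

section \<open>The bimodule laws for classes of extensions\<close>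

context abelian_category begin

abbreviation is_ext :: "('b, 'c) garrow => 'b => 'b => bool" where
  "is_ext e X Y \<equiv> g_arr C e & g_deg e = 1 & g_src e = X & g_trg e = Y"

lemma is_ext_ob: "is_ext e X Y ==> X \<in> Ob C & Y \<in> Ob C" by (cases e rule: g_deg.cases) auto

lemma is_extE:
  assumes "is_ext e X Y"
  obtains s where "h.sexact s" "e = ext s" "h.quo s = X" "h.sub s = Y" using extE[of e] assms ext_typ by metis

lemma is_ext_ext: "h.sexact s ==> is_ext (ext s) (h.quo s) (h.sub s)" using ext_arr by simp

lemma g_push_ex:
  assumes "h.sexact s" "h.sub s = Y" "h.hm g Y Z"
  obtains s' where "h.sexact s'" "h.sub s' = Z" "h.quo s' = h.quo s" "h.mor s s' g (g_ide C (h.quo s))" "g_cmp C g (ext s) = ext s'"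
proof -
  obtain s' where m: "h.mor s s' g (g_ide C (h.quo s))" using h.push_ex[OF assms(1,3)[folded assms(2)]] .
  thus ?thesis using that[OF _ _ _ m push_ext[OF m]] h.morD[OF m] assms(3) h.ses_ob(2)[OF assms(1)] by simp
qed

lemma g_pull_ex:
  assumes "h.sexact s" "h.quo s = X" "h.hm f W X"
  obtains s' where "h.sexact s'" "h.sub s' = h.sub s" "h.quo s' = W" "h.mor s' s (g_ide C (h.sub s)) f" "g_cmp C (ext s) f = ext s'"
proof -
  obtain s' where m: "h.mor s' s (g_ide C (h.sub s)) f" using h.pull_ex[OF assms(1,3)[folded assms(2)]] .
  thus ?thesis using that[OF _ _ _ m pull_ext[OF m]] h.morD[OF m] assms(3) h.ses_ob(1)[OF assms(1)] by simp
qed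

lemma ext_cmp_left:
  assumes "is_ext e X Y" "h.hm g Y Z"
  shows "is_ext (g_cmp C g e) X Z"
proof -
  obtain s where s: "h.sexact s" "e = ext s" "h.quo s = X" "h.sub s = Y" using is_extE[OF assms(1)] .
  obtain s' where "h.sexact s'" "h.sub s' = Z" "h.quo s' = h.quo s" "h.mor s s' g (g_ide C (h.quo s))" "g_cmp C g (ext s) = ext s'"
    by (rule g_push_ex[OF s(1,4) assms(2)])
  thus ?thesis using is_ext_ext[of s'] s by simp
qed

lemma ext_cmp_right:
  assumes "is_ext e X Y" "h.hm f W X"
  shows "is_ext (g_cmp C e f) W Y"
proof -
  obtain s where s: "h.sexact s" "e = ext s" "h.quo s = X" "h.sub s = Y" using is_extE[OF assms(1)] .
  obtain s' where "h.sexact s'" "h.sub s' = h.sub s" "h.quo s' = W" "h.mor s' s (g_ide C (h.sub s)) f" "g_cmp C (ext s) f = ext s'"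
    by (rule g_pull_ex[OF s(1,3) assms(2)])
  thus ?thesis using is_ext_ext[of s'] s by simp
qed

lemma ext_ide:
  assumes "is_ext e X Y"
  shows "g_cmp C (g_ide C Y) e = e" "g_cmp C e (g_ide C X) = e"
proof -
  obtain s where s: "h.sexact s" "e = ext s" "h.quo s = X" "h.sub s = Y" using is_extE[OF assms(1)] .
  have "h.mor s s (g_ide C (h.sub s)) (g_ide C (h.quo s))" by (rule h.mor_ide[OF s(1)])
  from push_ext[OF this] pull_ext[OF this] show "g_cmp C (g_ide C Y) e = e" "g_cmp C e (g_ide C X) = e" using s by simp_all
qed

lemma ext_assoc1:
  assumes e: "is_ext e X Y" and g: "h.hm g Y Z" "h.hm g' Z W"
  shows "g_cmp C g' (g_cmp C g e) = g_cmp C (g_cmp C g' g) e"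
proof -
  obtain s where s: "h.sexact s" "e = ext s" "h.quo s = X" "h.sub s = Y" using is_extE[OF e] .
  obtain s' where s': "h.sexact s'" "h.sub s' = Z" "h.quo s' = h.quo s" "h.mor s s' g (g_ide C (h.quo s))" "g_cmp C g (ext s) = ext s'"
    by (rule g_push_ex[OF s(1,4) g(1)])
  obtain s'' where s'': "h.sexact s''" "h.sub s'' = W" "h.quo s'' = h.quo s'" "h.mor s' s'' g' (g_ide C (h.quo s'))" "g_cmp C g' (ext s') = ext s''"
    by (rule g_push_ex[OF s'(1,2) g(2)])
  have "h.mor s s'' (g_cmp C g' g) (g_ide C (h.quo s))" using h.mor_comp[OF s'(4) s''(4)] s'(3) h.ses_ob(2)[OF s(1)] by simp
  from push_ext[OF this] show ?thesis using s(2) s'(5) s''(5) by simp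
qed

lemma ext_assoc2:
  assumes e: "is_ext e X Y" and g: "h.hm g Y Z" and f: "h.hm f W X"
  shows "g_cmp C (g_cmp C g e) f = g_cmp C g (g_cmp C e f)"
proof -
  obtain s where s: "h.sexact s" "e = ext s" "h.quo s = X" "h.sub s = Y" using is_extE[OF e] .
  obtain s' where s': "h.sexact s'" "h.sub s' = Z" "h.quo s' = h.quo s" "h.mor s s' g (g_ide C (h.quo s))" "g_cmp C g (ext s) = ext s'"
    by (rule g_push_ex[OF s(1,4) g(1)])
  obtain r where r: "h.sexact r" "h.sub r = h.sub s" "h.quo r = W" "h.mor r s (g_ide C (h.sub s)) f" "g_cmp C (ext s) f = ext r"
    by (rule g_pull_ex[OF s(1,3) f])
  have m: "h.mor r s' g f" using h.mor_comp[OF r(4) s'(4)] g f s by simp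
  have "g_cmp C g (ext r) = g_cmp C (ext s') f" using mor_iff_ext[OF r(1) s'(1), of g f] m g f s r(2,3) s'(2,3) by simp
  thus ?thesis using s(2) s'(5) r(5) by simp
qed

lemma ext_assoc3:
  assumes e: "is_ext e X Y" and f: "h.hm f W X" "h.hm f' V W"
  shows "g_cmp C (g_cmp C e f) f' = g_cmp C e (g_cmp C f f')"
proof -
  obtain s where s: "h.sexact s" "e = ext s" "h.quo s = X" "h.sub s = Y" using is_extE[OF e] .
  obtain r where r: "h.sexact r" "h.sub r = h.sub s" "h.quo r = W" "h.mor r s (g_ide C (h.sub s)) f" "g_cmp C (ext s) f = ext r"
    by (rule g_pull_ex[OF s(1,3) f(1)])
  obtain q where q: "h.sexact q" "h.sub q = h.sub r" "h.quo q = V" "h.mor q r (g_ide C (h.sub r)) f'" "g_cmp C (ext r) f' = ext q"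
    by (rule g_pull_ex[OF r(1,3) f(2)])
  have "h.mor q s (g_ide C (h.sub s)) (g_cmp C f f')" using h.mor_comp[OF q(4) r(4)] r(2) h.ses_ob(1)[OF s(1)] by simp
  from pull_ext[OF this] show ?thesis using s(2) r(5) q(5) by simp
qed

text \<open>The device behind the module laws: classes that start at one object become pushouts
  \<open>g z\<close> and \<open>g' z\<close> of a single class, and by \<open>ext_add_left\<close>
  their Baer sum is \<open>(g + g') z\<close>.\<close>

lemma ext_common:
  assumes "is_ext e X Y" "is_ext e' X Y'"
  obtains z g g' Z where "is_ext z X Z" "h.hm g Z Y" "h.hm g' Z Y'" "e = g_cmp C g z" "e' = g_cmp C g' z"
proof -
  obtain s where s: "h.sexact s" "e = ext s" "h.quo s = X" "h.sub s = Y" using is_extE[OF assms(1)] .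
  obtain s' where s': "h.sexact s'" "e' = ext s'" "h.quo s' = X" "h.sub s' = Y'" using is_extE[OF assms(2)] .
  have "h.quo s' = h.quo s" using s(3) s'(3) by simp
  then obtain z g g' where m: "h.mor z s g (g_ide C (h.quo s))" "h.mor z s' g' (g_ide C (h.quo s))" by (rule h.common_push[OF s(1) s'(1)])
  note m = m[unfolded s(3)]
  note d = h.morD[OF m(1)] and d' = h.morD[OF m(2)]
  have X: "X \<in> Ob C" using is_ext_ob assms by blast
  have q: "h.quo z = X" using d(9) X by simp
  show ?thesis by (rule that[of "ext z" "h.sub z" g g'])
      (use d d' s s' q is_ext_ext[OF d(1)] push_ext[of z s g] push_ext[of z s' g'] m in auto)
qed

lemma ext_add_left:
  assumes e: "is_ext e X Y" and g: "h.hm g Y Z" "h.hm g' Y Z"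
  shows "g_cmp C (g_add C g g') e = g_add C (g_cmp C g e) (g_cmp C g' e)"
proof -
  obtain s where s: "h.sexact s" "e = ext s" "h.quo s = X" "h.sub s = Y" using is_extE[OF e] .
  have ag: "h.hm (g_add C g g') Y Z" using g by simp
  obtain s1 where s1: "h.sexact s1" "h.sub s1 = Z" "h.quo s1 = h.quo s" "h.mor s s1 g (g_ide C (h.quo s))" "g_cmp C g (ext s) = ext s1"
    by (rule g_push_ex[OF s(1,4) g(1)])
  obtain s2 where s2: "h.sexact s2" "h.sub s2 = Z" "h.quo s2 = h.quo s" "h.mor s s2 g' (g_ide C (h.quo s))" "g_cmp C g' (ext s) = ext s2"
    by (rule g_push_ex[OF s(1,4) g(2)])
  obtain s3 where s3: "h.sexact s3" "h.sub s3 = Z" "h.quo s3 = h.quo s" "h.mor s s3 (g_add C g g') (g_ide C (h.quo s))" "g_cmp C (g_add C g g') (ext s) = ext s3"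
    by (rule g_push_ex[OF s(1,4) ag])
  have "g_add C (ext s1) (ext s2) = ext s3" by (rule add_ext_push[OF s1(4) s2(4) s3(4)]) (use g in simp)
  thus ?thesis using s(2) s1(5) s2(5) s3(5) by simp
qed

lemma ext_add_right:
  assumes e: "is_ext e X Y" and f: "h.hm f W X" "h.hm f' W X"
  shows "g_cmp C e (g_add C f f') = g_add C (g_cmp C e f) (g_cmp C e f')"
proof -
  obtain s where s: "h.sexact s" "e = ext s" "h.quo s = X" "h.sub s = Y" using is_extE[OF e] .
  have ag: "h.hm (g_add C f f') W X" using f by simp
  obtain s1 where s1: "h.sexact s1" "h.sub s1 = h.sub s" "h.quo s1 = W" "h.mor s1 s (g_ide C (h.sub s)) f" "g_cmp C (ext s) f = ext s1"
    by (rule g_pull_ex[OF s(1,3) f(1)])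
  obtain s2 where s2: "h.sexact s2" "h.sub s2 = h.sub s" "h.quo s2 = W" "h.mor s2 s (g_ide C (h.sub s)) f'" "g_cmp C (ext s) f' = ext s2"
    by (rule g_pull_ex[OF s(1,3) f(2)])
  obtain s3 where s3: "h.sexact s3" "h.sub s3 = h.sub s" "h.quo s3 = W" "h.mor s3 s (g_ide C (h.sub s)) (g_add C f f')" "g_cmp C (ext s) (g_add C f f') = ext s3"
    by (rule g_pull_ex[OF s(1,3) ag])
  have "g_add C (ext s1) (ext s2) = ext s3" by (rule add_ext_pull[OF s1(4) s2(4) s3(4)]) (use f in simp)
  thus ?thesis using s(2) s1(5) s2(5) s3(5) by simp
qed

lemma ext_zero_left:
  assumes e: "is_ext e X Y" and Z: "Z \<in> Ob C"
  shows "g_cmp C (g_zer C 0 Y Z) e = g_zer C 1 X Z"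
proof -
  obtain s where s: "h.sexact s" "e = ext s" "h.quo s = X" "h.sub s = Y" using is_extE[OF e] .
  have Y: "X \<in> Ob C" "Y \<in> Ob C" using is_ext_ob[OF e] by simp_all
  have z: "h.hm (g_zer C 0 Y Z) Y Z" using Y Z by simp
  obtain s1 where s1: "h.sexact s1" "h.sub s1 = Z" "h.quo s1 = h.quo s" "h.mor s s1 (g_zer C 0 Y Z) (g_ide C (h.quo s))" "g_cmp C (g_zer C 0 Y Z) (ext s) = ext s1"
    by (rule g_push_ex[OF s(1,4) z])
  have i: "g_hom C (fst s)" "g_deg (fst s) = 0" "g_trg (fst s) \<in> Ob C" using h.sexactD(1,3)[of "fst s" "snd s"] s(1) by auto
  have "h.split s1" unfolding h.push_split[OF s1(4)] by (rule exI[of _ "g_zer C 0 (g_trg (fst s)) Z"]) (use i Z Y s(4) in simp)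
  from zero_ext[OF this] show ?thesis using s s1 by simp
qed

text \<open>Multiplication by \<open>a\<close> on all three terms of a sequence is a morphism of the
  sequence to itself, so pushing along \<open>a\<close> on the left and pulling along
  \<open>a\<close> on the right give the same class.\<close>

lemma scl_ext:
  assumes e: "is_ext e X Y" and a: "a \<in> carrier k"
  shows "g_scl C a e = g_cmp C (g_scl C a (g_ide C Y)) e" "g_cmp C e (g_scl C a (g_ide C X)) = g_scl C a e"
proof -
  have XY: "X \<in> Ob C" "Y \<in> Ob C" using is_ext_ob[OF e] by simp_all
  obtain c where c: "e = (X, Inr c, Y)" using e by (cases e rule: g_deg.cases) auto
  show 1: "g_scl C a e = g_cmp C (g_scl C a (g_ide C Y)) e" unfolding c g_ide_def by (simp add: Ext1_def)
  obtain s where s: "h.sexact s" "e = ext s" "h.quo s = X" "h.sub s = Y" using is_extE[OF e] .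
  obtain i p where ip: "s = (i, p)" by (cases s)
  note d = h.sexactD[OF s(1)[unfolded ip]]
  have t: "g_src i = Y" "g_trg p = X" using s(3,4) ip by auto
  have "h.mor (i, p) (i, p) (g_scl C a (g_ide C Y)) (g_scl C a (g_ide C X))"
    by (rule h.morI[where h="g_scl C a (g_ide C (g_trg i))"]) (use s(1) ip d(1-5) t XY a in \<open>simp_all add: h.cmp_scl_left h.cmp_scl_right\<close>)
  hence "h.mor s s (g_scl C a (g_ide C Y)) (g_scl C a (g_ide C X))" unfolding ip .
  hence "g_cmp C (g_scl C a (g_ide C Y)) (ext s) = g_cmp C (ext s) (g_scl C a (g_ide C X))"
    using mor_iff_ext[OF s(1,1), of "g_scl C a (g_ide C Y)" "g_scl C a (g_ide C X)"] s(3,4) XY a by simp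
  thus "g_cmp C e (g_scl C a (g_ide C X)) = g_scl C a e" using 1 s(2) by simp
qed

lemma scl_ext_left:
  assumes e: "is_ext e X Y" and a: "a \<in> carrier k" and g: "h.hm g Y Z"
  shows "g_scl C a (g_cmp C g e) = g_cmp C (g_scl C a g) e" "g_cmp C g (g_scl C a e) = g_cmp C (g_scl C a g) e"
proof -
  have YZ: "Y \<in> Ob C" "Z \<in> Ob C" using g h.src_ob h.trg_ob by blast+
  have i: "h.hm (g_scl C a (g_ide C Y)) Y Y" "h.hm (g_scl C a (g_ide C Z)) Z Z" using YZ a by simp_all
  have c: "g_cmp C (g_scl C a (g_ide C Z)) g = g_scl C a g" "g_cmp C g (g_scl C a (g_ide C Y)) = g_scl C a g"
    using g YZ a by (simp_all add: h.cmp_scl_left h.cmp_scl_right)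
  show "g_scl C a (g_cmp C g e) = g_cmp C (g_scl C a g) e" unfolding scl_ext(1)[OF ext_cmp_left[OF e g] a] ext_assoc1[OF e g i(2)] c ..
  show "g_cmp C g (g_scl C a e) = g_cmp C (g_scl C a g) e" unfolding scl_ext(1)[OF e a] ext_assoc1[OF e i(1) g] c ..
qed

lemma ext_module:
  assumes X: "X \<in> Ob C" "Y \<in> Ob C"
  shows "module k (hom_mod (g_arr C) g_src g_trg g_deg (g_add C) (g_zer C) (g_scl C) 1 X Y)"
proof -
  let ?M = "hom_mod (g_arr C) g_src g_trg g_deg (g_add C) (g_zer C) (g_scl C) 1 X Y"
  have M: "carrier ?M = {e. is_ext e X Y}" "0[?M] = g_zer C 1 X Y" "!!e e'. e +[?M] e' = g_add C e e'" "!!a e. a .[?M] e = g_scl C a e"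
    unfolding hom_mod_def by auto
  have add: "is_ext (g_add C e e') X Y" if "is_ext e X Y" "is_ext e' X Y" for e e'
  proof -
    obtain z g g' Z where z: "is_ext z X Z" "h.hm g Z Y" "h.hm g' Z Y" "e = g_cmp C g z" "e' = g_cmp C g' z" using ext_common[OF \<open>is_ext e X Y\<close> \<open>is_ext e' X Y\<close>] .
    have "h.hm (g_add C g g') Z Y" using z by simp
    from ext_cmp_left[OF z(1) this] show ?thesis unfolding ext_add_left[OF z(1-3)] z(4,5) .
  qed
  have scl: "is_ext (g_scl C a e) X Y" if "is_ext e X Y" "a \<in> carrier k" for a e
    unfolding scl_ext(1)[OF that] by (rule ext_cmp_left[OF that(1)]) (use that X in simp)
  obtain s where s: "h.split s" "h.sub s = Y" "h.quo s = X" using h.split_ex[OF X] .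
  have zero: "is_ext (g_zer C 1 X Y) X Y" using zero_ext[OF s(1)] is_ext_ext[of s] s unfolding h.split_def by simp
  have ag: "abelian_group ?M"
  proof (rule abelian_groupI, unfold M mem_Collect_eq)
    fix e assume e: "is_ext e X Y"
    have "g_add C (g_zer C 1 X Y) e = g_cmp C (g_add C (g_zer C 0 Y Y) (g_ide C Y)) e"
      using ext_add_left[OF e, of "g_zer C 0 Y Y" Y "g_ide C Y"] ext_zero_left[OF e X(2)] ext_ide(1)[OF e] X by simp
    thus "g_add C (g_zer C 1 X Y) e = e" using ext_ide(1)[OF e] X by simp
    have n: "h.hm (h.neg (g_ide C Y)) Y Y" using X by simp
    have "g_add C (g_cmp C (h.neg (g_ide C Y)) e) e = g_cmp C (g_add C (h.neg (g_ide C Y)) (g_ide C Y)) e"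
      using ext_add_left[OF e n, of "g_ide C Y"] ext_ide(1)[OF e] X by simp
    also have "\<dots> = g_zer C 1 X Y" using ext_zero_left[OF e X(2)] X by simp
    finally show "\<exists>e'\<in>{e. is_ext e X Y}. g_add C e' e = g_zer C 1 X Y" using ext_cmp_left[OF e n] by blast
    fix e' assume e': "is_ext e' X Y"
    obtain z g g' Z where z: "is_ext z X Z" "h.hm g Z Y" "h.hm g' Z Y" "e = g_cmp C g z" "e' = g_cmp C g' z" using ext_common[OF e e'] .
    show "g_add C e e' = g_add C e' e" using ext_add_left[OF z(1-3)] ext_add_left[OF z(1,3,2)] h.add_comm[of g g'] z(2-5) by simp
    fix e'' assume e'': "is_ext e'' X Y"
    \<comment> \<open>For three summands the common source is refined once more: \<open>w\<close>
      has both \<open>z\<close> and the third class as pushouts.\<close>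
    obtain w r q W where w: "is_ext w X W" "h.hm r W Z" "h.hm q W Y" "z = g_cmp C r w" "e'' = g_cmp C q w" using ext_common[OF z(1) e''] .
    have g: "h.hm (g_cmp C g r) W Y" "h.hm (g_cmp C g' r) W Y" using z w by simp_all
    have E: "e = g_cmp C (g_cmp C g r) w" "e' = g_cmp C (g_cmp C g' r) w"
      unfolding z(4,5) w(4) using ext_assoc1[OF w(1,2) z(2)] ext_assoc1[OF w(1,2) z(3)] by simp_all
    have s: "h.hm (g_add C (g_cmp C g r) (g_cmp C g' r)) W Y" "h.hm (g_add C (g_cmp C g' r) q) W Y" using g w(3) by simp_all
    show "g_add C (g_add C e e') e'' = g_add C e (g_add C e' e'')"
      unfolding E w(5) ext_add_left[OF w(1) g, symmetric] ext_add_left[OF w(1) s(1) w(3), symmetric]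
        ext_add_left[OF w(1) g(2) w(3), symmetric] ext_add_left[OF w(1) g(1) s(2), symmetric]
      using h.add_assoc[of "g_cmp C g r" "g_cmp C g' r" q] g w(3) by simp
  qed (use add zero in auto)
  show ?thesis
  proof (rule moduleI[OF base_cring ag], unfold M mem_Collect_eq)
    interpret k: cring k by (rule base_cring)
    interpret E: module k "Hom C Y Y" by (rule hom_module[OF X(2,2)])
    have iE: "Ident C Y \<in> carrier (Hom C Y Y)" by (rule ident_closed[OF X(2)])
    fix a e assume a: "a \<in> carrier k" and e: "is_ext e X Y"
    have i: "h.hm (g_ide C Y) Y Y" using X by simp
    show "is_ext (g_scl C a e) X Y" using scl[OF e a] .
    fix b assume b: "b \<in> carrier k"
    have ab: "h.hm (g_scl C a (g_ide C Y)) Y Y" "h.hm (g_scl C b (g_ide C Y)) Y Y" using X a b by simp_all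
    show "g_scl C (a +[k] b) e = g_add C (g_scl C a e) (g_scl C b e)"
      unfolding scl_ext(1)[OF e a] scl_ext(1)[OF e b] scl_ext(1)[OF e k.add.m_closed[OF a b]] ext_add_left[OF e ab, symmetric]
      using E.smult_l_distr[OF a b iE] by (simp add: g_ide_def)
    show "g_scl C (a *[k] b) e = g_scl C a (g_scl C b e)"
      unfolding scl_ext(1)[OF e b] scl_ext_left(1)[OF e a ab(2)] scl_ext(1)[OF e k.m_closed[OF a b]]
      using E.smult_assoc1[OF a b iE] by (simp add: g_ide_def)
  next
    fix a e e' assume a: "a \<in> carrier k" and e: "is_ext e X Y" "is_ext e' X Y"
    obtain z g g' Z where z: "is_ext z X Z" "h.hm g Z Y" "h.hm g' Z Y" "e = g_cmp C g z" "e' = g_cmp C g' z" using ext_common[OF e] .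
    have gg: "h.hm (g_add C g g') Z Y" "h.hm (g_scl C a g) Z Y" "h.hm (g_scl C a g') Z Y" using z a by simp_all
    have "g_scl C a (g_add C g g') = g_add C (g_scl C a g) (g_scl C a g')"
    proof -
      have ZO: "Z \<in> Ob C" using is_ext_ob z(1) by blast
      interpret H: module k "Hom C Z Y" by (rule hom_module[OF ZO X(2)])
      obtain u u' where "g = (Z, Inl u, Y)" "g' = (Z, Inl u', Y)" "u \<in> arr C Z Y" "u' \<in> arr C Z Y" using z(2,3) by (auto elim!: g_homE)
      thus ?thesis using H.smult_r_distr[OF a] by simp
    qed
    thus "g_scl C a (g_add C e e') = g_add C (g_scl C a e) (g_scl C a e')"
      unfolding z(4,5) ext_add_left[OF z(1-3), symmetric] scl_ext_left(1)[OF z(1) a gg(1)] scl_ext_left(1)[OF z(1) a z(2)]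
        scl_ext_left(1)[OF z(1) a z(3)] ext_add_left[OF z(1) gg(2,3), symmetric] by simp
  next
    fix e assume e: "is_ext e X Y"
    interpret k: cring k by (rule base_cring)
    interpret E: module k "Hom C Y Y" by (rule hom_module[OF X(2,2)])
    show "g_scl C 1[k] e = e"
      unfolding scl_ext(1)[OF e k.one_closed] using E.smult_one[OF ident_closed[OF X(2)]] ext_ide(1)[OF e] by (simp add: g_ide_def)
  qed
qed

end

lemma g_deg_cases: "g_deg f = 0 \<or> g_deg f = 1" by (cases f rule: g_deg.cases) auto

text \<open>In an admissible composite at most one factor has degree one. This leaves the case of
  morphisms only, covered by the instance \<open>h\<close>, and one case for each position of the
  class.\<close>

sublocale abelian_category \<subseteq> e: gcat k 1 "Ob C" "g_arr C" g_src g_trg g_deg "g_ide C" "g_cmp C" "g_add C" "g_zer C" "g_scl C"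
proof (rule gcat.intro)
  have H: "g_hom C f" if "g_arr C f" "g_deg f = 0" for f using that unfolding g_hom_def by simp
  have A: "g_arr C f" if "g_hom C f" for f using that unfolding g_hom_def by simp
  show "cring k" by (rule base_cring)
  show "g_src f \<in> Ob C" "g_trg f \<in> Ob C" if "g_arr C f" for f using that by (cases f rule: g_deg.cases; simp)+
  show "g_deg f \<le> 1" if "g_arr C f" for f using g_deg_cases[of f] by auto
  show "g_arr C (g_ide C X)" "g_src (g_ide C X) = X" "g_trg (g_ide C X) = X" "g_deg (g_ide C X) = 0" if "X \<in> Ob C" for X
    using that A by simp_all
  have cmp: "g_arr C (g_cmp C g f) & g_src (g_cmp C g f) = g_src f & g_trg (g_cmp C g f) = g_trg g & g_deg (g_cmp C g f) = g_deg g + g_deg f"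
    if c: "g_arr C f" "g_arr C g" "g_src g = g_trg f" "g_deg g + g_deg f \<le> 1" for f g
  proof -
    consider "g_deg f = 0" "g_deg g = 0" | "g_deg f = 1" "g_deg g = 0" | "g_deg f = 0" "g_deg g = 1"
      using g_deg_cases[of f] g_deg_cases[of g] c(4) by fastforce
    thus ?thesis
    proof cases
      case 1
      thus ?thesis using c H A by simp
    next
      case 2
      thus ?thesis using ext_cmp_left[of f "g_src f" "g_trg f" g "g_trg g"] c H by simp
    next
      case 3
      hence "h.hm f (g_src f) (g_src g)" "is_ext g (g_src g) (g_trg g)" using c H[of f] by simp_all
      thus ?thesis using ext_cmp_right[of g "g_src g" "g_trg g" f "g_src f"] 3 by simp
    qed
  qed
  show "g_arr C (g_cmp C g f)" "g_src (g_cmp C g f) = g_src f" "g_trg (g_cmp C g f) = g_trg g" "g_deg (g_cmp C g f) = g_deg g + g_deg f"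
    if "g_arr C f" "g_arr C g" "g_src g = g_trg f" "g_deg g + g_deg f \<le> 1" for f g using cmp[OF that] by blast+
  show "g_cmp C f (g_ide C X) = f" if "g_arr C f" "g_src f = X" for f X
    using g_deg_cases[of f] ext_ide(2)[of f X "g_trg f"] h.cmp_ide_right[OF H[of f] that(2)] that by blast
  show "g_cmp C (g_ide C Y) f = f" if "g_arr C f" "g_trg f = Y" for f Y
    using g_deg_cases[of f] ext_ide(1)[of f "g_src f" Y] h.cmp_ide_left[OF H[of f] that(2)] that by blast
  show "g_cmp C (g_cmp C h g) f = g_cmp C h (g_cmp C g f)"
    if c: "g_arr C f" "g_arr C g" "g_arr C h" "g_src g = g_trg f" "g_src h = g_trg g" "g_deg h + g_deg g + g_deg f \<le> 1" for f g h
  proof -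
    consider "g_deg f = 0" "g_deg g = 0" "g_deg h = 0" | "g_deg f = 1" "g_deg g = 0" "g_deg h = 0"
      | "g_deg f = 0" "g_deg g = 1" "g_deg h = 0" | "g_deg f = 0" "g_deg g = 0" "g_deg h = 1"
      using g_deg_cases[of f] g_deg_cases[of g] g_deg_cases[of h] c(6) by fastforce
    thus ?thesis
    proof cases
      case 1
      thus ?thesis using c H by simp
    next
      case 2
      thus ?thesis using ext_assoc1[of f "g_src f" "g_trg f" g "g_trg g" h "g_trg h"] c H by simp
    next
      case 3
      hence "h.hm f (g_src f) (g_src g)" "is_ext g (g_src g) (g_trg g)" "h.hm h (g_trg g) (g_trg h)" using c H[of f] H[of h] by simp_all
      thus ?thesis using ext_assoc2[of g "g_src g" "g_trg g" h "g_trg h" f "g_src f"] by blast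
    next
      case 4
      hence "h.hm f (g_src f) (g_src g)" "h.hm g (g_src g) (g_src h)" "is_ext h (g_src h) (g_trg h)" using c H[of f] H[of g] by simp_all
      thus ?thesis using ext_assoc3[of h "g_src h" "g_trg h" g "g_src g" f "g_src f"] by blast
    qed
  qed
  show "module k (hom_mod (g_arr C) g_src g_trg g_deg (g_add C) (g_zer C) (g_scl C) d X Y)"
    if X: "X \<in> Ob C" "Y \<in> Ob C" "d \<le> 1" for d X Y
  proof (cases "d = 0")
    case True
    have "hom_mod (g_arr C) g_src g_trg g_deg (g_add C) (g_zer C) (g_scl C) 0 X Y = hom_mod (g_hom C) g_src g_trg g_deg (g_add C) (g_zer C) (g_scl C) 0 X Y"
      unfolding hom_mod_def g_hom_def by auto
    thus ?thesis using g_hom_module[OF X(1,2)] True by simp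
  next
    case False
    hence "d = 1" using X(3) by simp
    thus ?thesis using ext_module[OF X(1,2)] by simp
  qed
  show "g_cmp C g (g_add C f f') = g_add C (g_cmp C g f) (g_cmp C g f')"
    if c: "g_arr C f" "g_arr C f'" "g_arr C g" "g_src f' = g_src f" "g_trg f' = g_trg f" "g_deg f' = g_deg f" "g_src g = g_trg f"
      "g_deg g + g_deg f \<le> 1" for f f' g
  proof -
    consider "g_deg f = 0" "g_deg g = 0" | "g_deg f = 1" "g_deg g = 0" | "g_deg f = 0" "g_deg g = 1"
      using g_deg_cases[of f] g_deg_cases[of g] c(8) by fastforce
    thus ?thesis
    proof cases
      case 1
      thus ?thesis using c H by (simp add: h.cmp_add_right)
    next
      case 2
      have f: "is_ext f (g_src f) (g_trg f)" "is_ext f' (g_src f) (g_trg f)" using 2 c by simp_all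
      \<comment> \<open>Additivity in the class becomes distributivity of arrows once both classes
        are pushouts of one \<open>z\<close>.\<close>
      obtain z r r' Z where z: "is_ext z (g_src f) Z" "h.hm r Z (g_trg f)" "h.hm r' Z (g_trg f)" "f = g_cmp C r z" "f' = g_cmp C r' z"
        using ext_common[OF f] .
      have g: "h.hm g (g_trg f) (g_trg g)" using 2 c H by simp
      have gr: "h.hm (g_add C r r') Z (g_trg f)" "h.hm (g_cmp C g r) Z (g_trg g)" "h.hm (g_cmp C g r') Z (g_trg g)" using z(2,3) g by simp_all
      have "g_cmp C g (g_add C f f') = g_cmp C (g_cmp C g (g_add C r r')) z"
        unfolding z(4,5) ext_add_left[OF z(1-3), symmetric] ext_assoc1[OF z(1) gr(1) g] ..
      also have "g_cmp C g (g_add C r r') = g_add C (g_cmp C g r) (g_cmp C g r')" using z(2,3) g by (simp add: h.cmp_add_right)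
      finally show ?thesis unfolding ext_add_left[OF z(1) gr(2,3)] ext_assoc1[OF z(1,2) g, symmetric] ext_assoc1[OF z(1,3) g, symmetric] z(4,5)[symmetric] .
    next
      case 3
      hence "h.hm f (g_src f) (g_src g)" "h.hm f' (g_src f) (g_src g)" "is_ext g (g_src g) (g_trg g)" using c H[of f] H[of f'] by simp_all
      thus ?thesis using ext_add_right[of g "g_src g" "g_trg g" f "g_src f" f'] by blast
    qed
  qed
  show "g_cmp C (g_add C g g') f = g_add C (g_cmp C g f) (g_cmp C g' f)"
    if c: "g_arr C f" "g_arr C g" "g_arr C g'" "g_src g' = g_src g" "g_trg g' = g_trg g" "g_deg g' = g_deg g" "g_src g = g_trg f"
      "g_deg g + g_deg f \<le> 1" for f g g'
  proof -
    consider "g_deg f = 0" "g_deg g = 0" | "g_deg f = 1" "g_deg g = 0" | "g_deg f = 0" "g_deg g = 1"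
      using g_deg_cases[of f] g_deg_cases[of g] c(8) by fastforce
    thus ?thesis
    proof cases
      case 1
      thus ?thesis using c H by (simp add: h.cmp_add_left)
    next
      case 2
      thus ?thesis using ext_add_left[of f "g_src f" "g_trg f" g "g_trg g" g'] c H by simp
    next
      case 3
      have e: "is_ext g (g_src g) (g_trg g)" "is_ext g' (g_src g) (g_trg g)" using 3 c by simp_all
      obtain z r r' Z where z: "is_ext z (g_src g) Z" "h.hm r Z (g_trg g)" "h.hm r' Z (g_trg g)" "g = g_cmp C r z" "g' = g_cmp C r' z"
        using ext_common[OF e] .
      have f: "h.hm f (g_src f) (g_src g)" using 3 c H[of f] by simp
      have rr: "h.hm (g_add C r r') Z (g_trg g)" using z(2,3) by simp
      have zf: "is_ext (g_cmp C z f) (g_src f) Z" by (rule ext_cmp_right[OF z(1) f])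
      have "g_cmp C (g_add C g g') f = g_cmp C (g_add C r r') (g_cmp C z f)"
        unfolding z(4,5) ext_add_left[OF z(1-3), symmetric] ext_assoc2[OF z(1) rr f] ..
      thus ?thesis unfolding ext_add_left[OF zf z(2,3)] ext_assoc2[OF z(1,2) f, symmetric] ext_assoc2[OF z(1,3) f, symmetric] z(4,5)[symmetric] .
    qed
  qed
  show "g_cmp C g (g_scl C a f) = g_scl C a (g_cmp C g f)"
    if c: "g_arr C f" "g_arr C g" "a \<in> carrier k" "g_src g = g_trg f" "g_deg g + g_deg f \<le> 1" for f g a
  proof -
    consider "g_deg f = 0" "g_deg g = 0" | "g_deg f = 1" "g_deg g = 0" | "g_deg f = 0" "g_deg g = 1"
      using g_deg_cases[of f] g_deg_cases[of g] c(5) by fastforce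
    thus ?thesis
    proof cases
      case 1
      thus ?thesis using c H by (simp add: h.cmp_scl_right)
    next
      case 2
      thus ?thesis using scl_ext_left[of f "g_src f" "g_trg f" a g "g_trg g"] c H by simp
    next
      case 3
      have g: "is_ext g (g_src g) (g_trg g)" and f: "h.hm f (g_src f) (g_src g)" using 3 c H[of f] by simp_all
      have o: "g_src f \<in> Ob C" "g_src g \<in> Ob C" using f h.src_ob[of f] h.trg_ob[of f] by auto
      have i: "h.hm (g_scl C a (g_ide C (g_src f))) (g_src f) (g_src f)" using o c(3) by simp
      have "g_scl C a f = g_cmp C f (g_scl C a (g_ide C (g_src f)))" using f o c(3) by (simp add: h.cmp_scl_right)
      hence "g_cmp C g (g_scl C a f) = g_cmp C (g_cmp C g f) (g_scl C a (g_ide C (g_src f)))" using ext_assoc3[OF g f i] by simp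
      thus ?thesis using scl_ext(2)[OF ext_cmp_right[OF g f] c(3)] by simp
    qed
  qed
  show "g_cmp C (g_scl C a g) f = g_scl C a (g_cmp C g f)"
    if c: "g_arr C f" "g_arr C g" "a \<in> carrier k" "g_src g = g_trg f" "g_deg g + g_deg f \<le> 1" for f g a
  proof -
    consider "g_deg f = 0" "g_deg g = 0" | "g_deg f = 1" "g_deg g = 0" | "g_deg f = 0" "g_deg g = 1"
      using g_deg_cases[of f] g_deg_cases[of g] c(5) by fastforce
    thus ?thesis
    proof cases
      case 1
      thus ?thesis using c H by (simp add: h.cmp_scl_left)
    next
      case 2
      thus ?thesis using scl_ext_left(1)[of f "g_src f" "g_trg f" a g "g_trg g"] c H by simp
    next
      case 3
      have g: "is_ext g (g_src g) (g_trg g)" and f: "h.hm f (g_src f) (g_src g)" using 3 c H[of f] by simp_all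
      have o: "g_trg g \<in> Ob C" using is_ext_ob[OF g] by simp
      have i: "h.hm (g_scl C a (g_ide C (g_trg g))) (g_trg g) (g_trg g)" using o c(3) by simp
      show ?thesis unfolding scl_ext(1)[OF g c(3)] scl_ext(1)[OF ext_cmp_right[OF g f] c(3)] by (rule ext_assoc2[OF g i f])
    qed
  qed
qed

section \<open>Splitting of idempotents and exactness of the Hom-Ext sequences\<close>

text \<open>The splitting object is the kernel \<open>j\<close> of \<open>1 - e\<close>: the
  idempotent factors as \<open>e = j q\<close>, and \<open>e j = j\<close> gives
  \<open>q j = 1\<close>.\<close>

lemma (in abgcat) idem_splits:
  assumes e: "hm e X X" "e ** e = e"
  shows "\<exists>q j. hm q X (trg q) & hm j (trg q) X & q ** j = ide (trg q) & j ** q = e"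
proof -
  have X: "X \<in> Ob" using e by auto
  define f where "f = ide X +++ neg e"
  have f: "hm f X X" unfolding f_def using e X by simp
  obtain j where k: "ker f j" using ker_ex f by blast
  note j = kerD[OF k]
  have "f ** e = zer 0 X X" unfolding f_def using e X by (simp add: dist)
  then obtain q where q: "hm q X (src j)" "j ** q = e" using j(6)[of e] e(1) f by auto
  have "j ** neg (ide (src j)) = neg j" using j(2,3) by (simp add: dist)
  have "f ** j = j +++ neg (e ** j)" unfolding f_def using e(1) j(2-4) f X by (simp add: dist)
  hence "j +++ neg (e ** j) = zer 0 (src j) X" using j(5) f by simp
  hence ej: "e ** j = j" using eq_iff_diff[of j "e ** j"] e(1) j(2-4) f by simp
  have "q ** j = ide (src j)"
  proof (rule mono_cancel[OF j(1)])
    show "j ** (q ** j) = j ** ide (src j)" using pre_cancel[OF q(2), of j] q(1) e(1) j(2-4) f ej by simp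
  qed (use q j(2-4) f in auto)
  thus ?thesis using q j(2-4) f by (intro exI[of _ q] exI[of _ j]) simp
qed

context abelian_category begin

text \<open>The instances \<open>h\<close> and \<open>e\<close> have the same arrows of degree zero
  but different arrow predicates; from this equation their monomorphisms, epimorphisms and
  biproducts are identified.\<close>

lemma g_hom_conj: "g_hom C f & g_deg f = 0 <-> g_arr C f & g_deg f = 0" unfolding g_hom_def by blast

lemma e_hm: "g_arr C f & g_deg f = 0 & Q <-> g_hom C f & g_deg f = 0 & Q" using g_hom_conj by blast

lemma e_mono: "e.mono i = h.mono i" unfolding e.mono_def h.mono_def e_hm ..

lemma e_epi: "e.epi p = h.epi p" unfolding e.epi_def h.epi_def e_hm ..

lemma e_bip: "e.bip i1 i2 p1 p2 = h.bip i1 i2 p1 p2" unfolding e.bip_def h.bip_def e_hm ..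

lemma ext_zero_iff:
  assumes s: "h.sexact s"
  shows "ext s = g_zer C 1 (h.quo s) (h.sub s) <-> h.split s"
proof -
  obtain z where z: "h.split z" "h.sub z = h.sub s" "h.quo z = h.quo s" using h.split_ex[OF h.ses_ob(2,1)[OF s]] .
  have zs: "h.sexact z" using z(1) unfolding h.split_def by simp
  have "ext s = g_zer C 1 (h.quo s) (h.sub s) <-> ext z = ext s" using zero_ext[OF z(1)] z(2,3) by auto
  also have "\<dots> <-> h.mor z s (g_ide C (h.sub z)) (g_ide C (h.quo z))" by (rule ext_eq[OF zs s])
  also have "\<dots> <-> h.split s" using h.split_mor[OF z(1)] h.split_unique[OF z(1)] z(2,3) by metis
  finally show ?thesis .
qed

text \<open>Vanishing of \<open>c f\<close> and of \<open>g c\<close> is splitting of a pullback or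
  pushout, hence a lifting property. For the other exactness: if \<open>e p = 0\<close>, then
  \<open>p\<close> lifts to an arrow between the middle terms, which restricts to an arrow
  \<open>g\<close> of the kernels, and the resulting morphism of sequences says
  \<open>g c = e\<close>; the argument for \<open>i e = 0\<close> is dual.\<close>

lemma rep_ext:
  assumes s: "h.sexact (i, p)"
  shows "e.rep (ext (i, p)) i p"
proof -
  note a = h.sexactD[OF s]
  have A: "g_arr C (ext (i, p))" using ext_arr[OF s] .
  have O: "g_src i \<in> Ob C" "g_trg p \<in> Ob C" using a(1,2) by auto
  have right: "e.rep_right (ext (i, p)) p" unfolding e.rep_right_def e_hm
  proof (intro conjI allI impI)
    fix f assume f: "g_hom C f & g_deg f = 0 & g_trg f = g_src (ext (i, p))"
    hence f': "h.hm f (g_src f) (g_trg p)" by simp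
    obtain s' where s': "h.sexact s'" "h.sub s' = h.sub (i, p)" "h.quo s' = g_src f"
      "h.mor s' (i, p) (g_ide C (h.sub (i, p))) f" "g_cmp C (ext (i, p)) f = ext s'" by (rule g_pull_ex[OF s _ f']) simp
    have "g_cmp C (ext (i, p)) f = g_zer C 1 (g_src f) (g_trg (ext (i, p))) <-> h.split s'" using ext_zero_iff[OF s'(1)] s'(2,3,5) by simp
    also have "\<dots> <-> (\<exists>h. h.hm h (g_src f) (g_src p) & g_cmp C p h = f)" using h.pull_split[OF s'(4)] a(5) by simp
    finally show "g_cmp C (ext (i, p)) f = g_zer C 1 (g_src f) (g_trg (ext (i, p))) <-> (\<exists>h. h.hm h (g_src f) (g_src p) & g_cmp C p h = f)" .
  next
    fix e assume e: "g_arr C e & g_deg e = 1 & g_src e = g_src (ext (i, p)) & g_cmp C e p = g_zer C 1 (g_src p) (g_trg e)"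
    then obtain s' where s': "h.sexact s'" "e = ext s'" using extE by blast
    obtain i' p' where ip: "s' = (i', p')" by (cases s')
    note a' = h.sexactD[OF s'(1)[unfolded ip]]
    have q: "g_trg p' = g_trg p" using e s'(2) ip by simp
    have p': "h.hm p (g_src p) (h.quo s')" using a(2,4) q ip by simp
    obtain r where r: "h.sexact r" "h.sub r = h.sub s'" "h.quo r = g_src p" "h.mor r s' (g_ide C (h.sub s')) p" "g_cmp C (ext s') p = ext r"
      by (rule g_pull_ex[OF s'(1) refl p'])
    have "h.split r" using ext_zero_iff[OF r(1)] e r(2,3,5) s'(2) by simp
    then obtain h where h: "h.hm h (g_src p) (g_trg i')" "g_cmp C p' h = p" using h.pull_split[OF r(4)] ip by auto
    have "g_cmp C p' (g_cmp C h i) = g_cmp C p i" using h.pre_cancel[OF h(2), of i] h(1) a(1-5) a'(1-5) by simp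
    hence "g_cmp C p' (g_cmp C h i) = g_zer C 0 (g_src i) (g_trg p')" using a(8) q by simp
    then obtain g where g: "h.hm g (g_src i) (g_src i')" "g_cmp C i' g = g_cmp C h i" using a'(9)[of "g_cmp C h i"] h(1) a(1-5) by auto
    have "h.mor (i, p) (i', p') g (g_ide C (g_trg p))"
      by (rule h.morI[OF s s'(1)[unfolded ip], where h=h]) (use g h a(1-5) a'(1-5) q O in simp_all)
    hence "g_cmp C g (ext (i, p)) = e" using push_ext[of "(i, p)" s' g] s'(2) ip by simp
    thus "\<exists>g. h.hm g (g_trg (ext (i, p))) (g_trg e) & g_cmp C g (ext (i, p)) = e" using g(1) s'(2) ip by (intro exI[of _ g]) simp
  qed
  have left: "e.rep_left (ext (i, p)) i" unfolding e.rep_left_def e_hm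
  proof (intro conjI allI impI)
    fix g assume g: "g_hom C g & g_deg g = 0 & g_src g = g_trg (ext (i, p))"
    hence g': "h.hm g (g_src i) (g_trg g)" by simp
    obtain s' where s': "h.sexact s'" "h.sub s' = g_trg g" "h.quo s' = h.quo (i, p)"
      "h.mor (i, p) s' g (g_ide C (h.quo (i, p)))" "g_cmp C g (ext (i, p)) = ext s'" by (rule g_push_ex[OF s _ g']) simp
    have "g_cmp C g (ext (i, p)) = g_zer C 1 (g_src (ext (i, p))) (g_trg g) <-> h.split s'" using ext_zero_iff[OF s'(1)] s'(2,3,5) by simp
    also have "\<dots> <-> (\<exists>h. h.hm h (g_trg i) (g_trg g) & g_cmp C h i = g)" using h.push_split[OF s'(4)] by simp
    finally show "g_cmp C g (ext (i, p)) = g_zer C 1 (g_src (ext (i, p))) (g_trg g) <-> (\<exists>h. h.hm h (g_trg i) (g_trg g) & g_cmp C h i = g)" .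
  next
    fix e assume e: "g_arr C e & g_deg e = 1 & g_trg e = g_trg (ext (i, p)) & g_cmp C i e = g_zer C 1 (g_src e) (g_trg i)"
    then obtain s' where s': "h.sexact s'" "e = ext s'" using extE by blast
    obtain i' p' where ip: "s' = (i', p')" by (cases s')
    note a' = h.sexactD[OF s'(1)[unfolded ip]]
    have q: "g_src i' = g_src i" using e s'(2) ip by simp
    have i': "h.hm i (h.sub s') (g_trg i)" using a(1,3) q ip by simp
    obtain r where r: "h.sexact r" "h.sub r = g_trg i" "h.quo r = h.quo s'" "h.mor s' r i (g_ide C (h.quo s'))" "g_cmp C i (ext s') = ext r"
      by (rule g_push_ex[OF s'(1) refl i'])
    have "h.split r" using ext_zero_iff[OF r(1)] e r(2,3,5) s'(2) by simp
    then obtain h where h: "h.hm h (g_trg i') (g_trg i)" "g_cmp C h i' = i" using h.push_split[OF r(4)] ip by auto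
    have "g_cmp C (g_cmp C p h) i' = g_cmp C p i" using h(1,2) a(1-5) a'(1-5) by simp
    hence "g_cmp C (g_cmp C p h) i' = g_zer C 0 (g_src i') (g_trg p)" using a(8) q by simp
    then obtain f where f: "h.hm f (g_trg p') (g_trg p)" "g_cmp C f p' = g_cmp C p h" using a'(10)[of "g_cmp C p h"] h(1) a(1-5) by auto
    have "h.mor (i', p') (i, p) (g_ide C (g_src i)) f"
      by (rule h.morI[OF s'(1)[unfolded ip] s, where h=h]) (use f h a(1-5) a'(1-5) q O in simp_all)
    hence "g_cmp C (ext (i, p)) f = e" using pull_ext[of s' "(i, p)" f] s'(2) ip by simp
    thus "\<exists>f. h.hm f (g_src e) (g_src (ext (i, p))) & g_cmp C (ext (i, p)) f = e" using f(1) s'(2) ip by (intro exI[of _ f]) simp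
  qed
  show ?thesis unfolding e.rep_def e_mono e_epi using A right left a by simp
qed

end

sublocale abelian_category \<subseteq> e: excat k "Ob C" "g_arr C" g_src g_trg g_deg "g_ide C" "g_cmp C" "g_add C" "g_zer C" "g_scl C"
proof (unfold_locales, unfold e_bip e_mono e_epi)
  show "\<exists>i1 i2 p1 p2. h.bip i1 i2 p1 p2 & g_src i1 = X & g_src i2 = Y" if "X \<in> Ob C" "Y \<in> Ob C" for X Y
    using h.bip_ex[OF that] .
  show "\<exists>q j. e.hm q X (g_trg q) & e.hm j (g_trg q) X & g_cmp C q j = g_ide C (g_trg q) & g_cmp C j q = e"
    if "e.hm e X X" "g_cmp C e e = e" for e X using h.idem_splits[of e X] that unfolding e_hm by blast
  show "\<exists>i p. e.rep c i p" if c: "g_arr C c" "g_deg c = 1" for c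
  proof -
    obtain s where "h.sexact s" "c = ext s" using extE[OF c] .
    hence "e.rep c (fst s) (snd s)" using rep_ext[of "fst s" "snd s"] by simp
    thus ?thesis by blast
  qed
  show "\<exists>c i. e.rep c i p" if p: "h.epi p" for p
  proof -
    obtain i where "h.ker p i" using h.ker_ex h.epiD(1,2)[OF p] by blast
    thus ?thesis using rep_ext[OF h.sexactI'[OF p]] by blast
  qed
  show "\<exists>c p. e.rep c i p" if i: "h.mono i" for i
  proof -
    obtain p where "h.coker i p" using h.coker_ex h.monoD(1,2)[OF i] by blast
    thus ?thesis using rep_ext[OF h.sexactI[OF i]] by blast
  qed
qed

locale serre_cat = abelian_category k C + matlis k E
  for k :: "'k ring" and C :: "('k, 'o, 'm) lincat" (structure) and E :: "('k, 'e) module" +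
  assumes hom_fin: "hom_finite k C"

sublocale serre_cat \<subseteq> e: serre k "Ob C" "g_arr C" g_src g_trg g_deg "g_ide C" "g_cmp C" "g_add C" "g_zer C" "g_scl C" E
proof
  fix X Y assume X: "X \<in> Ob C" "Y \<in> Ob C"
  have m: "module k (e.HM 0 X Y)" by (rule e.hom_module) (use X in auto)
  have f: "fgen k (Hom C X Y)" using fg_module_fgen[OF hom_module[OF X]] hom_fin X unfolding hom_finite_def by blast
  show "fgen k (e.HM 0 X Y)"
  proof (rule fgen_iso[OF hom_module[OF X] f m])
    show "lin_on k (Hom C X Y) (e.HM 0 X Y) (arr C X Y) (%u. (X, Inl u, Y))"
      by (rule lin_onI) (use X in \<open>auto simp: e.HM_simps\<close>)
    show "carrier (e.HM 0 X Y) \<subseteq> (%u. (X, Inl u, Y)) ` arr C X Y"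
    proof
      fix f assume "f \<in> carrier (e.HM 0 X Y)"
      hence "g_hom C f" "g_src f = X" "g_trg f = Y" unfolding e.HM_simps g_hom_def by auto
      thus "f \<in> (%u. (X, Inl u, Y)) ` arr C X Y" by (auto elim!: g_homE)
    qed
  qed
qed

section \<open>Uniqueness and transport of Serre pairings; the functor \<tau> and its
  quasi-inverse\<close>

context serre begin

lemma SPl_eqI:
  assumes s: "SPl X K t" and g: "hm g Y K" "hm g' Y K"
    and eq: "!!e. [| ar e; deg e = 1; src e = X; trg e = Y |] ==> t (g ** e) = t (g' ** e)"
  shows "g = g'"
proof (rule SPlD(5)[OF s g])
  show "push_func X Y t g = push_func X Y t g'" by (rule func_eqI[OF push_func[OF SPlD(3,1)[OF s] g(1)] push_func[OF SPlD(3,1)[OF s] g(2)]])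
      (simp add: push_func_val eq)
qed

lemma SPr_eqI:
  assumes s: "SPr X K t" and g: "hm f X Y" "hm f' X Y"
    and eq: "!!e. [| ar e; deg e = 1; src e = Y; trg e = K |] ==> t (e ** f) = t (e ** f')"
  shows "f = f'"
proof (rule SPrD(5)[OF s g])
  show "pull_func Y K t f = pull_func Y K t f'" by (rule func_eqI[OF pull_func[OF SPrD(3,2)[OF s] g(1)] pull_func[OF SPrD(3,2)[OF s] g(2)]])
      (simp add: pull_func_val eq)
qed

lemma SPl_repr:
  assumes s: "SPl X K t" and d: "Y \<in> Ob" "d \<in> func X Y"
  obtains g where "hm g Y K" "!!e. [| ar e; deg e = 1; src e = X; trg e = Y |] ==> t (g ** e) = d e"
  using SPlD(4)[OF s d] push_func_val by metis

lemma SPr_repr: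
  assumes s: "SPr X K t" and d: "Y \<in> Ob" "d \<in> func Y K"
  obtains f where "hm f X Y" "!!e. [| ar e; deg e = 1; src e = Y; trg e = K |] ==> t (e ** f) = d e"
  using SPrD(4)[OF s d] pull_func_val by metis

lemma SPl_unique:
  assumes s: "SPl X K t" and s': "SPl X K' t'"
  obtains u v where "inv_pair u v" "src u = K" "trg u = K'"
proof -
  note d = SPlD[OF s] and d' = SPlD[OF s']
  obtain u where u: "hm u K K'" "!!e. [| ar e; deg e = 1; src e = X; trg e = K |] ==> t' (u ** e) = t e"
    using SPl_repr[OF s' d(2,3)] by blast
  obtain v where v: "hm v K' K" "!!e. [| ar e; deg e = 1; src e = X; trg e = K' |] ==> t (v ** e) = t' e"
    using SPl_repr[OF s d'(2,3)] by blast
  have "v ** u = ide K" by (rule SPl_eqI[OF s, of _ K]) (use u v d(2) in simp_all)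
  moreover have "u ** v = ide K'" by (rule SPl_eqI[OF s', of _ K']) (use u v d'(2) in simp_all)
  ultimately show ?thesis using that[of u v] u(1) v(1) unfolding inv_pair_def by simp
qed

text \<open>A Serre duality provides pairings directly only for objects of the form
  \<open>\<tau> X\<close>. An arbitrary object is isomorphic to one of these, and the pairing is
  moved along the isomorphism.\<close>

lemma SP_transport:
  assumes s: "SP X K t" and w: "inv_pair w w'" "trg w = K"
  shows "SP X (src w) (push_func X (src w) t w)"
proof -
  note i = inv_pairD[OF w(1)]
  have l: "SPl X K t" and r: "SPr X K t" using s unfolding SP_def by auto
  note L = SPlD[OF l]
  let ?K = "src w" and ?t = "push_func X (src w) t w"
  have O: "?K \<in> Ob" using i by simp
  have wh: "hm w ?K K" "hm w' K ?K" using i w(2) by simp_all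
  have t': "?t \<in> func X ?K" by (rule push_func[OF L(3,1) wh(1)])
  have val: "?t e = t (w ** e)" if "ar e" "deg e = 1" "src e = X" "trg e = ?K" for e by (rule push_func_val[OF that])
  have "SPl X ?K ?t" unfolding SPl_def
  proof (intro conjI ballI allI impI L(1) O t')
    fix Y d assume Y: "Y \<in> Ob" "d \<in> func X Y"
    obtain g where g: "hm g Y K" "!!e. [| ar e; deg e = 1; src e = X; trg e = Y |] ==> t (g ** e) = d e" using SPl_repr[OF l Y] by blast
    have h: "hm (w' ** g) Y ?K" using g(1) wh by simp
    have "push_func X Y ?t (w' ** g) = d"
    proof (rule func_eqI[OF push_func[OF t' L(1) h] Y(2)])
      fix e assume e: "ar e" "deg e = 1" "src e = X" "trg e = Y"
      have "w ** (w' ** (g ** e)) = g ** e" using i(10)[of "g ** e"] g(1) e w(2) by simp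
      thus "push_func X Y ?t (w' ** g) e = d e" using g e wh by (simp add: push_func_val val)
    qed
    thus "\<exists>g. hm g Y ?K & push_func X Y ?t g = d" using h by blast
  next
    fix g g' assume a: "ar g & ar g' & deg g = 0 & deg g' = 0 & trg g = ?K & trg g' = ?K & src g' = src g &
      push_func X (src g) ?t g = push_func X (src g) ?t g'"
    have "w ** g = w ** g'"
    proof (rule SPl_eqI[OF l, of _ "src g"])
      fix e assume e: "ar e" "deg e = 1" "src e = X" "trg e = src g"
      have "?t (g ** e) = ?t (g' ** e)" using a push_func_val[OF e, of ?t g] push_func_val[OF e, of ?t g'] by simp
      thus "t ((w ** g) ** e) = t ((w ** g') ** e)" using a e wh by (simp add: val)
    qed (use a wh in auto)
    hence "w' ** (w ** g) = w' ** (w ** g')" by simp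
    thus "g = g'" using i(9)[of g] i(9)[of g'] a by simp
  qed
  moreover have "SPr X ?K ?t" unfolding SPr_def serre.SPl_def[OF op_serre] op_simps op_push_func
  proof (intro conjI ballI allI impI L(1) O t')
    fix Y d assume Y: "Y \<in> Ob" "d \<in> func Y ?K"
    have d': "push_func Y K d w' \<in> func Y K" by (rule push_func[OF Y(2,1) wh(2)])
    obtain f where f: "hm f X Y" "!!e. [| ar e; deg e = 1; src e = Y; trg e = K |] ==> t (e ** f) = push_func Y K d w' e"
      using SPr_repr[OF r Y(1) d'] by blast
    have "pull_func Y ?K ?t f = d"
    proof (rule func_eqI[OF pull_func[OF t' O f(1)] Y(2)])
      fix e assume e: "ar e" "deg e = 1" "src e = Y" "trg e = ?K"
      have "w' ** (w ** e) = e" using i(9)[of e] e by simp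
      hence "t ((w ** e) ** f) = d e" using f(2)[of "w ** e"] push_func_val[of "w ** e" Y K d w'] e wh by simp
      thus "pull_func Y ?K ?t f e = d e" using f(1) e wh by (simp add: pull_func_val val)
    qed
    thus "\<exists>g. (ar g & deg g = 0 & trg g = Y & src g = X) & pull_func Y ?K ?t g = d" using f(1) by blast
  next
    fix g g' assume a: "ar g & ar g' & deg g = 0 & deg g' = 0 & src g = X & src g' = X & trg g' = trg g &
      pull_func (trg g) ?K ?t g = pull_func (trg g) ?K ?t g'"
    show "g = g'"
    proof (rule SPr_eqI[OF r, of _ "trg g"])
      fix e assume e: "ar e" "deg e = 1" "src e = trg g" "trg e = K"
      have w'e: "ar (w' ** e)" "deg (w' ** e) = 1" "src (w' ** e) = trg g" "trg (w' ** e) = ?K" using e wh by simp_all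
      have "?t ((w' ** e) ** g) = ?t ((w' ** e) ** g')" using a pull_func_val[OF w'e, of ?t g] pull_func_val[OF w'e, of ?t g'] by simp
      moreover have "w ** (w' ** (e ** g)) = e ** g" "w ** (w' ** (e ** g')) = e ** g'"
        using i(10)[of "e ** g"] i(10)[of "e ** g'"] a e w(2) by simp_all
      ultimately show "t (e ** g) = t (e ** g')" using a e wh by (simp add: val)
    qed (use a in auto)
  qed
  ultimately show ?thesis unfolding SP_def by blast
qed

end

locale serre_choice = serre k Ob ar src trg deg ide cmp pls zer scl E for k :: "'k ring" and Ob :: "'o set" and ar :: "'a => bool"
    and src trg :: "'a => 'o" and deg :: "'a => nat" and ide :: "'o => 'a"
    and cmp :: "'a => 'a => 'a" (infixl \<open>**\<close> 75)
    and pls :: "'a => 'a => 'a" (infixl \<open>+++\<close> 65)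
    and zer :: "nat => 'o => 'o => 'a"
    and scl :: "'k => 'a => 'a" (infixr \<open>\<star>\<close> 80)
    and E :: "('k, 'e) module" +
  fixes tau :: "'o => 'o" and T :: "'o => 'a => 'e"
  assumes SP_tau: "X \<in> Ob ==> SP X (tau X) (T X)"
    and SP_dense: "K \<in> Ob ==> \<exists>X t. SP X K t"
begin

lemma SPl_tau: "X \<in> Ob ==> SPl X (tau X) (T X)" and SPr_tau: "X \<in> Ob ==> SPr X (tau X) (T X)" using SP_tau unfolding SP_def by auto

lemma tau_ob [simp]: "X \<in> Ob ==> tau X \<in> Ob" using SPlD(2)[OF SPl_tau] .

lemma T_func: "X \<in> Ob ==> T X \<in> func X (tau X)" using SPlD(3)[OF SPl_tau] .

lemma tau_eqI:
  assumes "X \<in> Ob" "hm g Y (tau X)" "hm g' Y (tau X)"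
    "!!e. [| ar e; deg e = 1; src e = X; trg e = Y |] ==> T X (g ** e) = T X (g' ** e)"
  shows "g = g'" using SPl_eqI[OF SPl_tau[OF assms(1)] assms(2-4)] .

text \<open>The arrow that represents the functional \<open>e \<mapsto> T (src f) (e ** f)\<close>.
  The defining equation determines it, so functoriality and linearity are checked after applying
  \<open>T\<close>.\<close>

definition tauf :: "'a => 'a" where
  "tauf f = (SOME h. hm h (tau (src f)) (tau (trg f)) &
     (\<forall>e. ar e & deg e = 1 & src e = trg f & trg e = tau (src f) --> T (trg f) (h ** e) = T (src f) (e ** f)))"

lemma tauf:
  assumes f: "hm f X X'"
  shows "hm (tauf f) (tau X) (tau X')"
    "!!e. [| ar e; deg e = 1; src e = X'; trg e = tau X |] ==> T X' (tauf f ** e) = T X (e ** f)"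
proof -
  have X: "X \<in> Ob" "X' \<in> Ob" using f by auto
  have p: "pull_func X' (tau X) (T X) f \<in> func X' (tau X)" by (rule pull_func[OF T_func[OF X(1)] tau_ob[OF X(1)] f])
  obtain h where h: "hm h (tau X) (tau X')"
    "!!e. [| ar e; deg e = 1; src e = X'; trg e = tau X |] ==> T X' (h ** e) = pull_func X' (tau X) (T X) f e"
    using SPl_repr[OF SPl_tau[OF X(2)] tau_ob[OF X(1)] p] by blast
  have "\<exists>h. hm h (tau (src f)) (tau (trg f)) &
     (\<forall>e. ar e & deg e = 1 & src e = trg f & trg e = tau (src f) --> T (trg f) (h ** e) = T (src f) (e ** f))"
    by (rule exI[of _ h]) (use h f pull_func_val in auto)
  from someI_ex[OF this, folded tauf_def]
  show "hm (tauf f) (tau X) (tau X')"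
    "!!e. [| ar e; deg e = 1; src e = X'; trg e = tau X |] ==> T X' (tauf f ** e) = T X (e ** f)" using f by auto
qed

lemma tauf_ide: "X \<in> Ob ==> tauf (ide X) = ide (tau X)" by (rule tau_eqI[of X _ "tau X"]) (use tauf[of "ide X" X X] in simp_all)

lemma tauf_comp:
  assumes f: "hm f X Y" and g: "hm g Y Z"
  shows "tauf (g ** f) = tauf g ** tauf f"
proof (rule tau_eqI[of Z _ "tau X"])
  have gf: "hm (g ** f) X Z" using f g by simp
  note F = tauf[OF f] and G = tauf[OF g] and H = tauf[OF gf]
  have O: "X \<in> Ob" "Y \<in> Ob" "Z \<in> Ob" using f g by auto
  show "Z \<in> Ob" by fact
  show "hm (tauf (g ** f)) (tau X) (tau Z)" "hm (tauf g ** tauf f) (tau X) (tau Z)" using F(1) G(1) H(1) by simp_all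
  fix e assume e: "ar e" "deg e = 1" "src e = Z" "trg e = tau X"
  have "T Z ((tauf g ** tauf f) ** e) = T Z (tauf g ** (tauf f ** e))" using F(1) G(1) e by simp
  also have "\<dots> = T Y ((tauf f ** e) ** g)" by (rule G(2)) (use F(1) e in auto)
  also have "(tauf f ** e) ** g = tauf f ** (e ** g)" using F(1) e g by simp
  also have "T Y (tauf f ** (e ** g)) = T X ((e ** g) ** f)" by (rule F(2)) (use e g in auto)
  also have "(e ** g) ** f = e ** (g ** f)" using e f g by simp
  finally show "T Z (tauf (g ** f) ** e) = T Z ((tauf g ** tauf f) ** e)" using H(2)[OF e] by simp
qed

lemma tauf_add:
  assumes f: "hm f X Y" "hm g X Y"
  shows "tauf (f +++ g) = tauf f +++ tauf g"
proof (rule tau_eqI[of Y _ "tau X"])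
  have fg: "hm (f +++ g) X Y" using f by simp
  note F = tauf[OF f(1)] and G = tauf[OF f(2)] and H = tauf[OF fg]
  have O: "X \<in> Ob" "Y \<in> Ob" using f by auto
  show "Y \<in> Ob" by fact
  show "hm (tauf (f +++ g)) (tau X) (tau Y)" "hm (tauf f +++ tauf g) (tau X) (tau Y)" using F(1) G(1) H(1) by simp_all
  fix e assume e: "ar e" "deg e = 1" "src e = Y" "trg e = tau X"
  note tX = funcD[OF T_func[OF O(1)] O(1) tau_ob[OF O(1)]] and tY = funcD[OF T_func[OF O(2)] O(2) tau_ob[OF O(2)]]
  have "T Y ((tauf f +++ tauf g) ** e) = T Y (tauf f ** e) +[E] T Y (tauf g ** e)"
    using F(1) G(1) e tY(2)[of "tauf f ** e" "tauf g ** e"] by (simp add: dist)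
  also have "\<dots> = T X (e ** (f +++ g))" unfolding F(2)[OF e] G(2)[OF e] using f e tX(2)[of "e ** f" "e ** g"] by (simp add: dist)
  finally show "T Y (tauf (f +++ g) ** e) = T Y ((tauf f +++ tauf g) ** e)" using H(2)[OF e] by simp
qed

lemma tauf_scl:
  assumes f: "hm f X Y" and a: "a \<in> carrier k"
  shows "tauf (a \<star> f) = a \<star> tauf f"
proof (rule tau_eqI[of Y _ "tau X"])
  have fg: "hm (a \<star> f) X Y" using f a by simp
  note F = tauf[OF f] and H = tauf[OF fg]
  have O: "X \<in> Ob" "Y \<in> Ob" using f by auto
  show "Y \<in> Ob" by fact
  show "hm (tauf (a \<star> f)) (tau X) (tau Y)" "hm (a \<star> tauf f) (tau X) (tau Y)" using F(1) H(1) a by simp_all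
  fix e assume e: "ar e" "deg e = 1" "src e = Y" "trg e = tau X"
  note tX = funcD[OF T_func[OF O(1)] O(1) tau_ob[OF O(1)]] and tY = funcD[OF T_func[OF O(2)] O(2) tau_ob[OF O(2)]]
  have "T Y ((a \<star> tauf f) ** e) = a .[E] T Y (tauf f ** e)" using F(1) e a tY(3)[of a "tauf f ** e"] by (simp add: dist)
  also have "\<dots> = T X (e ** (a \<star> f))" unfolding F(2)[OF e] using f e a tX(3)[of a "e ** f"] by (simp add: dist)
  finally show "T Y (tauf (a \<star> f) ** e) = T Y ((a \<star> tauf f) ** e)" using H(2)[OF e] by simp
qed

text \<open>Faithfulness is the uniqueness half, and fullness below the existence half, of the
  right-hand pairing \<open>SPr\<close> at \<open>X\<close>.\<close>

lemma tauf_faithful: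
  assumes f: "hm f X Y" "hm g X Y" "tauf f = tauf g"
  shows "f = g"
proof (rule SPr_eqI[OF SPr_tau, of X f Y g])
  show "X \<in> Ob" using f by auto
  show "T X (e ** f) = T X (e ** g)" if "ar e" "deg e = 1" "src e = Y" "trg e = tau X" for e
    using tauf(2)[OF f(1) that] tauf(2)[OF f(2) that] f(3) by simp
qed (use f in auto)

lemma tauf_full:
  assumes h: "hm h (tau X) (tau Y)" and O: "X \<in> Ob" "Y \<in> Ob"
  obtains f where "hm f X Y" "tauf f = h"
proof -
  have p: "push_func Y (tau X) (T Y) h \<in> func Y (tau X)" by (rule push_func[OF T_func[OF O(2)] O(2) h])
  obtain f where f: "hm f X Y" "!!e. [| ar e; deg e = 1; src e = Y; trg e = tau X |] ==> T X (e ** f) = push_func Y (tau X) (T Y) h e"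
    using SPr_repr[OF SPr_tau[OF O(1)] O(2) p] by blast
  have "tauf f = h" by (rule tau_eqI[OF O(2), of _ "tau X"]) (use tauf[OF f(1)] h f push_func_val in simp_all)
  thus ?thesis using that f(1) by blast
qed

text \<open>Object and arrows are chosen together so that the mutually inverse arrows belong to the
  chosen object. Existence: some \<open>X\<close> is paired with \<open>K\<close>, and the object
  representing \<open>X\<close> on that side is unique up to isomorphism.\<close>

definition inv_data :: "'o => 'o \<times> 'a \<times> 'a" where
  "inv_data K = (SOME (X, u, v). X \<in> Ob & inv_pair u v & src u = K & trg u = tau X)"

definition G :: "'o => 'o" where "G K = fst (inv_data K)"
definition u :: "'o => 'a" where "u K = fst (snd (inv_data K))"
definition v :: "'o => 'a" where "v K = snd (snd (inv_data K))"

lemma inv_data: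
  assumes K: "K \<in> Ob"
  shows "G K \<in> Ob" "inv_pair (u K) (v K)" "hm (u K) K (tau (G K))" "hm (v K) (tau (G K)) K"
proof -
  obtain X t where "SP X K t" using SP_dense[OF K] by blast
  hence s: "SPl X K t" unfolding SP_def by simp
  have X: "X \<in> Ob" using SPlD(1)[OF s] .
  obtain a b where "inv_pair a b" "src a = K" "trg a = tau X" using SPl_unique[OF s SPl_tau[OF X]] .
  hence "\<exists>x. (case x of (X, p, q) => X \<in> Ob & inv_pair p q & src p = K & trg p = tau X)"
    using X by (intro exI[of _ "(X, a, b)"]) simp
  from someI_ex[OF this, folded inv_data_def]
  have *: "G K \<in> Ob" "inv_pair (u K) (v K)" "src (u K) = K" "trg (u K) = tau (G K)"
    unfolding G_def u_def v_def by (auto split: prod.splits)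
  thus "G K \<in> Ob" "inv_pair (u K) (v K)" "hm (u K) K (tau (G K))" "hm (v K) (tau (G K)) K" using inv_pairD(1-6)[OF *(2)] by simp_all
qed

lemma uv:
  assumes "K \<in> Ob"
  shows "v K ** u K = ide K" "u K ** v K = ide (tau (G K))"
    "!!z. [| ar z; trg z = K |] ==> v K ** (u K ** z) = z" "!!z. [| ar z; trg z = tau (G K) |] ==> u K ** (v K ** z) = z"
  using inv_pairD[OF inv_data(2)[OF assms]] inv_data(3)[OF assms] by simp_all

definition Gf :: "'a => 'a" where
  "Gf f = (SOME h. hm h (G (src f)) (G (trg f)) & tauf h = u (trg f) ** (f ** v (src f)))"

lemma Gf:
  assumes f: "hm f K L"
  shows "hm (Gf f) (G K) (G L)" "tauf (Gf f) = u L ** (f ** v K)"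
proof -
  have O: "K \<in> Ob" "L \<in> Ob" using f by auto
  note K = inv_data[OF O(1)] and L = inv_data[OF O(2)]
  have h: "hm (u L ** (f ** v K)) (tau (G K)) (tau (G L))" using K L f by simp
  obtain w where "hm w (G K) (G L)" "tauf w = u L ** (f ** v K)" using tauf_full[OF h K(1) L(1)] .
  hence "\<exists>h. hm h (G (src f)) (G (trg f)) & tauf h = u (trg f) ** (f ** v (src f))" using f by blast
  from someI_ex[OF this, folded Gf_def] show "hm (Gf f) (G K) (G L)" "tauf (Gf f) = u L ** (f ** v K)" using f by auto
qed

lemma Gf_ide:
  assumes K: "K \<in> Ob"
  shows "Gf (ide K) = ide (G K)"
proof (rule tauf_faithful)
  note d = inv_data[OF K] and g = Gf[of "ide K" K K]
  show "hm (Gf (ide K)) (G K) (G K)" "hm (ide (G K)) (G K) (G K)" using g K d by simp_all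
  show "tauf (Gf (ide K)) = tauf (ide (G K))" using g K d uv[OF K] by (simp add: tauf_ide)
qed

lemma Gf_comp:
  assumes f: "hm f K L" and g: "hm g L M"
  shows "Gf (g ** f) = Gf g ** Gf f"
proof (rule tauf_faithful)
  have O: "K \<in> Ob" "L \<in> Ob" "M \<in> Ob" using f g by auto
  have gf: "hm (g ** f) K M" using f g by simp
  note dK = inv_data(3,4)[OF O(1)] and dL = inv_data(3,4)[OF O(2)] and dM = inv_data(3,4)[OF O(3)]
  note F = Gf[OF f] and G' = Gf[OF g] and H = Gf[OF gf]
  show "hm (Gf (g ** f)) (G K) (G M)" "hm (Gf g ** Gf f) (G K) (G M)" using F(1) G'(1) H(1) by simp_all
  have "tauf (Gf g ** Gf f) = (u M ** (g ** v L)) ** (u L ** (f ** v K))" using tauf_comp[OF F(1) G'(1)] F(2) G'(2) by simp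
  also have "\<dots> = u M ** (g ** (v L ** (u L ** (f ** v K))))" using dK dL dM f g by simp
  also have "v L ** (u L ** (f ** v K)) = f ** v K" by (rule uv(3)[OF O(2)]) (use dK f in auto)
  also have "u M ** (g ** (f ** v K)) = tauf (Gf (g ** f))" unfolding H(2) using dK f g by simp
  finally show "tauf (Gf (g ** f)) = tauf (Gf g ** Gf f)" by simp
qed

text \<open>As \<open>tauf\<close> is full and faithful, the comparison arrow may be prescribed by
  its image \<open>v (tau X)\<close>; invertibility and naturality are verified on images as
  well.\<close>

definition eta :: "'o => 'a" where
  "eta X = (SOME f. hm f (G (tau X)) X & tauf f = v (tau X))"

lemma eta:
  assumes X: "X \<in> Ob"
  shows "hm (eta X) (G (tau X)) X" "tauf (eta X) = v (tau X)" "iso (eta X)"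
proof -
  note d = inv_data[OF tau_ob[OF X]] and i = uv(1,2)[OF tau_ob[OF X]]
  obtain f where "hm f (G (tau X)) X" "tauf f = v (tau X)" using tauf_full[OF d(4,1) X] .
  hence "\<exists>f. hm f (G (tau X)) X & tauf f = v (tau X)" by blast
  from someI_ex[OF this, folded eta_def] show e: "hm (eta X) (G (tau X)) X" "tauf (eta X) = v (tau X)" by auto
  obtain w where w: "hm w X (G (tau X))" "tauf w = u (tau X)" using tauf_full[OF d(3) X d(1)] .
  have "w ** eta X = ide (G (tau X))"
    by (rule tauf_faithful[of _ "G (tau X)" "G (tau X)"]) (use e w d i tauf_comp[OF e(1) w(1)] in \<open>simp_all add: tauf_ide\<close>)
  moreover have "eta X ** w = ide X"
    by (rule tauf_faithful[of _ X X]) (use e w d i X tauf_comp[OF w(1) e(1)] in \<open>simp_all add: tauf_ide\<close>)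
  ultimately show "iso (eta X)" using isoI[OF e(1) w(1)] by blast
qed

lemma eta_natural:
  assumes f: "hm f X Y"
  shows "f ** eta X = eta Y ** Gf (tauf f)"
proof (rule tauf_faithful)
  have O: "X \<in> Ob" "Y \<in> Ob" using f by auto
  note eX = eta[OF O(1)] and eY = eta[OF O(2)] and F = tauf(1)[OF f] and H = Gf[OF tauf(1)[OF f]]
  note dX = inv_data(3,4)[OF tau_ob[OF O(1)]] and dY = inv_data(3,4)[OF tau_ob[OF O(2)]]
  show "hm (f ** eta X) (G (tau X)) Y" "hm (eta Y ** Gf (tauf f)) (G (tau X)) Y" using eX eY H f by simp_all
  have "tauf (eta Y ** Gf (tauf f)) = v (tau Y) ** (u (tau Y) ** (tauf f ** v (tau X)))" unfolding tauf_comp[OF H(1) eY(1)] eY(2) H(2) ..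
  also have "\<dots> = tauf f ** v (tau X)" by (rule uv(3)) (use O F dX in auto)
  finally show "tauf (f ** eta X) = tauf (eta Y ** Gf (tauf f))" unfolding tauf_comp[OF eX(1) f] eX(2) by simp
qed

lemma v_natural:
  assumes f: "hm f K L"
  shows "f ** v K = v L ** tauf (Gf f)"
proof -
  have O: "K \<in> Ob" "L \<in> Ob" using f by auto
  show ?thesis unfolding Gf(2)[OF f] using uv(3)[OF O(2), of "f ** v K"] f inv_data(4)[OF O(1)] by simp
qed

end

section \<open>Translation of the definitions about opposites, submodules, equivalences and
  determined morphisms\<close>

context linear_category begin

lemma opposite_linear: "linear_category k (opposite C)"
  by (rule linear_category.intro) (simp_all add: opposite_def base_cring hom_module ident_closed comp_closed comp_ident_right comp_ident_left
    comp_assoc comp_add_right comp_add_left comp_smult_right comp_smult_left)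

text \<open>The additive inverses demanded by \<open>submodule\<close> come from acting with minus
  the identity of \<open>D\<close>.\<close>

lemma submodule_Gamma:
  assumes D: "D \<in> Ob C" "Y \<in> Ob C"
  shows "submodule H (Gamma C D) (HomGamma C D Y) <-> H \<subseteq> arr C D Y & 0[Hom C D Y] \<in> H &
    (\<forall>h\<in>H. \<forall>h'\<in>H. h +[Hom C D Y] h' \<in> H) & (\<forall>h\<in>H. \<forall>a\<in>arr C D D. h \<cdot> a \<in> H)"
proof -
  interpret M: module k "Hom C D Y" by (rule hom_module[OF D])
  interpret N: module k "Hom C D D" by (rule hom_module[OF D(1,1)])
  have inv: "inv\<^bsub>add_monoid (HomGamma C D Y)\<^esub> h = -[Hom C D Y] h" for h unfolding a_inv_def m_inv_def HomGamma_def by simp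
  have neg: "h \<cdot> (-[Hom C D D] Ident C D) = -[Hom C D Y] h" if h: "h \<in> arr C D Y" for h
  proof -
    have m1: "-[k] 1[k] \<in> carrier k" by simp
    have i: "Ident C D \<in> arr C D D" by (rule ident_closed[OF D(1)])
    have "-[Hom C D D] Ident C D = (-[k] 1[k]) .[Hom C D D] Ident C D" using N.smult_l_minus[OF M.R.one_closed i] N.smult_one[OF i] by simp
    hence "h \<cdot> (-[Hom C D D] Ident C D) = (-[k] 1[k]) .[Hom C D Y] h"
      using comp_smult_right[OF D(1,1,2) m1 i h] comp_ident_right[OF D h] by simp
    thus ?thesis using M.smult_l_minus[OF M.R.one_closed h] M.smult_one[OF h] by simp
  qed
  show ?thesis
  proof
    assume s: "submodule H (Gamma C D) (HomGamma C D Y)"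
    note g = submodule.axioms(1)[OF s] and sm = submodule.smult_closed[OF s]
    show "H \<subseteq> arr C D Y & 0[Hom C D Y] \<in> H &
      (\<forall>h\<in>H. \<forall>h'\<in>H. h +[Hom C D Y] h' \<in> H) & (\<forall>h\<in>H. \<forall>a\<in>arr C D D. h \<cdot> a \<in> H)"
      using subgroup.subset[OF g] subgroup.one_closed[OF g] subgroup.m_closed[OF g] sm by (simp add: HomGamma_def Gamma_def)
  next
    assume a: "H \<subseteq> arr C D Y & 0[Hom C D Y] \<in> H &
      (\<forall>h\<in>H. \<forall>h'\<in>H. h +[Hom C D Y] h' \<in> H) & (\<forall>h\<in>H. \<forall>a\<in>arr C D D. h \<cdot> a \<in> H)"
    have "subgroup H (add_monoid (HomGamma C D Y))"
    proof
      show "inv\<^bsub>add_monoid (HomGamma C D Y)\<^esub> x \<in> H" if "x \<in> H" for x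
        unfolding inv using a that neg[of x] N.M.a_inv_closed[OF ident_closed[OF D(1)]] by (metis subsetD)
    qed (use a in \<open>auto simp: HomGamma_def\<close>)
    thus "submodule H (Gamma C D) (HomGamma C D Y)"
      unfolding submodule_def submodule_axioms_def using a by (simp add: HomGamma_def Gamma_def)
  qed
qed

text \<open>Cancelling the invertible \<open>\<eta>\<close> gives injectivity of \<open>Fm\<close>,
  and cancelling \<open>\<epsilon>\<close> that of \<open>Gm\<close>. A preimage of \<open>h\<close>
  is obtained by conjugating \<open>Gm h\<close> with \<open>\<eta>\<close>; it is correct after
  \<open>Gm\<close>, hence correct.\<close>

lemma auto_equivalence_bij:
  assumes ae: "auto_equivalence C Fo Fm" and X: "X \<in> Ob C" "Y \<in> Ob C"
  shows "bij_betw (Fm X Y) (arr C X Y) (arr C (Fo X) (Fo Y))"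
proof -
  obtain Go Gm where F: "endofunctor C Fo Fm" and G: "endofunctor C Go Gm"
    and n1: "naturally_isomorphic C (%X. Go (Fo X)) (%X Y f. Gm (Fo X) (Fo Y) (Fm X Y f)) (%X. X) (%X Y f. f)"
    and n2: "naturally_isomorphic C (%X. Fo (Go X)) (%X Y f. Fm (Go X) (Go Y) (Gm X Y f)) (%X. X) (%X Y f. f)"
    using ae unfolding auto_equivalence_def by blast
  obtain \<eta> where eta: "!!X. X \<in> Ob C ==> \<eta> X \<in> iso_arr C (Go (Fo X)) X"
    "!!X Y f. [| X \<in> Ob C; Y \<in> Ob C; f \<in> arr C X Y |] ==> f \<cdot> \<eta> X = \<eta> Y \<cdot> Gm (Fo X) (Fo Y) (Fm X Y f)"
    using n1 unfolding naturally_isomorphic_def by blast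
  obtain \<epsilon> where eps: "!!X. X \<in> Ob C ==> \<epsilon> X \<in> iso_arr C (Fo (Go X)) X"
    "!!X Y f. [| X \<in> Ob C; Y \<in> Ob C; f \<in> arr C X Y |] ==> f \<cdot> \<epsilon> X = \<epsilon> Y \<cdot> Fm (Go X) (Go Y) (Gm X Y f)"
    using n2 unfolding naturally_isomorphic_def by blast
  note Fob = endofunctor.ob_closed[OF F] and Gob = endofunctor.ob_closed[OF G]
    and Farr = endofunctor.arr_closed[OF F] and Garr = endofunctor.arr_closed[OF G]
  have cancel_right: "f = f'" if iso: "i \<in> iso_arr C A B" and O: "A \<in> Ob C" "B \<in> Ob C" "Z \<in> Ob C"
    and f: "f \<in> arr C B Z" "f' \<in> arr C B Z" "f \<cdot> i = f' \<cdot> i" for i A B Z f f'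
  proof -
    obtain j where j: "i \<in> arr C A B" "j \<in> arr C B A" "i \<cdot> j = Ident C B" using iso unfolding iso_arr_def by blast
    have "h \<cdot> i \<cdot> j = h" if "h \<in> arr C B Z" for h
      using comp_assoc[OF O(2,1,2,3) j(2,1) that] j(3) comp_ident_right[OF O(2,3) that] by simp
    thus ?thesis using f by metis
  qed
  have cancel_left: "f = f'" if iso: "i \<in> iso_arr C A B" and O: "A \<in> Ob C" "B \<in> Ob C" "Z \<in> Ob C"
    and f: "f \<in> arr C Z A" "f' \<in> arr C Z A" "i \<cdot> f = i \<cdot> f'" for i A B Z f f'
  proof -
    obtain j where j: "i \<in> arr C A B" "j \<in> arr C B A" "j \<cdot> i = Ident C A" using iso unfolding iso_arr_def by blast
    have "j \<cdot> (i \<cdot> h) = h" if "h \<in> arr C Z A" for h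
      using comp_assoc[OF O(3,1,2,1) that j(1,2)] j(3) comp_ident_left[OF O(3,1) that] by simp
    thus ?thesis using f by metis
  qed
  have Gfaithful: "f = f'" if O: "A \<in> Ob C" "B \<in> Ob C" and f: "f \<in> arr C A B" "f' \<in> arr C A B" "Gm A B f = Gm A B f'" for A B f f'
    by (rule cancel_right[OF eps(1)[OF O(1)] _ O f(1,2)]) (use eps(2)[OF O f(1)] eps(2)[OF O f(2)] f(3) Fob Gob O in auto)
  show ?thesis unfolding bij_betw_def
  proof
    show "inj_on (Fm X Y) (arr C X Y)"
    proof (rule inj_onI)
      fix f f' assume f: "f \<in> arr C X Y" "f' \<in> arr C X Y" "Fm X Y f = Fm X Y f'"
      show "f = f'" by (rule cancel_right[OF eta(1)[OF X(1)] _ X f(1,2)]) (use eta(2)[OF X f(1)] eta(2)[OF X f(2)] f(3) Fob Gob X in auto)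
    qed
    show "Fm X Y ` arr C X Y = arr C (Fo X) (Fo Y)"
    proof
      show "Fm X Y ` arr C X Y \<subseteq> arr C (Fo X) (Fo Y)" using Farr[OF X] by blast
      show "arr C (Fo X) (Fo Y) \<subseteq> Fm X Y ` arr C X Y"
      proof
        fix h assume h: "h \<in> arr C (Fo X) (Fo Y)"
        have O: "Fo X \<in> Ob C" "Fo Y \<in> Ob C" "Go (Fo X) \<in> Ob C" "Go (Fo Y) \<in> Ob C" using Fob Gob X by auto
        obtain j where j: "\<eta> X \<in> arr C (Go (Fo X)) X" "j \<in> arr C X (Go (Fo X))" "j \<cdot> \<eta> X = Ident C (Go (Fo X))"
          using eta(1)[OF X(1)] unfolding iso_arr_def by blast
        have eY: "\<eta> Y \<in> arr C (Go (Fo Y)) Y" using eta(1)[OF X(2)] unfolding iso_arr_def by blast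
        have Gh: "Gm (Fo X) (Fo Y) h \<in> arr C (Go (Fo X)) (Go (Fo Y))" by (rule Garr[OF O(1,2) h])
        define w where "w = \<eta> Y \<cdot> Gm (Fo X) (Fo Y) h"
        have w: "w \<in> arr C (Go (Fo X)) Y" unfolding w_def by (rule comp_closed[OF O(3,4) X(2) Gh eY])
        define f where "f = w \<cdot> j"
        have f: "f \<in> arr C X Y" unfolding f_def by (rule comp_closed[OF X(1) O(3) X(2) j(2) w])
        have "f \<cdot> \<eta> X = w" unfolding f_def using comp_assoc[OF O(3) X(1) O(3) X(2) j(1,2) w] j(3) comp_ident_right[OF O(3) X(2) w] by simp
        hence "\<eta> Y \<cdot> Gm (Fo X) (Fo Y) (Fm X Y f) = \<eta> Y \<cdot> Gm (Fo X) (Fo Y) h" using eta(2)[OF X f] unfolding w_def by simp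
        hence "Gm (Fo X) (Fo Y) (Fm X Y f) = Gm (Fo X) (Fo Y) h"
          by (rule cancel_left[OF eta(1)[OF X(2)] O(4) X(2) O(3) Garr[OF O(1,2) Farr[OF X f]] Gh])
        hence "Fm X Y f = h" by (rule Gfaithful[OF O(1,2) Farr[OF X f] h])
        thus "h \<in> Fm X Y ` arr C X Y" using f by blast
      qed
    qed
  qed
qed

end

context excat begin

text \<open>The encoding \<open>j\<close> of arrows is a parameter, so that one proof serves
  \<open>C\<close> itself and its opposite, where the end terms of the encoded arrow are
  exchanged.\<close>

lemma rec_presented:
  fixes D :: "('k, 'o, 'm) lincat"
  assumes lin: "linear_category k D" and Ob: "lincat.Ob D = Ob"
    and hm: "!!f X Y. hm f X Y <-> X \<in> Ob & Y \<in> Ob & (\<exists>u\<in>arr D X Y. f = j X u Y)"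
    and inj: "!!X Y u v. j X u Y = j X v Y <-> u = v" "!!X Y u. src (j X u Y) = X" "!!X Y u. trg (j X u Y) = Y"
    and cmp: "!!X Y Z u v. j Y v Z ** j X u Y = j X (v \<cdot>\<^bsub>D\<^esub> u) Z"
    and pls: "!!X Y u v. j X u Y +++ j X v Y = j X (u +[Hom D X Y] v) Y"
    and zer: "!!X Y. zer 0 X Y = j X 0[Hom D X Y] Y"
    and epi: "!!X Y u. [| X \<in> Ob; Y \<in> Ob |] ==> epi (j X u Y) <-> u \<in> epi_arr D X Y"
    and Y: "Y \<in> Ob"
  shows "right_epi_classified D Y <-> rec1 Y & rec2 Y"
proof -
  interpret D: linear_category k D by (rule lin)
  have ex_hm: "(\<exists>f. hm f X Y & P f) <-> (\<exists>u\<in>arr D X Y. P (j X u Y))"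
    and all_hm: "(\<forall>f. hm f X Y --> P f) <-> (\<forall>u\<in>arr D X Y. P (j X u Y))" if "X \<in> Ob" "Y \<in> Ob" for X Y P
    using that unfolding hm by blast+
  have image: "image_hom (j X \<alpha> Y) B = (%w. j B w Y) ` Im_Hom D B X \<alpha>" if O: "X \<in> Ob" "B \<in> Ob" for X B \<alpha>
  proof -
    have "image_hom (j X \<alpha> Y) B = {g. \<exists>h. hm h B X & g = j X \<alpha> Y ** h}" unfolding image_hom_def inj by auto
    thus ?thesis unfolding ex_hm[OF O(2,1)] Im_Hom_def by (auto simp: cmp)
  qed
  have rdet: "rdet (j X \<alpha> Y) B <-> right_determined D X Y \<alpha> B" if O: "X \<in> Ob" "B \<in> Ob" for X B \<alpha>
  proof -
    have "rdet (j X \<alpha> Y) B <-> (\<forall>T\<in>Ob. \<forall>f. hm f T Y -->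
       (\<forall>h. hm h B T --> f ** h \<in> image_hom (j X \<alpha> Y) B) --> (\<exists>t'. hm t' T X & j X \<alpha> Y ** t' = f))"
      (is "?L <-> ?R")
    proof
      assume l: ?L
      show ?R using l[unfolded rdet_def inj] by (intro ballI allI impI) blast
    next
      assume r: ?R
      show ?L unfolding rdet_def inj
      proof (intro allI impI)
        fix t assume t: "ar t & deg t = 0 & trg t = Y & (\<forall>h. hm h B (src t) --> t ** h \<in> image_hom (j X \<alpha> Y) B)"
        hence "src t \<in> Ob" by simp
        thus "\<exists>t'. hm t' (src t) X & j X \<alpha> Y ** t' = t" using r t by blast
      qed
    qed
    also have "\<dots> <-> (\<forall>T\<in>Ob. \<forall>t\<in>arr D T Y. (\<forall>h\<in>arr D B T. t \<cdot>\<^bsub>D\<^esub> h \<in> Im_Hom D B X \<alpha>) -->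
        (\<exists>t'\<in>arr D T X. \<alpha> \<cdot>\<^bsub>D\<^esub> t' = t))"
    proof (intro ball_cong refl)
      fix T assume T: "T \<in> Ob"
      show "(\<forall>f. hm f T Y --> (\<forall>h. hm h B T --> f ** h \<in> image_hom (j X \<alpha> Y) B) -->
          (\<exists>t'. hm t' T X & j X \<alpha> Y ** t' = f)) <->
        (\<forall>t\<in>arr D T Y. (\<forall>h\<in>arr D B T. t \<cdot>\<^bsub>D\<^esub> h \<in> Im_Hom D B X \<alpha>) --> (\<exists>t'\<in>arr D T X. \<alpha> \<cdot>\<^bsub>D\<^esub> t' = t))"
        unfolding all_hm[OF T Y] all_hm[OF O(2) T] ex_hm[OF T O(1)] image[OF O] by (auto simp: image_iff cmp inj)
    qed
    also have "\<dots> <-> right_determined D X Y \<alpha> B"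
      unfolding right_determined_def Ob by (intro ball_cong refl) (auto simp: Im_Hom_def)
    finally show ?thesis .
  qed
  have endsub: "endsub B Y H <-> (\<exists>H'. submodule H' (Gamma D B) (HomGamma D B Y) & H = (%u. j B u Y) ` H')"
    if O: "B \<in> Ob" for B H
  proof
    note sub_iff = D.submodule_Gamma[unfolded Ob, OF O Y]
    assume s: "endsub B Y H"
    define H' where "H' = {u. j B u Y \<in> H}"
    have sub: "!!h. h \<in> H ==> \<exists>u\<in>arr D B Y. h = j B u Y" using s unfolding endsub_def hm by blast
    have H: "H = (%u. j B u Y) ` H'" unfolding H'_def using sub by blast
    have "submodule H' (Gamma D B) (HomGamma D B Y)" unfolding sub_iff
    proof (intro conjI ballI subsetI)
      fix h assume h: "h \<in> H'"
      thus "h \<in> arr D B Y" using sub[of "j B h Y"] unfolding H'_def by (auto simp: inj)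
      show "h +[Hom D B Y] h' \<in> H'" if h': "h' \<in> H'" for h'
      proof -
        have "j B h Y +++ j B h' Y \<in> H" using s h h' unfolding endsub_def H'_def by blast
        thus ?thesis unfolding H'_def pls by simp
      qed
      show "h \<cdot>\<^bsub>D\<^esub> a \<in> H'" if "a \<in> arr D B B" for a
      proof -
        have "hm (j B a B) B B" unfolding hm using that O by blast
        hence "j B h Y ** j B a B \<in> H" using s h unfolding endsub_def H'_def by blast
        thus ?thesis unfolding H'_def cmp by simp
      qed
    qed (use s in \<open>simp add: endsub_def H'_def zer\<close>)
    thus "\<exists>H'. submodule H' (Gamma D B) (HomGamma D B Y) & H = (%u. j B u Y) ` H'" using H by blast
  next
    note sub_iff = D.submodule_Gamma[unfolded Ob, OF O Y]
    assume "\<exists>H'. submodule H' (Gamma D B) (HomGamma D B Y) & H = (%u. j B u Y) ` H'"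
    then obtain H' where h: "H = (%u. j B u Y) ` H'" "submodule H' (Gamma D B) (HomGamma D B Y)" by blast
    show "endsub B Y H" unfolding endsub_def h(1) using h(2)[unfolded sub_iff] O Y by (auto simp: hm pls cmp zer inj)
  qed
  have epi': "epi p & trg p = Y <-> (\<exists>X\<in>Ob. \<exists>\<alpha>\<in>epi_arr D X Y. p = j X \<alpha> Y)" for p
  proof
    assume p: "epi p & trg p = Y"
    then obtain X \<alpha> where x: "p = j X \<alpha> Y" "X \<in> Ob" using epiD(1,2)[of p] hm[of p "src p" Y] by auto
    thus "\<exists>X\<in>Ob. \<exists>\<alpha>\<in>epi_arr D X Y. p = j X \<alpha> Y" using p epi[OF x(2) Y] by blast
  next
    assume "\<exists>X\<in>Ob. \<exists>\<alpha>\<in>epi_arr D X Y. p = j X \<alpha> Y"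
    thus "epi p & trg p = Y" using epi Y inj(3) by auto
  qed
  have "rec1 Y <-> (\<forall>X\<in>Ob. \<forall>\<alpha>\<in>epi_arr D X Y. \<exists>B\<in>Ob. rdet (j X \<alpha> Y) B)"
    unfolding rec1_def epi' by blast
  hence 1: "rec1 Y <-> (\<forall>X\<in>Ob. \<forall>\<alpha>\<in>epi_arr D X Y. \<exists>B\<in>Ob. right_determined D X Y \<alpha> B)"
    using rdet by auto
  have all_endsub: "(\<forall>H. endsub B Y H --> P H) <-> (\<forall>H. submodule H (Gamma D B) (HomGamma D B Y) --> P ((%u. j B u Y) ` H))"
    if "B \<in> Ob" for B P unfolding endsub[OF that] by blast
  have ex_epi: "(\<exists>p. epi p & trg p = Y & Q p) <-> (\<exists>X\<in>Ob. \<exists>\<alpha>\<in>epi_arr D X Y. Q (j X \<alpha> Y))" for Q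
    by (simp only: conj_assoc[symmetric] epi') blast
  have "rec2 Y <-> (\<forall>B\<in>Ob. \<forall>H. submodule H (Gamma D B) (HomGamma D B Y) -->
      (\<exists>X\<in>Ob. \<exists>\<alpha>\<in>epi_arr D X Y. rdet (j X \<alpha> Y) B & (%u. j B u Y) ` H = image_hom (j X \<alpha> Y) B))"
    unfolding rec2_def ex_epi by (intro ball_cong refl) (rule all_endsub)
  also have "\<dots> <-> (\<forall>B\<in>Ob. \<forall>H. submodule H (Gamma D B) (HomGamma D B Y) -->
      (\<exists>X\<in>Ob. \<exists>\<alpha>\<in>epi_arr D X Y. right_determined D X Y \<alpha> B & H = Im_Hom D B X \<alpha>))"
  proof (intro ball_cong all_cong1 arg_cong2[where f="(-->)"] bex_cong refl)
    fix B H X \<alpha> assume "B \<in> Ob" "X \<in> Ob"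
    thus "rdet (j X \<alpha> Y) B & (%u. j B u Y) ` H = image_hom (j X \<alpha> Y) B <->
        right_determined D X Y \<alpha> B & H = Im_Hom D B X \<alpha>" using rdet image by (simp add: inj_image_eq_iff inj_def inj)
  qed
  finally show ?thesis unfolding right_epi_classified_def right_represented_def 1 Ob by simp
qed

end

context abelian_category begin

lemma hm_iff: "e.hm f X Y <-> X \<in> Ob C & Y \<in> Ob C & (\<exists>u\<in>arr C X Y. f = (X, Inl u, Y))"
  by (cases f rule: g_deg.cases) auto

lemma rec_iff:
  assumes "Y \<in> Ob C"
  shows "right_epi_classified C Y <-> e.rec1 Y & e.rec2 Y" by (rule e.rec_presented[where j="%X u Y. (X, Inl u, Y)"])
    (use assms in \<open>auto simp: linear_category_axioms hm_iff g_zer_def e_epi g_epi\<close>)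

end

lemma opposite_simps:
  "Ob (opposite C) = Ob C" "Hom (opposite C) X Y = Hom C Y X" "Ident (opposite C) = Ident C" "g \<cdot>\<^bsub>opposite C\<^esub> f = f \<cdot>\<^bsub>C\<^esub> g"
  unfolding opposite_def by simp_all

lemma opposite_epi: "epi_arr (opposite C) X Y = mono_arr C Y X" unfolding epi_arr_def mono_arr_def opposite_simps ..

section \<open>Serre duality is the same as the existence of Serre pairings\<close>

context serre_cat begin

lemma op_hm: "g_arr C f & g_deg f = 0 & g_trg f = X & g_src f = Y <-> e.hm f Y X" by blast

lemma op_rec_iff:
  assumes "Y \<in> Ob C"
  shows "left_mono_classified C Y <-> e.op_rec1 Y & e.op_rec2 Y" unfolding left_mono_classified_def
  by (rule excat.rec_presented[OF e.op_excat, where j="%X u Y. (Y, Inl u, X)", unfolded e.op_simps op_hm])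
    (use assms in \<open>auto simp: opposite_linear opposite_simps opposite_epi hm_iff g_zer_def e_mono g_mono\<close>)

text \<open>With \<open>dr\<close>, moves functionals between \<open>Ext1 C X Y\<close>, whose
  elements are untyped classes, and the arrows of degree one, which carry their end terms. Both
  restrict their result to keep it extensional.\<close>

definition lf :: "'o => 'o => (('o \<times> 'm \<times> 'm) set => 'e) => ('o, 'm) garrow => 'e" where
  "lf X Y d = (\<lambda>e\<in>carrier (e.HM 1 X Y). d (projr (fst (snd e))))"

definition dr :: "'o => 'o => (('o, 'm) garrow => 'e) => ('o \<times> 'm \<times> 'm) set => 'e" where
  "dr X Y t = (\<lambda>c\<in>carrier (Ext1 C X Y). t (X, Inr c, Y))"

lemma is_ext_iff:
  assumes "X \<in> Ob C" "Y \<in> Ob C"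
  shows "is_ext e X Y <-> (\<exists>c\<in>carrier (Ext1 C X Y). e = (X, Inr c, Y))" using assms by (cases e rule: g_deg.cases) auto

lemma HM1_carrier:
  assumes "X \<in> Ob C" "Y \<in> Ob C"
  shows "carrier (e.HM 1 X Y) = (%c. (X, Inr c, Y)) ` carrier (Ext1 C X Y)" unfolding e.HM_simps using is_ext_iff[OF assms] by blast

lemma lf_val: "[| X \<in> Ob C; Y \<in> Ob C; c \<in> carrier (Ext1 C X Y) |] ==> lf X Y d (X, Inr c, Y) = d c"
  unfolding lf_def by (simp add: e.HM_simps)

lemma ext_ops_closed:
  assumes "X \<in> Ob C" "Y \<in> Ob C" "c \<in> carrier (Ext1 C X Y)"
  shows "c' \<in> carrier (Ext1 C X Y) ==> c +[Ext1 C X Y] c' \<in> carrier (Ext1 C X Y)"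
    "a \<in> carrier k ==> a .[Ext1 C X Y] c \<in> carrier (Ext1 C X Y)"
    "[| Z \<in> Ob C; g \<in> arr C Y Z |] ==> ext_push C X Z g c \<in> carrier (Ext1 C X Z)"
    "[| W \<in> Ob C; f \<in> arr C W X |] ==> ext_pull C W Y f c \<in> carrier (Ext1 C W Y)"
  using e.add_closed(1)[of "(X, Inr c, Y)" "(X, Inr c', Y)"] e.scl_closed(1)[of "(X, Inr c, Y)" a]
    e.cmp_arr[of "(X, Inr c, Y)" "(Y, Inl g, Z)"] e.cmp_arr[of "(W, Inl f, X)" "(X, Inr c, Y)"] assms by simp_all

lemma lf_func:
  assumes O: "X \<in> Ob C" "Y \<in> Ob C" and d: "d \<in> lin_hom k (Ext1 C X Y) E"
  shows "lf X Y d \<in> e.func X Y"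
proof -
  note d' = lin_homD[OF d]
  have "lin_on k (e.HM 1 X Y) E (carrier (e.HM 1 X Y)) (%e. d (projr (fst (snd e))))"
    unfolding HM1_carrier[OF O] by (rule lin_onI) (use d' in \<open>auto simp: e.HM_simps\<close>)
  from lin_on_lin_hom[OF e.ext_mod[OF O] this] show ?thesis unfolding lf_def .
qed

lemma dr_lin:
  assumes O: "X \<in> Ob C" "Y \<in> Ob C" and t: "t \<in> e.func X Y"
  shows "dr X Y t \<in> lin_hom k (Ext1 C X Y) E"
proof (rule lin_homI)
  note t' = e.funcD[OF t O]
  show "dr X Y t \<in> extensional (carrier (Ext1 C X Y))" unfolding dr_def by simp
  fix c assume c: "c \<in> carrier (Ext1 C X Y)"
  show "dr X Y t c \<in> carrier E" unfolding dr_def using c O t'(1)[of "(X, Inr c, Y)"] by simp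
  show "dr X Y t (c +[Ext1 C X Y] c') = dr X Y t c +[E] dr X Y t c'" if "c' \<in> carrier (Ext1 C X Y)" for c'
    using c that O t'(2)[of "(X, Inr c, Y)" "(X, Inr c', Y)"] ext_ops_closed(1)[OF O c that] by (simp add: dr_def)
  show "dr X Y t (a .[Ext1 C X Y] c) = a .[E] dr X Y t c" if "a \<in> carrier k" for a
    using c that O t'(3)[of a "(X, Inr c, Y)"] ext_ops_closed(2)[OF O c that] by (simp add: dr_def)
qed

lemma dr_lf: "[| X \<in> Ob C; Y \<in> Ob C; d \<in> lin_hom k (Ext1 C X Y) E |] ==> dr X Y (lf X Y d) = d"
  using lf_val[of X Y] lin_homD(4)[of d k "Ext1 C X Y" E] by (auto simp: dr_def extensional_def fun_eq_iff)

lemma dual_map_push: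
  assumes O: "X \<in> Ob C" "Y \<in> Ob C" "K \<in> Ob C" and g: "g \<in> arr C Y K"
  shows "dual_map (Ext1 C X Y) (ext_push C X K g) d = dr X Y (e.push_func X Y (lf X K d) (Y, Inl g, K))" unfolding dual_map_def dr_def
  by (rule restrict_ext) (use O g ext_ops_closed(3)[OF O(1,2)] lf_val[OF O(1,3)] in \<open>simp add: e.push_func_val\<close>)

lemma dual_map_pull:
  assumes O: "X \<in> Ob C" "Y \<in> Ob C" "K \<in> Ob C" and f: "f \<in> arr C X Y"
  shows "dual_map (Ext1 C Y K) (ext_pull C X K f) d = dr Y K (e.pull_func Y K (lf X K d) (X, Inl f, Y))" unfolding dual_map_def dr_def
  by (rule restrict_ext) (use O f ext_ops_closed(4)[OF O(2,3)] lf_val[OF O(1,3)] in \<open>simp add: e.pull_func_val\<close>)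

lemma func_dr_eq:
  assumes O: "X \<in> Ob C" "Y \<in> Ob C" and t: "t \<in> e.func X Y" "t' \<in> e.func X Y" "dr X Y t = dr X Y t'"
  shows "t = t'"
proof (rule e.func_eqI[OF t(1,2)])
  fix e assume "g_arr C e" "g_deg e = 1" "g_src e = X" "g_trg e = Y"
  then obtain c where c: "c \<in> carrier (Ext1 C X Y)" "e = (X, Inr c, Y)" using is_ext_iff[OF O, of e] by blast
  thus "t e = t' e" using fun_cong[OF t(3), of c] unfolding dr_def by simp
qed

text \<open>The functional \<open>t\<close> is the one that the duality isomorphism takes to the
  identity of \<open>\<tau> X\<close>. Naturality in \<open>Y\<close> then sends the functional
  \<open>t (g -)\<close> to \<open>g\<close>, and naturality in \<open>X\<close> sends
  \<open>t (- f)\<close> to \<open>\<tau> f\<close>. So the left half of the pairing is bijectivity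
  of \<open>\<phi>\<close>, and the right half uses in addition that \<open>\<tau>\<close> is full
  and faithful.\<close>

theorem serre_SP:
  assumes "has_serre_duality k E C"
  shows "X \<in> Ob C ==> \<exists>K t. e.SP X K t" "K \<in> Ob C ==> \<exists>X t. e.SP X K t"
proof -
  obtain to tm \<phi> where ae: "auto_equivalence C to tm"
    and 1: "\<forall>X\<in>Ob C. \<forall>Y\<in>Ob C. \<phi> X Y \<in> lin_iso k (dual_module k E (Ext1 C X Y)) (Hom C Y (to X))"
    and 2: "\<forall>X\<in>Ob C. \<forall>X'\<in>Ob C. \<forall>Y\<in>Ob C. \<forall>f\<in>arr C X X'. \<forall>d\<in>carrier (dual_module k E (Ext1 C X Y)).
      \<phi> X' Y (dual_map (Ext1 C X' Y) (ext_pull C X Y f) d) = tm X X' f \<cdot> \<phi> X Y d"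
    and 3: "\<forall>X\<in>Ob C. \<forall>Y\<in>Ob C. \<forall>Y'\<in>Ob C. \<forall>g\<in>arr C Y' Y. \<forall>d\<in>carrier (dual_module k E (Ext1 C X Y)).
      \<phi> X Y' (dual_map (Ext1 C X Y') (ext_push C X Y g) d) = \<phi> X Y d \<cdot> g"
    using assms unfolding has_serre_duality_def by (elim exE conjE) (rule that)
  note iso = 1[rule_format] and nat1 = 2[rule_format] and nat2 = 3[rule_format]
  have F: "endofunctor C to tm" using ae unfolding auto_equivalence_def by blast
  note tob = endofunctor.ob_closed[OF F] and tarr = endofunctor.arr_closed[OF F]
  have bij: "bij_betw (\<phi> X Y) (lin_hom k (Ext1 C X Y) E) (arr C Y (to X))" if "X \<in> Ob C" "Y \<in> Ob C" for X Y
    using iso[OF that] unfolding lin_iso_def by (simp add: dual_simps)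
  have inj: "d = d'" if "X \<in> Ob C" "Y \<in> Ob C" "d \<in> lin_hom k (Ext1 C X Y) E" "d' \<in> lin_hom k (Ext1 C X Y) E" "\<phi> X Y d = \<phi> X Y d'" for X Y d d'
    using bij[OF that(1,2)] that(3-5) unfolding bij_betw_def inj_on_def by blast
  have mem: "\<phi> X Y d \<in> arr C Y (to X)" if "X \<in> Ob C" "Y \<in> Ob C" "d \<in> lin_hom k (Ext1 C X Y) E" for X Y d
    using bij_betwE[OF bij[OF that(1,2)]] that(3) by blast
  have main: "\<exists>t. e.SP X (to X) t" if X: "X \<in> Ob C" for X
  proof -
    have K: "to X \<in> Ob C" by (rule tob[OF X])
    let ?K = "to X"
    have "Ident C ?K \<in> \<phi> X ?K ` lin_hom k (Ext1 C X ?K) E" using bij[OF X K] ident_closed[OF K] unfolding bij_betw_def by simp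
    then obtain t0 where t0: "t0 \<in> lin_hom k (Ext1 C X ?K) E" "\<phi> X ?K t0 = Ident C ?K" by force
    let ?t = "lf X ?K t0"
    have t: "?t \<in> e.func X ?K" by (rule lf_func[OF X K t0(1)])
    have push: "\<phi> X Y (dr X Y (e.push_func X Y ?t (Y, Inl g, ?K))) = g" if Y: "Y \<in> Ob C" and g: "g \<in> arr C Y ?K" for Y g
      using nat2[OF X K Y g, of t0] t0 dual_map_push[OF X Y K g] comp_ident_left[OF Y K g] by (simp add: dual_simps)
    have pull: "\<phi> Y ?K (dr Y ?K (e.pull_func Y ?K ?t (X, Inl f, Y))) = tm X Y f" if Y: "Y \<in> Ob C" and f: "f \<in> arr C X Y" for Y f
      using nat1[OF X Y K f, of t0] t0 dual_map_pull[OF X Y K f] comp_ident_right[OF K tob[OF Y] tarr[OF X Y f]] by (simp add: dual_simps)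
    have pf: "e.push_func X Y ?t g \<in> e.func X Y" if "e.hm g Y ?K" for g Y by (rule e.push_func[OF t X that])
    have plf: "e.pull_func Y ?K ?t f \<in> e.func Y ?K" if "e.hm f X Y" for f Y by (rule e.pull_func[OF t K that])
    have "e.SPl X ?K ?t" unfolding e.SPl_def
    proof (intro conjI ballI allI impI X K t)
      fix Y d assume Y: "Y \<in> Ob C" and d: "d \<in> e.func X Y"
      let ?g = "\<phi> X Y (dr X Y d)"
      have g: "?g \<in> arr C Y ?K" by (rule mem[OF X Y dr_lin[OF X Y d]])
      have h: "e.hm (Y, Inl ?g, ?K) Y ?K" using g Y K by simp
      have "dr X Y (e.push_func X Y ?t (Y, Inl ?g, ?K)) = dr X Y d"
        by (rule inj[OF X Y dr_lin[OF X Y pf[OF h]] dr_lin[OF X Y d] push[OF Y g]])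
      hence "e.push_func X Y ?t (Y, Inl ?g, ?K) = d" by (rule func_dr_eq[OF X Y pf[OF h] d])
      thus "\<exists>g. e.hm g Y ?K & e.push_func X Y ?t g = d" using h by blast
    next
      fix g g' assume a: "g_arr C g & g_arr C g' & g_deg g = 0 & g_deg g' = 0 & g_trg g = ?K & g_trg g' = ?K & g_src g' = g_src g &
        e.push_func X (g_src g) ?t g = e.push_func X (g_src g) ?t g'"
      hence "e.hm g (g_src g) ?K" "e.hm g' (g_src g) ?K" by auto
      then obtain w w' where w: "g = (g_src g, Inl w, ?K)" "w \<in> arr C (g_src g) ?K" "g' = (g_src g, Inl w', ?K)" "w' \<in> arr C (g_src g) ?K" "g_src g \<in> Ob C"
        unfolding hm_iff by metis
      have "w = w'" using push[OF w(5,2)] push[OF w(5,4)] a w(1,3) by metis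
      thus "g = g'" using w(1,3) by metis
    qed
    moreover have "e.SPr X ?K ?t" unfolding e.SPr_def serre.SPl_def[OF e.op_serre] e.op_simps e.op_push_func op_hm
    proof (intro conjI ballI allI impI X K t)
      note tb = auto_equivalence_bij[OF ae X]
      fix Y d assume Y: "Y \<in> Ob C" and d: "d \<in> e.func Y ?K"
      have "\<phi> Y ?K (dr Y ?K d) \<in> arr C ?K (to Y)" by (rule mem[OF Y K dr_lin[OF Y K d]])
      then obtain f where f: "f \<in> arr C X Y" "tm X Y f = \<phi> Y ?K (dr Y ?K d)" using tb[OF Y] unfolding bij_betw_def by force
      have h: "e.hm (X, Inl f, Y) X Y" using f X Y by simp
      have "dr Y ?K (e.pull_func Y ?K ?t (X, Inl f, Y)) = dr Y ?K d"
        by (rule inj[OF Y K dr_lin[OF Y K plf[OF h]] dr_lin[OF Y K d]]) (use pull[OF Y f(1)] f(2) in simp)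
      hence "e.pull_func Y ?K ?t (X, Inl f, Y) = d" by (rule func_dr_eq[OF Y K plf[OF h] d])
      thus "\<exists>g. e.hm g X Y & e.pull_func Y ?K ?t g = d" using h by blast
    next
      fix g g' assume a: "g_arr C g & g_arr C g' & g_deg g = 0 & g_deg g' = 0 & g_src g = X & g_src g' = X & g_trg g' = g_trg g &
        e.pull_func (g_trg g) ?K ?t g = e.pull_func (g_trg g) ?K ?t g'"
      hence "e.hm g X (g_trg g)" "e.hm g' X (g_trg g)" by auto
      then obtain w w' where w: "g = (X, Inl w, g_trg g)" "w \<in> arr C X (g_trg g)" "g' = (X, Inl w', g_trg g)" "w' \<in> arr C X (g_trg g)" "g_trg g \<in> Ob C"
        unfolding hm_iff by metis
      have "tm X (g_trg g) w = tm X (g_trg g) w'" using pull[OF w(5,2)] pull[OF w(5,4)] a w(1,3) by metis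
      hence "w = w'" using auto_equivalence_bij[OF ae X w(5)] w(2,4) unfolding bij_betw_def inj_on_def by blast
      thus "g = g'" using w(1,3) by metis
    qed
    ultimately show ?thesis unfolding e.SP_def by blast
  qed
  thus "X \<in> Ob C ==> \<exists>K t. e.SP X K t" by blast
  assume K: "K \<in> Ob C"
  obtain Go Gm where G: "endofunctor C Go Gm"
    and n2: "naturally_isomorphic C (%X. to (Go X)) (%X Y f. tm (Go X) (Go Y) (Gm X Y f)) (%X. X) (%X Y f. f)"
    using ae unfolding auto_equivalence_def by blast
  have GK: "Go K \<in> Ob C" by (rule endofunctor.ob_closed[OF G K])
  have tGK: "to (Go K) \<in> Ob C" by (rule tob[OF GK])
  obtain i j where ij: "i \<in> arr C (to (Go K)) K" "j \<in> arr C K (to (Go K))" "j \<cdot> i = Ident C (to (Go K))" "i \<cdot> j = Ident C K"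
    using n2 K unfolding naturally_isomorphic_def iso_arr_def by blast
  have w: "e.inv_pair (K, Inl j, to (Go K)) (to (Go K), Inl i, K)" unfolding e.inv_pair_def using ij K tGK by (simp add: g_ide_def)
  obtain t where "e.SP (Go K) (to (Go K)) t" using main[OF GK] by blast
  from e.SP_transport[OF this w] show "\<exists>X t. e.SP X K t" by auto
qed

end

definition raw :: "('o, 'm) garrow => 'm" where "raw f = projl (fst (snd f))"

lemma raw_Inl [simp]: "raw (X, Inl u, Y) = u" unfolding raw_def by simp

context serre_cat begin

lemma raw_hm: "e.hm f X Y ==> raw f \<in> arr C X Y & (X, Inl (raw f), Y) = f" unfolding hm_iff by auto

lemma raw_iso:
  assumes "e.hm f X Y" "e.iso f"
  shows "raw f \<in> iso_arr C X Y"
proof -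
  obtain g where "e.inv_pair f g" using assms(2) unfolding e.iso_def by blast
  note g = e.inv_pairD[OF this]
  have gh: "e.hm g Y X" using g assms(1) by auto
  obtain a where a: "f = (X, Inl a, Y)" "a \<in> arr C X Y" using assms(1) unfolding hm_iff by blast
  obtain b where b: "g = (Y, Inl b, X)" "b \<in> arr C Y X" using gh unfolding hm_iff by blast
  show ?thesis unfolding iso_arr_def using a b g(7,8) by (auto simp: g_ide_def)
qed

lemma endofunctor_raw:
  assumes A: "!!X. X \<in> Ob C ==> A X \<in> Ob C"
    and H: "!!X Y f. [| X \<in> Ob C; Y \<in> Ob C; f \<in> arr C X Y |] ==>
      Am X Y f \<in> arr C (A X) (A Y) & H (X, Inl f, Y) = (A X, Inl (Am X Y f), A Y)"
    and ide: "!!X. X \<in> Ob C ==> H (g_ide C X) = g_ide C (A X)"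
    and comp: "!!f g X Y Z. [| e.hm f X Y; e.hm g Y Z |] ==> H (g_cmp C g f) = g_cmp C (H g) (H f)"
  shows "endofunctor C A Am"
proof
  fix X assume X: "X \<in> Ob C"
  show "A X \<in> Ob C" by (rule A[OF X])
  show "Am X X (Ident C X) = Ident C (A X)" using ide[OF X] H[OF X X ident_closed[OF X]] by (simp add: g_ide_def)
next
  fix X Y f assume f: "X \<in> Ob C" "Y \<in> Ob C" "f \<in> arr C X Y"
  show "Am X Y f \<in> arr C (A X) (A Y)" using H[OF f] by simp
  fix Z g assume g: "Z \<in> Ob C" "g \<in> arr C Y Z"
  show "Am X Z (g \<cdot> f) = Am Y Z g \<cdot> Am X Y f" using comp[of "(X, Inl f, Y)" X Y "(Y, Inl g, Z)" Z] H[OF f] H[OF f(2) g]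
      H[OF f(1) g(1) comp_closed[OF f(1,2) g(1) f(3) g(2)]] f g by simp
qed

lemma naturally_isomorphic_raw:
  assumes H: "!!X Y f. [| X \<in> Ob C; Y \<in> Ob C; f \<in> arr C X Y |] ==> H (X, Inl f, Y) = (A X, Inl (Am X Y f), A Y)"
    and t: "!!X. X \<in> Ob C ==> e.hm (t X) (A X) X" "!!X. X \<in> Ob C ==> e.iso (t X)"
    and nat: "!!f X Y. e.hm f X Y ==> g_cmp C f (t X) = g_cmp C (t Y) (H f)"
  shows "naturally_isomorphic C A Am (%X. X) (%X Y f. f)" unfolding naturally_isomorphic_def
proof (intro exI[of _ "%X. raw (t X)"] conjI ballI)
  show "raw (t X) \<in> iso_arr C (A X) X" if "X \<in> Ob C" for X by (rule raw_iso[OF t[OF that]])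
  fix X Y f assume f: "X \<in> Ob C" "Y \<in> Ob C" "f \<in> arr C X Y"
  have e: "t X = (A X, Inl (raw (t X)), X)" "t Y = (A Y, Inl (raw (t Y)), Y)"
    using raw_hm[OF t(1)[OF f(1)]] raw_hm[OF t(1)[OF f(2)]] by simp_all
  have "g_cmp C (X, Inl f, Y) (A X, Inl (raw (t X)), X) = g_cmp C (A Y, Inl (raw (t Y)), Y) (A X, Inl (Am X Y f), A Y)"
    using nat[of "(X, Inl f, Y)" X Y] f H[OF f] e by simp
  thus "f \<cdot> raw (t X) = raw (t Y) \<cdot> Am X Y f" by simp
qed

text \<open>The duality is constructed through its inverse \<open>\<psi>\<close>, which takes
  \<open>g\<close> to the functional \<open>T X (g -)\<close>. For \<open>\<psi>\<close>, naturality
  in \<open>Y\<close> is associativity, and naturality in \<open>X\<close> is the defining equation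
  of \<open>tauf\<close>.\<close>

theorem SP_serre:
  assumes A: "!!X. X \<in> Ob C ==> \<exists>K t. e.SP X K t" and B: "!!K. K \<in> Ob C ==> \<exists>X t. e.SP X K t"
  shows "has_serre_duality k E C"
proof -
  obtain tau T where tT: "!!X. X \<in> Ob C ==> e.SP X (tau X) (T X)" using A by metis
  interpret s: serre_choice k "Ob C" "g_arr C" g_src g_trg g_deg "g_ide C" "g_cmp C" "g_add C" "g_zer C" "g_scl C" E tau T
    by unfold_locales (use tT B in auto)
  define tm where "tm X Y f = raw (s.tauf (X, Inl f, Y))" for X Y f
  define Gm where "Gm X Y f = raw (s.Gf (X, Inl f, Y))" for X Y f
  have hmI: "e.hm (X, Inl f, Y) X Y" if "X \<in> Ob C" "Y \<in> Ob C" "f \<in> arr C X Y" for X Y f using that by simp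
  have tm: "tm X Y f \<in> arr C (tau X) (tau Y)" "s.tauf (X, Inl f, Y) = (tau X, Inl (tm X Y f), tau Y)"
    if "X \<in> Ob C" "Y \<in> Ob C" "f \<in> arr C X Y" for X Y f using raw_hm[OF s.tauf(1)[OF hmI[OF that]]] unfolding tm_def by simp_all
  have Gm: "Gm X Y f \<in> arr C (s.G X) (s.G Y)" "s.Gf (X, Inl f, Y) = (s.G X, Inl (Gm X Y f), s.G Y)"
    if "X \<in> Ob C" "Y \<in> Ob C" "f \<in> arr C X Y" for X Y f using raw_hm[OF s.Gf(1)[OF hmI[OF that]]] unfolding Gm_def by simp_all
  have G: "s.G X \<in> Ob C" if "X \<in> Ob C" for X using s.inv_data(1)[OF that] .
  have F: "endofunctor C tau tm" by (rule endofunctor_raw[where H=s.tauf]) (use tm s.tauf_ide s.tauf_comp in auto)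
  have lin: "linear_endofunctor k C tau tm"
  proof (rule linear_endofunctor.intro[OF F], unfold_locales)
    fix X Y f g assume f: "X \<in> Ob C" "Y \<in> Ob C" "f \<in> arr C X Y" and g: "g \<in> arr C X Y"
    have "f +[Hom C X Y] g \<in> arr C X Y" using e.add_closed(1)[of "(X, Inl f, Y)" "(X, Inl g, Y)"] f g by simp
    thus "tm X Y (f +[Hom C X Y] g) = tm X Y f +[Hom C (tau X) (tau Y)] tm X Y g"
      using s.tauf_add[OF hmI[OF f] hmI[OF f(1,2) g]] tm(2)[OF f] tm(2)[OF f(1,2) g] tm(2)[OF f(1,2)] by simp
  next
    fix X Y a f assume f: "X \<in> Ob C" "Y \<in> Ob C" and a: "a \<in> carrier k" and f': "f \<in> arr C X Y"
    have "a .[Hom C X Y] f \<in> arr C X Y" using e.scl_closed(1)[of "(X, Inl f, Y)" a] f a f' by simp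
    thus "tm X Y (a .[Hom C X Y] f) = a .[Hom C (tau X) (tau Y)] tm X Y f"
      using s.tauf_scl[OF hmI[OF f f'] a] tm(2)[OF f f'] tm(2)[OF f] by simp
  qed
  have Gfun: "endofunctor C s.G Gm" by (rule endofunctor_raw[where H=s.Gf]) (use G Gm s.Gf_ide s.Gf_comp in auto)
  have n1: "naturally_isomorphic C (%X. s.G (tau X)) (%X Y f. Gm (tau X) (tau Y) (tm X Y f)) (%X. X) (%X Y f. f)"
    by (rule naturally_isomorphic_raw[where t=s.eta and H="%f. s.Gf (s.tauf f)"])
      (use tm Gm s.eta(1,3) s.eta_natural in auto)
  have n2: "naturally_isomorphic C (%X. tau (s.G X)) (%X Y f. tm (s.G X) (s.G Y) (Gm X Y f)) (%X. X) (%X Y f. f)"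
  proof (rule naturally_isomorphic_raw[where t=s.v and H="%f. s.tauf (s.Gf f)"])
    show "e.iso (s.v X)" if "X \<in> Ob C" for X unfolding e.iso_def using e.inv_pair_sym[OF s.inv_data(2)[OF that]] by blast
  qed (use tm Gm G s.inv_data(4) s.v_natural in auto)
  have ae: "auto_equivalence C tau tm" unfolding auto_equivalence_def using F Gfun n1 n2 by blast
  define \<psi> where "\<psi> X Y g = dr X Y (e.push_func X Y (T X) (Y, Inl g, tau X))" for X Y g
  have psi_val: "\<psi> X Y g c = T X (g_cmp C (Y, Inl g, tau X) (X, Inr c, Y))"
    if "X \<in> Ob C" "Y \<in> Ob C" "c \<in> carrier (Ext1 C X Y)" for X Y g c
    using that unfolding \<psi>_def dr_def by (simp add: e.push_func_val)
  have psi_lin: "\<psi> X Y g \<in> lin_hom k (Ext1 C X Y) E" if O: "X \<in> Ob C" "Y \<in> Ob C" and g: "g \<in> arr C Y (tau X)" for X Y g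
    unfolding \<psi>_def by (rule dr_lin[OF O e.push_func[OF s.T_func[OF O(1)] O(1) hmI[OF O(2) _ g]]]) (use O in simp)
  have psi_eqI: "d = \<psi> X Y g" if O: "X \<in> Ob C" "Y \<in> Ob C" and g: "g \<in> arr C Y (tau X)" and d: "d \<in> extensional (carrier (Ext1 C X Y))"
    "!!c. c \<in> carrier (Ext1 C X Y) ==> d c = T X (g_cmp C (Y, Inl g, tau X) (X, Inr c, Y))" for X Y g d
    by (rule extensionalityI[OF d(1) lin_homD(4)[OF psi_lin[OF O g]]]) (use d(2) psi_val[OF O] in simp)
  have psi_bij: "bij_betw (\<psi> X Y) (arr C Y (tau X)) (lin_hom k (Ext1 C X Y) E)" if O: "X \<in> Ob C" "Y \<in> Ob C" for X Y
    unfolding bij_betw_def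
  proof
    have K: "tau X \<in> Ob C" using O by simp
    note sp = s.SPl_tau[OF O(1)]
    show "inj_on (\<psi> X Y) (arr C Y (tau X))"
    proof (rule inj_onI)
      fix g g' assume g: "g \<in> arr C Y (tau X)" "g' \<in> arr C Y (tau X)" "\<psi> X Y g = \<psi> X Y g'"
      note h = hmI[OF O(2) K g(1)] hmI[OF O(2) K g(2)]
      note pf = e.push_func[OF s.T_func[OF O(1)] O(1)]
      have "e.push_func X Y (T X) (Y, Inl g, tau X) = e.push_func X Y (T X) (Y, Inl g', tau X)"
        by (rule func_dr_eq[OF O pf[OF h(1)] pf[OF h(2)] g(3)[unfolded \<psi>_def]])
      thus "g = g'" using e.SPlD(5)[OF sp h] by simp
    qed
    show "\<psi> X Y ` arr C Y (tau X) = lin_hom k (Ext1 C X Y) E"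
    proof
      show "\<psi> X Y ` arr C Y (tau X) \<subseteq> lin_hom k (Ext1 C X Y) E" using psi_lin[OF O] by blast
      show "lin_hom k (Ext1 C X Y) E \<subseteq> \<psi> X Y ` arr C Y (tau X)"
      proof
        fix d assume d: "d \<in> lin_hom k (Ext1 C X Y) E"
        obtain g where g: "e.hm g Y (tau X)" "e.push_func X Y (T X) g = lf X Y d" using e.SPlD(4)[OF sp O(2) lf_func[OF O d]] by blast
        have "\<psi> X Y (raw g) = d" unfolding \<psi>_def using raw_hm[OF g(1)] g(2) dr_lf[OF O d] by simp
        thus "d \<in> \<psi> X Y ` arr C Y (tau X)" using raw_hm[OF g(1)] by blast
      qed
    qed
  qed
  \<comment> \<open>The restriction to functionals makes the map extensional, as membership in
    \<open>lin_hom\<close> demands.\<close>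
  define \<phi> where "\<phi> X Y = (\<lambda>d\<in>lin_hom k (Ext1 C X Y) E. inv_into (arr C Y (tau X)) (\<psi> X Y) d)" for X Y
  have phi_psi: "\<phi> X Y (\<psi> X Y g) = g" if O: "X \<in> Ob C" "Y \<in> Ob C" and g: "g \<in> arr C Y (tau X)" for X Y g
    unfolding \<phi>_def using psi_lin[OF O g] inv_into_f_f[OF bij_betw_imp_inj_on[OF psi_bij[OF O]] g] by simp
  have psi_ex: "\<exists>g\<in>arr C Y (tau X). d = \<psi> X Y g" if O: "X \<in> Ob C" "Y \<in> Ob C" and d: "d \<in> lin_hom k (Ext1 C X Y) E" for X Y d
    using psi_bij[OF O] d unfolding bij_betw_def by blast
  have "\<phi> X Y \<in> lin_iso k (dual_module k E (Ext1 C X Y)) (Hom C Y (tau X))" if O: "X \<in> Ob C" "Y \<in> Ob C" for X Y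
  proof -
    have K: "tau X \<in> Ob C" using O by simp
    interpret H: module k "Hom C Y (tau X)" by (rule hom_module[OF O(2) K])
    let ?D = "dual_module k E (Ext1 C X Y)"
    note tX = e.funcD[OF s.T_func[OF O(1)] O(1) K]
    have "\<phi> X Y \<in> lin_hom k ?D (Hom C Y (tau X))"
    proof (rule lin_homI, unfold dual_simps(1))
      show "\<phi> X Y \<in> extensional (lin_hom k (Ext1 C X Y) E)" unfolding \<phi>_def by simp
      fix d assume "d \<in> lin_hom k (Ext1 C X Y) E"
      then obtain g where g: "g \<in> arr C Y (tau X)" "d = \<psi> X Y g" using psi_ex[OF O] by blast
      show "\<phi> X Y d \<in> arr C Y (tau X)" using phi_psi[OF O g(1)] g by simp
      show "\<phi> X Y (a .[?D] d) = a .[Hom C Y (tau X)] \<phi> X Y d" if a: "a \<in> carrier k" for a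
      proof -
        have ag: "a .[Hom C Y (tau X)] g \<in> arr C Y (tau X)" using a g(1) by simp
        have "a .[?D] d = \<psi> X Y (a .[Hom C Y (tau X)] g)"
        proof (rule psi_eqI[OF O ag])
          show "a .[?D] d \<in> extensional (carrier (Ext1 C X Y))" by (simp add: dual_simps)
          fix c assume c: "c \<in> carrier (Ext1 C X Y)"
          have "T X (g_cmp C (g_scl C a (Y, Inl g, tau X)) (X, Inr c, Y)) = a .[E] T X (g_cmp C (Y, Inl g, tau X) (X, Inr c, Y))"
            using e.cmp_scl_left[of "(X, Inr c, Y)" "(Y, Inl g, tau X)" a] tX(3)[of a "g_cmp C (Y, Inl g, tau X) (X, Inr c, Y)"]
              ext_cmp_left[of "(X, Inr c, Y)" X Y "(Y, Inl g, tau X)" "tau X"] a c g(1) O K by (simp add: g_hom_Inl)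
          thus "(a .[?D] d) c = T X (g_cmp C (Y, Inl (a .[Hom C Y (tau X)] g), tau X) (X, Inr c, Y))"
            using c psi_val[OF O c, of g] g(2) by (simp add: dual_simps)
        qed
        thus ?thesis using phi_psi[OF O ag] phi_psi[OF O g(1)] g(2) by simp
      qed
      fix d' assume "d' \<in> lin_hom k (Ext1 C X Y) E"
      then obtain g' where g': "g' \<in> arr C Y (tau X)" "d' = \<psi> X Y g'" using psi_ex[OF O] by blast
      have ag: "g +[Hom C Y (tau X)] g' \<in> arr C Y (tau X)" using g(1) g'(1) by simp
      have "d +[?D] d' = \<psi> X Y (g +[Hom C Y (tau X)] g')"
      proof (rule psi_eqI[OF O ag])
        show "d +[?D] d' \<in> extensional (carrier (Ext1 C X Y))" by (simp add: dual_simps)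
        fix c assume c: "c \<in> carrier (Ext1 C X Y)"
        have "T X (g_cmp C (g_add C (Y, Inl g, tau X) (Y, Inl g', tau X)) (X, Inr c, Y)) =
            T X (g_cmp C (Y, Inl g, tau X) (X, Inr c, Y)) +[E] T X (g_cmp C (Y, Inl g', tau X) (X, Inr c, Y))"
          using e.cmp_add_left[of "(X, Inr c, Y)" "(Y, Inl g, tau X)" "(Y, Inl g', tau X)"]
            tX(2)[of "g_cmp C (Y, Inl g, tau X) (X, Inr c, Y)" "g_cmp C (Y, Inl g', tau X) (X, Inr c, Y)"]
            ext_cmp_left[of "(X, Inr c, Y)" X Y "(Y, Inl g, tau X)" "tau X"]
            ext_cmp_left[of "(X, Inr c, Y)" X Y "(Y, Inl g', tau X)" "tau X"] c g(1) g'(1) O K by (simp add: g_hom_Inl)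
        thus "(d +[?D] d') c = T X (g_cmp C (Y, Inl (g +[Hom C Y (tau X)] g'), tau X) (X, Inr c, Y))"
          using c psi_val[OF O c, of g] psi_val[OF O c, of g'] g(2) g'(2) by (simp add: dual_simps)
      qed
      thus "\<phi> X Y (d +[?D] d') = \<phi> X Y d +[Hom C Y (tau X)] \<phi> X Y d'"
        using phi_psi[OF O ag] phi_psi[OF O g(1)] phi_psi[OF O g'(1)] g(2) g'(2) by simp
    qed
    moreover have "bij_betw (\<phi> X Y) (lin_hom k (Ext1 C X Y) E) (arr C Y (tau X))"
      using bij_betw_inv_into[OF psi_bij[OF O]] unfolding \<phi>_def by (rule bij_betw_cong[THEN iffD1, rotated]) simp
    ultimately show ?thesis unfolding lin_iso_def by (simp add: dual_simps)
  qed
  moreover have "\<phi> X' Y (dual_map (Ext1 C X' Y) (ext_pull C X Y f) d) = tm X X' f \<cdot> \<phi> X Y d"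
    if O: "X \<in> Ob C" "X' \<in> Ob C" "Y \<in> Ob C" and f: "f \<in> arr C X X'" and d: "d \<in> carrier (dual_module k E (Ext1 C X Y))" for X X' Y f d
  proof -
    obtain g where g: "g \<in> arr C Y (tau X)" "d = \<psi> X Y g" using psi_ex[OF O(1,3)] d by (auto simp: dual_simps)
    have K: "tau X \<in> Ob C" "tau X' \<in> Ob C" using O by simp_all
    note t = tm[OF O(1,2) f]
    have tg: "tm X X' f \<cdot> g \<in> arr C Y (tau X')" by (rule comp_closed[OF O(3) K g(1) t(1)])
    have "dual_map (Ext1 C X' Y) (ext_pull C X Y f) d = \<psi> X' Y (tm X X' f \<cdot> g)"
    proof (rule psi_eqI[OF O(2,3) tg])
      show "dual_map (Ext1 C X' Y) (ext_pull C X Y f) d \<in> extensional (carrier (Ext1 C X' Y))" unfolding dual_map_def by simp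
      fix c assume c: "c \<in> carrier (Ext1 C X' Y)"
      have cf: "ext_pull C X Y f c \<in> carrier (Ext1 C X Y)" by (rule ext_ops_closed(4)[OF O(2,3) c O(1) f])
      let ?c = "(X', Inr c, Y)" and ?f = "(X, Inl f, X')" and ?g = "(Y, Inl g, tau X)"
      have h: "is_ext ?c X' Y" "e.hm ?f X X'" "e.hm ?g Y (tau X)" using c f g(1) O K by simp_all
      have gc: "is_ext (g_cmp C ?g ?c) X' (tau X)" by (rule ext_cmp_left[OF h(1)]) (use g(1) O K in \<open>simp add: g_hom_Inl\<close>)
      have "dual_map (Ext1 C X' Y) (ext_pull C X Y f) d c = T X (g_cmp C ?g (g_cmp C ?c ?f))"
        unfolding dual_map_def g(2) using c psi_val[OF O(1,3) cf, of g] by simp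
      also have "g_cmp C ?g (g_cmp C ?c ?f) = g_cmp C (g_cmp C ?g ?c) ?f" by (rule e.assoc[symmetric]) (use h in auto)
      also have "T X (g_cmp C (g_cmp C ?g ?c) ?f) = T X' (g_cmp C (s.tauf ?f) (g_cmp C ?g ?c))"
        by (rule s.tauf(2)[OF h(2), symmetric]) (use gc in auto)
      also have "g_cmp C (s.tauf ?f) (g_cmp C ?g ?c) = g_cmp C (g_cmp C (s.tauf ?f) ?g) ?c"
        by (rule e.assoc[symmetric]) (use h s.tauf(1)[OF h(2)] in auto)
      finally show "dual_map (Ext1 C X' Y) (ext_pull C X Y f) d c = T X' (g_cmp C (Y, Inl (tm X X' f \<cdot> g), tau X') ?c)"
        unfolding t(2) by simp
    qed
    thus ?thesis using phi_psi[OF O(2,3) tg] phi_psi[OF O(1,3) g(1)] g(2) by simp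
  qed
  moreover have "\<phi> X Y' (dual_map (Ext1 C X Y') (ext_push C X Y g') d) = \<phi> X Y d \<cdot> g'"
    if O: "X \<in> Ob C" "Y \<in> Ob C" "Y' \<in> Ob C" and g': "g' \<in> arr C Y' Y" and d: "d \<in> carrier (dual_module k E (Ext1 C X Y))" for X Y Y' g' d
  proof -
    obtain g where g: "g \<in> arr C Y (tau X)" "d = \<psi> X Y g" using psi_ex[OF O(1,2)] d by (auto simp: dual_simps)
    have K: "tau X \<in> Ob C" using O by simp
    have gg: "g \<cdot> g' \<in> arr C Y' (tau X)" by (rule comp_closed[OF O(3,2) K g' g(1)])
    have "dual_map (Ext1 C X Y') (ext_push C X Y g') d = \<psi> X Y' (g \<cdot> g')"
    proof (rule psi_eqI[OF O(1,3) gg])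
      show "dual_map (Ext1 C X Y') (ext_push C X Y g') d \<in> extensional (carrier (Ext1 C X Y'))" unfolding dual_map_def by simp
      fix c assume c: "c \<in> carrier (Ext1 C X Y')"
      have cf: "ext_push C X Y g' c \<in> carrier (Ext1 C X Y)" by (rule ext_ops_closed(3)[OF O(1,3) c O(2) g'])
      let ?c = "(X, Inr c, Y')" and ?g' = "(Y', Inl g', Y)" and ?g = "(Y, Inl g, tau X)"
      have "dual_map (Ext1 C X Y') (ext_push C X Y g') d c = T X (g_cmp C ?g (g_cmp C ?g' ?c))"
        unfolding dual_map_def g(2) using c psi_val[OF O(1,2) cf, of g] by simp
      also have "g_cmp C ?g (g_cmp C ?g' ?c) = g_cmp C (g_cmp C ?g ?g') ?c" by (rule e.assoc[symmetric]) (use c g' g(1) O K in auto)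
      finally show "dual_map (Ext1 C X Y') (ext_push C X Y g') d c = T X (g_cmp C (Y', Inl (g \<cdot> g'), tau X) ?c)" by simp
    qed
    thus ?thesis using phi_psi[OF O(1,3) gg] phi_psi[OF O(1,2) g(1)] g(2) by simp
  qed
  ultimately show ?thesis unfolding has_serre_duality_def by (intro exI[of _ tau] exI[of _ tm] conjI lin ae exI[of _ \<phi>]) blast+
qed

end

theorem theorem3p4:
  fixes k :: "'k ring" and E :: "('k, 'e) module" and C :: "('k, 'o, 'm) lincat"
  assumes "artinian_cring k"
    and "minimal_injective_cogenerator k E"
    and "abelian_category k C"
    and "hom_finite k C"
  shows "has_serre_duality k E C \<longleftrightarrow>
    has_right_determined_epis C \<and> has_left_determined_monos C"
proof -
  interpret serre_cat k C E by (intro serre_cat.intro serre_cat_axioms.intro matlis.intro) (fact assms)+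
  show ?thesis
  proof
    assume s: "has_serre_duality k E C"
    note A = serre_SP(1)[OF s] and B = serre_SP(2)[OF s]
    have "e.rec1 Y & e.rec2 Y" if "Y \<in> Ob C" for Y using e.SP_rec[OF A B that] by blast
    \<comment> \<open>A Serre pairing is a self-dual notion with its two objects exchanged, so the
      same theorem applies in the opposite category with \<open>A\<close> and \<open>B\<close> in
      the other order.\<close>
    moreover have "e.op_rec1 Y & e.op_rec2 Y" if "Y \<in> Ob C" for Y
      using serre.SP_rec[OF e.op_serre, unfolded e.op_SP, OF B A that] by blast
    ultimately show "has_right_determined_epis C & has_left_determined_monos C"
      unfolding has_right_determined_epis_def has_left_determined_monos_def using rec_iff op_rec_iff by blast
  next
    assume "has_right_determined_epis C & has_left_determined_monos C"
    hence "e.rec2 Y" "e.op_rec2 Y" if "Y \<in> Ob C" for Y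
      using that unfolding has_right_determined_epis_def has_left_determined_monos_def using rec_iff op_rec_iff by blast+
    thus "has_serre_duality k E C" using SP_serre[OF e.SP_all e.SP_all_op] by blast
  qed
qed

end
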